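(* Let $\alpha>0$, $\mu>0$ and $T>0$. Let $(\mathbf{u}^1,\mathcal{B}^1)$ be a strong solution on $[0,T]$, with initial data $\mathbf{u}_0^1,\mathcal{B}_0^1\in V$, and let $(\mathbf{u}^2,\mathcal{B}^2)$ be a weak solution on $[0,T]$, with initial data $\mathbf{u}_0^2,\mathcal{B}_0^2\in V$, of the inviscid resistive MHD-Voigt system $$\frac{d}{dt}\left(\alpha^2 A\mathbf{u}+\mathbf{u}\right)=B(\mathcal{B},\mathcal{B})-B(\mathbf{u},\mathbf{u}),\qquad \frac{d}{dt}\mathcal{B}+\mu A\mathcal{B}=B(\mathcal{B},\mathbf{u})-B(\mathbf{u},\mathcal{B}).$$ Write $\delta\mathbf{u}=\mathbf{u}^1-\mathbf{u}^2$, $\delta\mathcal{B}=\mathcal{B}^1-\mathcal{B}^2$, $\delta\mathbf{u}_0=\mathbf{u}^1_0-\mathbf{u}^2_0$, $\delta\mathcal{B}_0=\mathcal{B}^1_0-\mathcal{B}^2_0$. Then there is a positive constant $K^4_{\alpha,\mu}$, depending only on $K^1_\alpha$, $K^3_{\alpha,\mu}$, $\alpha$ and $\mu$ (with $K^1_\alpha,K^3_{\alpha,\mu}$ the constants defined in the context), such that for all $t\in[0,T]$, $$|\delta\mathbf{u}(t)|^2+\alpha^2\|\delta\mathbf{u}(t)\|^2+|\delta\mathcal{B}(t)|^2+\mu\int_0^t\|\delta\mathcal{B}(s)\|^2e^{K^4_{\alpha,\mu}(t-s)}\,ds\le\left(|\delta\mathbf{u}_0|^2+\alpha^2\|\delta\mathbf{u}_0\|^2+|\delta\mathcal{B}_0|^2\right)e^{K^4_{\alpha,\mu}t}.$$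 In particular, if $\mathbf{u}_0^1=\mathbf{u}_0^2$ and $\mathcal{B}_0^1=\mathcal{B}_0^2$ in the sense of $H$, then $\mathbf{u}^1=\mathbf{u}^2$ and $\mathcal{B}^1=\mathcal{B}^2$ in the sense of $L^1([0,T],H)$.
   Context: Setting: $\Omega=\mathbb{T}^3=[0,1]^3$ with periodic boundary conditions. $\mathcal{V}$ is the set of $\mathbb{R}^3$-valued trigonometric polynomials $\varphi$ on $\Omega$ with $\nabla\cdot\varphi=0$ and $\int_\Omega\varphi\,d\mathbf{x}=0$; $H$ and $V$ are the closures of $\mathcal{V}$ in $L^2(\Omega)$ and $H^1(\Omega)$. $H$ carries the $L^2$ inner product $(\cdot,\cdot)$ and norm $|\cdot|$; $V$ carries the inner product $((\mathbf{u},\mathbf{v}))=\sum_{i,j}\int_\Omega \partial_{x_j}u_i\,\partial_{x_j}v_i\,d\mathbf{x}$ and norm $\|\cdot\|$. $V'$ is the dual of $V$, with $V\hookrightarrow H\equiv H'\hookrightarrow V'$. $P_\sigma:L^2\to H$ is the Leray-Helmholtz (orthogonal) projection, $A=-P_\sigma\triangle$ is the Stokes operator with domain $\mathcal{D}(A)=H^2\cap V$, extended to a bounded operator $A:V\to V'$. $B(\mathbf{u},\mathbf{v})=P_\sigma((\mathbf{u}\cdot\nabla)\mathbf{v})$ for $\mathbf{u},\mathbf{v}\in\mathcal{V}$, extended to a continuous bilinear map $B:V\times V\to V'$. $C_w([0,T],X)$ denotes the functions in $L^\infty([0,T],X)$ that are weakly continuous in time. Definition (weak solution). For $\mathbf{u}_0\in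 V$, $\mathcal{B}_0\in H$, the pair $(\mathbf{u},\mathcal{B})$ is a weak solution on $[0,T]$ with initial data $(\mathbf{u}_0,\mathcal{B}_0)$ if $\mathbf{u}\in C([0,T],V)$, $\mathcal{B}\in L^2((0,T),V)\cap C_w([0,T],H)$, $\frac{d\mathbf{u}}{dt}\in L^4((0,T),H)$, $\frac{d\mathcal{B}}{dt}\in L^2((0,T),V')$, the first (momentum) equation holds in the sense of $L^{4/3}([0,T],V')$, the second (magnetic) equation holds in the sense of $L^2([0,T],V')$, and $\mathbf{u}(0)=\mathbf{u}_0$, $\mathcal{B}(0)=\mathcal{B}_0$. Definition (strong solution). For $\mathbf{u}_0,\mathcal{B}_0\in V$, a weak solution $(\mathbf{u},\mathcal{B})$ is a strong solution if additionally $\mathcal{B}\in L^2((0,T),\mathcal{D}(A))\cap C([0,T],V)$, $\frac{d\mathbf{u}}{dt}\in C([0,T],V)$ and $\frac{d\mathcal{B}}{dt}\in L^2((0,T),H)$. Constants (for the data of the strong solution): $(K^1_\alpha)^2=\alpha^2\|\mathbf{u}^1_0\|^2+|\mathbf{u}^1_0|^2+|\mathcal{B}^1_0|^2$; $K^2_{\alpha,\mu}=C(\alpha^{-1}K^1_\alpha)^4\mu^{-3}$ with $C$ an absolute constant; $K^3_{\alpha,\mu}=\|\mathcal{B}^1_0\|^2+K^2_{\alpha,\mu}(K^1_\alpha)^2/\mu$. *)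

theory Defs
  imports "HOL-Analysis.Analysis"
begin

section \<open>Square-integrable vector fields on the torus\<close>

text \<open>
  Functions on the torus are represented by functions on \<open>real^3\<close>, of which only the values on the
  unit cube matter for measure-theoretic purposes.
\<close>

definition torus :: "(real^3) measure" where
  "torus = restrict_space lborel (cbox 0 1)"

definition square_integrable :: "(real^3 \<Rightarrow> real^3) \<Rightarrow> bool" where
  "square_integrable f \<longleftrightarrow>
     f \<in> borel_measurable torus \<and> integrable torus (\<lambda>x. (norm (f x))\<^sup>2)"

lemma square_integrable_zero: "square_integrable (\<lambda>_. 0)"
  by (simp add: square_integrable_def)

lemma square_integrable_add:
  assumes "square_integrable f" "square_integrable g"
  shows "square_integrable (\<lambda>x. f x + g x)"
proof -
  have [measurable]: "f \<in> borel_measurable torus" "g \<in> borel_measurable torus"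
    using assms by (auto simp: square_integrable_def)
  have "integrable torus (\<lambda>x. 2 * (norm (f x))\<^sup>2 + 2 * (norm (g x))\<^sup>2)"
    using assms by (auto simp: square_integrable_def)
  then have "integrable torus (\<lambda>x. (norm (f x + g x))\<^sup>2)"
  proof (rule Bochner_Integration.integrable_bound)
    show "AE x in torus. norm ((norm (f x + g x))\<^sup>2) \<le> norm (2 * (norm (f x))\<^sup>2 + 2 * (norm (g x))\<^sup>2)"
    proof (rule AE_I2)
      fix x
      have "(norm (f x + g x))\<^sup>2 \<le> (norm (f x) + norm (g x))\<^sup>2"
        by (simp add: norm_triangle_ineq power_mono)
      also have "\<dots> \<le> 2 * (norm (f x))\<^sup>2 + 2 * (norm (g x))\<^sup>2"
        using zero_le_power2[of "norm (f x) - norm (g x)"]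
        by (simp add: power2_eq_square algebra_simps)
      finally show "norm ((norm (f x + g x))\<^sup>2) \<le> norm (2 * (norm (f x))\<^sup>2 + 2 * (norm (g x))\<^sup>2)"
        by simp
    qed
  qed measurable
  then show ?thesis
    by (simp add: square_integrable_def)
qed

lemma square_integrable_scaleR:
  assumes "square_integrable f"
  shows "square_integrable (\<lambda>x. c *\<^sub>R f x)"
  using assms by (auto simp: square_integrable_def power_mult_distrib)

lemma square_integrable_uminus:
  "square_integrable f \<Longrightarrow> square_integrable (\<lambda>x. - f x)"
  using square_integrable_scaleR[of f "-1"] by simp

lemma square_integrable_diff:
  "square_integrable f \<Longrightarrow> square_integrable g \<Longrightarrow> square_integrable (\<lambda>x. f x - g x)"
  using square_integrable_add[OF _ square_integrable_uminus, of f g] by simp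

lemma square_integrable_inner:
  assumes "square_integrable f" "square_integrable g"
  shows "integrable torus (\<lambda>x. f x \<bullet> g x)"
proof -
  have [measurable]: "f \<in> borel_measurable torus" "g \<in> borel_measurable torus"
    using assms by (auto simp: square_integrable_def)
  have "integrable torus (\<lambda>x. (norm (f x))\<^sup>2 + (norm (g x))\<^sup>2)"
    using assms by (auto simp: square_integrable_def)
  then show ?thesis
  proof (rule Bochner_Integration.integrable_bound)
    show "AE x in torus. norm (f x \<bullet> g x) \<le> norm ((norm (f x))\<^sup>2 + (norm (g x))\<^sup>2)"
    proof (rule AE_I2)
      fix x
      have "\<bar>f x \<bullet> g x\<bar> \<le> norm (f x) * norm (g x)"
        by (rule Cauchy_Schwarz_ineq2)
      also have "\<dots> \<le> (norm (f x))\<^sup>2 + (norm (g x))\<^sup>2"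
        using sum_squares_bound[of "norm (f x)" "norm (g x)"] 
          mult_nonneg_nonneg[OF norm_ge_zero[of "f x"] norm_ge_zero[of "g x"]] by linarith
      finally show "norm (f x \<bullet> g x) \<le> norm ((norm (f x))\<^sup>2 + (norm (g x))\<^sup>2)" by simp
    qed
  qed measurable
qed

text \<open>Elements of \<open>L2\<close> are almost-everywhere classes of square-integrable fields.\<close>

quotient_type L2 = "real^3 \<Rightarrow> real^3" / partial:
  "\<lambda>f g. square_integrable f \<and> square_integrable g \<and> (AE x in torus. f x = g x)"
  morphisms rep_L2 to_L2
proof (rule part_equivpI)
  show "\<exists>f. square_integrable f \<and> square_integrable f \<and> (AE x in torus. f x = f x)"
    using square_integrable_zero by auto
  show "symp (\<lambda>f g. square_integrable f \<and> square_integrable g \<and> (AE x in torus. f x = g x))"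
    by (auto simp: symp_def elim: AE_mp)
  show "transp (\<lambda>f g. square_integrable f \<and> square_integrable g \<and> (AE x in torus. f x = g x))"
    unfolding transp_def by (auto elim: AE_mp)
qed

instantiation L2 :: real_inner
begin

lift_definition zero_L2 :: L2 is "\<lambda>_. 0"
  by (simp add: square_integrable_zero)

lift_definition plus_L2 :: "L2 \<Rightarrow> L2 \<Rightarrow> L2" is "\<lambda>f g x. f x + g x"
  by (auto simp: square_integrable_add)

lift_definition uminus_L2 :: "L2 \<Rightarrow> L2" is "\<lambda>f x. - f x"
  by (auto simp: square_integrable_uminus)

lift_definition minus_L2 :: "L2 \<Rightarrow> L2 \<Rightarrow> L2" is "\<lambda>f g x. f x - g x"
  by (auto simp: square_integrable_diff)

lift_definition scaleR_L2 :: "real \<Rightarrow> L2 \<Rightarrow> L2" is "\<lambda>c f x. c *\<^sub>R f x"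
  by (auto simp: square_integrable_scaleR)

lift_definition inner_L2 :: "L2 \<Rightarrow> L2 \<Rightarrow> real" is "\<lambda>f g. \<integral>x. f x \<bullet> g x \<partial>torus"
  by (auto simp: square_integrable_def intro!: integral_cong_AE)

definition norm_L2 :: "L2 \<Rightarrow> real" where "norm_L2 f = sqrt (f \<bullet> f)"
definition dist_L2 :: "L2 \<Rightarrow> L2 \<Rightarrow> real" where "dist_L2 f g = norm (f - g)"
definition sgn_L2 :: "L2 \<Rightarrow> L2" where "sgn_L2 f = inverse (norm f) *\<^sub>R f"
definition uniformity_L2 :: "(L2 \<times> L2) filter" where
  "uniformity_L2 = (INF e\<in>{0 <..}. principal {(x, y). dist x y < e})"
definition open_L2 :: "L2 set \<Rightarrow> bool" where
  "open_L2 U \<longleftrightarrow> (\<forall>x\<in>U. \<forall>\<^sub>F (x', y) in uniformity. x' = x \<longrightarrow> y \<in> U)"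

instance
proof
  fix a b c :: L2 and r s :: real and U :: "L2 set"
  show "a + b + c = a + (b + c)"
    by transfer (auto simp: algebra_simps square_integrable_add)
  show "a + b = b + a"
    by transfer (auto simp: algebra_simps square_integrable_add)
  show "0 + a = a" by transfer auto
  show "- a + a = 0" by transfer (auto simp: square_integrable_zero)
  show "a - b = a + - b"
    by transfer (auto simp: square_integrable_diff)
  show "r *\<^sub>R (a + b) = r *\<^sub>R a + r *\<^sub>R b"
    by transfer (auto simp: algebra_simps square_integrable_add square_integrable_scaleR)
  show "(r + s) *\<^sub>R a = r *\<^sub>R a + s *\<^sub>R a"
    by transfer (auto simp: algebra_simps square_integrable_add square_integrable_scaleR)
  show "r *\<^sub>R s *\<^sub>R a = (r * s) *\<^sub>R a"
    by transfer (auto simp: square_integrable_scaleR)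
  show "1 *\<^sub>R a = a" by transfer auto
  show "dist a b = norm (a - b)" by (fact dist_L2_def)
  show "sgn a = inverse (norm a) *\<^sub>R a" by (fact sgn_L2_def)
  show "(uniformity :: (L2 \<times> L2) filter) = (INF e\<in>{0 <..}. principal {(x, y). dist x y < e})"
    by (fact uniformity_L2_def)
  show "open U = (\<forall>x\<in>U. \<forall>\<^sub>F (x', y) in uniformity. x' = x \<longrightarrow> y \<in> U)"
    by (fact open_L2_def)
  show "a \<bullet> b = b \<bullet> a" by transfer (auto simp: inner_commute)
  show "(a + b) \<bullet> c = a \<bullet> c + b \<bullet> c"
    by transfer (auto simp: inner_add_left square_integrable_inner)
  show "(r *\<^sub>R a) \<bullet> b = r * (a \<bullet> b)" by transfer auto
  show "0 \<le> a \<bullet> a" by transfer auto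
  show "(a \<bullet> a = 0) = (a = 0)"
  proof transfer
    fix f assume "square_integrable f \<and> square_integrable f \<and> (AE x in torus. f x = f x)"
    then have f: "square_integrable f" by simp
    have "((\<integral>x. f x \<bullet> f x \<partial>torus) = 0) = (AE x in torus. f x \<bullet> f x = 0)"
      using square_integrable_inner[OF f f] by (intro integral_nonneg_eq_0_iff_AE) auto
    then show "((\<integral>x. f x \<bullet> f x \<partial>torus) = 0) =
      (square_integrable f \<and> square_integrable (\<lambda>_. 0) \<and> (AE x in torus. f x = 0))"
      using f square_integrable_zero by simp
  qed
  show "norm a = sqrt (a \<bullet> a)" by (fact norm_L2_def)
qed

end

section \<open>Smooth periodic functions and trigonometric polynomials\<close>

text \<open>\<open>C_diff k\<close> is the class of \<open>k\<close> times continuously differentiable functions.\<close>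

definition pd :: "3 \<Rightarrow> (real^3 \<Rightarrow> 'b) \<Rightarrow> real^3 \<Rightarrow> 'b::real_normed_vector" where
  "pd j f x = frechet_derivative f (at x) (axis j 1)"

primrec C_diff :: "nat \<Rightarrow> (real^3 \<Rightarrow> real) \<Rightarrow> bool" where
  "C_diff 0 f \<longleftrightarrow> continuous_on UNIV f"
| "C_diff (Suc k) f \<longleftrightarrow> (\<forall>x. f differentiable at x) \<and> (\<forall>j. C_diff k (pd j f))"

definition periodic :: "(real^3 \<Rightarrow> 'b) \<Rightarrow> bool" where
  "periodic f \<longleftrightarrow> (\<forall>x j. f (x + axis j 1) = f x)"

definition test_function :: "(real^3 \<Rightarrow> real) \<Rightarrow> bool" where
  "test_function \<psi> \<longleftrightarrow> (\<forall>k. C_diff k \<psi>) \<and> periodic \<psi>"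

definition trig_poly :: "(real^3 \<Rightarrow> real^3) \<Rightarrow> bool" where
  "trig_poly \<phi> \<longleftrightarrow> (\<exists>K a b. finite K \<and> (\<forall>k\<in>K. \<forall>i. k $ i \<in> \<int>) \<and>
     \<phi> = (\<lambda>x. \<Sum>k\<in>K. cos (2 * pi * (k \<bullet> x)) *\<^sub>R a k + sin (2 * pi * (k \<bullet> x)) *\<^sub>R b k))"

definition divergence :: "(real^3 \<Rightarrow> real^3) \<Rightarrow> real^3 \<Rightarrow> real" where
  "divergence \<phi> x = (\<Sum>i\<in>UNIV. pd i \<phi> x $ i)"

text \<open>Solenoidal trigonometric polynomials of mean zero.\<close>

definition \<V> :: "(real^3 \<Rightarrow> real^3) set" where
  "\<V> = {\<phi>. trig_poly \<phi> \<and> (\<forall>x. divergence \<phi> x = 0) \<and> (\<integral>x. \<phi> x \<partial>torus) = 0}"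

lemma pd_eqI: "(f has_derivative D) (at x) \<Longrightarrow> pd j f x = D (axis j 1)"
  unfolding pd_def by (metis frechet_derivative_at)

lemma C_diff_continuous: "C_diff k f \<Longrightarrow> continuous_on UNIV f"
  by (cases k) (auto simp: continuous_on_eq_continuous_at differentiable_imp_continuous_within)

lemma C_diff_SucD: "C_diff (Suc k) f \<Longrightarrow> C_diff k f"
proof (induction k arbitrary: f)
  case 0 then show ?case by (metis C_diff.simps(1) C_diff_continuous)
next
  case (Suc k)
  then show ?case by (metis C_diff.simps(2))
qed

lemma pd_add:
  assumes "f differentiable at x" "g differentiable at x"
  shows "pd j (\<lambda>x. f x + g x) x = pd j f x + pd j g x"
  using pd_eqI[OF has_derivative_add[OF assms[unfolded frechet_derivative_works]]]
  by (simp add: pd_def)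

lemma pd_mult:
  fixes f g :: "real^3 \<Rightarrow> real"
  assumes "f differentiable at x" "g differentiable at x"
  shows "pd j (\<lambda>x. f x * g x) x = f x * pd j g x + pd j f x * g x"
  using pd_eqI[OF has_derivative_mult[OF assms[unfolded frechet_derivative_works]]]
  by (simp add: pd_def)

lemma pd_scaleR:
  assumes "f differentiable at x" "g differentiable at x"
  shows "pd j (\<lambda>x. f x *\<^sub>R g x) x = f x *\<^sub>R pd j g x + pd j f x *\<^sub>R g x"
  using pd_eqI[OF has_derivative_scaleR[OF assms[unfolded frechet_derivative_works]]]
  by (simp add: pd_def)

lemma pd_const: "pd j (\<lambda>x. c) x = 0"
  using pd_eqI[OF has_derivative_const, of j c x] by simp

lemma C_diff_const: "C_diff k (\<lambda>x. c)"
proof (induction k arbitrary: c)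
  case (Suc k)
  have "pd j (\<lambda>x. c) = (\<lambda>x. 0)" for j using pd_const by blast
  with Suc show ?case by simp
qed simp

lemma C_diff_add: "C_diff k f \<Longrightarrow> C_diff k g \<Longrightarrow> C_diff k (\<lambda>x. f x + g x)"
proof (induction k arbitrary: f g)
  case 0 then show ?case by (simp add: continuous_on_add)
next
  case (Suc k)
  then have "pd j (\<lambda>x. f x + g x) = (\<lambda>x. pd j f x + pd j g x)" for j
    by (intro ext pd_add) auto
  with Suc show ?case by simp
qed

lemma C_diff_mult: "C_diff k f \<Longrightarrow> C_diff k g \<Longrightarrow> C_diff k (\<lambda>x. f x * g x)"
proof (induction k arbitrary: f g)
  case 0 then show ?case by (simp add: continuous_on_mult)
next
  case (Suc k)
  then have eq: "pd j (\<lambda>x. f x * g x) = (\<lambda>x. f x * pd j g x + pd j f x * g x)" for j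
    by (intro ext pd_mult) auto
  have "C_diff k f" "C_diff k g" using Suc.prems C_diff_SucD by blast+
  then have "C_diff k (\<lambda>x. f x * pd j g x + pd j f x * g x)" for j
    using Suc by (intro C_diff_add) auto
  with Suc.prems show ?case unfolding C_diff.simps eq by simp
qed

lemma trig_has_derivative:
  fixes c :: "real^3" and a b :: "'b::real_normed_vector"
  shows "((\<lambda>x. cos (c \<bullet> x) *\<^sub>R a + sin (c \<bullet> x) *\<^sub>R b) has_derivative
    (\<lambda>h. (c \<bullet> h) *\<^sub>R (cos (c \<bullet> x) *\<^sub>R b - sin (c \<bullet> x) *\<^sub>R a))) (at x)"
  by (auto intro!: derivative_eq_intros simp: algebra_simps)

lemma pd_trig:
  "pd j (\<lambda>x. cos (c \<bullet> x) *\<^sub>R a + sin (c \<bullet> x) *\<^sub>R b) x =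
     cos (c \<bullet> x) *\<^sub>R ((c $ j) *\<^sub>R b) + sin (c \<bullet> x) *\<^sub>R (- (c $ j) *\<^sub>R a)"
  by (subst pd_eqI[OF trig_has_derivative]) (simp add: algebra_simps inner_axis)

lemma C_diff_trig: "C_diff k (\<lambda>x. cos (c \<bullet> x) * a + sin (c \<bullet> x) * b)"
proof (induction k arbitrary: a b)
  case 0 show ?case by (auto intro!: continuous_intros)
next
  case (Suc k)
  have "pd j (\<lambda>x. cos (c \<bullet> x) * a + sin (c \<bullet> x) * b) =
     (\<lambda>x. cos (c \<bullet> x) * (c $ j * b) + sin (c \<bullet> x) * (- (c $ j) * a))" for j
    using pd_trig[of j c a b] by (auto simp: fun_eq_iff)
  moreover have "(\<lambda>x. cos (c \<bullet> x) * a + sin (c \<bullet> x) * b) differentiable at x" for x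
    using trig_has_derivative[of c a b x] by (auto simp: differentiable_def)
  ultimately show ?case using Suc[of "c $ _ * b" "- (c $ _) * a"] by (simp only: C_diff.simps) simp
qed

lemma trig_periodic:
  fixes k x :: "real^3"
  assumes "\<forall>i. k $ i \<in> \<int>"
  shows "cos (2 * pi * (k \<bullet> (x + axis j 1))) = cos (2 * pi * (k \<bullet> x))"
    "sin (2 * pi * (k \<bullet> (x + axis j 1))) = sin (2 * pi * (k \<bullet> x))"
proof -
  obtain n where n: "k $ j = of_int n" using assms Ints_cases by blast
  have "2 * pi * (k \<bullet> (x + axis j 1)) = 2 * pi * (k \<bullet> x) + 2 * pi * of_int n"
    by (simp add: inner_add_right inner_axis n algebra_simps)
  then show "cos (2 * pi * (k \<bullet> (x + axis j 1))) = cos (2 * pi * (k \<bullet> x))"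
    "sin (2 * pi * (k \<bullet> (x + axis j 1))) = sin (2 * pi * (k \<bullet> x))"
    by (simp_all add: cos_add sin_add)
qed

lemma test_function_trig:
  assumes "\<forall>i. k $ i \<in> \<int>"
  shows "test_function (\<lambda>x. cos (2 * pi * (k \<bullet> x)) * a + sin (2 * pi * (k \<bullet> x)) * b)"
  using C_diff_trig[of _ "(2 * pi) *\<^sub>R k" a b] trig_periodic[OF assms]
  by (auto simp: test_function_def periodic_def)

lemma test_function_const: "test_function (\<lambda>x. c)"
  by (simp add: test_function_def C_diff_const periodic_def)

lemma test_function_add: "test_function f \<Longrightarrow> test_function g \<Longrightarrow> test_function (\<lambda>x. f x + g x)"
  by (simp add: test_function_def C_diff_add periodic_def)

lemma test_function_mult: "test_function f \<Longrightarrow> test_function g \<Longrightarrow> test_function (\<lambda>x. f x * g x)"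
  by (simp add: test_function_def C_diff_mult periodic_def)

lemma test_function_sum:
  "finite I \<Longrightarrow> (\<And>i. i \<in> I \<Longrightarrow> test_function (f i)) \<Longrightarrow> test_function (\<lambda>x. \<Sum>i\<in>I. f i x)"
  by (induction I rule: finite_induct) (auto intro: test_function_const test_function_add)

lemma test_function_differentiable: "test_function \<psi> \<Longrightarrow> \<psi> differentiable at x"
  unfolding test_function_def using C_diff.simps(2) by blast

lemma test_function_continuous: "test_function \<psi> \<Longrightarrow> continuous_on UNIV \<psi>"
  unfolding test_function_def using C_diff.simps(1) by blast

lemma periodic_pd:
  assumes "periodic f" "\<And>x. f differentiable at x"
  shows "periodic (pd i f)"
  unfolding periodic_def
proof (intro allI)
  fix x j
  have eq: "f \<circ> (\<lambda>x. x + axis j 1) = f" using assms(1) by (auto simp: periodic_def)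
  have "(f has_derivative frechet_derivative f (at (x + axis j 1))) (at (x + axis j 1))"
    using assms(2) frechet_derivative_works by blast
  then have "(f \<circ> (\<lambda>x. x + axis j 1) has_derivative
      frechet_derivative f (at (x + axis j 1)) \<circ> (\<lambda>h. h)) (at x)"
    by (intro diff_chain_at) (auto intro!: derivative_eq_intros)
  then show "pd i f (x + axis j 1) = pd i f x"
    unfolding eq using pd_eqI by (fastforce simp: pd_def)
qed

lemma test_function_pd: "test_function \<psi> \<Longrightarrow> test_function (pd j \<psi>)"
  using periodic_pd[of \<psi> j] test_function_differentiable[of \<psi>]
  unfolding test_function_def by (metis C_diff.simps(2))

lemma space_torus: "space torus = cbox 0 1"
  by (simp add: torus_def space_restrict_space)

lemma finite_measure_torus: "finite_measure torus"
proof
  show "emeasure torus (space torus) \<noteq> \<infinity>"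
    by (simp add: space_torus) (simp add: torus_def emeasure_restrict_space emeasure_lborel_cbox_eq)
qed

lemma borel_measurable_torus_continuous:
  fixes f :: "real^3 \<Rightarrow> 'b::topological_space"
  shows "continuous_on UNIV f \<Longrightarrow> f \<in> borel_measurable torus"
  unfolding torus_def by (intro measurable_restrict_space1) (simp add: borel_measurable_continuous_onI)

lemma bounded_torus_continuous:
  fixes f :: "real^3 \<Rightarrow> 'b::real_normed_vector"
  assumes "continuous_on UNIV f"
  obtains B where "\<And>x. x \<in> space torus \<Longrightarrow> norm (f x) \<le> B" "0 \<le> B"
proof -
  have "compact (f ` cbox 0 1)"
    using assms by (intro compact_continuous_image) (auto intro: continuous_on_subset)
  then obtain B where "\<forall>y\<in>f ` cbox 0 1. norm y \<le> B" "B > 0"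
    using bounded_pos compact_imp_bounded by metis
  then show ?thesis using that[of B] by (auto simp: space_torus)
qed

lemma integrable_torus_continuous:
  fixes f :: "real^3 \<Rightarrow> 'b::{banach, second_countable_topology}"
  assumes "continuous_on UNIV f"
  shows "integrable torus f"
proof -
  interpret finite_measure torus by (rule finite_measure_torus)
  obtain B where "\<And>x. x \<in> space torus \<Longrightarrow> norm (f x) \<le> B"
    using bounded_torus_continuous[OF assms] by blast
  then show ?thesis
    using borel_measurable_torus_continuous[OF assms]
    by (intro integrable_const_bound[of _ B]) auto
qed

lemma square_integrable_continuous:
  assumes "continuous_on UNIV f"
  shows "square_integrable f"
  unfolding square_integrable_def
  by (intro conjI borel_measurable_torus_continuous integrable_torus_continuous continuous_intros assms)

lemma square_integrable_bounded_mult: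
  assumes "square_integrable f" "continuous_on UNIV \<psi>"
  shows "square_integrable (\<lambda>x. \<psi> x *\<^sub>R f x)"
proof -
  obtain B where B: "\<And>x. x \<in> space torus \<Longrightarrow> norm (\<psi> x) \<le> B"
    using bounded_torus_continuous[OF assms(2)] by blast
  have [measurable]: "f \<in> borel_measurable torus" "\<psi> \<in> borel_measurable torus"
    using assms borel_measurable_torus_continuous by (auto simp: square_integrable_def)
  have "integrable torus (\<lambda>x. B\<^sup>2 * (norm (f x))\<^sup>2)"
    using assms by (auto simp: square_integrable_def)
  then have "integrable torus (\<lambda>x. (norm (\<psi> x *\<^sub>R f x))\<^sup>2)"
  proof (rule Bochner_Integration.integrable_bound)
    show "AE x in torus. norm ((norm (\<psi> x *\<^sub>R f x))\<^sup>2) \<le> norm (B\<^sup>2 * (norm (f x))\<^sup>2)"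
    proof (rule AE_I2)
      fix x assume "x \<in> space torus"
      then have "\<bar>\<psi> x\<bar>\<^sup>2 \<le> B\<^sup>2" using B power_mono[of "\<bar>\<psi> x\<bar>" B 2] by auto
      then show "norm ((norm (\<psi> x *\<^sub>R f x))\<^sup>2) \<le> norm (B\<^sup>2 * (norm (f x))\<^sup>2)"
        by (simp add: power_mult_distrib mult_right_mono)
    qed
  qed measurable
  then show ?thesis by (simp add: square_integrable_def)
qed

lemma square_integrable_integrable:
  assumes "square_integrable f"
  shows "integrable torus f"
proof -
  interpret finite_measure torus by (rule finite_measure_torus)
  have [measurable]: "f \<in> borel_measurable torus" using assms by (auto simp: square_integrable_def)
  have "integrable torus (\<lambda>x. 1 + (norm (f x))\<^sup>2)"
    using assms by (auto simp: square_integrable_def)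
  then show ?thesis
  proof (rule Bochner_Integration.integrable_bound)
    show "AE x in torus. norm (f x) \<le> norm (1 + (norm (f x))\<^sup>2)"
    proof (rule AE_I2)
      fix x
      have "2 * norm (f x) \<le> 1 + (norm (f x))\<^sup>2"
        using zero_le_power2[of "norm (f x) - 1"] by (simp add: power2_eq_square algebra_simps)
      moreover have "norm (1 + (norm (f x))\<^sup>2) = 1 + (norm (f x))\<^sup>2" by simp
      ultimately show "norm (f x) \<le> norm (1 + (norm (f x))\<^sup>2)"
        using norm_ge_zero[of "f x"] by linarith
    qed
  qed measurable
qed

lemma AE_torus_iff: "(AE x in torus. P x) \<longleftrightarrow> (AE x in lborel. x \<in> cbox 0 1 \<longrightarrow> P x)"
  unfolding torus_def by (rule AE_restrict_space_iff) simp

lemma AE_torusI: "(AE x in lborel. x \<in> cbox 0 1 \<longrightarrow> P x) \<Longrightarrow> AE x in torus. P x"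
  by (simp only: AE_torus_iff)

lemma AE_hyperplane: "AE x in lborel. (x::real^3) $ i \<noteq> c"
proof -
  have "{x. (x::real^3) $ i = c} \<in> null_sets lebesgue"
    unfolding negligible_iff_null_sets[symmetric] using negligible_standard_hyperplane[of "axis i (1::real)" c] by (simp add: inner_axis axis_in_Basis_iff)
  moreover have "{x. (x::real^3) $ i = c} \<in> sets lborel"
  proof -
    have "closed {x. (x::real^3) $ i = c}" 
      by (intro closed_Collect_eq continuous_intros)
    then show ?thesis by simp
  qed
  ultimately have "{x. (x::real^3) $ i = c} \<in> null_sets lborel"
    by (simp only: null_sets_completion_iff)
  then show ?thesis by (rule AE_I') simp
qed

lemma cbox_01: "x \<in> cbox 0 (1::real^3) \<longleftrightarrow> (\<forall>i. 0 \<le> x $ i \<and> x $ i \<le> 1)"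
  by (simp add: mem_box_cart)

lemma torus_integral_halfopen:
  fixes f :: "real^3 \<Rightarrow> 'b::{banach, second_countable_topology}"
  assumes [measurable]: "f \<in> borel_measurable borel"
  shows "(\<integral>x. f x \<partial>torus) =
    (\<integral>x. indicator {x. \<forall>i. 0 \<le> x $ i \<and> x $ i < 1} x *\<^sub>R f x \<partial>lborel)"
proof -
  have [measurable]: "(\<lambda>x::real^3. x $ i) \<in> borel_measurable borel" for i
    by (intro borel_measurable_continuous_onI continuous_intros)
  have [measurable]: "{x::real^3. \<forall>i. 0 \<le> x $ i \<and> x $ i < 1} \<in> sets borel"
    by measurable
  have "(\<integral>x. f x \<partial>torus) = (\<integral>x. indicator (cbox 0 1) x *\<^sub>R f x \<partial>lborel)"
    unfolding torus_def by (rule integral_restrict_space) simp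
  also have "\<dots> = (\<integral>x. indicator {x. \<forall>i. 0 \<le> x $ i \<and> x $ i < 1} x *\<^sub>R f x \<partial>lborel)"
  proof (rule integral_cong_AE)
    have "AE x in lborel. \<forall>i\<in>UNIV. (x::real^3) $ i \<noteq> 1"
      by (intro AE_finite_allI AE_hyperplane) simp
    then show "AE x in lborel. indicator (cbox 0 1) x *\<^sub>R f x = 
        indicator {x. \<forall>i. 0 \<le> x $ i \<and> x $ i < 1} x *\<^sub>R f x"
    proof eventually_elim
      case (elim x)
      then have "x \<in> cbox 0 1 \<longleftrightarrow> x \<in> {x. \<forall>i. 0 \<le> x $ i \<and> x $ i < 1}"
        by (simp add: cbox_01 less_le)
      then show ?case by (simp only: indicator_def)
    qed
  qed measurable
  finally show ?thesis .
qed

lemma torus_integral_shift: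
  fixes f :: "real^3 \<Rightarrow> 'b::{banach, second_countable_topology}"
  assumes f: "continuous_on UNIV f" and per: "periodic f" and s: "0 \<le> s" "s \<le> 1"
  shows "(\<integral>x. f (x + s *\<^sub>R axis j 1) \<partial>torus) = (\<integral>x. f x \<partial>torus)"
proof -
  have fm [measurable]: "f \<in> borel_measurable borel"
    using f by (rule borel_measurable_continuous_onI)
  define Q where "Q x = (\<forall>i. i \<noteq> j \<longrightarrow> 0 \<le> x $ i \<and> x $ i < 1)" for x :: "real^3"
  define R where "R a b = {x. Q x \<and> a \<le> x $ j \<and> x $ j < b}" for a b
  have R_meas [measurable]: "R a b \<in> sets borel" for a b
  proof -
    have [measurable]: "(\<lambda>x::real^3. x $ i) \<in> borel_measurable borel" for i
      by (intro borel_measurable_continuous_onI continuous_intros)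
    show ?thesis unfolding R_def Q_def by measurable
  qed
  have trans: "(\<integral>x. indicator (R a b) x *\<^sub>R f (x + t *\<^sub>R axis j 1) \<partial>lborel) =
      (\<integral>x. indicator (R (a + t) (b + t)) x *\<^sub>R f x \<partial>lborel)" for a b t
  proof -
    have "(\<integral>x. indicator (R (a + t) (b + t)) x *\<^sub>R f x \<partial>lborel) = 
       (\<integral>x. indicator (R (a + t) (b + t)) x *\<^sub>R f x \<partial>(distr lborel borel ((+) (t *\<^sub>R axis j 1))))"
      by (simp add: lborel_distr_plus)
    also have "\<dots> = (\<integral>x. indicator (R (a + t) (b + t)) (t *\<^sub>R axis j 1 + x) *\<^sub>R f (t *\<^sub>R axis j 1 + x) \<partial>lborel)"
      by (subst integral_distr) auto
    also have "\<dots> = (\<integral>x. indicator (R a b) x *\<^sub>R f (x + t *\<^sub>R axis j 1) \<partial>lborel)"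
    proof (rule Bochner_Integration.integral_cong[OF refl])
      fix x :: "real^3"
      have "(t *\<^sub>R axis j 1 + x) $ i = (if i = j then t + x $ j else x $ i)" for i
        by (simp add: axis_def)
      then have "t *\<^sub>R axis j 1 + x \<in> R (a + t) (b + t) \<longleftrightarrow> x \<in> R a b"
        by (simp add: R_def Q_def)
      then show "indicator (R (a + t) (b + t)) (t *\<^sub>R axis j 1 + x) *\<^sub>R f (t *\<^sub>R axis j 1 + x) =
          indicator (R a b) x *\<^sub>R f (x + t *\<^sub>R axis j 1)"
        by (simp add: indicator_def add.commute)
    qed
    finally show ?thesis by simp
  qed
  have H: "{x. \<forall>i. 0 \<le> x $ i \<and> x $ i < 1} = R 0 1"
    by (auto simp: R_def Q_def)
  have int: "integrable lborel (\<lambda>x. indicator (R a b) x *\<^sub>R f x)" if "0 \<le> a" "b \<le> 2" for a b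
  proof -
    have sub: "R a b \<subseteq> cbox 0 (2::real^3)"
    proof
      fix x assume x: "x \<in> R a b"
      have "0 \<le> x $ i \<and> x $ i \<le> 2" for i
      proof (cases "i = j")
        case True
        have "a \<le> x $ j" "x $ j < b" using x by (auto simp: R_def)
        then have "0 \<le> x $ j \<and> x $ j \<le> 2" using that by linarith
        then show ?thesis using True by simp
      next
        case False
        then have "0 \<le> x $ i" "x $ i < 1" using x by (auto simp: R_def Q_def)
        then show ?thesis by linarith
      qed
      then show "x \<in> cbox 0 2" by (simp add: mem_box_cart)
    qed
    have "integrable lborel (\<lambda>x. indicator (cbox 0 (2::real^3)) x *\<^sub>R f x)"
      using borel_integrable_compact[of "cbox 0 (2::real^3)" f] f
      by (auto intro: continuous_on_subset)
    then show ?thesis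
    proof (rule Bochner_Integration.integrable_bound)
      show "AE x in lborel. norm (indicator (R a b) x *\<^sub>R f x) \<le> norm (indicator (cbox 0 2) x *\<^sub>R f x)"
        using sub by (auto simp: indicator_def)
    qed measurable
  qed
  have fs: "(\<lambda>x. f (x + s *\<^sub>R axis j 1)) \<in> borel_measurable borel" by measurable
  have "(\<integral>x. f (x + s *\<^sub>R axis j 1) \<partial>torus) = (\<integral>x. indicator (R s (1 + s)) x *\<^sub>R f x \<partial>lborel)"
    using torus_integral_halfopen[OF fs] trans[of 0 1 s] by (simp add: H)
  also have "\<dots> = (\<integral>x. indicator (R s 1) x *\<^sub>R f x + indicator (R 1 (1 + s)) x *\<^sub>R f x \<partial>lborel)"
  proof (rule Bochner_Integration.integral_cong[OF refl])
    fix x show "indicator (R s (1 + s)) x *\<^sub>R f x = indicator (R s 1) x *\<^sub>R f x + indicator (R 1 (1 + s)) x *\<^sub>R f x"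
      using s by (auto simp: R_def indicator_def)
  qed
  also have "\<dots> = (\<integral>x. indicator (R s 1) x *\<^sub>R f x \<partial>lborel) + (\<integral>x. indicator (R 1 (1 + s)) x *\<^sub>R f x \<partial>lborel)"
    using s by (intro Bochner_Integration.integral_add int) auto
  also have "(\<integral>x. indicator (R 1 (1 + s)) x *\<^sub>R f x \<partial>lborel) = (\<integral>x. indicator (R 0 s) x *\<^sub>R f x \<partial>lborel)"
    using trans[of 0 s 1] per by (simp add: periodic_def add.commute)
  also have "(\<integral>x. indicator (R s 1) x *\<^sub>R f x \<partial>lborel) + (\<integral>x. indicator (R 0 s) x *\<^sub>R f x \<partial>lborel) =
     (\<integral>x. indicator (R s 1) x *\<^sub>R f x + indicator (R 0 s) x *\<^sub>R f x \<partial>lborel)"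
    using s by (intro Bochner_Integration.integral_add[symmetric] int) auto
  also have "\<dots> = (\<integral>x. indicator (R 0 1) x *\<^sub>R f x \<partial>lborel)"
  proof (rule Bochner_Integration.integral_cong[OF refl])
    fix x show "indicator (R s 1) x *\<^sub>R f x + indicator (R 0 s) x *\<^sub>R f x = indicator (R 0 1) x *\<^sub>R f x"
      using s by (auto simp: R_def indicator_def)
  qed
  also have "\<dots> = (\<integral>x. f x \<partial>torus)"
    using torus_integral_halfopen[OF fm] by (simp add: H)
  finally show ?thesis .
qed

lemma torus_integral_pd_zero:
  fixes f :: "real^3 \<Rightarrow> 'b::euclidean_space"
  assumes diff: "\<And>x. f differentiable at x" and cont: "continuous_on UNIV (pd j f)" and per: "periodic f"
  shows "(\<integral>x. pd j f x \<partial>torus) = 0"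
proof -
  define M where "M = restrict_space lborel {0..1::real}"
  interpret A: finite_measure torus by (rule finite_measure_torus)
  interpret B: finite_measure M
    by standard (simp add: M_def space_restrict_space emeasure_restrict_space)
  interpret P: pair_sigma_finite torus M ..
  interpret PP: finite_measure "torus \<Otimes>\<^sub>M M"
    by (rule finite_measure_pair_measure) unfold_locales
  define g where "g x s = pd j f (x + s *\<^sub>R axis j 1)" for x s
  have per': "periodic (pd j f)" using periodic_pd[OF per diff] .
  have [measurable]: "pd j f \<in> borel_measurable borel"
    using cont by (rule borel_measurable_continuous_onI)
  have id1: "(\<lambda>x. x) \<in> borel_measurable torus" unfolding torus_def by (intro measurable_restrict_space1) simp
  have id2: "(\<lambda>x. x) \<in> borel_measurable M" unfolding M_def by (intro measurable_restrict_space1) simp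
  have m: "case_prod g \<in> borel_measurable (torus \<Otimes>\<^sub>M M)"
  proof -
    have [measurable]: "fst \<in> borel_measurable (torus \<Otimes>\<^sub>M M)" "snd \<in> borel_measurable (torus \<Otimes>\<^sub>M M)"
      using measurable_compose[OF measurable_fst id1] measurable_compose[OF measurable_snd id2] by auto
    show ?thesis unfolding g_def case_prod_beta by measurable
  qed
  obtain K where K: "\<And>x. x \<in> cbox 0 (2::real^3) \<Longrightarrow> norm (pd j f x) \<le> K"
  proof -
    have "compact (pd j f ` cbox 0 2)"
      using cont by (intro compact_continuous_image) (auto intro: continuous_on_subset)
    then show ?thesis using that bounded_iff compact_imp_bounded by (metis imageI)
  qed
  have int: "integrable (torus \<Otimes>\<^sub>M M) (case_prod g)"
  proof (rule PP.integrable_const_bound[OF _ m])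
    show "AE z in torus \<Otimes>\<^sub>M M. norm (case_prod g z) \<le> K"
    proof (rule AE_I2)
      fix z assume "z \<in> space (torus \<Otimes>\<^sub>M M)"
      then have "fst z \<in> cbox 0 1" "snd z \<in> {0..1}"
        by (auto simp: space_pair_measure space_torus M_def space_restrict_space)
      then have "fst z + snd z *\<^sub>R axis j 1 \<in> cbox 0 (2::real^3)"
      proof -
        have "0 \<le> (fst z + snd z *\<^sub>R axis j 1) $ i \<and> (fst z + snd z *\<^sub>R axis j 1) $ i \<le> 2" for i
        proof -
          have "0 \<le> fst z $ i \<and> fst z $ i \<le> 1" using \<open>fst z \<in> cbox 0 1\<close> by (simp add: cbox_01)
          moreover have "(fst z + snd z *\<^sub>R axis j 1) $ i = fst z $ i + (if i = j then snd z else 0)"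
            by (simp add: axis_def)
          moreover have "0 \<le> snd z" "snd z \<le> 1" using \<open>snd z \<in> {0..1}\<close> by auto
          ultimately show ?thesis by (cases "i = j") auto
        qed
        then show ?thesis by (simp add: mem_box_cart)
      qed
      then show "norm (case_prod g z) \<le> K" using K by (auto simp: g_def case_prod_beta)
    qed
  qed
  have inner0: "(\<integral>s. g x s \<partial>M) = 0" for x
  proof -
    have "(\<integral>s. g x s \<partial>M) = (\<integral>s. indicator {0..1} s *\<^sub>R g x s \<partial>lborel)"
      unfolding M_def by (subst integral_restrict_space) auto
    also have "\<dots> = f (x + 1 *\<^sub>R axis j 1) - f (x + 0 *\<^sub>R axis j 1)"
    proof (rule integral_FTC_Icc)
      show "continuous_on {0..1} (g x)" unfolding g_def
        by (rule continuous_on_compose2[OF cont]) (auto intro!: continuous_intros)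
      fix s :: real
      have "(f has_derivative frechet_derivative f (at (x + s *\<^sub>R axis j 1))) (at (x + s *\<^sub>R axis j 1))"
        using diff frechet_derivative_works by blast
      then have "((f \<circ> (\<lambda>s. x + s *\<^sub>R axis j 1)) has_derivative
          frechet_derivative f (at (x + s *\<^sub>R axis j 1)) \<circ> (\<lambda>h. h *\<^sub>R axis j 1)) (at s)"
        by (intro diff_chain_at) (auto intro!: derivative_eq_intros)
      moreover have "frechet_derivative f (at (x + s *\<^sub>R axis j 1)) (h *\<^sub>R axis j 1) = h *\<^sub>R g x s" for h
        unfolding g_def pd_def
        using diff linear_frechet_derivative linear_cmul by blast
      ultimately show "((\<lambda>s. f (x + s *\<^sub>R axis j 1)) has_vector_derivative g x s) (at s within {0..1})"
        unfolding has_vector_derivative_def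
        by (simp add: o_def has_derivative_at_withinI)
    qed simp
    also have "\<dots> = 0" using per by (simp add: periodic_def)
    finally show ?thesis .
  qed
  have "(\<integral>s. (\<integral>x. g x s \<partial>torus) \<partial>M) = (\<integral>x. (\<integral>s. g x s \<partial>M) \<partial>torus)"
    using P.Fubini_integral[OF int] .
  also have "\<dots> = 0" using inner0 by simp
  finally have "(\<integral>s. (\<integral>x. g x s \<partial>torus) \<partial>M) = 0" .
  moreover have "(\<integral>s. (\<integral>x. g x s \<partial>torus) \<partial>M) = (\<integral>s. (\<integral>x. pd j f x \<partial>torus) \<partial>M)"
    by (rule Bochner_Integration.integral_cong[OF refl])
      (auto simp: g_def M_def space_restrict_space intro!: torus_integral_shift cont per')
  ultimately show ?thesis
    by (simp add: M_def measure_restrict_space space_restrict_space)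
qed

lemma trig_polyE:
  assumes "trig_poly \<phi>"
  shows trig_poly_differentiable: "\<phi> differentiable at x"
    and trig_poly_pd_continuous: "continuous_on UNIV (pd j \<phi>)"
    and trig_poly_continuous: "continuous_on UNIV \<phi>"
    and trig_poly_periodic: "periodic \<phi>"
proof -
  obtain K a b where K: "finite K" "\<And>k i. k \<in> K \<Longrightarrow> k $ i \<in> \<int>" and
    \<phi>: "\<phi> = (\<lambda>x. \<Sum>k\<in>K. cos (2 * pi * (k \<bullet> x)) *\<^sub>R a k + sin (2 * pi * (k \<bullet> x)) *\<^sub>R b k)"
    using assms unfolding trig_poly_def by blast
  have D: "(\<phi> has_derivative (\<lambda>h. \<Sum>k\<in>K. (((2 * pi) *\<^sub>R k) \<bullet> h) *\<^sub>R 
      (cos (((2 * pi) *\<^sub>R k) \<bullet> x) *\<^sub>R b k - sin (((2 * pi) *\<^sub>R k) \<bullet> x) *\<^sub>R a k))) (at x)" for x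
    unfolding \<phi>
  proof (rule has_derivative_sum)
    fix k
    show "((\<lambda>x. cos (2 * pi * (k \<bullet> x)) *\<^sub>R a k + sin (2 * pi * (k \<bullet> x)) *\<^sub>R b k) has_derivative
      (\<lambda>h. (((2 * pi) *\<^sub>R k) \<bullet> h) *\<^sub>R
        (cos (((2 * pi) *\<^sub>R k) \<bullet> x) *\<^sub>R b k - sin (((2 * pi) *\<^sub>R k) \<bullet> x) *\<^sub>R a k))) (at x)"
      unfolding inner_scaleR_left
      using trig_has_derivative[where c = "(2 * pi) *\<^sub>R k" and a = "a k" and b = "b k" and x = x]
      unfolding inner_scaleR_left .
  qed
  then show d: "\<phi> differentiable at x" for x by (auto simp: differentiable_def)
  then show "continuous_on UNIV \<phi>"
    by (simp add: continuous_on_eq_continuous_at differentiable_imp_continuous_within)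
  show "continuous_on UNIV (pd j \<phi>)"
    unfolding pd_eqI[OF D, abs_def] by (intro continuous_intros)
  show "periodic \<phi>"
    unfolding periodic_def \<phi> using trig_periodic K(2) by (auto intro!: sum.cong)
qed

text \<open>Test functions are dense enough to detect the zero element of \<open>L2\<close>.\<close>

definition circle_map :: "real^3 \<Rightarrow> (real^3) \<times> (real^3)" where
  "circle_map x = ((\<chi> j. cos (2 * pi * x $ j)), (\<chi> j. sin (2 * pi * x $ j)))"

lemma test_function_cos_sin:
  "test_function (\<lambda>x. cos (2 * pi * x $ j))" "test_function (\<lambda>x. sin (2 * pi * x $ j))"
proof -
  have int: "\<forall>i. axis j (1::real) $ i \<in> \<int>" by (auto simp: axis_def)
  show "test_function (\<lambda>x. cos (2 * pi * x $ j))" "test_function (\<lambda>x. sin (2 * pi * x $ j))"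
    using test_function_trig[OF int, of 1 0] test_function_trig[OF int, of 0 1]
    by (auto simp: inner_axis')
qed

lemma vec_axis_sum: "(v::real^3) = (\<Sum>j\<in>UNIV. v $ j *\<^sub>R axis j 1)"
  by (simp add: basis_expansion scalar_mult_eq_scaleR[symmetric])

lemma test_function_poly_circle:
  "real_polynomial_function p \<Longrightarrow> test_function (\<lambda>x. p (circle_map x))"
proof (induction p rule: real_polynomial_function.induct)
  case (linear f)
  interpret f: bounded_linear f by fact
  have split: "f (v, w) = (\<Sum>j\<in>UNIV. v $ j * f (axis j 1, 0)) + (\<Sum>j\<in>UNIV. w $ j * f (0, axis j 1))" for v w :: "real^3"
  proof -
    have "f (v, w) = f (v, 0) + f (0, w)" by (simp flip: f.add)
    also have "(v, 0::real^3) = (\<Sum>j\<in>UNIV. v $ j *\<^sub>R (axis j 1, 0))"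
      by (subst vec_axis_sum[of v]) (simp add: prod_eq_iff fst_sum snd_sum)
    also have "(0::real^3, w) = (\<Sum>j\<in>UNIV. w $ j *\<^sub>R (0, axis j 1))"
      by (subst vec_axis_sum[of w]) (simp add: prod_eq_iff fst_sum snd_sum)
    also have "f (\<Sum>j\<in>UNIV. v $ j *\<^sub>R (axis j 1, 0)) = (\<Sum>j\<in>UNIV. v $ j * f (axis j 1, 0))"
      by (subst f.sum, rule sum.cong[OF refl], subst f.scaleR, rule real_scaleR_def)
    also have "f (\<Sum>j\<in>UNIV. w $ j *\<^sub>R (0, axis j 1)) = (\<Sum>j\<in>UNIV. w $ j * f (0, axis j 1))"
      by (subst f.sum, rule sum.cong[OF refl], subst f.scaleR, rule real_scaleR_def)
    finally show ?thesis .
  qed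
  have eq: "(\<lambda>x. f (circle_map x)) = (\<lambda>x. (\<Sum>j\<in>UNIV. cos (2 * pi * x $ j) * f (axis j 1, 0)) +
     (\<Sum>j\<in>UNIV. sin (2 * pi * x $ j) * f (0, axis j 1)))"
    unfolding circle_map_def by (rule ext, subst split) simp
  show ?case
    unfolding eq
    by (rule test_function_add[OF
          test_function_sum[OF finite test_function_mult[OF test_function_cos_sin(1) test_function_const]]
          test_function_sum[OF finite test_function_mult[OF test_function_cos_sin(2) test_function_const]]])
qed (auto intro: test_function_const test_function_add test_function_mult)

lemma circle_map_inj:
  assumes "circle_map x = circle_map y" "x \<in> cbox 0 1" "y \<in> box 0 1"
  shows "x = y"
proof (rule vec_eq_iff[THEN iffD2], rule allI)
  fix i
  have "cos (2 * pi * x $ i) = cos (2 * pi * y $ i)" "sin (2 * pi * x $ i) = sin (2 * pi * y $ i)"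
    using assms(1) by (simp_all add: circle_map_def vec_eq_iff)
  then obtain n :: int where n: "2 * pi * x $ i = 2 * pi * y $ i + 2 * pi * n"
    using sin_cos_eq_iff by metis
  then have "(2 * pi) * x $ i = (2 * pi) * (y $ i + n)"
    by (simp only: distrib_left)
  then have "x $ i = y $ i + n"
    by (rule mult_left_cancel[THEN iffD1, rotated]) simp
  moreover have "0 \<le> x $ i" "x $ i \<le> 1" "0 < y $ i" "y $ i < 1"
    using assms(2,3) by (auto simp: mem_box_cart)
  ultimately have "n = 0" by linarith
  then show "x $ i = y $ i" using \<open>x $ i = y $ i + n\<close> by simp
qed

lemma continuous_circle_map: "continuous_on S circle_map"
  unfolding circle_map_def by (intro continuous_intros)

lemma test_function_detects_zero:
  assumes g: "square_integrable g"
    and 0: "\<And>\<psi>. test_function \<psi> \<Longrightarrow> (\<integral>x. \<psi> x *\<^sub>R g x \<partial>torus) = 0"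
  shows "AE x in torus. g x = 0"
proof -
  have gi: "integrable torus g" using g by (rule square_integrable_integrable)
  then have [measurable]: "g \<in> borel_measurable torus" by auto
  have ng: "integrable torus (\<lambda>x. norm (g x))" using gi by auto
  have sets: "sets torus = sets (restrict_space borel (cbox 0 1))"
    unfolding torus_def by (rule sets_restrict_space_cong) simp
  have borel_torus: "A \<in> sets borel \<Longrightarrow> A \<inter> cbox 0 1 \<in> sets torus" for A
    unfolding sets by (auto simp: sets_restrict_space)
  have ind_meas: "A \<in> sets borel \<Longrightarrow> (indicator A :: _ \<Rightarrow> real) \<in> borel_measurable torus" for A
    unfolding torus_def by (intro measurable_restrict_space1 borel_measurable_indicator) simp
  have cont0: "(\<integral>x. F (circle_map x) *\<^sub>R g x \<partial>torus) = 0" 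
    if F: "continuous_on UNIV F" for F :: "(real^3) \<times> (real^3) \<Rightarrow> real"
  proof -
    let ?S = "circle_map ` cbox 0 1"
    have S: "compact ?S" by (intro compact_continuous_image continuous_circle_map) simp
    have "\<exists>p. real_polynomial_function p \<and> (\<forall>z\<in>?S. \<bar>F z - p z\<bar> < inverse (real (Suc n)))" for n
    proof -
      have "0 < inverse (real (Suc n))" by simp
      then obtain q where "real_polynomial_function q" "\<And>z. z \<in> ?S \<Longrightarrow> \<bar>F z - q z\<bar> < inverse (real (Suc n))"
        using Stone_Weierstrass_real_polynomial_function[OF S continuous_on_subset[OF F subset_UNIV]] by blast
      then show ?thesis by blast
    qed
    then obtain p where p: "\<And>n. real_polynomial_function (p n)"
      "\<And>n z. z \<in> ?S \<Longrightarrow> \<bar>F z - p n z\<bar> < inverse (real (Suc n))" by metis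
    have Fc: "continuous_on UNIV (\<lambda>x. F (circle_map x))"
      by (rule continuous_on_compose2[OF F continuous_circle_map]) auto
    obtain B where B: "\<And>x. x \<in> space torus \<Longrightarrow> norm (F (circle_map x)) \<le> B"
      using bounded_torus_continuous[OF Fc] by blast
    have [measurable]: "(\<lambda>x. F (circle_map x)) \<in> borel_measurable torus"
      using Fc by (rule borel_measurable_torus_continuous)
    have [measurable]: "(\<lambda>x. p n (circle_map x)) \<in> borel_measurable torus" for n
      using test_function_continuous[OF test_function_poly_circle[OF p(1)]]
      by (rule borel_measurable_torus_continuous)
    have "(\<lambda>n. \<integral>x. p n (circle_map x) *\<^sub>R g x \<partial>torus) \<longlonglongrightarrow> (\<integral>x. F (circle_map x) *\<^sub>R g x \<partial>torus)"
    proof (rule integral_dominated_convergence)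
      show "integrable torus (\<lambda>x. (B + 1) * norm (g x))" using ng by simp
      show "AE x in torus. (\<lambda>n. p n (circle_map x) *\<^sub>R g x) \<longlonglongrightarrow> F (circle_map x) *\<^sub>R g x"
      proof (rule AE_I2)
        fix x assume x: "x \<in> space torus"
        have "(\<lambda>n. p n (circle_map x)) \<longlonglongrightarrow> F (circle_map x)"
        proof (rule LIMSEQ_I)
          fix r :: real assume "0 < r"
          then obtain N where N: "inverse (real (Suc N)) < r" using reals_Archimedean by blast
          have "norm (p n (circle_map x) - F (circle_map x)) < r" if "n \<ge> N" for n
          proof -
            have "\<bar>F (circle_map x) - p n (circle_map x)\<bar> < inverse (real (Suc n))"
              using p(2) x by (simp add: space_torus)
            also have "\<dots> \<le> inverse (real (Suc N))" using that by (simp add: field_simps)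
            finally show ?thesis using N by (simp add: abs_minus_commute)
          qed
          then show "\<exists>N. \<forall>n\<ge>N. norm (p n (circle_map x) - F (circle_map x)) < r" by blast
        qed
        then show "(\<lambda>n. p n (circle_map x) *\<^sub>R g x) \<longlonglongrightarrow> F (circle_map x) *\<^sub>R g x"
          by (intro tendsto_intros)
      qed
      show "AE x in torus. norm (p n (circle_map x) *\<^sub>R g x) \<le> (B + 1) * norm (g x)" for n
      proof (rule AE_I2)
        fix x assume x: "x \<in> space torus"
        have "\<bar>F (circle_map x) - p n (circle_map x)\<bar> < inverse (real (Suc n))"
          using p(2) x by (simp add: space_torus)
        also have "\<dots> \<le> 1" by (simp add: field_simps)
        finally have "\<bar>p n (circle_map x)\<bar> \<le> B + 1" using B[OF x] by simp
        then show "norm (p n (circle_map x) *\<^sub>R g x) \<le> (B + 1) * norm (g x)"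
          by (simp add: mult_right_mono)
      qed
    qed measurable
    moreover have "(\<integral>x. p n (circle_map x) *\<^sub>R g x \<partial>torus) = 0" for n
      using 0[OF test_function_poly_circle[OF p(1)]] .
    ultimately show ?thesis by (simp add: LIMSEQ_const_iff)
  qed
  have compact0: "(\<integral>x. indicator K x *\<^sub>R g x \<partial>torus) = 0" if K: "compact K" "K \<subseteq> box 0 1" for K
  proof (cases "K = {}")
    case False
    define C where "C = circle_map ` K"
    have C: "closed C" "C \<noteq> {}"
      using False compact_imp_closed[OF compact_continuous_image[OF continuous_circle_map K(1)]]
      by (auto simp: C_def)
    have mem: "circle_map x \<in> C \<longleftrightarrow> x \<in> K" if "x \<in> cbox 0 1" for x
      using circle_map_inj[OF _ that] K(2) by (auto simp: C_def)
    define F where "F n z = max 0 (1 - real n * infdist z C)" for n z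
    have Fc: "continuous_on UNIV (F n)" for n
      unfolding F_def by (intro continuous_intros)
    have "(\<lambda>n. \<integral>x. F n (circle_map x) *\<^sub>R g x \<partial>torus) \<longlonglongrightarrow> (\<integral>x. indicator K x *\<^sub>R g x \<partial>torus)"
    proof (rule integral_dominated_convergence[OF _ _ ng])
      show "(\<lambda>x. indicator K x *\<^sub>R g x) \<in> borel_measurable torus"
        using ind_meas[of K] K(1) by (simp add: borel_compact)
      show "(\<lambda>x. F n (circle_map x) *\<^sub>R g x) \<in> borel_measurable torus" for n
        using borel_measurable_torus_continuous[OF continuous_on_compose2[OF Fc continuous_circle_map subset_UNIV]]
        by simp
      show "AE x in torus. (\<lambda>n. F n (circle_map x) *\<^sub>R g x) \<longlonglongrightarrow> indicator K x *\<^sub>R g x"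
      proof (rule AE_I2)
        fix x assume "x \<in> space torus"
        then have x: "x \<in> cbox 0 1" by (simp add: space_torus)
        have "(\<lambda>n. F n (circle_map x)) \<longlonglongrightarrow> indicator K x"
        proof (cases "x \<in> K")
          case True
          then have "F n (circle_map x) = 1" for n
            using mem[OF x] by (simp add: F_def)
          then show ?thesis using True by simp
        next
          case False
          then have d: "infdist (circle_map x) C > 0"
            using mem[OF x] in_closed_iff_infdist_zero[OF C, of "circle_map x"] infdist_nonneg[of "circle_map x" C]
            by (simp add: less_le)
          obtain N where N: "1 / infdist (circle_map x) C < real N" using reals_Archimedean2 by blast
          have "F n (circle_map x) = 0" if "n \<ge> N" for n
          proof -
            have "1 / infdist (circle_map x) C < real n" using N that by linarith
            then have "1 < real n * infdist (circle_map x) C" using d by (simp add: field_simps)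
            then show ?thesis by (simp add: F_def)
          qed
          then have "eventually (\<lambda>n. F n (circle_map x) = 0) sequentially"
            by (auto simp: eventually_sequentially)
          then show ?thesis using False by (simp add: tendsto_eventually)
        qed
        then show "(\<lambda>n. F n (circle_map x) *\<^sub>R g x) \<longlonglongrightarrow> indicator K x *\<^sub>R g x"
          by (intro tendsto_intros)
      qed
      show "AE x in torus. norm (F n (circle_map x) *\<^sub>R g x) \<le> norm (g x)" for n
        by (rule AE_I2) (auto simp: F_def infdist_nonneg intro!: mult_left_le_one_le)
    qed
    then show ?thesis using cont0[OF Fc] by (simp add: LIMSEQ_const_iff)
  qed simp
  have closed0: "(\<integral>x. indicator (A \<inter> box 0 1) x *\<^sub>R g x \<partial>torus) = 0" if A: "closed A" for A
  proof -
    define K where "K n = A \<inter> cbox (\<chi> i. inverse (real (Suc n))) (\<chi> i. 1 - inverse (real (Suc n)))" for n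
    have K: "compact (K n)" for n unfolding K_def using A by (intro closed_Int_compact compact_cbox)
    have Ksub: "K n \<subseteq> box 0 1" for n
      unfolding K_def subset_eq
    proof (intro ballI)
      fix x :: "real^3" assume x: "x \<in> A \<inter> cbox (\<chi> i. inverse (real (Suc n))) (\<chi> i. 1 - inverse (real (Suc n)))"
      have "0 < inverse (real (Suc n))" by simp
      then have "0 < x $ i \<and> x $ i < 1" for i
      proof -
        have "inverse (real (Suc n)) \<le> x $ i \<and> x $ i \<le> 1 - inverse (real (Suc n))"
          using x unfolding Int_iff mem_box_cart vec_lambda_beta by blast
        then show ?thesis using \<open>0 < inverse (real (Suc n))\<close> by linarith
      qed
      then show "x \<in> box 0 1" by (simp add: mem_box_cart)
    qed
    have "(\<lambda>n. \<integral>x. indicator (K n) x *\<^sub>R g x \<partial>torus) \<longlonglongrightarrow> (\<integral>x. indicator (A \<inter> box 0 1) x *\<^sub>R g x \<partial>torus)"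
    proof (rule integral_dominated_convergence[OF _ _ ng])
      show "(\<lambda>x. indicator (A \<inter> box 0 1) x *\<^sub>R g x) \<in> borel_measurable torus"
        using ind_meas[of "A \<inter> box 0 1"] A by simp
      show "(\<lambda>x. indicator (K n) x *\<^sub>R g x) \<in> borel_measurable torus" for n
        using ind_meas[of "K n"] K by (simp add: borel_compact)
      show "AE x in torus. norm (indicator (K n) x *\<^sub>R g x) \<le> norm (g x)" for n
        by (rule AE_I2) (auto simp: indicator_def)
      show "AE x in torus. (\<lambda>n. indicator (K n) x *\<^sub>R g x) \<longlonglongrightarrow> indicator (A \<inter> box 0 1) x *\<^sub>R g x"
      proof (rule AE_I2)
        fix x
        have "eventually (\<lambda>n. indicator (K n) x = (indicator (A \<inter> box 0 1) x :: real)) sequentially"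
        proof (cases "x \<in> A \<inter> box 0 1")
          case False
          then have "x \<notin> K n" for n using Ksub[of n] by (auto simp: K_def)
          then show ?thesis using False by (simp add: indicator_def)
        next
          case True
          define m where "m = Min (range (\<lambda>i. min (x $ i) (1 - x $ i)))"
          have m: "m \<le> x $ i" "m \<le> 1 - x $ i" for i
          proof -
            have "m \<le> min (x $ i) (1 - x $ i)" unfolding m_def by (rule Min_le) auto
            then show "m \<le> x $ i" "m \<le> 1 - x $ i" by simp_all
          qed
          have "m > 0"
          proof -
            have "m \<in> range (\<lambda>i. min (x $ i) (1 - x $ i))" unfolding m_def by (rule Min_in) auto
            then show ?thesis using True by (auto simp: mem_box_cart)
          qed
          then obtain N where N: "inverse (real (Suc N)) < m" using reals_Archimedean by blast
          have "x \<in> K n" if "n \<ge> N" for n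
          proof -
            have "inverse (real (Suc n)) \<le> inverse (real (Suc N))" using that by (simp add: field_simps)
            with N have n: "inverse (real (Suc n)) \<le> m" by linarith
            have "inverse (real (Suc n)) \<le> x $ i \<and> x $ i \<le> 1 - inverse (real (Suc n))" for i
              using n m[of i] by linarith
            then show ?thesis using True unfolding K_def mem_box_cart Int_iff vec_lambda_beta by blast
          qed
          then show ?thesis using True by (auto simp: eventually_sequentially indicator_def)
        qed
        then have "(\<lambda>n. indicator (K n) x :: real) \<longlonglongrightarrow> indicator (A \<inter> box 0 1) x"
          by (rule tendsto_eventually)
        then show "(\<lambda>n. indicator (K n) x *\<^sub>R g x) \<longlonglongrightarrow> indicator (A \<inter> box 0 1) x *\<^sub>R g x"
          by (intro tendsto_intros)
      qed
    qed
    then show ?thesis using compact0[OF K Ksub] by (simp add: LIMSEQ_const_iff)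
  qed
  have int_ind: "A \<in> sets borel \<Longrightarrow> integrable torus (\<lambda>x. indicator A x *\<^sub>R g x)" for A
  proof (rule Bochner_Integration.integrable_bound[OF gi])
    show "(\<lambda>x. indicator A x *\<^sub>R g x) \<in> borel_measurable torus" if "A \<in> sets borel"
      by (intro borel_measurable_scaleR ind_meas that) measurable
    show "AE x in torus. norm (indicator A x *\<^sub>R g x) \<le> norm (g x)"
      by (rule AE_I2) (simp add: indicator_def)
  qed
  have borel0: "(\<integral>x. indicator (A \<inter> box 0 1) x *\<^sub>R g x \<partial>torus) = 0" if "A \<in> sets borel" for A
  proof -
    have "Int_stable (Collect closed :: (real^3) set set)"
      by (auto simp: Int_stable_def)
    moreover have "(Collect closed :: (real^3) set set) \<subseteq> Pow UNIV" by simp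
    moreover have "A \<in> sigma_sets UNIV (Collect closed)" using that by (simp add: borel_eq_closed)
    ultimately show ?thesis
    proof (induct rule: sigma_sets_induct_disjoint)
      case (basic A) then show ?case using closed0 by simp
    next
      case empty then show ?case by simp
    next
      case (compl A)
      have A: "A \<in> sets borel" using compl(1) by (simp add: borel_eq_closed)
      have "(\<integral>x. indicator ((UNIV - A) \<inter> box 0 1) x *\<^sub>R g x \<partial>torus) = 
         (\<integral>x. indicator (UNIV \<inter> box 0 1) x *\<^sub>R g x - indicator (A \<inter> box 0 1) x *\<^sub>R g x \<partial>torus)"
        by (rule Bochner_Integration.integral_cong) (auto simp: indicator_def)
      also have "\<dots> = (\<integral>x. indicator (UNIV \<inter> box 0 1) x *\<^sub>R g x \<partial>torus) - (\<integral>x. indicator (A \<inter> box 0 1) x *\<^sub>R g x \<partial>torus)"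
        using A by (intro Bochner_Integration.integral_diff int_ind) auto
      also have "\<dots> = 0" using closed0[OF closed_UNIV] compl(2) by simp
      finally show ?case .
    next
      case (union A)
      have A: "A i \<in> sets borel" for i using union(2) by (auto simp: borel_eq_closed)
      have "(\<lambda>n. \<integral>x. (\<Sum>i<n. indicator (A i \<inter> box 0 1) x *\<^sub>R g x) \<partial>torus) \<longlonglongrightarrow> 
          (\<integral>x. indicator ((\<Union>i. A i) \<inter> box 0 1) x *\<^sub>R g x \<partial>torus)"
      proof (rule integral_dominated_convergence[OF _ _ ng])
        show "(\<lambda>x. indicator ((\<Union>i. A i) \<inter> box 0 1) x *\<^sub>R g x) \<in> borel_measurable torus"
          by (rule borel_measurable_integrable, rule int_ind) (use A in auto)
        show "(\<lambda>x. \<Sum>i<n. indicator (A i \<inter> box 0 1) x *\<^sub>R g x) \<in> borel_measurable torus" for n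
          by (intro borel_measurable_sum borel_measurable_integrable int_ind) (use A in auto)
        have disj: "disjoint_family (\<lambda>i. A i \<inter> box 0 1)"
          using union(1) by (auto simp: disjoint_family_on_def)
        have sums: "(\<lambda>i. indicator (A i \<inter> box 0 1) x :: real) sums indicator (\<Union>i. A i \<inter> box 0 1) x" for x
          using indicator_sums[of "\<lambda>i. A i \<inter> box 0 1" x] disj by (auto simp: disjoint_family_on_def)
        have eq: "(\<Sum>i<n. indicator (A i \<inter> box 0 1) x *\<^sub>R g x) = (\<Sum>i<n. indicator (A i \<inter> box 0 1) x) *\<^sub>R g x" for n x
          by (simp add: scaleR_sum_left)
        show "AE x in torus. (\<lambda>n. \<Sum>i<n. indicator (A i \<inter> box 0 1) x *\<^sub>R g x) \<longlonglongrightarrow> indicator ((\<Union>i. A i) \<inter> box 0 1) x *\<^sub>R g x"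
        proof (rule AE_I2)
          fix x
          have "(\<Union>i. A i) \<inter> box 0 1 = (\<Union>i. A i \<inter> box 0 1)" by auto
          then show "(\<lambda>n. \<Sum>i<n. indicator (A i \<inter> box 0 1) x *\<^sub>R g x) \<longlonglongrightarrow> indicator ((\<Union>i. A i) \<inter> box 0 1) x *\<^sub>R g x"
            unfolding eq using sums[of x] by (intro tendsto_intros) (simp add: sums_def)
        qed
        show "AE x in torus. norm (\<Sum>i<n. indicator (A i \<inter> box 0 1) x *\<^sub>R g x) \<le> norm (g x)" for n
        proof (rule AE_I2)
          fix x
          have "(\<Sum>i<n. indicator (A i \<inter> box 0 1) x :: real) \<le> indicator (\<Union>i. A i \<inter> box 0 1) x"
            using sums[of x] by (intro sum_le_suminf[of _ "{..<n}", simplified, THEN order_trans])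
              (auto simp: sums_iff)
          also have "\<dots> \<le> 1" by (simp add: indicator_def)
          finally show "norm (\<Sum>i<n. indicator (A i \<inter> box 0 1) x *\<^sub>R g x) \<le> norm (g x)"
            unfolding eq by (simp add: sum_nonneg mult_left_le_one_le)
        qed
      qed
      moreover have "(\<integral>x. (\<Sum>i<n. indicator (A i \<inter> box 0 1) x *\<^sub>R g x) \<partial>torus) = 0" for n
        using union(3) A by (subst Bochner_Integration.integral_sum) (auto intro!: int_ind)
      ultimately show ?case by (simp add: LIMSEQ_const_iff)
    qed
  qed
  have bdry: "AE x in torus. x \<in> box 0 1"
  proof (rule AE_torusI)
    have "AE x in lborel. \<forall>i\<in>UNIV. (x::real^3) $ i \<noteq> 0 \<and> x $ i \<noteq> 1"
      by (intro AE_finite_allI AE_conjI AE_hyperplane) simp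
    then show "AE x in lborel. x \<in> cbox 0 (1::real^3) \<longrightarrow> x \<in> box 0 1"
      by eventually_elim (auto simp: mem_box_cart less_le)
  qed
  interpret finite_measure torus by (rule finite_measure_torus)
  show ?thesis
  proof (rule density_zero[OF gi])
    fix A assume "A \<in> sets torus"
    then obtain B where B: "B \<in> sets borel" "A = cbox 0 1 \<inter> B"
      unfolding sets by (auto simp: sets_restrict_space)
    have "(\<integral>x. indicator A x *\<^sub>R g x \<partial>torus) = (\<integral>x. indicator (B \<inter> box 0 1) x *\<^sub>R g x \<partial>torus)"
    proof (rule integral_cong_AE)
      show "AE x in torus. indicator A x *\<^sub>R g x = indicator (B \<inter> box 0 1) x *\<^sub>R g x"
        using bdry by eventually_elim (use B box_subset_cbox in \<open>auto simp: indicator_def\<close>)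
    qed (use B in \<open>auto intro!: borel_measurable_scaleR ind_meas\<close>)
    also have "\<dots> = 0" using borel0 B by blast
    finally show "set_lebesgue_integral torus A g = 0" unfolding set_lebesgue_integral_def .
  qed
qed

section \<open>Weak derivatives and the spaces \<open>H\<close> and \<open>V\<close>\<close>

lemma square_integrable_rep_L2: "square_integrable (rep_L2 f)"
  using Quotient_rep_reflp[OF Quotient_L2, of f] by simp

lemma to_L2_rep_L2: "to_L2 (rep_L2 f) = f"
  using Quotient_abs_rep[OF Quotient_L2] .

lemma to_L2_eq_iff:
  "square_integrable f \<Longrightarrow> square_integrable g \<Longrightarrow> to_L2 f = to_L2 g \<longleftrightarrow> (AE x in torus. f x = g x)"
  using Quotient_rel[OF Quotient_L2, of f g] by simp

lemma rep_to_L2: "square_integrable f \<Longrightarrow> AE x in torus. rep_L2 (to_L2 f) x = f x"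
  using to_L2_eq_iff[OF square_integrable_rep_L2, of f "to_L2 f"] by (simp add: to_L2_rep_L2)

lemma L2_eq_iff: "f = g \<longleftrightarrow> (AE x in torus. rep_L2 f x = rep_L2 g x)"
  using to_L2_eq_iff[OF square_integrable_rep_L2 square_integrable_rep_L2, of f g]
  by (simp add: to_L2_rep_L2)

lemma to_L2_add: "square_integrable f \<Longrightarrow> square_integrable g \<Longrightarrow> to_L2 (\<lambda>x. f x + g x) = to_L2 f + to_L2 g"
  by (rule sym) (rule plus_L2.abs_eq; simp)

lemma to_L2_scaleR: "square_integrable f \<Longrightarrow> to_L2 (\<lambda>x. c *\<^sub>R f x) = c *\<^sub>R to_L2 f"
  by (rule sym) (rule scaleR_L2.abs_eq; simp)

lemma rep_L2_add: "AE x in torus. rep_L2 (f + g) x = rep_L2 f x + rep_L2 g x"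
  using rep_to_L2[OF square_integrable_add[OF square_integrable_rep_L2 square_integrable_rep_L2], of f g]
  by (simp add: to_L2_add square_integrable_rep_L2 to_L2_rep_L2)

lemma rep_L2_scaleR: "AE x in torus. rep_L2 (c *\<^sub>R f) x = c *\<^sub>R rep_L2 f x"
  using rep_to_L2[OF square_integrable_scaleR[OF square_integrable_rep_L2], of c f]
  by (simp add: to_L2_scaleR square_integrable_rep_L2 to_L2_rep_L2)

lemma inner_L2_rep: "f \<bullet> g = (\<integral>x. rep_L2 f x \<bullet> rep_L2 g x \<partial>torus)"
  using inner_L2.abs_eq[of "rep_L2 f" "rep_L2 g"] by (simp add: square_integrable_rep_L2 to_L2_rep_L2)

text \<open>
  Weak derivatives on the torus are tested against smooth periodic functions, not against functions
  of compact support in the open cube, so that periodicity is part of membership in \<open>H1\<close>.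
\<close>

definition weak_pd :: "3 \<Rightarrow> L2 \<Rightarrow> L2 \<Rightarrow> bool" where
  "weak_pd j f g \<longleftrightarrow> (\<forall>\<psi>. test_function \<psi> \<longrightarrow>
     (\<integral>x. pd j \<psi> x *\<^sub>R rep_L2 f x \<partial>torus) = - (\<integral>x. \<psi> x *\<^sub>R rep_L2 g x \<partial>torus))"

definition H1 :: "L2 set" where
  "H1 = {f. \<forall>j. \<exists>g. weak_pd j f g}"

definition wpd :: "3 \<Rightarrow> L2 \<Rightarrow> L2" where
  "wpd j f = (THE g. weak_pd j f g)"

definition norm_H1 :: "L2 \<Rightarrow> real" where
  "norm_H1 f = sqrt ((norm f)\<^sup>2 + (\<Sum>j\<in>UNIV. (norm (wpd j f))\<^sup>2))"

definition H_set :: "L2 set" where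
  "H_set = closure (to_L2 ` \<V>)"

definition V_set :: "L2 set" where
  "V_set = {f \<in> H1. \<forall>e>0. \<exists>\<phi>\<in>\<V>. norm_H1 (f - to_L2 \<phi>) < e}"

lemma integrable_test_rep:
  "test_function \<psi> \<Longrightarrow> integrable torus (\<lambda>x. \<psi> x *\<^sub>R rep_L2 f x)"
  by (intro square_integrable_integrable square_integrable_bounded_mult square_integrable_rep_L2
      test_function_continuous)

lemma test_integral_cong:
  assumes "test_function \<psi>" "AE x in torus. rep_L2 f x = h x" "square_integrable h"
  shows "(\<integral>x. \<psi> x *\<^sub>R rep_L2 f x \<partial>torus) = (\<integral>x. \<psi> x *\<^sub>R h x \<partial>torus)"
proof (rule integral_cong_AE)
  show "(\<lambda>x. \<psi> x *\<^sub>R rep_L2 f x) \<in> borel_measurable torus"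
    using integrable_test_rep[OF assms(1)] by (rule borel_measurable_integrable)
  show "(\<lambda>x. \<psi> x *\<^sub>R h x) \<in> borel_measurable torus"
    using square_integrable_bounded_mult[OF assms(3) test_function_continuous[OF assms(1)]]
    by (simp add: square_integrable_def)
  show "AE x in torus. \<psi> x *\<^sub>R rep_L2 f x = \<psi> x *\<^sub>R h x"
    using assms(2) by eventually_elim simp
qed

lemma test_integral_add:
  assumes "test_function \<psi>"
  shows "(\<integral>x. \<psi> x *\<^sub>R rep_L2 (f + g) x \<partial>torus) =
    (\<integral>x. \<psi> x *\<^sub>R rep_L2 f x \<partial>torus) + (\<integral>x. \<psi> x *\<^sub>R rep_L2 g x \<partial>torus)"
  using test_integral_cong[OF assms rep_L2_add square_integrable_add[OF square_integrable_rep_L2 square_integrable_rep_L2], of f g]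
  by (simp add: scaleR_add_right integrable_test_rep[OF assms])

lemma test_integral_scaleR:
  assumes "test_function \<psi>"
  shows "(\<integral>x. \<psi> x *\<^sub>R rep_L2 (c *\<^sub>R f) x \<partial>torus) = c *\<^sub>R (\<integral>x. \<psi> x *\<^sub>R rep_L2 f x \<partial>torus)"
proof -
  have "(\<integral>x. \<psi> x *\<^sub>R rep_L2 (c *\<^sub>R f) x \<partial>torus) = (\<integral>x. \<psi> x *\<^sub>R (c *\<^sub>R rep_L2 f x) \<partial>torus)"
    by (rule test_integral_cong[OF assms rep_L2_scaleR square_integrable_scaleR[OF square_integrable_rep_L2]])
  also have "\<dots> = (\<integral>x. c *\<^sub>R (\<psi> x *\<^sub>R rep_L2 f x) \<partial>torus)"
    by (simp only: scaleR_left_commute)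
  also have "\<dots> = c *\<^sub>R (\<integral>x. \<psi> x *\<^sub>R rep_L2 f x \<partial>torus)"
    by (rule integral_scaleR_right)
  finally show ?thesis .
qed

lemma weak_pd_add: "weak_pd j f f' \<Longrightarrow> weak_pd j g g' \<Longrightarrow> weak_pd j (f + g) (f' + g')"
  by (simp add: weak_pd_def test_integral_add test_function_pd)

lemma weak_pd_scaleR: "weak_pd j f f' \<Longrightarrow> weak_pd j (c *\<^sub>R f) (c *\<^sub>R f')"
  by (simp add: weak_pd_def test_integral_scaleR test_function_pd)

lemma weak_pd_unique:
  assumes "weak_pd j f g" "weak_pd j f g'"
  shows "g = g'"
proof -
  have "AE x in torus. rep_L2 (g + (-1) *\<^sub>R g') x = 0"
  proof (rule test_function_detects_zero[OF square_integrable_rep_L2])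
    fix \<psi> assume \<psi>: "test_function \<psi>"
    have "(\<integral>x. \<psi> x *\<^sub>R rep_L2 g x \<partial>torus) = (\<integral>x. \<psi> x *\<^sub>R rep_L2 g' x \<partial>torus)"
      using assms \<psi> by (simp add: weak_pd_def)
    then show "(\<integral>x. \<psi> x *\<^sub>R rep_L2 (g + (-1) *\<^sub>R g') x \<partial>torus) = 0"
      by (simp only: test_integral_add[OF \<psi>] test_integral_scaleR[OF \<psi>]) simp
  qed
  then have "to_L2 (rep_L2 (g + (-1) *\<^sub>R g')) = to_L2 (\<lambda>_. 0)"
    using to_L2_eq_iff[OF square_integrable_rep_L2 square_integrable_zero] by blast
  then have "g + (-1) *\<^sub>R g' = 0" by (simp only: to_L2_rep_L2 zero_L2.abs_eq)
  then show ?thesis by simp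
qed

lemma wpd_eqI: "weak_pd j f g \<Longrightarrow> wpd j f = g"
  unfolding wpd_def using weak_pd_unique by blast

lemma weak_pd_wpd: "f \<in> H1 \<Longrightarrow> weak_pd j f (wpd j f)"
  using wpd_eqI by (fastforce simp: H1_def)

lemma H1_add: "f \<in> H1 \<Longrightarrow> g \<in> H1 \<Longrightarrow> f + g \<in> H1"
  unfolding H1_def using weak_pd_add by fast

lemma H1_scaleR: "f \<in> H1 \<Longrightarrow> c *\<^sub>R f \<in> H1"
  unfolding H1_def using weak_pd_scaleR by fast

lemma H1_diff: "f \<in> H1 \<Longrightarrow> g \<in> H1 \<Longrightarrow> f - g \<in> H1"
  using H1_add[of f "(-1) *\<^sub>R g"] H1_scaleR[of g "-1"] by simp

lemma wpd_add: "f \<in> H1 \<Longrightarrow> g \<in> H1 \<Longrightarrow> wpd j (f + g) = wpd j f + wpd j g"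
  by (intro wpd_eqI weak_pd_add weak_pd_wpd)

lemma wpd_scaleR: "f \<in> H1 \<Longrightarrow> wpd j (c *\<^sub>R f) = c *\<^sub>R wpd j f"
  by (intro wpd_eqI weak_pd_scaleR weak_pd_wpd)

lemma norm_H1_alt: "norm_H1 f = norm (f, (\<chi> j. wpd j f))"
  by (simp add: norm_H1_def norm_prod_def norm_vec_def L2_set_def sum_nonneg)

lemma norm_H1_add: "f \<in> H1 \<Longrightarrow> g \<in> H1 \<Longrightarrow> norm_H1 (f + g) \<le> norm_H1 f + norm_H1 g"
proof -
  assume "f \<in> H1" "g \<in> H1"
  then have "(f + g, (\<chi> j. wpd j (f + g))) = (f, (\<chi> j. wpd j f)) + (g, (\<chi> j. wpd j g))"
    by (simp add: wpd_add vec_eq_iff)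
  then show ?thesis unfolding norm_H1_alt by (simp only: norm_triangle_ineq)
qed

lemma norm_H1_scaleR: "f \<in> H1 \<Longrightarrow> norm_H1 (c *\<^sub>R f) = \<bar>c\<bar> * norm_H1 f"
proof -
  assume "f \<in> H1"
  then have "(c *\<^sub>R f, (\<chi> j. wpd j (c *\<^sub>R f))) = c *\<^sub>R (f, (\<chi> j. wpd j f))"
    by (simp add: wpd_scaleR vec_eq_iff)
  then show ?thesis unfolding norm_H1_alt by (simp only: norm_scaleR)
qed

lemma norm_le_norm_H1: "norm f \<le> norm_H1 f"
  unfolding norm_H1_def by (rule real_le_rsqrt) (simp add: sum_nonneg)

lemma weak_pd_trig_poly:
  assumes "trig_poly \<phi>"
  shows "weak_pd j (to_L2 \<phi>) (to_L2 (pd j \<phi>))"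
  unfolding weak_pd_def
proof (intro allI impI)
  fix \<psi> assume \<psi>: "test_function \<psi>"
  note c = trig_poly_continuous[OF assms] trig_poly_pd_continuous[OF assms]
    test_function_continuous[OF \<psi>] test_function_continuous[OF test_function_pd[OF \<psi>]]
  note d = test_function_differentiable[OF \<psi>] trig_poly_differentiable[OF assms]
  have eq: "pd j (\<lambda>x. \<psi> x *\<^sub>R \<phi> x) = (\<lambda>x. \<psi> x *\<^sub>R pd j \<phi> x + pd j \<psi> x *\<^sub>R \<phi> x)"
    by (intro ext pd_scaleR d)
  have cont: "continuous_on UNIV (\<lambda>x. \<psi> x *\<^sub>R pd j \<phi> x)" "continuous_on UNIV (\<lambda>x. pd j \<psi> x *\<^sub>R \<phi> x)"
    by (intro continuous_intros c)+
  have "(\<integral>x. pd j (\<lambda>x. \<psi> x *\<^sub>R \<phi> x) x \<partial>torus) = 0"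
  proof (rule torus_integral_pd_zero)
    show "(\<lambda>x. \<psi> x *\<^sub>R \<phi> x) differentiable at x" for x
      using d by (intro differentiable_scaleR)
    show "continuous_on UNIV (pd j (\<lambda>x. \<psi> x *\<^sub>R \<phi> x))"
      unfolding eq using cont by (rule continuous_on_add)
    show "periodic (\<lambda>x. \<psi> x *\<^sub>R \<phi> x)"
      using \<psi> trig_poly_periodic[OF assms] by (simp add: periodic_def test_function_def)
  qed
  then have "(\<integral>x. \<psi> x *\<^sub>R pd j \<phi> x \<partial>torus) + (\<integral>x. pd j \<psi> x *\<^sub>R \<phi> x \<partial>torus) = 0"
    unfolding eq by (simp add: integrable_torus_continuous cont)
  moreover have "(\<integral>x. pd j \<psi> x *\<^sub>R rep_L2 (to_L2 \<phi>) x \<partial>torus) = (\<integral>x. pd j \<psi> x *\<^sub>R \<phi> x \<partial>torus)"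
    using \<psi> c by (intro test_integral_cong rep_to_L2 test_function_pd square_integrable_continuous)
  moreover have "(\<integral>x. \<psi> x *\<^sub>R rep_L2 (to_L2 (pd j \<phi>)) x \<partial>torus) = (\<integral>x. \<psi> x *\<^sub>R pd j \<phi> x \<partial>torus)"
    using \<psi> c by (intro test_integral_cong rep_to_L2 square_integrable_continuous)
  ultimately show "(\<integral>x. pd j \<psi> x *\<^sub>R rep_L2 (to_L2 \<phi>) x \<partial>torus) =
      - (\<integral>x. \<psi> x *\<^sub>R rep_L2 (to_L2 (pd j \<phi>)) x \<partial>torus)"
    by (simp add: eq_neg_iff_add_eq_0 add.commute)
qed

lemma trig_poly_H1: "trig_poly \<phi> \<Longrightarrow> to_L2 \<phi> \<in> H1"
  using weak_pd_trig_poly by (auto simp: H1_def)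

lemma trig_poly_add:
  assumes "trig_poly \<phi>" "trig_poly \<psi>"
  shows "trig_poly (\<lambda>x. \<phi> x + \<psi> x)"
proof -
  define T where "T K a b x = (\<Sum>k\<in>K. cos (2 * pi * (k \<bullet> x)) *\<^sub>R a k + sin (2 * pi * (k \<bullet> x)) *\<^sub>R b k)"
    for K and a b :: "real^3 \<Rightarrow> real^3" and x
  have pad: "T K a b x = T L (\<lambda>k. if k \<in> K then a k else 0) (\<lambda>k. if k \<in> K then b k else 0) x"
    if "finite L" "K \<subseteq> L" for K L a b x
    unfolding T_def using that by (intro sum.mono_neutral_cong_left) auto
  obtain K a b where K: "finite K" "\<forall>k\<in>K. \<forall>i. k $ i \<in> \<int>" and \<phi>: "\<phi> = T K a b"
    using assms(1) unfolding trig_poly_def T_def by blast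
  obtain K' a' b' where K': "finite K'" "\<forall>k\<in>K'. \<forall>i. k $ i \<in> \<int>" and \<psi>: "\<psi> = T K' a' b'"
    using assms(2) unfolding trig_poly_def T_def by blast
  let ?L = "K \<union> K'"
  let ?z = "\<lambda>K (a :: real^3 \<Rightarrow> real^3) k. if k \<in> K then a k else 0"
  define A where "A k = ?z K a k + ?z K' a' k" for k
  define B where "B k = ?z K b k + ?z K' b' k" for k
  have eq: "(\<lambda>x. \<phi> x + \<psi> x) = T ?L A B"
  proof (rule ext)
    fix x
    have L: "finite ?L" using K K' by simp
    have 1: "\<phi> x = T ?L (?z K a) (?z K b) x"
      unfolding \<phi> by (rule pad[OF L Un_upper1])
    have 2: "\<psi> x = T ?L (?z K' a') (?z K' b') x"
      unfolding \<psi> by (rule pad[OF L Un_upper2])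
    show "\<phi> x + \<psi> x = T ?L A B x"
      unfolding 1 2 unfolding T_def sum.distrib[symmetric] A_def B_def
      by (rule sum.cong[OF refl]) (simp only: scaleR_add_right add_ac)
  qed
  have "finite ?L" "\<forall>k\<in>?L. \<forall>i. k $ i \<in> \<int>" using K K' by auto
  then show ?thesis
    unfolding trig_poly_def using eq[unfolded T_def[abs_def]]
    by (intro exI[of _ ?L] exI[of _ A] exI[of _ B] conjI)
qed

lemma trig_poly_scaleR:
  assumes "trig_poly \<phi>"
  shows "trig_poly (\<lambda>x. c *\<^sub>R \<phi> x)"
proof -
  obtain K a b where K: "finite K" "\<forall>k\<in>K. \<forall>i. k $ i \<in> \<int>" and
    \<phi>: "\<phi> = (\<lambda>x. \<Sum>k\<in>K. cos (2 * pi * (k \<bullet> x)) *\<^sub>R a k + sin (2 * pi * (k \<bullet> x)) *\<^sub>R b k)"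
    using assms unfolding trig_poly_def by blast
  have "(\<lambda>x. c *\<^sub>R \<phi> x) = (\<lambda>x. \<Sum>k\<in>K. cos (2 * pi * (k \<bullet> x)) *\<^sub>R (c *\<^sub>R a k) + sin (2 * pi * (k \<bullet> x)) *\<^sub>R (c *\<^sub>R b k))"
    unfolding \<phi> by (simp add: scaleR_sum_right scaleR_add_right mult.commute)
  then show ?thesis
    unfolding trig_poly_def using K 
    by (intro exI[of _ K] exI[of _ "\<lambda>k. c *\<^sub>R a k"] exI[of _ "\<lambda>k. c *\<^sub>R b k"]) simp
qed

lemma \<V>_trig: "\<phi> \<in> \<V> \<Longrightarrow> trig_poly \<phi>"
  by (simp add: \<V>_def)

lemma \<V>_square_integrable: "\<phi> \<in> \<V> \<Longrightarrow> square_integrable \<phi>"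
  using \<V>_trig trig_poly_continuous square_integrable_continuous by blast

lemma \<V>_zero: "(\<lambda>_. 0) \<in> \<V>"
proof -
  have "trig_poly (\<lambda>_. 0)" unfolding trig_poly_def by (rule exI[of _ "{}"]) simp
  then show ?thesis by (simp add: \<V>_def divergence_def pd_const)
qed

lemma \<V>_add:
  assumes "\<phi> \<in> \<V>" "\<psi> \<in> \<V>"
  shows "(\<lambda>x. \<phi> x + \<psi> x) \<in> \<V>"
proof -
  note t = assms[THEN \<V>_trig]
  have "divergence (\<lambda>x. \<phi> x + \<psi> x) x = divergence \<phi> x + divergence \<psi> x" for x
    unfolding divergence_def
    by (simp add: pd_add[OF trig_poly_differentiable[OF t(1)] trig_poly_differentiable[OF t(2)]] sum.distrib)
  moreover have "(\<integral>x. \<phi> x + \<psi> x \<partial>torus) = (\<integral>x. \<phi> x \<partial>torus) + (\<integral>x. \<psi> x \<partial>torus)"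
    using t by (intro Bochner_Integration.integral_add integrable_torus_continuous trig_poly_continuous)
  ultimately show ?thesis using assms trig_poly_add[OF t] by (simp add: \<V>_def)
qed

lemma \<V>_scaleR:
  assumes "\<phi> \<in> \<V>"
  shows "(\<lambda>x. c *\<^sub>R \<phi> x) \<in> \<V>"
proof -
  note t = assms[THEN \<V>_trig]
  have "pd j (\<lambda>x. c *\<^sub>R \<phi> x) x = c *\<^sub>R pd j \<phi> x" for j x
    using pd_scaleR[OF differentiable_const trig_poly_differentiable[OF t], of j c x] by (simp add: pd_const)
  then have "divergence (\<lambda>x. c *\<^sub>R \<phi> x) x = c * divergence \<phi> x" for x
    unfolding divergence_def by (simp add: sum_distrib_left)
  then show ?thesis using assms trig_poly_scaleR[OF t] by (simp add: \<V>_def)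
qed

lemma \<V>_subset_V_set: "\<phi> \<in> \<V> \<Longrightarrow> to_L2 \<phi> \<in> V_set"
proof -
  assume \<phi>: "\<phi> \<in> \<V>"
  have h: "to_L2 \<phi> \<in> H1" using trig_poly_H1[OF \<V>_trig[OF \<phi>]] .
  have "norm_H1 (to_L2 \<phi> - to_L2 \<phi>) = 0"
    using norm_H1_scaleR[OF h, of 0] by simp
  then have "\<exists>\<phi>'\<in>\<V>. norm_H1 (to_L2 \<phi> - to_L2 \<phi>') < e" if "0 < e" for e
    using that \<phi> by (intro bexI[of _ \<phi>]) simp_all
  then show ?thesis using h by (simp add: V_set_def)
qed

lemma V_set_zero: "0 \<in> V_set"
  using \<V>_subset_V_set[OF \<V>_zero] by (simp add: zero_L2.abs_eq)

lemma V_set_add: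
  assumes "f \<in> V_set" "g \<in> V_set"
  shows "f + g \<in> V_set"
  unfolding V_set_def
proof (intro CollectI conjI allI impI)
  have h: "f \<in> H1" "g \<in> H1" using assms by (auto simp: V_set_def)
  then show "f + g \<in> H1" by (rule H1_add)
  fix e :: real assume "0 < e"
  then have e: "0 < e / 2" by simp
  obtain \<phi> where \<phi>: "\<phi> \<in> \<V>" "norm_H1 (f - to_L2 \<phi>) < e / 2"
    using assms(1) e unfolding V_set_def by blast
  obtain \<psi> where \<psi>: "\<psi> \<in> \<V>" "norm_H1 (g - to_L2 \<psi>) < e / 2"
    using assms(2) e unfolding V_set_def by blast
  have eq: "f + g - to_L2 (\<lambda>x. \<phi> x + \<psi> x) = (f - to_L2 \<phi>) + (g - to_L2 \<psi>)"
    using \<phi>(1) \<psi>(1) by (simp add: to_L2_add \<V>_square_integrable)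
  have "norm_H1 (f + g - to_L2 (\<lambda>x. \<phi> x + \<psi> x)) \<le> norm_H1 (f - to_L2 \<phi>) + norm_H1 (g - to_L2 \<psi>)"
    unfolding eq using h \<phi>(1) \<psi>(1) by (intro norm_H1_add H1_diff trig_poly_H1 \<V>_trig)
  then have "norm_H1 (f + g - to_L2 (\<lambda>x. \<phi> x + \<psi> x)) < e" using \<phi>(2) \<psi>(2) by linarith
  then show "\<exists>\<phi>\<in>\<V>. norm_H1 (f + g - to_L2 \<phi>) < e"
    using \<V>_add[OF \<phi>(1) \<psi>(1)] by blast
qed

lemma V_set_scaleR:
  assumes "f \<in> V_set"
  shows "c *\<^sub>R f \<in> V_set"
  unfolding V_set_def
proof (intro CollectI conjI allI impI)
  have h: "f \<in> H1" using assms by (auto simp: V_set_def)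
  then show "c *\<^sub>R f \<in> H1" by (rule H1_scaleR)
  fix e :: real assume "0 < e"
  then have e: "0 < e / (\<bar>c\<bar> + 1)" by (simp add: add_nonneg_pos)
  obtain \<phi> where \<phi>: "\<phi> \<in> \<V>" "norm_H1 (f - to_L2 \<phi>) < e / (\<bar>c\<bar> + 1)"
    using assms e unfolding V_set_def by blast
  have eq: "c *\<^sub>R f - to_L2 (\<lambda>x. c *\<^sub>R \<phi> x) = c *\<^sub>R (f - to_L2 \<phi>)"
    using \<phi>(1) by (simp add: to_L2_scaleR \<V>_square_integrable scaleR_diff_right)
  have "norm_H1 (c *\<^sub>R f - to_L2 (\<lambda>x. c *\<^sub>R \<phi> x)) = \<bar>c\<bar> * norm_H1 (f - to_L2 \<phi>)"
    unfolding eq using h \<phi>(1) by (intro norm_H1_scaleR H1_diff trig_poly_H1 \<V>_trig)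
  also have "\<dots> \<le> (\<bar>c\<bar> + 1) * norm_H1 (f - to_L2 \<phi>)"
    by (rule mult_right_mono) (auto simp: norm_H1_def sum_nonneg)
  also have "\<dots> < e" using \<phi>(2) by (simp add: pos_less_divide_eq add_nonneg_pos mult.commute)
  finally show "\<exists>\<phi>\<in>\<V>. norm_H1 (c *\<^sub>R f - to_L2 \<phi>) < e"
    using \<V>_scaleR[OF \<phi>(1), of c] by blast
qed

lemma V_set_uminus: "f \<in> V_set \<Longrightarrow> - f \<in> V_set"
  using V_set_scaleR[of f "-1"] by simp

lemma V_set_diff: "f \<in> V_set \<Longrightarrow> g \<in> V_set \<Longrightarrow> f - g \<in> V_set"
  using V_set_add[of f "- g"] V_set_uminus[of g] by simp

lemma V_set_subset_H_set: "V_set \<subseteq> H_set"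
proof
  fix f assume f: "f \<in> V_set"
  show "f \<in> H_set"
    unfolding H_set_def closure_approachable
  proof (intro allI impI)
    fix e :: real assume "0 < e"
    then obtain \<phi> where "\<phi> \<in> \<V>" "norm_H1 (f - to_L2 \<phi>) < e"
      using f unfolding V_set_def by blast
    moreover have "dist (to_L2 \<phi>) f \<le> norm_H1 (f - to_L2 \<phi>)"
      using norm_le_norm_H1[of "f - to_L2 \<phi>"] by (simp add: dist_norm norm_minus_commute)
    ultimately show "\<exists>y\<in>to_L2 ` \<V>. dist y f < e" by (meson imageI order_le_less_trans)
  qed
qed

lemma inner_to_L2:
  assumes "square_integrable h"
  shows "f \<bullet> to_L2 h = (\<integral>x. rep_L2 f x \<bullet> h x \<partial>torus)"
  using inner_L2.abs_eq[of "rep_L2 f" h] assms by (simp add: square_integrable_rep_L2 to_L2_rep_L2)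

lemma H_set_mean_zero:
  assumes "f \<in> H_set"
  shows "(\<integral>x. rep_L2 f x \<partial>torus) = 0"
proof -
  have c: "square_integrable (\<lambda>_. a)" for a by (intro square_integrable_continuous continuous_intros)
  have i: "f \<bullet> to_L2 (\<lambda>_. a) = (\<integral>x. rep_L2 f x \<partial>torus) \<bullet> a" for f a
    unfolding inner_to_L2[OF c]
    by (rule integral_inner_left) (simp add: square_integrable_integrable square_integrable_rep_L2)
  have "closed {f. f \<bullet> to_L2 (\<lambda>_. a) = 0}" for a
    by (intro closed_Collect_eq continuous_intros)
  moreover have "to_L2 ` \<V> \<subseteq> {f. f \<bullet> to_L2 (\<lambda>_. a) = 0}" for a
  proof clarify
    fix \<phi> assume \<phi>: "\<phi> \<in> \<V>"
    have "(\<integral>x. rep_L2 (to_L2 \<phi>) x \<partial>torus) = (\<integral>x. \<phi> x \<partial>torus)"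
      using test_integral_cong[OF test_function_const[of 1] rep_to_L2] \<V>_square_integrable[OF \<phi>]
      by simp
    then show "to_L2 \<phi> \<bullet> to_L2 (\<lambda>_. a) = 0" using \<phi> by (simp add: i \<V>_def)
  qed
  ultimately have "f \<bullet> to_L2 (\<lambda>_. a) = 0" for a
    using assms closure_minimal[of "to_L2 ` \<V>" "{f. f \<bullet> to_L2 (\<lambda>_. a) = 0}"] unfolding H_set_def by blast
  then have "(\<integral>x. rep_L2 f x \<partial>torus) \<bullet> (\<integral>x. rep_L2 f x \<partial>torus) = 0" unfolding i .
  then show ?thesis by simp
qed

lemma V_set_gradient_zero:
  assumes f: "f \<in> V_set" and 0: "\<And>j. wpd j f = 0"
  shows "f = 0"
proof -
  have fH1: "f \<in> H1" using f by (simp add: V_set_def)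
  have rep0: "AE x in torus. rep_L2 0 x = 0"
    using rep_to_L2[OF square_integrable_zero] by (simp add: zero_L2.abs_eq)
  have pd0: "(\<integral>x. pd j \<psi> x *\<^sub>R rep_L2 f x \<partial>torus) = 0" if "test_function \<psi>" for j \<psi>
    using weak_pd_wpd[OF fH1, of j] that test_integral_cong[OF that rep0 square_integrable_zero]
    by (simp add: weak_pd_def 0)
  have mode: "(\<integral>x. (cos (2 * pi * (k \<bullet> x)) * a + sin (2 * pi * (k \<bullet> x)) * b) *\<^sub>R rep_L2 f x \<partial>torus) = 0"
    if k: "\<forall>i. k $ i \<in> \<int>" for k a b
  proof (cases "k = 0")
    case True
    have "(\<integral>x. rep_L2 f x \<partial>torus) = 0"
      using H_set_mean_zero f V_set_subset_H_set by blast
    then show ?thesis using True by simp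
  next
    case False
    then obtain j where j: "k $ j \<noteq> 0" by (auto simp: vec_eq_iff)
    define p q where "p = - b / (2 * pi * k $ j)" and "q = a / (2 * pi * k $ j)"
    let ?\<psi> = "\<lambda>x. cos (2 * pi * (k \<bullet> x)) * p + sin (2 * pi * (k \<bullet> x)) * q"
    have "pd j ?\<psi> x = cos (2 * pi * (k \<bullet> x)) * a + sin (2 * pi * (k \<bullet> x)) * b" for x
      using pd_trig[of j "(2 * pi) *\<^sub>R k" p q x] j by (simp add: p_def q_def)
    then show ?thesis using pd0[OF test_function_trig[OF k, of p q], of j] by simp
  qed
  have orth: "f \<bullet> to_L2 \<phi> = 0" if \<phi>: "\<phi> \<in> \<V>" for \<phi>
  proof -
    obtain K a b where K: "finite K" "\<forall>k\<in>K. \<forall>i. k $ i \<in> \<int>" and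
      eq: "\<phi> = (\<lambda>x. \<Sum>k\<in>K. cos (2 * pi * (k \<bullet> x)) *\<^sub>R a k + sin (2 * pi * (k \<bullet> x)) *\<^sub>R b k)"
      using \<V>_trig[OF \<phi>] unfolding trig_poly_def by blast
    have int: "integrable torus (\<lambda>x. cos (2 * pi * (k \<bullet> x)) *\<^sub>R rep_L2 f x)"
      "integrable torus (\<lambda>x. sin (2 * pi * (k \<bullet> x)) *\<^sub>R rep_L2 f x)" if "k \<in> K" for k
      using integrable_test_rep[OF test_function_trig[OF K(2)[rule_format, OF that, THEN allI], of 1 0], of f]
        integrable_test_rep[OF test_function_trig[OF K(2)[rule_format, OF that, THEN allI], of 0 1], of f]
      by auto
    have z: "(\<integral>x. cos (2 * pi * (k \<bullet> x)) *\<^sub>R rep_L2 f x \<partial>torus) = 0"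
      "(\<integral>x. sin (2 * pi * (k \<bullet> x)) *\<^sub>R rep_L2 f x \<partial>torus) = 0" if "k \<in> K" for k
      using mode[OF K(2)[rule_format, OF that, THEN allI], of 1 0]
        mode[OF K(2)[rule_format, OF that, THEN allI], of 0 1] by auto
    have "f \<bullet> to_L2 \<phi> = (\<integral>x. rep_L2 f x \<bullet> \<phi> x \<partial>torus)"
      by (rule inner_to_L2[OF \<V>_square_integrable[OF \<phi>]])
    also have "\<dots> = (\<integral>x. (\<Sum>k\<in>K. (cos (2 * pi * (k \<bullet> x)) *\<^sub>R rep_L2 f x) \<bullet> a k + 
        (sin (2 * pi * (k \<bullet> x)) *\<^sub>R rep_L2 f x) \<bullet> b k) \<partial>torus)"
      unfolding eq by (simp add: inner_sum_right inner_add_right)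
    also have "\<dots> = (\<Sum>k\<in>K. (\<integral>x. (cos (2 * pi * (k \<bullet> x)) *\<^sub>R rep_L2 f x) \<bullet> a k + 
        (sin (2 * pi * (k \<bullet> x)) *\<^sub>R rep_L2 f x) \<bullet> b k \<partial>torus))"
      using int by (intro Bochner_Integration.integral_sum Bochner_Integration.integrable_add
          integrable_inner_left) auto
    also have "\<dots> = (\<Sum>k\<in>K. 0)"
    proof (rule sum.cong[OF refl])
      fix k assume k: "k \<in> K"
      have "(\<integral>x. (cos (2 * pi * (k \<bullet> x)) *\<^sub>R rep_L2 f x) \<bullet> a k + 
        (sin (2 * pi * (k \<bullet> x)) *\<^sub>R rep_L2 f x) \<bullet> b k \<partial>torus) =
        (\<integral>x. (cos (2 * pi * (k \<bullet> x)) *\<^sub>R rep_L2 f x) \<bullet> a k \<partial>torus) + 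
        (\<integral>x. (sin (2 * pi * (k \<bullet> x)) *\<^sub>R rep_L2 f x) \<bullet> b k \<partial>torus)"
        using int[OF k] by (intro Bochner_Integration.integral_add integrable_inner_left) auto
      also have "\<dots> = 0"
        by (subst integral_inner_left, rule int[OF k], subst integral_inner_left, rule int[OF k])
          (simp add: z[OF k] del: inner_scaleR_left)
      finally show "(\<integral>x. (cos (2 * pi * (k \<bullet> x)) *\<^sub>R rep_L2 f x) \<bullet> a k + 
        (sin (2 * pi * (k \<bullet> x)) *\<^sub>R rep_L2 f x) \<bullet> b k \<partial>torus) = 0" .
    qed
    finally show ?thesis by simp
  qed
  have "closed {g. f \<bullet> g = 0}" by (intro closed_Collect_eq continuous_intros)
  then have "H_set \<subseteq> {g. f \<bullet> g = 0}"
    unfolding H_set_def using orth by (intro closure_minimal) auto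
  then have "f \<bullet> f = 0" using f V_set_subset_H_set by blast
  then show ?thesis by simp
qed

text \<open>
  \<open>V\<close> is turned into an inner product space by the gradient inner product, so that \<open>norm v\<close> is the
  \<open>V\<close>-norm of \<open>v\<close> while \<open>norm (of_V v)\<close> is its \<open>L2\<close>-norm. For elements of \<open>V_set\<close> the gradient norm
  and \<open>norm_H1\<close> are equivalent by the Poincare inequality.
\<close>

typedef V = V_set morphisms of_V to_V
  using V_set_zero by blast

setup_lifting type_definition_V

lemma of_V_H1: "of_V v \<in> H1"
  using of_V[of v] by (simp add: V_set_def)

instantiation V :: real_inner
begin

lift_definition zero_V :: V is 0 by (rule V_set_zero)
lift_definition plus_V :: "V \<Rightarrow> V \<Rightarrow> V" is "(+)" by (rule V_set_add)
lift_definition uminus_V :: "V \<Rightarrow> V" is uminus by (rule V_set_uminus)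
lift_definition minus_V :: "V \<Rightarrow> V \<Rightarrow> V" is "(-)" by (rule V_set_diff)
lift_definition scaleR_V :: "real \<Rightarrow> V \<Rightarrow> V" is "(*\<^sub>R)" by (rule V_set_scaleR)
definition inner_V :: "V \<Rightarrow> V \<Rightarrow> real" where
  "inner_V u v = (\<Sum>j\<in>UNIV. wpd j (of_V u) \<bullet> wpd j (of_V v))"
definition norm_V :: "V \<Rightarrow> real" where "norm_V v = sqrt (v \<bullet> v)"
definition dist_V :: "V \<Rightarrow> V \<Rightarrow> real" where "dist_V u v = norm (u - v)"
definition sgn_V :: "V \<Rightarrow> V" where "sgn_V v = inverse (norm v) *\<^sub>R v"
definition uniformity_V :: "(V \<times> V) filter" where
  "uniformity_V = (INF e\<in>{0 <..}. principal {(x, y). dist x y < e})"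
definition open_V :: "V set \<Rightarrow> bool" where
  "open_V U \<longleftrightarrow> (\<forall>x\<in>U. \<forall>\<^sub>F (x', y) in uniformity. x' = x \<longrightarrow> y \<in> U)"

instance
proof
  fix a b c :: V and r s :: real and U :: "V set"
  show "a + b + c = a + (b + c)" by transfer (simp add: add.assoc)
  show "a + b = b + a" by transfer (simp add: add.commute)
  show "0 + a = a" by transfer simp
  show "- a + a = 0" by transfer simp
  show "a - b = a + - b" by transfer simp
  show "r *\<^sub>R (a + b) = r *\<^sub>R a + r *\<^sub>R b" by transfer (simp add: scaleR_add_right)
  show "(r + s) *\<^sub>R a = r *\<^sub>R a + s *\<^sub>R a" by transfer (simp add: scaleR_add_left)
  show "r *\<^sub>R s *\<^sub>R a = (r * s) *\<^sub>R a" by transfer simp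
  show "1 *\<^sub>R a = a" by transfer simp
  show "dist a b = norm (a - b)" by (fact dist_V_def)
  show "sgn a = inverse (norm a) *\<^sub>R a" by (fact sgn_V_def)
  show "(uniformity :: (V \<times> V) filter) = (INF e\<in>{0 <..}. principal {(x, y). dist x y < e})"
    by (fact uniformity_V_def)
  show "open U = (\<forall>x\<in>U. \<forall>\<^sub>F (x', y) in uniformity. x' = x \<longrightarrow> y \<in> U)"
    by (fact open_V_def)
  show "a \<bullet> b = b \<bullet> a" by (simp add: inner_V_def inner_commute)
  show "(a + b) \<bullet> c = a \<bullet> c + b \<bullet> c"
    by (simp add: inner_V_def plus_V.rep_eq wpd_add of_V_H1 inner_add_left sum.distrib)
  show "(r *\<^sub>R a) \<bullet> b = r * (a \<bullet> b)"
    by (simp add: inner_V_def scaleR_V.rep_eq wpd_scaleR of_V_H1 sum_distrib_left)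
  show "0 \<le> a \<bullet> a" by (simp add: inner_V_def sum_nonneg)
  show "(a \<bullet> a = 0) = (a = 0)"
  proof
    assume "a \<bullet> a = 0"
    then have "wpd j (of_V a) = 0" for j
      by (simp add: inner_V_def sum_nonneg_eq_0_iff)
    then have "of_V a = 0" using V_set_gradient_zero[OF of_V] by blast
    then show "a = 0" by transfer
  next
    assume "a = 0"
    have "of_V 0 = 0 *\<^sub>R of_V 0" by (simp add: zero_V.rep_eq)
    then have "wpd j (of_V 0) = 0" for j
      using wpd_scaleR[OF of_V_H1, of j 0 0] by simp
    then show "a \<bullet> a = 0" using \<open>a = 0\<close> by (simp add: inner_V_def)
  qed
  show "norm a = sqrt (a \<bullet> a)" by (fact norm_V_def)
qed

end

definition H2 :: "L2 set" where
  "H2 = {f \<in> H1. \<forall>j. wpd j f \<in> H1}"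

section \<open>Leray projection, Stokes operator, and the bilinear map\<close>

definition Leray :: "L2 \<Rightarrow> L2" where
  "Leray f = (THE h. h \<in> H_set \<and> (\<forall>k\<in>H_set. (f - h) \<bullet> k = 0))"

definition Dom_A :: "V set" where
  "Dom_A = {v. of_V v \<in> H2}"

definition Stokes :: "V \<Rightarrow> L2" where
  "Stokes v = - Leray (\<Sum>j\<in>UNIV. wpd j (wpd j (of_V v)))"

text \<open>
  The dual of \<open>V\<close> is the type \<open>V \<Rightarrow>\<^sub>L real\<close>. The embedding of \<open>H\<close> into it sends \<open>f\<close> to the
  functional \<open>v \<mapsto> (f, v)\<close>, which is bounded on \<open>V\<close> by the Poincare inequality.
\<close>

definition to_dual :: "L2 \<Rightarrow> (V \<Rightarrow>\<^sub>L real)" where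
  "to_dual f = Blinfun (\<lambda>v. f \<bullet> of_V v)"

text \<open>
  \<open>A_op\<close> and \<open>B_op\<close> are the unique continuous extensions to \<open>V\<close> of the Stokes operator and of
  \<open>Leray ((\<phi> \<cdot> \<nabla>) \<psi>)\<close>, the latter being given for \<open>\<phi>\<close>, \<open>\<psi>\<close> in \<open>\<V>\<close>.
\<close>

definition A_op :: "V \<Rightarrow> (V \<Rightarrow>\<^sub>L real)" where
  "A_op = (THE A. bounded_linear A \<and> (\<forall>u\<in>Dom_A. A u = to_dual (Stokes u)))"

definition advection :: "(real^3 \<Rightarrow> real^3) \<Rightarrow> (real^3 \<Rightarrow> real^3) \<Rightarrow> real^3 \<Rightarrow> real^3" where
  "advection \<phi> \<psi> x = (\<Sum>j\<in>UNIV. \<phi> x $ j *\<^sub>R pd j \<psi> x)"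

definition B_op :: "V \<Rightarrow> V \<Rightarrow> (V \<Rightarrow>\<^sub>L real)" where
  "B_op = (THE B. bounded_bilinear B \<and>
     (\<forall>\<phi>\<in>\<V>. \<forall>\<psi>\<in>\<V>. B (to_V (to_L2 \<phi>)) (to_V (to_L2 \<psi>)) = to_dual (Leray (to_L2 (advection \<phi> \<psi>)))))"

section \<open>Functions of time with values in a normed space\<close>

text \<open>
  Strong (Bochner) measurability is stated through simple functions, so no separability of the
  target type is required.
\<close>

definition strongly_measurable :: "'a measure \<Rightarrow> ('a \<Rightarrow> 'b::real_normed_vector) \<Rightarrow> bool" where
  "strongly_measurable M f \<longleftrightarrow>
     (\<exists>s. (\<forall>n. simple_function M (s n)) \<and> (AE x in M. (\<lambda>n::nat. s n x) \<longlonglongrightarrow> f x))"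

definition Lp_time :: "real \<Rightarrow> real \<Rightarrow> (real \<Rightarrow> 'b::real_normed_vector) \<Rightarrow> bool" where
  "Lp_time p T f \<longleftrightarrow> strongly_measurable (lebesgue_on {0<..<T}) f \<and>
     integrable (lebesgue_on {0<..<T}) (\<lambda>t. norm (f t) powr p)"

definition Linf_time :: "real \<Rightarrow> (real \<Rightarrow> 'b::real_normed_vector) \<Rightarrow> bool" where
  "Linf_time T f \<longleftrightarrow> strongly_measurable (lebesgue_on {0<..<T}) f \<and>
     (\<exists>c. AE t in lebesgue_on {0<..<T}. norm (f t) \<le> c)"

definition Lp_time_eq ::
    "real \<Rightarrow> real \<Rightarrow> (real \<Rightarrow> 'b::real_normed_vector) \<Rightarrow> (real \<Rightarrow> 'b) \<Rightarrow> bool" where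
  "Lp_time_eq p T f g \<longleftrightarrow> Lp_time p T f \<and> Lp_time p T g \<and>
     (AE t in lebesgue_on {0<..<T}. f t = g t)"

definition Cw_H :: "real \<Rightarrow> (real \<Rightarrow> L2) \<Rightarrow> bool" where
  "Cw_H T f \<longleftrightarrow> (\<forall>t\<in>{0..T}. f t \<in> H_set) \<and> Linf_time T f \<and>
     (\<forall>h\<in>H_set. continuous_on {0..T} (\<lambda>t. f t \<bullet> h))"

definition time_test_function :: "real \<Rightarrow> (real \<Rightarrow> real) \<Rightarrow> bool" where
  "time_test_function T \<phi> \<longleftrightarrow> (\<forall>n t. ((deriv ^^ n) \<phi>) differentiable (at t)) \<and>
     (\<exists>a b. 0 < a \<and> b < T \<and> (\<forall>t. \<phi> t \<noteq> 0 \<longrightarrow> a \<le> t \<and> t \<le> b))"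

text \<open>
  The derivative \<open>g = df/dt\<close> in the sense of vector-valued distributions on \<open>(0,T)\<close>. It is only
  used for Bochner integrable \<open>f\<close> and \<open>g\<close>, for which the gauge integral of the library exists and
  coincides with the Bochner integral.
\<close>

definition has_time_derivative ::
    "real \<Rightarrow> (real \<Rightarrow> 'b::real_normed_vector) \<Rightarrow> (real \<Rightarrow> 'b) \<Rightarrow> bool" where
  "has_time_derivative T f g \<longleftrightarrow> (\<forall>\<phi>. time_test_function T \<phi> \<longrightarrow>
     (\<exists>J. ((\<lambda>t. \<phi> t *\<^sub>R g t) has_integral J) {0..T} \<and>
          ((\<lambda>t. deriv \<phi> t *\<^sub>R f t) has_integral - J) {0..T}))"

section \<open>Weak and strong solutions of the inviscid resistive MHD-Voigt system\<close>

text \<open>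
  A function with values in \<open>V\<close> for almost every time only, such as the magnetic field of a weak
  solution, is an \<open>L2\<close>-valued function \<open>B\<close>; composing it with \<open>to_V\<close> views it in \<open>V\<close>. The value
  of \<open>to_V\<close> outside \<open>V_set\<close> is unspecified and matters only on a null set of times.
\<close>

definition weak_solution ::
    "real \<Rightarrow> real \<Rightarrow> real \<Rightarrow> V \<Rightarrow> L2 \<Rightarrow> (real \<Rightarrow> V) \<Rightarrow> (real \<Rightarrow> L2) \<Rightarrow> bool" where
  "weak_solution \<alpha> \<mu> T u\<^sub>0 B\<^sub>0 u B \<longleftrightarrow>
     B\<^sub>0 \<in> H_set \<and>
     continuous_on {0..T} u \<and>
     (AE t in lebesgue_on {0<..<T}. B t \<in> V_set) \<and> Lp_time 2 T (\<lambda>t. to_V (B t)) \<and> Cw_H T B \<and>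
     (\<exists>u'. (AE t in lebesgue_on {0<..<T}. u' t \<in> H_set) \<and> Lp_time 4 T u' \<and>
        has_time_derivative T (\<lambda>t. of_V (u t)) u') \<and>
     (\<exists>w'. Lp_time (4/3) T w' \<and>
        has_time_derivative T (\<lambda>t. \<alpha>\<^sup>2 *\<^sub>R A_op (u t) + to_dual (of_V (u t))) w' \<and>
        (AE t in lebesgue_on {0<..<T}.
           w' t = B_op (to_V (B t)) (to_V (B t)) - B_op (u t) (u t))) \<and>
     (\<exists>B'. Lp_time 2 T B' \<and> has_time_derivative T (\<lambda>t. to_dual (B t)) B' \<and>
        (AE t in lebesgue_on {0<..<T}.
           B' t + \<mu> *\<^sub>R A_op (to_V (B t)) = B_op (to_V (B t)) (u t) - B_op (u t) (to_V (B t)))) \<and>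
     u 0 = u\<^sub>0 \<and> B 0 = B\<^sub>0"

text \<open>
  Membership in \<open>L\<^sup>2((0,T), D(A))\<close> is expressed through the norm \<open>|A v|\<close> of \<open>D(A)\<close>, for which \<open>A\<close> is
  an isometry of \<open>D(A)\<close> onto \<open>H\<close>.
\<close>

definition strong_solution ::
    "real \<Rightarrow> real \<Rightarrow> real \<Rightarrow> V \<Rightarrow> V \<Rightarrow> (real \<Rightarrow> V) \<Rightarrow> (real \<Rightarrow> L2) \<Rightarrow> bool" where
  "strong_solution \<alpha> \<mu> T u\<^sub>0 B\<^sub>0 u B \<longleftrightarrow>
     weak_solution \<alpha> \<mu> T u\<^sub>0 (of_V B\<^sub>0) u B \<and>
     (AE t in lebesgue_on {0<..<T}. to_V (B t) \<in> Dom_A) \<and> Lp_time 2 T (\<lambda>t. Stokes (to_V (B t))) \<and>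
     (\<forall>t\<in>{0..T}. B t \<in> V_set) \<and> continuous_on {0..T} (\<lambda>t. to_V (B t)) \<and>
     (\<exists>u'. continuous_on {0..T} u' \<and> has_time_derivative T u u') \<and>
     (\<exists>B'. (AE t in lebesgue_on {0<..<T}. B' t \<in> H_set) \<and> Lp_time 2 T B' \<and>
        has_time_derivative T B B')"

definition K1_const :: "real \<Rightarrow> V \<Rightarrow> V \<Rightarrow> real" where
  "K1_const \<alpha> u\<^sub>0 B\<^sub>0 = sqrt (\<alpha>\<^sup>2 * (norm u\<^sub>0)\<^sup>2 + (norm (of_V u\<^sub>0))\<^sup>2 + (norm (of_V B\<^sub>0))\<^sup>2)"

definition K2_const :: "real \<Rightarrow> real \<Rightarrow> real \<Rightarrow> V \<Rightarrow> V \<Rightarrow> real" where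
  "K2_const C \<alpha> \<mu> u\<^sub>0 B\<^sub>0 = C * (K1_const \<alpha> u\<^sub>0 B\<^sub>0 / \<alpha>) ^ 4 / \<mu> ^ 3"

definition K3_const :: "real \<Rightarrow> real \<Rightarrow> real \<Rightarrow> V \<Rightarrow> V \<Rightarrow> real" where
  "K3_const C \<alpha> \<mu> u\<^sub>0 B\<^sub>0 = (norm B\<^sub>0)\<^sup>2 + K2_const C \<alpha> \<mu> u\<^sub>0 B\<^sub>0 * (K1_const \<alpha> u\<^sub>0 B\<^sub>0)\<^sup>2 / \<mu>"

end

theory Submission
  imports Defs
begin

text \<open>
  Testing the momentum equation of a solution with \<open>u\<close> and the magnetic one with
  \<open>b\<close> (the field \<open>B\<close> seen in \<open>V\<close>) gives the balance of the
  energy \<open>|u|^2 + \<alpha>^2 ||u||^2 + |B|^2\<close>; the trilinear form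
  \<open>B(u,v)w\<close> is antisymmetric in \<open>v, w\<close>, so that only the dissipation
  \<open>-2 \<mu> ||b||^2\<close> remains. The same test applied to the difference of two
  solutions leaves, besides the dissipation, four trilinear terms, each containing the difference
  twice and the strong solution once (\<open>difference_power_balance\<close>). Because of the Voigt term
  the energy of the difference controls \<open>||\<delta>u||\<close>, and the Ladyzhenskaya
  inequality bounds the form with \<open>\<delta>b\<close> twice by \<open>||u1|| (e
  ||\<delta>b||^2 + D |\<delta>B|^2)\<close> for every \<open>e > 0\<close>. Half of the
  dissipation absorbs the gradient of \<open>\<delta>b\<close>; what is left is \<open>K\<close>
  times the energy of the difference, and a Gronwall argument that keeps the other half of the
  dissipation is the asserted estimate (\<open>difference_estimate\<close>).

  The rate \<open>K\<close> involves the suprema in time of \<open>||u1||\<close> and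
  \<open>||b1||\<close>, and these must be bounded by the data alone, uniformly in
  \<open>T\<close>. The energy balance gives \<open>||u1|| \<le> K1 / \<alpha>\<close> and
  \<open>|B1| \<le> K1\<close>. For \<open>||b1||\<close> the magnetic equation is tested with the
  Stokes operator of \<open>b1\<close>: the two nonlinear terms are at most \<open>||u1|| |A b1|
  (e |A b1| + D |B1|)\<close> (\<open>B_op_Stokes_bound\<close>, from an Agmon and a Ladyzhenskaya
  inequality), hence \<open>d/dt ||b1||^2 \<le> c - (\<mu>/2) ||b1||^2\<close>, and
  \<open>||b1||^2\<close> can never rise above the larger of its initial value and \<open>2 c /
  \<mu>\<close> (\<open>gradient_bound\<close>). The initial value \<open>||B0||^2\<close> is not
  among the arguments of \<open>K4\<close>, but it is a function of them: with the absolute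
  constant \<open>C = 1\<close> it equals \<open>K3 - (K1/\<alpha>)^4 \<mu>^(-3) K1^2 /
  \<mu>\<close>.

  The tests are carried out on the Fourier side. For every nonzero frequency \<open>k\<close> the
  sine and cosine waves polarised along the projections of the three axes to the plane orthogonal
  to \<open>k\<close> form a tight frame of the solenoidal waves of frequency \<open>k\<close>,
  which avoids choosing bases of these planes. Testing an equation with one mode gives a scalar
  distributional equation, so each Fourier coefficient is the primitive of an integrable function
  (\<open>has_time_derivative_imp_primitive_on\<close>); the squares of the coefficients with
  frequencies up to \<open>N\<close> are summed with the weights of the required norm, and
  \<open>N\<close> tends to infinity by dominated convergence (\<open>Galerkin_energy\<close>).
  The estimates for \<open>B\<close> are likewise proved for trigonometric polynomials and
  transferred to \<open>V\<close> by truncation; this includes the existence of the continuous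
  extensions \<open>A_op\<close> and \<open>B_op\<close>, without which their descriptions would
  say nothing.
\<close>

section \<open>A smooth step function\<close>

text \<open>
  Smoothness is shown by exhibiting a family of differentiable functions that is closed under
  differentiation; no formula for the higher derivatives is needed.
\<close>

lemma smooth_family_iterated_deriv:
  fixes D :: "(real \<Rightarrow> real) set"
  assumes "\<And>f t. f \<in> D \<Longrightarrow> f differentiable (at t)" "\<And>f. f \<in> D \<Longrightarrow> deriv f \<in> D" "f \<in> D"
  shows "((deriv ^^ n) f) differentiable (at t)"
proof -
  have "(deriv ^^ n) f \<in> D"
    by (induction n) (use assms in auto)
  then show ?thesis using assms(1) by blast
qed

text \<open>
  The flat function \<open>exp (-1/x)\<close> times a polynomial in \<open>1/x\<close>. The
  polynomial is a parameter because differentiation reproduces the form with another polynomial.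
\<close>

definition flat_exp :: "real poly \<Rightarrow> real \<Rightarrow> real" where
  "flat_exp p x = (if x > 0 then poly p (1 / x) * exp (- (1 / x)) else 0)"

lemma tendsto_poly_times_exp_minus:
  fixes p :: "real poly"
  shows "((\<lambda>y. poly p y * exp (- y)) \<longlongrightarrow> 0) at_top"
proof -
  have "((\<lambda>y. \<Sum>i\<le>degree p. coeff p i * (y ^ i / exp y)) \<longlongrightarrow> (\<Sum>i\<le>degree p. coeff p i * 0)) at_top"
    by (intro tendsto_sum tendsto_mult tendsto_const tendsto_power_div_exp_0)
  then show ?thesis
    by (simp add: poly_altdef exp_minus divide_inverse sum_distrib_right mult.assoc)
qed

text \<open>
  Away from \<open>0\<close> this is the chain rule; at \<open>0\<close> the difference quotient
  tends to \<open>0\<close> because \<open>exp\<close> beats every polynomial.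
\<close>

lemma has_derivative_flat_exp:
  "(flat_exp p has_real_derivative flat_exp ([:0, 0, 1:] * (p - pderiv p)) x) (at x)"
proof -
  let ?q = "[:0, 0, 1:] * (p - pderiv p)"
  consider "x < 0" | "x > 0" | "x = 0" by linarith
  then show ?thesis
  proof cases
    case 1
    have "eventually (\<lambda>y. flat_exp p y = 0) (nhds x)"
      using 1 by (auto simp: flat_exp_def eventually_nhds intro!: exI[of _ "{..<0}"])
    then show ?thesis
      using 1 by (subst DERIV_cong_ev[OF refl]) (auto simp: flat_exp_def)
  next
    case 2
    have "eventually (\<lambda>y. flat_exp p y = poly p (1 / y) * exp (- (1 / y))) (nhds x)"
      using 2 by (auto simp: flat_exp_def eventually_nhds intro!: exI[of _ "{0<..}"])
    moreover have "((\<lambda>y. poly p (1 / y) * exp (- (1 / y))) has_real_derivative flat_exp ?q x) (at x)"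
      using 2 by (auto intro!: derivative_eq_intros DERIV_chain'[OF _ poly_DERIV] simp: flat_exp_def field_simps power2_eq_square)
    ultimately show ?thesis
      by (subst DERIV_cong_ev[OF refl]) auto
  next
    case 3
    have R: "((\<lambda>h. flat_exp p h / h) \<longlongrightarrow> 0) (at_right 0)"
    proof -
      have "((\<lambda>h. poly ([:0, 1:] * p) (inverse h) * exp (- inverse h)) \<longlongrightarrow> 0) (at_right 0)"
        by (rule filterlim_compose[OF tendsto_poly_times_exp_minus filterlim_inverse_at_top_right])
      then show ?thesis
        by (rule Lim_transform_eventually)
          (auto simp: flat_exp_def field_simps eventually_at_right_less intro!: eventually_at_rightI[of 0 1])
    qed
    have L: "((\<lambda>h. flat_exp p h / h) \<longlongrightarrow> 0) (at_left 0)"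
      by (rule Lim_transform_eventually[OF tendsto_const])
        (auto simp: flat_exp_def intro!: eventually_at_leftI[of "-1"])
    have "((\<lambda>h. flat_exp p h / h) \<longlongrightarrow> 0) (at 0)"
      using L R by (simp add: filterlim_at_split)
    then show ?thesis
      using 3 by (subst DERIV_def) (simp add: flat_exp_def)
  qed
qed

text \<open>
  Differences are included since reflecting the second factor puts a minus sign into the product
  rule.
\<close>

inductive_set bump_family :: "(real \<Rightarrow> real) set" where
  bump_base: "(\<lambda>x. flat_exp p x * flat_exp q (1 - x)) \<in> bump_family"
| bump_diff: "f \<in> bump_family \<Longrightarrow> g \<in> bump_family \<Longrightarrow> (\<lambda>x. f x - g x) \<in> bump_family"

lemma bump_family_derivative:
  "f \<in> bump_family \<Longrightarrow> \<exists>g\<in>bump_family. \<forall>x. (f has_real_derivative g x) (at x)"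
proof (induction rule: bump_family.induct)
  case (bump_base p q)
  let ?d = "\<lambda>p. [:0, 0, 1:] * (p - pderiv p)"
  have d: "((\<lambda>x. flat_exp q (1 - x)) has_real_derivative - flat_exp (?d q) (1 - x)) (at x)" for x
  proof -
    have "((\<lambda>x. 1 - x) has_real_derivative - 1) (at x)" by (auto intro!: derivative_eq_intros)
    from DERIV_chain2[OF has_derivative_flat_exp this, of q] show ?thesis by simp
  qed
  have "((\<lambda>x. flat_exp p x * flat_exp q (1 - x)) has_real_derivative
      flat_exp (?d p) x * flat_exp q (1 - x) - flat_exp p x * flat_exp (?d q) (1 - x)) (at x)" for x
    using DERIV_mult[OF has_derivative_flat_exp[of p x] d[of x]] by (simp add: algebra_simps)
  then show ?case
    by (intro bexI[of _ "\<lambda>x. flat_exp (?d p) x * flat_exp q (1 - x) - flat_exp p x * flat_exp (?d q) (1 - x)"]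
        bump_family.intros) auto
next
  case (bump_diff f g)
  then obtain f' g' where "f' \<in> bump_family" "g' \<in> bump_family"
    "\<And>x. (f has_real_derivative f' x) (at x)" "\<And>x. (g has_real_derivative g' x) (at x)" by blast
  then show ?case
    by (intro bexI[of _ "\<lambda>x. f' x - g' x"] bump_family.bump_diff) (auto intro: DERIV_diff)
qed

text \<open>
  The normalised integral of the bump \<open>exp (-1/x) exp (-1/(1-x))\<close>.
\<close>

lemma smooth_step_exists:
  obtains \<theta> :: "real \<Rightarrow> real" where
    "\<And>n t. ((deriv ^^ n) \<theta>) differentiable (at t)"
    "\<And>x. x \<le> 0 \<Longrightarrow> \<theta> x = 0" "\<And>x. x \<ge> 1 \<Longrightarrow> \<theta> x = 1" "\<And>x. deriv \<theta> x \<ge> 0"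
proof -
  define \<beta> where "\<beta> x = flat_exp 1 x * flat_exp 1 (1 - x)" for x
  have \<beta>: "\<beta> \<in> bump_family" using bump_base[of 1 1] by (simp add: \<beta>_def[abs_def])
  have fam: "f differentiable (at t) \<and> deriv f \<in> bump_family" if f: "f \<in> bump_family" for f t
  proof -
    obtain g where "g \<in> bump_family" "\<And>x. (f has_real_derivative g x) (at x)"
      using bump_family_derivative[OF f] by blast
    moreover from this have "deriv f = g" by (auto intro: DERIV_imp_deriv)
    ultimately show ?thesis using real_differentiable_def by blast
  qed
  have sm: "((deriv ^^ n) \<beta>) differentiable (at t)" for n t
    using smooth_family_iterated_deriv[of bump_family \<beta> n t] fam \<beta> by blast
  have cont: "continuous_on S \<beta>" for S
    using fam[OF \<beta>] by (meson continuous_at_imp_continuous_on differentiable_imp_continuous_within)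
  have nonneg: "\<beta> x \<ge> 0" for x by (simp add: \<beta>_def flat_exp_def)
  have out: "\<beta> x = 0" if "x \<le> 0 \<or> x \<ge> 1" for x using that by (auto simp: \<beta>_def flat_exp_def)
  define c where "c = integral {0..1} \<beta>"
  have c: "c > 0"
  proof -
    have "c \<ge> 0" unfolding c_def by (rule integral_nonneg) (auto intro: integrable_continuous_real cont nonneg)
    moreover have "c \<noteq> 0"
    proof
      assume "c = 0"
      then have "(\<beta> has_integral 0) {0..1}"
        using integrable_integral[OF integrable_continuous_real[OF cont], of 0 1] by (simp add: c_def)
      then have "\<beta> (1/2) = 0"
        using has_integral_0_cbox_imp_0[of 0 1 \<beta> "1/2"] cont nonneg by auto
      then show False by (simp add: \<beta>_def flat_exp_def)
    qed
    ultimately show ?thesis by linarith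
  qed
  define \<theta> where "\<theta> x = (if x \<le> 0 then 0 else integral {0..x} \<beta> / c)" for x
  have one: "\<theta> x = 1" if "x \<ge> 1" for x
  proof -
    have "integral {0..x} \<beta> = integral {0..1} \<beta> + integral {1..x} \<beta>"
      using that by (intro Henstock_Kurzweil_Integration.integral_combine[symmetric] integrable_continuous_real cont) auto
    also have "integral {1..x} \<beta> = 0" using out by (intro integral_unique has_integral_is_0) auto
    finally show ?thesis using c that by (simp add: \<theta>_def c_def)
  qed
  \<comment> \<open>Near \<open>y\<close> the step is the integral from a fixed point to the left of
    \<open>y\<close> and of \<open>0\<close>, to which the fundamental theorem applies.\<close>
  have alt: "\<theta> x = integral {-1 - \<bar>y\<bar>..x} \<beta> / c" if "x \<in> {-1 - \<bar>y\<bar>..1 + \<bar>y\<bar>}" for x y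
  proof (cases "x \<le> 0")
    case True then show ?thesis using out by (auto simp: \<theta>_def intro!: integral_unique has_integral_is_0)
  next
    case False
    have "integral {-1 - \<bar>y\<bar>..x} \<beta> = integral {-1 - \<bar>y\<bar>..0} \<beta> + integral {0..x} \<beta>"
      using False by (intro Henstock_Kurzweil_Integration.integral_combine[symmetric] integrable_continuous_real cont) auto
    also have "integral {-1 - \<bar>y\<bar>..0} \<beta> = 0" using out by (intro integral_unique has_integral_is_0) auto
    finally show ?thesis using False by (simp add: \<theta>_def)
  qed
  have der: "(\<theta> has_real_derivative \<beta> y / c) (at y)" for y
  proof -
    have "((\<lambda>x. integral {-1 - \<bar>y\<bar>..x} \<beta>) has_real_derivative \<beta> y) (at y within {-1 - \<bar>y\<bar>..1 + \<bar>y\<bar>})"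
      by (rule integral_has_real_derivative[OF cont]) auto
    then have "((\<lambda>x. integral {-1 - \<bar>y\<bar>..x} \<beta> / c) has_real_derivative \<beta> y / c) (at y within {-1 - \<bar>y\<bar>..1 + \<bar>y\<bar>})"
      by (rule DERIV_cdivide)
    moreover have "at y within {-1 - \<bar>y\<bar>..1 + \<bar>y\<bar>} = at y"
      by (rule at_within_interior) (auto simp: interior_atLeastAtMost_real)
    ultimately have "((\<lambda>x. integral {-1 - \<bar>y\<bar>..x} \<beta> / c) has_real_derivative \<beta> y / c) (at y)" by simp
    moreover have "eventually (\<lambda>x. \<theta> x = integral {-1 - \<bar>y\<bar>..x} \<beta> / c) (nhds y)"
      unfolding eventually_nhds using alt
      by (intro exI[of _ "{-1 - \<bar>y\<bar><..<1 + \<bar>y\<bar>}"]) auto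
    ultimately show ?thesis by (subst DERIV_cong_ev[OF refl]) auto
  qed
  then have d\<theta>: "deriv \<theta> = (\<lambda>x. \<beta> x / c)" by (auto intro: DERIV_imp_deriv)
  have it: "(deriv ^^ n) (\<lambda>x. \<beta> x / c) = (\<lambda>x. (deriv ^^ n) \<beta> x / c)" for n
  proof (induction n)
    case (Suc n)
    have "((\<lambda>x. (deriv ^^ n) \<beta> x / c) has_real_derivative (deriv ^^ Suc n) \<beta> x / c) (at x)" for x
      using sm[of n x] by (auto intro!: DERIV_cdivide simp: DERIV_deriv_iff_real_differentiable)
    then show ?case using Suc by (auto intro!: DERIV_imp_deriv)
  qed simp
  show ?thesis
  proof (rule that[of \<theta>])
    show "((deriv ^^ n) \<theta>) differentiable (at t)" for n t
    proof (cases n)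
      case 0 then show ?thesis using der real_differentiable_def by auto
    next
      case (Suc m)
      have "(deriv ^^ n) \<theta> = (\<lambda>x. (deriv ^^ m) \<beta> x / c)"
        unfolding Suc funpow_Suc_right o_def d\<theta> it ..
      then show ?thesis using sm[of m t] c by (auto intro: differentiable_divide)
    qed
  qed (use one c nonneg in \<open>auto simp: \<theta>_def d\<theta>\<close>)
qed

section \<open>Primitives of integrable functions and the Gronwall inequality\<close>

lemma open_interval_lebesgue: "{a<..<b::real} \<in> sets lebesgue"
  by (intro sets_completionI_sets) auto

text \<open>
  The integration theory used below is that of the gauge integral on closed intervals, whose
  exceptional sets are negligible sets; this and the next lemma translate to it.
\<close>

lemma AE_time_iff:
  fixes T :: real
  shows "(AE t in lebesgue_on {0<..<T}. P t) \<longleftrightarrow> (\<exists>N. negligible N \<and> (\<forall>t\<in>{0..T} - N. P t))"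
proof
  assume "AE t in lebesgue_on {0<..<T}. P t"
  then have "AE t in lebesgue. t \<in> {0<..<T} \<longrightarrow> P t" by (subst (asm) AE_restrict_space_iff) (auto simp: open_interval_lebesgue)
  then obtain N where "N \<in> null_sets lebesgue" "{t. \<not> (t \<in> {0<..<T} \<longrightarrow> P t)} \<subseteq> N"
    unfolding eventually_ae_filter by auto
  then show "\<exists>N. negligible N \<and> (\<forall>t\<in>{0..T} - N. P t)"
    proof (intro exI conjI)
    show "negligible (N \<union> {0, T})"
      using \<open>N \<in> null_sets lebesgue\<close> by (simp add: negligible_iff_null_sets[symmetric])
    show "\<forall>t\<in>{0..T} - (N \<union> {0, T}). P t"
      using \<open>{t. \<not> (t \<in> {0<..<T} \<longrightarrow> P t)} \<subseteq> N\<close> by (auto simp: subset_eq less_le)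
  qed
next
  assume "\<exists>N. negligible N \<and> (\<forall>t\<in>{0..T} - N. P t)"
  then obtain N where N: "N \<in> null_sets lebesgue" "\<forall>t\<in>{0..T} - N. P t"
    unfolding negligible_iff_null_sets by blast
  show "AE t in lebesgue_on {0<..<T}. P t"
    by (subst AE_restrict_space_iff) (use N in \<open>auto simp: open_interval_lebesgue intro!: AE_I'[of N]\<close>)
qed

lemma integrable_time_iff:
  fixes f :: "real \<Rightarrow> real"
  shows "integrable (lebesgue_on {0<..<T}) f \<longleftrightarrow> f absolutely_integrable_on {0..T}"
proof -
  have "integrable (lebesgue_on {0<..<T}) f \<longleftrightarrow> f absolutely_integrable_on {0<..<T}"
    unfolding set_integrable_def by (rule integrable_restrict_space) (auto simp: open_interval_lebesgue)
  also have "\<dots> \<longleftrightarrow> f absolutely_integrable_on {0..T}"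
  proof (rule absolutely_integrable_spike_set_eq)
    have "negligible {0, T}" by simp
    then show "negligible {x \<in> {0..T} - {0<..<T}. f x \<noteq> 0}"
      by (rule negligible_subset) (auto simp: less_le)
    have "{x \<in> {0<..<T} - {0..T}. f x \<noteq> 0} = {}" by auto
    then show "negligible {x \<in> {0<..<T} - {0..T}. f x \<noteq> 0}" by (simp only: negligible_empty)
  qed
  finally show ?thesis .
qed

lemma absolutely_integrable_continuous_mult_real:
  fixes f g :: "real \<Rightarrow> real"
  assumes f: "continuous_on {a..b} f" and g: "g absolutely_integrable_on {a..b}"
  shows "(\<lambda>x. f x * g x) absolutely_integrable_on {a..b}"
proof -
  obtain C where C: "\<And>x. x \<in> {a..b} \<Longrightarrow> \<bar>f x\<bar> \<le> C"
    using compact_imp_bounded[OF compact_continuous_image[OF f compact_Icc]]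
    unfolding bounded_iff real_norm_def by blast
  have gi: "integrable (lebesgue_on {a..b}) g" using g by (intro absolutely_integrable_imp_integrable) auto
  then have [measurable]: "g \<in> borel_measurable (lebesgue_on {a..b})" by auto
  have [measurable]: "f \<in> borel_measurable (lebesgue_on {a..b})"
    by (rule continuous_imp_measurable_on_sets_lebesgue[OF f]) auto
  have "integrable (lebesgue_on {a..b}) (\<lambda>x. C * g x)" using gi by simp
  then have "integrable (lebesgue_on {a..b}) (\<lambda>x. f x * g x)"
    by (rule Bochner_Integration.integrable_bound)
      (auto simp: space_restrict_space abs_mult intro!: AE_I2 mult_right_mono order_trans[OF C])
  then show ?thesis
    unfolding set_integrable_def by (subst (asm) integrable_restrict_space) auto
qed

text \<open>
  Absolute continuity, with the almost-everywhere derivative as an explicit second argument. All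
  time regularity of solutions is used in this form.
\<close>

definition primitive_on :: "real \<Rightarrow> (real \<Rightarrow> real) \<Rightarrow> (real \<Rightarrow> real) \<Rightarrow> bool" where
  "primitive_on T x g \<longleftrightarrow> g absolutely_integrable_on {0..T} \<and>
     (\<forall>s t. 0 \<le> s \<longrightarrow> s \<le> t \<longrightarrow> t \<le> T \<longrightarrow> x t - x s = integral {s..t} g)"

lemma primitive_onD:
  assumes "primitive_on T x g"
  shows primitive_on_absint: "g absolutely_integrable_on {0..T}"
    and primitive_on_integral: "0 \<le> s \<Longrightarrow> s \<le> t \<Longrightarrow> t \<le> T \<Longrightarrow> x t - x s = integral {s..t} g"
  using assms unfolding primitive_on_def by blast+

lemma time_subinterval_integrable:
  fixes g :: "real \<Rightarrow> real"
  assumes "g absolutely_integrable_on {0..T}" "0 \<le> s" "t \<le> T"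
  shows "g absolutely_integrable_on {s..t}" "g integrable_on {s..t}"
    "(\<lambda>x. \<bar>g x\<bar>) integrable_on {s..t}"
proof -
  show 1: "g absolutely_integrable_on {s..t}"
    using assms by (intro absolutely_integrable_on_subinterval[OF assms(1)]) auto
  then show "g integrable_on {s..t}" "(\<lambda>x. \<bar>g x\<bar>) integrable_on {s..t}"
    unfolding absolutely_integrable_on_def by auto
qed

text \<open>
  Dominated convergence for hypotheses that hold almost everywhere in time: the functions are
  replaced by \<open>0\<close> on the exceptional set.
\<close>

lemma time_dominated_convergence:
  assumes f: "\<And>n. f n absolutely_integrable_on {0..T::real}"
    and g: "AE r in lebesgue_on {0<..<T}. (\<lambda>n. f n r) \<longlonglongrightarrow> (h r :: real)"
    and w: "AE r in lebesgue_on {0<..<T}. \<forall>n. \<bar>f n r\<bar> \<le> w r" "w absolutely_integrable_on {0..T}"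
  shows "h absolutely_integrable_on {0..T}"
    "0 \<le> s \<Longrightarrow> t \<le> T \<Longrightarrow> (\<lambda>n. integral {s..t} (f n)) \<longlonglongrightarrow> integral {s..t} h"
proof -
  have "AE r in lebesgue_on {0<..<T}. (\<lambda>n. f n r) \<longlonglongrightarrow> h r \<and> (\<forall>n. \<bar>f n r\<bar> \<le> w r)"
    using g w(1) by eventually_elim simp
  then obtain N where N: "negligible N"
    "\<And>r. r \<in> {0..T} - N \<Longrightarrow> (\<lambda>n. f n r) \<longlonglongrightarrow> h r \<and> (\<forall>n. \<bar>f n r\<bar> \<le> w r)"
    unfolding AE_time_iff by blast
  define f' where "f' n r = (if r \<in> N then 0 else f n r)" for n r
  define h' where "h' r = (if r \<in> N then 0 else h r)" for r
  define w' where "w' r = (if r \<in> N then 0 else w r)" for r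
  have f'ai: "f' n absolutely_integrable_on {0..T}" for n
    by (rule absolutely_integrable_spike[OF f[of n] N(1)]) (simp add: f'_def)
  have w'ai: "w' absolutely_integrable_on {0..T}"
    by (rule absolutely_integrable_spike[OF w(2) N(1)]) (simp add: w'_def)
  have h'ai: "h' absolutely_integrable_on {0..T}"
  proof (rule dominated_convergence_absolutely_integrable[where f = f' and h = w'])
    show "w' integrable_on {0..T}" using time_subinterval_integrable[OF w'ai, of 0 T] by simp
    show "norm (h' r) \<le> w' r" if "r \<in> {0..T}" for r
    proof (cases "r \<in> N")
      case False
      then have "(\<lambda>n. \<bar>f n r\<bar>) \<longlonglongrightarrow> \<bar>h r\<bar>" using N(2)[of r] that by (intro tendsto_rabs) simp
      then have "\<bar>h r\<bar> \<le> w r" using N(2)[of r] that False by (intro LIMSEQ_le_const2[where a = "w r"]) auto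
      then show ?thesis by (simp add: h'_def w'_def False)
    qed (simp add: h'_def w'_def)
    show "(\<lambda>k. f' k r) \<longlonglongrightarrow> h' r" if "r \<in> {0..T}" for r
      using N(2)[of r] that by (simp add: f'_def h'_def)
  qed (rule f'ai)
  show "h absolutely_integrable_on {0..T}"
    by (rule absolutely_integrable_spike[OF h'ai N(1)]) (simp add: h'_def)
  assume st: "0 \<le> s" "t \<le> T"
  have "(\<lambda>n. integral {s..t} (f' n)) \<longlonglongrightarrow> integral {s..t} h'"
  proof (rule dominated_convergence[where h = w'])
    show "f' n integrable_on {s..t}" for n by (rule time_subinterval_integrable[OF f'ai st])
    show "w' integrable_on {s..t}" by (rule time_subinterval_integrable[OF w'ai st])
    show "norm (f' n r) \<le> w' r" if "r \<in> {s..t}" for n r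
      using N(2)[of r] st that by (simp add: f'_def w'_def)
    show "(\<lambda>n. f' n r) \<longlonglongrightarrow> h' r" if "r \<in> {s..t}" for r
      using N(2)[of r] st that by (simp add: f'_def h'_def)
  qed
  moreover have "integral {s..t} (f' n) = integral {s..t} (f n)" for n
    by (rule integral_spike[OF N(1)]) (simp add: f'_def)
  moreover have "integral {s..t} h' = integral {s..t} h"
    by (rule integral_spike[OF N(1)]) (simp add: h'_def)
  ultimately show "(\<lambda>n. integral {s..t} (f n)) \<longlonglongrightarrow> integral {s..t} h" by simp
qed

lemma integral_le_AE:
  fixes f g :: "real \<Rightarrow> real"
  assumes "f absolutely_integrable_on {0..T}" "g absolutely_integrable_on {0..T}"
    and "AE r in lebesgue_on {0<..<T}. f r \<le> g r" "0 \<le> s" "t \<le> T"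
  shows "integral {s..t} f \<le> integral {s..t} g"
proof -
  obtain N where N: "negligible N" "\<And>r. r \<in> {0..T} - N \<Longrightarrow> f r \<le> g r"
    using assms(3) unfolding AE_time_iff by blast
  define f' where "f' r = (if r \<in> N then g r else f r)" for r
  have eq: "integral {s..t} f' = integral {s..t} f"
    by (rule integral_spike[OF N(1)]) (simp add: f'_def)
  have "f integrable_on {s..t}" by (rule time_subinterval_integrable[OF assms(1,4,5)])
  then have "f' integrable_on {s..t}"
    by (rule integrable_spike[OF _ N(1)]) (simp add: f'_def)
  moreover have "g integrable_on {s..t}" by (rule time_subinterval_integrable[OF assms(2,4,5)])
  ultimately have "integral {s..t} f' \<le> integral {s..t} g"
    by (rule integral_le) (use N(2) assms(4,5) in \<open>auto simp: f'_def\<close>)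
  then show ?thesis by (simp add: eq)
qed

lemma primitive_on_continuous:
  assumes "primitive_on T x g" shows "continuous_on {0..T} x"
proof -
  have "continuous_on {0..T} (\<lambda>t. x 0 + integral {0..t} g)"
    using primitive_on_absint[OF assms]
    by (intro continuous_intros indefinite_integral_continuous_1) (simp add: absolutely_integrable_on_def)
  moreover have "x 0 + integral {0..t} g = x t" if "t \<in> {0..T}" for t
    using primitive_on_integral[OF assms, of 0 t] that by simp
  ultimately show ?thesis by (rule continuous_on_eq)
qed

lemma primitive_on_sum:
  assumes "finite I" "\<And>i. i \<in> I \<Longrightarrow> primitive_on T (x i) (g i)"
  shows "primitive_on T (\<lambda>t. \<Sum>i\<in>I. x i t) (\<lambda>r. \<Sum>i\<in>I. g i r)"
  unfolding primitive_on_def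
proof (intro conjI allI impI)
  show "(\<lambda>r. \<Sum>i\<in>I. g i r) absolutely_integrable_on {0..T}"
    using assms by (intro absolutely_integrable_sum) (auto simp: primitive_on_def)
  fix s t :: real assume st: "0 \<le> s" "s \<le> t" "t \<le> T"
  have "integral {s..t} (\<lambda>r. \<Sum>i\<in>I. g i r) = (\<Sum>i\<in>I. integral {s..t} (g i))"
    using assms st by (intro integral_sum) (auto intro: time_subinterval_integrable primitive_on_absint)
  then show "(\<Sum>i\<in>I. x i t) - (\<Sum>i\<in>I. x i s) = integral {s..t} (\<lambda>r. \<Sum>i\<in>I. g i r)"
    unfolding sum_subtractf[symmetric]
    by (simp only:) (rule sum.cong[OF refl], rule primitive_on_integral[OF assms(2) st])
qed

lemma primitive_on_cmult:
  assumes "primitive_on T x g"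
  shows "primitive_on T (\<lambda>t. c * x t) (\<lambda>r. c * g r)"
  unfolding primitive_on_def
proof (intro conjI allI impI)
  show "(\<lambda>r. c * g r) absolutely_integrable_on {0..T}"
    using primitive_on_absint[OF assms] by (intro set_integrable_mult_right)
  fix s t :: real assume "0 \<le> s" "s \<le> t" "t \<le> T"
  then show "c * x t - c * x s = integral {s..t} (\<lambda>r. c * g r)"
    using primitive_on_integral[OF assms, of s t] by (simp add: right_diff_distrib[symmetric])
qed

lemma primitive_on_add:
  assumes "primitive_on T x g" "primitive_on T y h"
  shows "primitive_on T (\<lambda>t. x t + y t) (\<lambda>r. g r + h r)"
proof -
  have "primitive_on T (\<lambda>t. \<Sum>b\<in>{True, False}. (if b then x else y) t)
      (\<lambda>r. \<Sum>b\<in>{True, False}. (if b then g else h) r)"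
    by (rule primitive_on_sum) (use assms in auto)
  then show ?thesis by simp
qed

lemma primitive_on_diff:
  assumes "primitive_on T x g" "primitive_on T y h"
  shows "primitive_on T (\<lambda>t. x t - y t) (\<lambda>r. g r - h r)"
  using primitive_on_add[OF assms(1) primitive_on_cmult[OF assms(2), of "-1"]] by simp

lemma primitive_on_limit:
  assumes n: "\<And>n. primitive_on T (x n) (g n)"
    and x: "\<And>t. t \<in> {0..T} \<Longrightarrow> (\<lambda>n. x n t) \<longlonglongrightarrow> y t"
    and g: "AE r in lebesgue_on {0<..<T}. (\<lambda>n. g n r) \<longlonglongrightarrow> h r"
    and w: "AE r in lebesgue_on {0<..<T}. \<forall>n. \<bar>g n r\<bar> \<le> w r" "w absolutely_integrable_on {0..T}"
  shows "primitive_on T y h"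
proof -
  have "g n absolutely_integrable_on {0..T}" for n by (rule primitive_on_absint[OF n])
  note lim = time_dominated_convergence[OF this g w]
  show ?thesis unfolding primitive_on_def
  proof (intro conjI allI impI lim(1))
    fix s t :: real assume st: "0 \<le> s" "s \<le> t" "t \<le> T"
    show "y t - y s = integral {s..t} h"
    proof (rule LIMSEQ_unique)
      show "(\<lambda>n. x n t - x n s) \<longlonglongrightarrow> y t - y s" using x st by (intro tendsto_diff) auto
      show "(\<lambda>n. x n t - x n s) \<longlonglongrightarrow> integral {s..t} h"
        using lim(2)[of s t] st primitive_on_integral[OF n st] by simp
    qed
  qed
qed

text \<open>
  Over a partition into intervals shorter than \<open>\<delta>\<close> the increments of
  \<open>W\<close> telescope, which gives the bound for all \<open>s, t\<close>; then
  \<open>\<epsilon>\<close> tends to \<open>0\<close>.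
\<close>

lemma small_increments_imp_constant:
  fixes D W :: "real \<Rightarrow> real"
  assumes \<delta>: "\<And>\<epsilon>. \<epsilon> > 0 \<Longrightarrow> \<exists>\<delta>>0. \<forall>s t. 0 \<le> s \<longrightarrow> s \<le> t \<longrightarrow> t \<le> T \<longrightarrow> t - s < \<delta> \<longrightarrow> \<bar>D t - D s\<bar> \<le> \<epsilon> * (W t - W s)"
    and st: "0 \<le> s" "s \<le> t" "t \<le> T"
  shows "D t = D s"
proof -
  have bound: "\<bar>D t - D s\<bar> \<le> \<epsilon> * (W t - W s)" if \<epsilon>: "\<epsilon> > 0" for \<epsilon>
  proof -
    obtain \<delta> where d: "\<delta> > 0"
      "\<And>s t. 0 \<le> s \<Longrightarrow> s \<le> t \<Longrightarrow> t \<le> T \<Longrightarrow> t - s < \<delta> \<Longrightarrow> \<bar>D t - D s\<bar> \<le> \<epsilon> * (W t - W s)"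
      using \<delta>[OF \<epsilon>] by blast
    have "\<bar>D t - D s\<bar> \<le> \<epsilon> * (W t - W s)" if "0 \<le> s" "s \<le> t" "t \<le> T" "t - s \<le> real n * (\<delta> / 2)" for n s t
      using that
    proof (induction n arbitrary: t)
      case 0
      then have "t = s" by simp
      then show ?case by simp
    next
      case (Suc n)
      define r where "r = max s (t - \<delta> / 2)"
      have r: "s \<le> r" "r \<le> t" "t - r < \<delta>" "r - s \<le> real n * (\<delta> / 2)"
        using Suc.prems d(1) by (auto simp: r_def algebra_simps max_def)
      have "\<bar>D r - D s\<bar> \<le> \<epsilon> * (W r - W s)" using Suc r by auto
      moreover have "\<bar>D t - D r\<bar> \<le> \<epsilon> * (W t - W r)" using Suc.prems r by (intro d(2)) auto
      ultimately show ?case by (simp add: algebra_simps)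
    qed
    moreover obtain n where "(t - s) / (\<delta> / 2) \<le> real n" using real_arch_simple by blast
    ultimately show ?thesis using st d(1) by (auto simp: field_simps)
  qed
  have "\<bar>D t - D s\<bar> \<le> 0"
  proof (rule field_le_epsilon)
    fix e :: real assume e: "e > 0"
    define \<epsilon> where "\<epsilon> = e / (\<bar>W t - W s\<bar> + 1)"
    have "\<epsilon> > 0" using e by (simp add: \<epsilon>_def add_nonneg_pos)
    then have "\<bar>D t - D s\<bar> \<le> \<epsilon> * (\<bar>W t - W s\<bar> + 1)"
      using bound[of \<epsilon>] mult_left_mono[of "W t - W s" "\<bar>W t - W s\<bar> + 1" \<epsilon>] by linarith
    then show "\<bar>D t - D s\<bar> \<le> 0 + e" by (simp add: \<epsilon>_def)
  qed
  then show ?thesis by simp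
qed

text \<open>
  On an interval \<open>[s, t]\<close> the increment of the product differs from the integral of
  the claimed derivative by the integral of \<open>(x t - x r) h r + (z s - z r) g r\<close>. By
  uniform continuity of \<open>x\<close> and \<open>z\<close> this is at most
  \<open>\<epsilon>\<close> times the integral of \<open>|g| + |h|\<close> when the interval is
  short, so the discrepancy is constant.
\<close>

lemma primitive_on_mult:
  assumes x: "primitive_on T x g" and z: "primitive_on T z h"
  shows "primitive_on T (\<lambda>t. x t * z t) (\<lambda>r. x r * h r + z r * g r)"
proof -
  have cx: "continuous_on {0..T} x" and cz: "continuous_on {0..T} z"
    using x z primitive_on_continuous by auto
  let ?k = "\<lambda>r. x r * h r + z r * g r"
  have gi: "g absolutely_integrable_on {0..T}" and hi: "h absolutely_integrable_on {0..T}"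
    using x z primitive_on_absint by auto
  have ki: "?k absolutely_integrable_on {0..T}"
    by (intro set_integral_add absolutely_integrable_continuous_mult_real cx cz gi hi)
  have wi: "(\<lambda>r. \<bar>g r\<bar> + \<bar>h r\<bar>) absolutely_integrable_on {0..T}"
    by (intro set_integral_add set_integrable_abs gi hi)
  define D where "D t = x t * z t - integral {0..t} ?k" for t
  define W where "W t = integral {0..t} (\<lambda>r. \<bar>g r\<bar> + \<bar>h r\<bar>)" for t
  have const: "D t = D s" if st: "0 \<le> s" "s \<le> t" "t \<le> T" for s t
  proof (rule small_increments_imp_constant[where T = T and W = W, OF _ st])
    fix \<epsilon> :: real assume e: "\<epsilon> > 0"
    obtain d1 where d1: "d1 > 0" "\<And>p q. p \<in> {0..T} \<Longrightarrow> q \<in> {0..T} \<Longrightarrow> \<bar>q - p\<bar> < d1 \<Longrightarrow> \<bar>x q - x p\<bar> < \<epsilon>"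
      using compact_uniformly_continuous[OF cx compact_Icc] e unfolding uniformly_continuous_on_def dist_real_def by metis
    obtain d2 where d2: "d2 > 0" "\<And>p q. p \<in> {0..T} \<Longrightarrow> q \<in> {0..T} \<Longrightarrow> \<bar>q - p\<bar> < d2 \<Longrightarrow> \<bar>z q - z p\<bar> < \<epsilon>"
      using compact_uniformly_continuous[OF cz compact_Icc] e unfolding uniformly_continuous_on_def dist_real_def by metis
    show "\<exists>\<delta>>0. \<forall>s t. 0 \<le> s \<longrightarrow> s \<le> t \<longrightarrow> t \<le> T \<longrightarrow> t - s < \<delta> \<longrightarrow> \<bar>D t - D s\<bar> \<le> \<epsilon> * (W t - W s)"
    proof (intro exI[of _ "min d1 d2"] conjI allI impI)
      fix s t assume st: "0 \<le> s" "s \<le> t" "t \<le> T" "t - s < min d1 d2"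
      have comb: "integral {0..t} f = integral {0..s} f + integral {s..t} f"
        if "f absolutely_integrable_on {0..T}" for f :: "real \<Rightarrow> real"
        using st by (intro Henstock_Kurzweil_Integration.integral_combine[symmetric] time_subinterval_integrable[OF that]) auto
      note sub = time_subinterval_integrable[OF gi st(1,3)] time_subinterval_integrable[OF hi st(1,3)] time_subinterval_integrable[OF ki st(1,3)] time_subinterval_integrable[OF wi st(1,3)]
      have "x t * z t - x s * z s = x t * (z t - z s) + z s * (x t - x s)" by (simp add: algebra_simps)
      also have "\<dots> = x t * integral {s..t} h + z s * integral {s..t} g"
        using primitive_on_integral[OF x] primitive_on_integral[OF z] st by simp
      also have "\<dots> = integral {s..t} (\<lambda>r. x t * h r + z s * g r)"
        using sub by (subst integral_add) (auto intro: integrable_on_mult_right)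
      finally have "D t - D s = integral {s..t} (\<lambda>r. x t * h r + z s * g r) - integral {s..t} ?k"
        by (simp add: D_def comb[OF ki])
      also have "\<dots> = integral {s..t} (\<lambda>r. (x t * h r + z s * g r) - ?k r)"
        using sub by (intro integral_diff[symmetric]) (auto intro: integrable_on_mult_right integrable_add)
      finally have eq: "D t - D s = integral {s..t} (\<lambda>r. (x t * h r + z s * g r) - ?k r)" .
      have "norm (integral {s..t} (\<lambda>r. (x t * h r + z s * g r) - ?k r)) \<le>
          integral {s..t} (\<lambda>r. \<epsilon> * (\<bar>g r\<bar> + \<bar>h r\<bar>))"
      proof (rule Henstock_Kurzweil_Integration.integral_norm_bound_integral)
        show "(\<lambda>r. (x t * h r + z s * g r) - ?k r) integrable_on {s..t}"
          using sub by (auto intro!: integrable_diff integrable_add integrable_on_mult_right)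
        show "(\<lambda>r. \<epsilon> * (\<bar>g r\<bar> + \<bar>h r\<bar>)) integrable_on {s..t}"
          using sub by (auto intro!: integrable_on_mult_right)
        fix r assume r: "r \<in> {s..t}"
        have "\<bar>x t - x r\<bar> \<le> \<epsilon>" using d1(2)[of r t] r st by auto
        moreover have "\<bar>z s - z r\<bar> \<le> \<epsilon>" using d2(2)[of r s] r st by auto
        moreover have "(x t * h r + z s * g r) - ?k r = (x t - x r) * h r + (z s - z r) * g r"
          by (simp add: algebra_simps)
        ultimately have "\<bar>(x t * h r + z s * g r) - ?k r\<bar> \<le> \<epsilon> * \<bar>h r\<bar> + \<epsilon> * \<bar>g r\<bar>"
          using abs_triangle_ineq[of "(x t - x r) * h r" "(z s - z r) * g r"]
            mult_right_mono[of "\<bar>x t - x r\<bar>" \<epsilon> "\<bar>h r\<bar>"] mult_right_mono[of "\<bar>z s - z r\<bar>" \<epsilon> "\<bar>g r\<bar>"]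
          by (simp add: abs_mult)
        then show "norm ((x t * h r + z s * g r) - ?k r) \<le> \<epsilon> * (\<bar>g r\<bar> + \<bar>h r\<bar>)"
          by (simp add: algebra_simps)
      qed
      then show "\<bar>D t - D s\<bar> \<le> \<epsilon> * (W t - W s)"
        unfolding eq W_def comb[OF wi] by simp
    qed (use d1 d2 in auto)
  qed
  show ?thesis unfolding primitive_on_def
  proof (intro conjI allI impI ki)
    fix s t assume st: "0 \<le> s" "s \<le> t" "t \<le> T"
    have "integral {0..t} ?k = integral {0..s} ?k + integral {s..t} ?k"
      using st by (intro Henstock_Kurzweil_Integration.integral_combine[symmetric] time_subinterval_integrable[OF ki]) auto
    then show "x t * z t - x s * z s = integral {s..t} ?k"
      using const[OF st] by (simp add: D_def)
  qed
qed

lemma primitive_on_derivative: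
  assumes "\<And>t. (x has_real_derivative g t) (at t)" "continuous_on {0..T} g"
  shows "primitive_on T x g"
  unfolding primitive_on_def
proof (intro conjI allI impI)
  show "g absolutely_integrable_on {0..T}" using assms(2) by (rule absolutely_integrable_continuous_real)
  fix s t :: real assume "0 \<le> s" "s \<le> t" "t \<le> T"
  then have "(g has_integral (x t - x s)) {s..t}"
    using assms(1) by (intro fundamental_theorem_of_calculus)
      (auto simp: has_real_derivative_iff_has_vector_derivative[symmetric] intro: has_field_derivative_at_within)
  then show "x t - x s = integral {s..t} g" by (simp add: integral_unique)
qed

text \<open>
  With the integrating factor \<open>exp (-K r)\<close> the derivative of \<open>y\<close> becomes
  at most \<open>- p r exp (-K r)\<close>. Keeping \<open>p\<close> produces the weighted
  dissipation integral on the left.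
\<close>

lemma Gronwall_primitive:
  assumes y: "primitive_on T y h" and p: "p absolutely_integrable_on {0..T}"
    and le: "AE r in lebesgue_on {0<..<T}. h r \<le> K * y r - p r" and t: "t \<in> {0..T}"
  shows "y t + (LINT r:{0..t}|lebesgue. p r * exp (K * (t - r))) \<le> y 0 * exp (K * t)"
proof -
  obtain N where N: "negligible N" "\<And>r. r \<in> {0..T} - N \<Longrightarrow> h r \<le> K * y r - p r"
    using le unfolding AE_time_iff by blast
  let ?e = "\<lambda>r. exp (- K * r)"
  let ?k = "\<lambda>r. y r * (- K * ?e r) + ?e r * h r"
  have e: "primitive_on T ?e (\<lambda>r. - K * ?e r)"
    by (rule primitive_on_derivative) (auto intro!: derivative_eq_intros continuous_intros)
  note ye = primitive_on_mult[OF y e]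
  have pe: "(\<lambda>r. ?e r * p r) absolutely_integrable_on {0..T}"
    by (intro absolutely_integrable_continuous_mult_real p continuous_intros)
  define k' where "k' r = (if r \<in> N then - (?e r * p r) else ?k r)" for r
  have tt: "0 \<le> t" "t \<le> T" using t by auto
  have ki: "?k integrable_on {0..t}" using time_subinterval_integrable(2)[OF primitive_on_absint[OF ye] _ tt(2), of 0] by simp
  have pei: "(\<lambda>r. ?e r * p r) absolutely_integrable_on {0..t}" "(\<lambda>r. ?e r * p r) integrable_on {0..t}"
    using time_subinterval_integrable[OF pe _ tt(2), of 0] by auto
  have "y t * ?e t - y 0 * ?e 0 = integral {0..t} ?k"
    using primitive_on_integral[OF ye, of 0 t] tt by simp
  also have "\<dots> = integral {0..t} k'"
    by (rule integral_spike[OF N(1)]) (auto simp: k'_def)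
  also have "\<dots> \<le> integral {0..t} (\<lambda>r. - (?e r * p r))"
  proof (rule integral_le)
    show "k' integrable_on {0..t}" by (rule integrable_spike[OF ki N(1)]) (auto simp: k'_def)
    show "(\<lambda>r. - (?e r * p r)) integrable_on {0..t}" using pei by (simp add: integrable_neg_iff)
    fix r assume r: "r \<in> {0..t}"
    show "k' r \<le> - (?e r * p r)"
    proof (cases "r \<in> N")
      case False
      then have "?e r * h r \<le> ?e r * (K * y r - p r)" using N(2)[of r] r tt by (intro mult_left_mono) auto
      then show ?thesis using False by (simp add: k'_def algebra_simps)
    qed (simp add: k'_def)
  qed
  also have "\<dots> = - (LINT r:{0..t}|lebesgue. ?e r * p r)"
    using set_lebesgue_integral_eq_integral(2)[OF pei(1)] by simp
  finally have "y t * ?e t + (LINT r:{0..t}|lebesgue. ?e r * p r) \<le> y 0" by simp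
  then have "exp (K * t) * (y t * ?e t + (LINT r:{0..t}|lebesgue. ?e r * p r)) \<le> exp (K * t) * y 0"
    by (intro mult_left_mono) auto
  moreover have "exp (K * t) * (LINT r:{0..t}|lebesgue. ?e r * p r) = (LINT r:{0..t}|lebesgue. p r * exp (K * (t - r)))"
    unfolding set_integral_mult_right[symmetric]
    by (intro arg_cong2[where f = "set_lebesgue_integral lebesgue"] refl ext)
      (simp add: exp_add[symmetric] exp_diff algebra_simps exp_minus field_simps)
  moreover have "exp (K * t) * (y t * ?e t) = y t" by (simp add: exp_minus field_simps)
  ultimately show ?thesis unfolding distrib_left by (simp only: mult.commute[of "y 0"])
qed

text \<open>
  While \<open>Z\<close> is above \<open>C / \<kappa>\<close> it cannot increase: if it exceeded
  \<open>M\<close> at time \<open>t\<close>, it would have stayed above \<open>M\<close> since the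
  last time \<open>s\<close> at which it was equal to \<open>M\<close>, hence could not have grown
  on \<open>[s, t]\<close>. The bound does not depend on \<open>T\<close>, which a Gronwall
  argument with the upper bound \<open>C\<close> alone would not give.
\<close>

lemma dissipation_comparison:
  fixes Z :: "real \<Rightarrow> real"
  assumes Z: "continuous_on {0..T} Z" and k: "\<kappa> > 0"
    and le: "\<And>s t. 0 \<le> s \<Longrightarrow> s \<le> t \<Longrightarrow> t \<le> T \<Longrightarrow> Z t - Z s \<le> integral {s..t} (\<lambda>r. C - \<kappa> * Z r)"
    and t: "t \<in> {0..T}" and M: "Z 0 \<le> M" "C / \<kappa> \<le> M"
  shows "Z t \<le> M"
proof (rule ccontr)
  assume "\<not> Z t \<le> M"
  then have gt: "Z t > M" by simp
  define S where "S = {s \<in> {0..t}. Z s = M}"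
  have c: "continuous_on {0..t} Z" by (rule continuous_on_subset[OF Z]) (use t in auto)
  have "bounded S" by (rule bounded_subset[OF bounded_closed_interval[of 0 t]]) (auto simp: S_def)
  moreover have "closed S"
    unfolding S_def by (rule continuous_closed_preimage_constant[OF c closed_atLeastAtMost])
  ultimately have "compact S" by (simp add: compact_eq_bounded_closed)
  moreover have "S \<noteq> {}"
    unfolding S_def using IVT'[of Z 0 M t] M(1) gt t c by auto
  ultimately obtain s where "s \<in> S \<and> (\<forall>r\<in>S. r \<le> s)" using compact_attains_sup[of S] by metis
  then have s: "s \<in> S" "\<And>r. r \<in> S \<Longrightarrow> r \<le> s" by auto
  have ge: "Z r \<ge> M" if r: "r \<in> {s..t}" for r
  proof (rule ccontr)
    assume "\<not> M \<le> Z r"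
    then have "\<exists>x\<ge>r. x \<le> t \<and> Z x = M"
      using r gt s(1) by (intro IVT' continuous_on_subset[OF c]) (auto simp: S_def)
    then obtain x where x: "r \<le> x" "x \<le> t" "Z x = M" by blast
    then have "x \<in> S" using r s(1) by (auto simp: S_def)
    then have "x = s" using s(2)[of x] x(1) r by auto
    then have "r = s" using x(1) r by auto
    then show False using \<open>\<not> M \<le> Z r\<close> s(1) by (simp add: S_def)
  qed
  have "integral {s..t} (\<lambda>r. C - \<kappa> * Z r) \<le> integral {s..t} (\<lambda>r. 0)"
  proof (rule integral_le)
    show "(\<lambda>r. C - \<kappa> * Z r) integrable_on {s..t}"
      by (intro integrable_continuous_real continuous_intros continuous_on_subset[OF c]) (use s(1) in \<open>auto simp: S_def\<close>)
    show "C - \<kappa> * Z r \<le> 0" if "r \<in> {s..t}" for r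
    proof -
      have "C / \<kappa> \<le> Z r" using ge[OF that] M(2) by simp
      then show ?thesis using k by (simp add: field_simps)
    qed
  qed (rule integrable_0)
  moreover have "Z t - Z s \<le> integral {s..t} (\<lambda>r. C - \<kappa> * Z r)"
    using s(1) t by (intro le) (auto simp: S_def)
  ultimately show False using s(1) gt by (simp add: S_def)
qed

section \<open>Distributional derivatives and measurability in time\<close>

text \<open>
  The derivatives of the rescaled steps \<open>\<theta> (n (x - p))\<close> are an approximate
  identity concentrated on the right of \<open>p\<close>. The one-sided concentration is why
  \<open>p = 0\<close> is admitted and \<open>p = T\<close> is not.
\<close>

lemma step_kernel_tendsto:
  fixes f \<theta> :: "real \<Rightarrow> real"
  assumes f: "continuous_on {0..T} f" and p: "0 \<le> p" "p < T"
    and d: "\<And>x. (\<theta> has_real_derivative \<theta>' x) (at x)" and c: "continuous_on UNIV \<theta>'"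
    and z: "\<And>x. x \<le> 0 \<Longrightarrow> \<theta> x = 0" and o: "\<And>x. x \<ge> 1 \<Longrightarrow> \<theta> x = 1" and nn: "\<And>x. \<theta>' x \<ge> 0"
  shows "(\<lambda>n. integral {0..T} (\<lambda>x. real n * \<theta>' (real n * (x - p)) * f x)) \<longlonglongrightarrow> f p"
proof (rule LIMSEQ_I)
  fix e :: real assume e: "e > 0"
  have out: "\<theta>' x = 0" if "x < 0 \<or> x > 1" for x
  proof -
    have "\<exists>S. open S \<and> x \<in> S \<and> (\<exists>k. \<forall>y\<in>S. \<theta> y = k)"
      using that z o by (auto intro!: exI[of _ "if x < 0 then {..<0} else {1<..}"])
    then obtain k where "eventually (\<lambda>y. \<theta> y = k) (nhds x)" by (auto simp: eventually_nhds)
    then have "(\<theta> has_real_derivative 0) (at x)" by (subst DERIV_cong_ev[OF refl _ refl]) auto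
    then show ?thesis using d DERIV_unique by blast
  qed
  have "p \<in> {0..T}" using p by auto
  then obtain \<delta> where \<delta>: "\<delta> > 0" "\<And>x. x \<in> {0..T} \<Longrightarrow> \<bar>x - p\<bar> < \<delta> \<Longrightarrow> \<bar>f x - f p\<bar> < e / 2"
    using f e unfolding continuous_on_iff dist_real_def by (metis half_gt_zero)
  obtain N where N: "1 / min \<delta> (T - p) < real N" using reals_Archimedean2 by blast
  show "\<exists>N. \<forall>n\<ge>N. norm (integral {0..T} (\<lambda>x. real n * \<theta>' (real n * (x - p)) * f x) - f p) < e"
  proof (intro exI[of _ N] allI impI)
    fix n assume "N \<le> n"
    then have n: "1 / min \<delta> (T - p) < real n" using N by linarith
    have m: "min \<delta> (T - p) > 0" using \<delta>(1) p by simp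
    then have n0: "real n > 0" using n by (meson divide_pos_pos less_trans zero_less_one)
    \<comment> \<open>The kernel has integral one once its support lies inside the interval.\<close>
    have "1 < real n * min \<delta> (T - p)" using n m by (simp add: divide_less_eq)
    moreover have "real n * min \<delta> (T - p) \<le> real n * (T - p)" "real n * min \<delta> (T - p) \<le> real n * \<delta>"
      using n0 by (auto intro!: mult_left_mono)
    ultimately have n1: "1 < real n * (T - p)" "1 < real n * \<delta>" by linarith+
    let ?k = "\<lambda>x. real n * \<theta>' (real n * (x - p))"
    have kc: "continuous_on {0..T} ?k"
      by (intro continuous_intros continuous_on_compose2[OF c]) auto
    have "(?k has_integral (\<theta> (real n * (T - p)) - \<theta> (real n * (0 - p)))) {0..T}"
    proof (rule fundamental_theorem_of_calculus)
      fix x assume "x \<in> {0..T}"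
      have "((\<lambda>x. real n * (x - p)) has_real_derivative real n) (at x)"
        by (auto intro!: derivative_eq_intros)
      from DERIV_chain2[OF d this]
      show "((\<lambda>x. \<theta> (real n * (x - p))) has_vector_derivative ?k x) (at x within {0..T})"
        by (auto simp: has_real_derivative_iff_has_vector_derivative[symmetric] mult.commute
            intro: has_field_derivative_at_within)
    qed (use p in auto)
    moreover have "\<theta> (real n * (T - p)) = 1" using n1 by (intro o) simp
    moreover have "\<theta> (real n * (0 - p)) = 0" using p by (intro z) (simp add: mult_le_0_iff)
    ultimately have k1: "(?k has_integral 1) {0..T}" by simp
    have int: "(\<lambda>x. ?k x * f x) integrable_on {0..T}" "(\<lambda>x. ?k x * f p) integrable_on {0..T}"
      by (intro integrable_continuous_real continuous_intros kc f)+
    have kf: "((\<lambda>x. ?k x * f p) has_integral (1 * f p)) {0..T}" by (rule has_integral_mult_left[OF k1])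
    have "integral {0..T} (\<lambda>x. ?k x * f x) - f p = integral {0..T} (\<lambda>x. ?k x * f x - ?k x * f p)"
      using integral_diff[OF int] integral_unique[OF kf] by simp
    moreover have "norm (integral {0..T} (\<lambda>x. ?k x * f x - ?k x * f p)) \<le> integral {0..T} (\<lambda>x. ?k x * (e / 2))"
    proof (rule Henstock_Kurzweil_Integration.integral_norm_bound_integral)
      show "(\<lambda>x. ?k x * f x - ?k x * f p) integrable_on {0..T}" by (intro integrable_diff int)
      show "(\<lambda>x. ?k x * (e / 2)) integrable_on {0..T}"
        by (intro integrable_continuous_real continuous_intros kc)
      fix x assume x: "x \<in> {0..T}"
      show "norm (?k x * f x - ?k x * f p) \<le> ?k x * (e / 2)"
      proof (cases "real n * (x - p) < 0 \<or> real n * (x - p) > 1")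
        case True then show ?thesis using out by simp
      next
        case False
        then have "x \<ge> p" using n0 by (simp add: mult_less_0_iff not_less)
        moreover have "real n * (x - p) < real n * \<delta>" using False n1 by linarith
        then have "x - p < \<delta>" using n0 by simp
        ultimately have "\<bar>f x - f p\<bar> \<le> e / 2" using \<delta>(2)[OF x] by simp
        moreover have "?k x \<ge> 0" using nn n0 by simp
        ultimately have "?k x * \<bar>f x - f p\<bar> \<le> ?k x * (e / 2)" by (intro mult_left_mono)
        moreover have "norm (?k x * f x - ?k x * f p) = ?k x * \<bar>f x - f p\<bar>"
            using \<open>?k x \<ge> 0\<close> unfolding right_diff_distrib[symmetric] real_norm_def abs_mult[of "?k x"] by simp
          ultimately show ?thesis by simp
      qed
    qed
    moreover have "integral {0..T} (\<lambda>x. ?k x * (e / 2)) = e / 2"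
      using integral_unique[OF has_integral_mult_left[OF k1, of "e / 2"]] by simp
    ultimately show "norm (integral {0..T} (\<lambda>x. ?k x * f x) - f p) < e" using e by simp
  qed
qed

text \<open>
  The family closed under differentiation consists of the multiples of \<open>D^i \<theta> (c (x -
  s)) - D^i \<theta> (c (x - t))\<close>.
\<close>

lemma iterated_deriv_step_difference:
  fixes \<theta> :: "real \<Rightarrow> real"
  assumes sm: "\<And>n t. ((deriv ^^ n) \<theta>) differentiable (at t)"
  shows "((deriv ^^ m) (\<lambda>x. \<theta> (c * (x - s)) - \<theta> (c * (x - t)))) differentiable (at y)"
proof -
  define F where "F i a = (\<lambda>x. a * ((deriv ^^ i) \<theta> (c * (x - s)) - (deriv ^^ i) \<theta> (c * (x - t))))" for i a
  have D: "(F i a has_real_derivative F (Suc i) (a * c) x) (at x)" for i a x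
  proof -
    have d: "((deriv ^^ i) \<theta> has_real_derivative (deriv ^^ Suc i) \<theta> z) (at z)" for z
      using sm[of i z] by (simp add: DERIV_deriv_iff_real_differentiable)
    have e: "((\<lambda>x. (deriv ^^ i) \<theta> (c * (x - r))) has_real_derivative (deriv ^^ Suc i) \<theta> (c * (x - r)) * c) (at x)" for r
      by (rule DERIV_chain2[OF d]) (auto intro!: derivative_eq_intros)
    have eq: "F (Suc i) (a * c) x = a * ((deriv ^^ Suc i) \<theta> (c * (x - s)) * c - (deriv ^^ Suc i) \<theta> (c * (x - t)) * c)"
      unfolding F_def by (simp only: left_diff_distrib[symmetric]) (simp only: mult_ac)
    show ?thesis unfolding eq unfolding F_def by (rule DERIV_cmult[OF DERIV_diff[OF e[of s] e[of t]]])
  qed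
  have "((deriv ^^ m) (F 0 1)) differentiable (at y)"
  proof (rule smooth_family_iterated_deriv[where D = "{F i a | i a. True}"])
    show "f differentiable (at t)" if f: "f \<in> {F i a | i a. True}" for f t
    proof -
      obtain i a where "f = F i a" using f by auto
      then show ?thesis using D[of i a t] by (auto simp: real_differentiable_def)
    qed
    show "deriv f \<in> {F i a | i a. True}" if f: "f \<in> {F i a | i a. True}" for f
    proof -
      obtain i a where "f = F i a" using f by auto
      then have "deriv f = F (Suc i) (a * c)" using DERIV_imp_deriv[OF D] by (intro ext) simp
      then show ?thesis by blast
    qed
  qed blast
  then show ?thesis by (simp add: F_def)
qed

text \<open>
  The test functions \<open>\<theta> (n (x - s)) - \<theta> (n (x - t))\<close> approximate the
  indicator of \<open>(s, t]\<close>, and their derivatives the difference of the point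
  evaluations at \<open>s\<close> and \<open>t\<close>. The end points of \<open>[0, T]\<close>
  are reached by continuity.
\<close>

lemma has_time_derivative_imp_primitive_on:
  fixes f g :: "real \<Rightarrow> real"
  assumes T: "0 < T" and f: "continuous_on {0..T} f" and g: "g absolutely_integrable_on {0..T}"
    and fg: "has_time_derivative T f g"
  shows "primitive_on T f g"
proof -
  obtain \<theta> :: "real \<Rightarrow> real" where sm: "\<And>n t. ((deriv ^^ n) \<theta>) differentiable (at t)"
    and z: "\<And>x. x \<le> 0 \<Longrightarrow> \<theta> x = 0" and o: "\<And>x. x \<ge> 1 \<Longrightarrow> \<theta> x = 1" and nn: "\<And>x. deriv \<theta> x \<ge> 0"
    using smooth_step_exists by blast
  have d: "(\<theta> has_real_derivative deriv \<theta> x) (at x)" for x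
    using sm[of 0 x] by (simp add: DERIV_deriv_iff_real_differentiable)
  have c: "continuous_on UNIV (deriv \<theta>)"
    using sm[of 1] by (auto simp: continuous_on_eq_continuous_at intro: differentiable_imp_continuous_within)
  have mono: "mono \<theta>"
  proof (rule monoI)
    fix x y :: real assume "x \<le> y"
    then show "\<theta> x \<le> \<theta> y"
      by (rule DERIV_nonneg_imp_nondecreasing) (use d nn in blast)
  qed
  have bnd: "0 \<le> \<theta> x" "\<theta> x \<le> 1" for x
    using monoD[OF mono, of "min x 0" x] monoD[OF mono, of x "max x 1"] z[of "min x 0"] o[of "max x 1"] by auto
  \<comment> \<open>The support of the test function has to stay away from the end points.\<close>
  have interior: "f t - f s = integral {s..t} g" if st: "0 < s" "s < t" "t < T" for s t
  proof -
    define \<phi> where "\<phi> n x = \<theta> (real n * (x - s)) - \<theta> (real n * (x - t))" for n x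
    obtain N where N: "1 / (T - t) < real N" using reals_Archimedean2 by blast
    have d\<phi>: "deriv (\<phi> n) x = real n * deriv \<theta> (real n * (x - s)) - real n * deriv \<theta> (real n * (x - t))" for n x
    proof -
      have "((\<lambda>x. \<theta> (real n * (x - r))) has_real_derivative deriv \<theta> (real n * (x - r)) * real n) (at x)" for r
        by (rule DERIV_chain2[OF d]) (auto intro!: derivative_eq_intros)
      then show ?thesis unfolding \<phi>_def[abs_def]
        by (intro DERIV_imp_deriv) (auto intro!: derivative_eq_intros simp: mult.commute)
    qed
    have test: "time_test_function T (\<phi> n)" if "n \<ge> N" for n
      unfolding time_test_function_def
    proof (intro conjI exI allI impI)
      have n: "1 / (T - t) < real n" using N that by linarith
      then have n0: "real n > 0" using st by (meson diff_gt_0_iff_gt divide_pos_pos less_trans zero_less_one)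
      show "((deriv ^^ m) (\<phi> n)) differentiable (at y)" for m y
        unfolding \<phi>_def[abs_def] by (rule iterated_deriv_step_difference[OF sm])
      show "0 < s" by (fact st)
      show "t + 1 / real n < T" using n n0 st by (simp add: field_simps)
      fix x assume x: "\<phi> n x \<noteq> 0"
      show "s \<le> x"
      proof (rule ccontr)
        assume "\<not> s \<le> x"
        then have "real n * (x - s) \<le> 0" "real n * (x - t) \<le> 0" using st by (auto simp: mult_le_0_iff)
        then show False using x z by (simp add: \<phi>_def)
      qed
      show "x \<le> t + 1 / real n"
      proof (rule ccontr)
        assume "\<not> x \<le> t + 1 / real n"
        then have "real n * (1 / real n) \<le> real n * (x - t)" by (intro mult_left_mono) auto
        then have 1: "1 \<le> real n * (x - t)" using n0 by simp
        moreover have "real n * (x - t) \<le> real n * (x - s)" using st by (intro mult_left_mono) auto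
        ultimately show False using x o by (simp add: \<phi>_def)
      qed
    qed
    have \<phi>c: "continuous_on S (\<phi> n)" for n S
    proof -
      have "continuous_on UNIV \<theta>" by (rule DERIV_continuous_on[OF d])
      then have "continuous_on S (\<lambda>x. \<theta> (real n * (x - r)))" for r
        by (rule continuous_on_compose2) (auto intro!: continuous_intros)
      then show ?thesis unfolding \<phi>_def[abs_def] by (intro continuous_on_diff)
    qed
    have lim1: "(\<lambda>n. integral {0..T} (\<lambda>x. \<phi> n x * g x)) \<longlonglongrightarrow> integral {0..T} (\<lambda>x. indicator {s<..t} x * g x)"
    proof (rule dominated_convergence[where h = "\<lambda>x. \<bar>g x\<bar>"])
      show "(\<lambda>x. \<phi> n x * g x) integrable_on {0..T}" for n
        using absolutely_integrable_continuous_mult_real[OF \<phi>c g] by (simp add: absolutely_integrable_on_def)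
      show "(\<lambda>x. \<bar>g x\<bar>) integrable_on {0..T}" using g by (simp add: absolutely_integrable_on_def)
      have "\<bar>\<phi> n x\<bar> \<le> 1" for n x
        using bnd[of "real n * (x - s)"] bnd[of "real n * (x - t)"] by (simp add: \<phi>_def)
      then show "norm (\<phi> n x * g x) \<le> \<bar>g x\<bar>" for n x
        by (simp add: abs_mult mult_left_le_one_le)
      show "(\<lambda>n. \<phi> n x * g x) \<longlonglongrightarrow> indicator {s<..t} x * g x" for x
      proof -
        have lim: "(\<lambda>n. \<theta> (real n * (x - r))) \<longlonglongrightarrow> (if x \<le> r then 0 else 1)" for r
        proof (cases "x \<le> r")
          case True
          then have "\<theta> (real n * (x - r)) = 0" for n by (intro z) (simp add: mult_le_0_iff)
          then show ?thesis using True by simp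
        next
          case False
          obtain M where M: "1 / (x - r) < real M" using reals_Archimedean2 by blast
          have "\<theta> (real n * (x - r)) = 1" if "n \<ge> M" for n
          proof (rule o)
            have "1 / (x - r) \<le> real n" using M that by linarith
            then show "1 \<le> real n * (x - r)" using False by (simp add: field_simps)
          qed
          then have "eventually (\<lambda>n. \<theta> (real n * (x - r)) = 1) sequentially"
            by (auto simp: eventually_sequentially)
          then show ?thesis using False by (simp add: tendsto_eventually)
        qed
        have "(\<lambda>n. \<phi> n x) \<longlonglongrightarrow> (if x \<le> s then 0 else 1) - (if x \<le> t then 0 else 1)"
          unfolding \<phi>_def by (intro tendsto_diff lim)
        moreover have "(if x \<le> s then 0 else 1) - (if x \<le> t then 0 else 1) = (indicator {s<..t} x :: real)"
          using st by (auto simp: indicator_def)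
        ultimately show ?thesis by (metis tendsto_mult_right)
      qed
    qed
    also have "integral {0..T} (\<lambda>x. indicator {s<..t} x * g x) = integral {s..t} g"
    proof -
      have "integral {0..T} (\<lambda>x. indicator {s<..t} x * g x) = integral {0..T} (\<lambda>x. if x \<in> {s..t} then g x else 0)"
        by (rule integral_spike[of "{s}"]) (auto simp: indicator_def)
      also have "\<dots> = integral ({s..t} \<inter> {0..T}) g" by (rule integral_restrict_Int)
      also have "{s..t} \<inter> {0..T} = {s..t}" using st by auto
      finally show ?thesis .
    qed
    finally have lim1: "(\<lambda>n. integral {0..T} (\<lambda>x. \<phi> n x * g x)) \<longlonglongrightarrow> integral {s..t} g" .
    have ci: "(\<lambda>x. real n * deriv \<theta> (real n * (x - r)) * f x) integrable_on {0..T}" for n r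
      by (intro integrable_continuous_real continuous_intros f continuous_on_compose2[OF c]) auto
    have "integral {0..T} (\<lambda>x. \<phi> n x * g x) =
        integral {0..T} (\<lambda>x. real n * deriv \<theta> (real n * (x - t)) * f x) -
        integral {0..T} (\<lambda>x. real n * deriv \<theta> (real n * (x - s)) * f x)" if n: "n \<ge> N" for n
    proof -
      obtain J where J: "((\<lambda>x. \<phi> n x *\<^sub>R g x) has_integral J) {0..T}"
        "((\<lambda>x. deriv (\<phi> n) x *\<^sub>R f x) has_integral - J) {0..T}"
        using fg test[OF n] unfolding has_time_derivative_def by blast
      have "- J = integral {0..T} (\<lambda>x. real n * deriv \<theta> (real n * (x - s)) * f x - real n * deriv \<theta> (real n * (x - t)) * f x)"
        using J(2) by (simp add: d\<phi> left_diff_distrib integral_unique)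
      also have "\<dots> = integral {0..T} (\<lambda>x. real n * deriv \<theta> (real n * (x - s)) * f x) -
          integral {0..T} (\<lambda>x. real n * deriv \<theta> (real n * (x - t)) * f x)"
        by (rule integral_diff[OF ci ci])
      finally show ?thesis using J(1) by (simp add: integral_unique)
    qed
    then have "eventually (\<lambda>n. integral {0..T} (\<lambda>x. \<phi> n x * g x) =
        integral {0..T} (\<lambda>x. real n * deriv \<theta> (real n * (x - t)) * f x) -
        integral {0..T} (\<lambda>x. real n * deriv \<theta> (real n * (x - s)) * f x)) sequentially"
      unfolding eventually_sequentially by blast
    moreover have "(\<lambda>n. integral {0..T} (\<lambda>x. real n * deriv \<theta> (real n * (x - t)) * f x) -
        integral {0..T} (\<lambda>x. real n * deriv \<theta> (real n * (x - s)) * f x)) \<longlonglongrightarrow> f t - f s"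
      using st by (intro tendsto_diff step_kernel_tendsto[OF f _ _ d c z o nn]) auto
    ultimately have "(\<lambda>n. integral {0..T} (\<lambda>x. \<phi> n x * g x)) \<longlonglongrightarrow> f t - f s"
      by (simp add: filterlim_cong)
    then show ?thesis using lim1 LIMSEQ_unique by blast
  qed
  have gi: "g integrable_on {a..b}" if "0 \<le> a" "b \<le> T" for a b using time_subinterval_integrable[OF g that] by simp
  have comb: "integral {0..b} g = integral {0..a} g + integral {a..b} g" if "0 \<le> a" "a \<le> b" "b \<le> T" for a b
    using that by (intro Henstock_Kurzweil_Integration.integral_combine[symmetric] gi) auto
  \<comment> \<open>The discrepancy is constant inside and continuous up to the end points.\<close>
  define k where "k t = f t - integral {0..t} g" for t
  have kc: "continuous_on {0..T} k"
    unfolding k_def by (intro continuous_intros f indefinite_integral_continuous_1 gi) auto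
  have "k t = k (T / 2)" if "t \<in> {0<..<T}" for t
  proof (cases "t = T / 2")
    case False
    then show ?thesis
      using interior[of t "T / 2"] interior[of "T / 2" t] comb[of t "T / 2"] comb[of "T / 2" t] that T
      by (cases "t < T / 2") (auto simp: k_def)
  next
    case True
    then show ?thesis by (simp only:)
  qed
  note inner = this
  have cl: "closure {0<..<T} = {0..T}" using T by simp
  have k: "k t = k (T / 2)" if t: "t \<in> {0..T}" for t
    by (rule continuous_constant_on_closure[of "{0<..<T}" k "k (T / 2)" t, unfolded cl, OF kc inner t])
  show ?thesis unfolding primitive_on_def
  proof (intro conjI allI impI g)
    fix s t :: real assume st: "0 \<le> s" "s \<le> t" "t \<le> T"
    then show "f t - f s = integral {s..t} g"
      using k[of s] k[of t] comb[OF st] by (simp add: k_def)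
  qed
qed

lemma Lp_time_norm_integrable:
  assumes f: "Lp_time p T f" and p: "p \<ge> 1"
  shows "(\<lambda>t. norm (f t)) absolutely_integrable_on {0..T}"
proof -
  have i: "integrable (lebesgue_on {0<..<T}) (\<lambda>t. norm (f t) powr p)" using f by (simp add: Lp_time_def)
  then have [measurable]: "(\<lambda>t. norm (f t) powr p) \<in> borel_measurable (lebesgue_on {0<..<T})" by auto
  have "(\<lambda>t. (norm (f t) powr p) powr (1 / p)) \<in> borel_measurable (lebesgue_on {0<..<T})" by measurable
  then have [measurable]: "(\<lambda>t. norm (f t)) \<in> borel_measurable (lebesgue_on {0<..<T})" using p by (simp add: powr_powr)
  have "integrable (lebesgue_on {0<..<T}) (\<lambda>t. 1 + norm (f t) powr p)"
  proof (intro Bochner_Integration.integrable_add i)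
    show "integrable (lebesgue_on {0<..<T}) (\<lambda>t. 1 :: real)"
      unfolding integrable_time_iff by (intro absolutely_integrable_continuous_real continuous_intros)
  qed
  then have "integrable (lebesgue_on {0<..<T}) (\<lambda>t. norm (f t))"
  proof (rule Bochner_Integration.integrable_bound)
    have "a \<le> 1 + a powr p" if "a \<ge> 0" for a :: real
    proof (cases "a \<le> 1")
      case True then show ?thesis by (simp add: add_increasing2)
    next
      case False
      then have "a powr 1 \<le> a powr p" using p by (intro powr_mono) auto
      then show ?thesis using False by simp
    qed
    then have "norm (f t) \<le> norm (1 + norm (f t) powr p)" for t
      by (metis abs_ge_self norm_ge_zero order_trans real_norm_def)
    then show "AE t in lebesgue_on {0<..<T}. norm (norm (f t)) \<le> norm (1 + norm (f t) powr p)" by simp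
  qed measurable
  then show ?thesis by (simp add: integrable_time_iff)
qed

lemma Lp_time_norm_square_integrable:
  assumes f: "Lp_time 2 T f"
  shows "(\<lambda>t. (norm (f t))\<^sup>2) absolutely_integrable_on {0..T}"
proof -
  have "norm (f t) powr 2 = (norm (f t))\<^sup>2" for t by (cases "norm (f t) = 0") (auto simp: powr_numeral)
  then show ?thesis using f by (simp add: Lp_time_def integrable_time_iff)
qed

text \<open>
  Only the limit of the compositions with simple functions is known to be measurable; it agrees
  with the composition almost everywhere.
\<close>

lemma strongly_measurable_compose_integrable:
  fixes T :: real and l :: "'a::real_normed_vector \<Rightarrow> real"
  assumes f: "strongly_measurable (lebesgue_on {0<..<T}) f"
    and l: "continuous_on UNIV l"
    and w: "AE t in lebesgue_on {0<..<T}. \<bar>l (f t)\<bar> \<le> w t" "w absolutely_integrable_on {0..T}"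
  shows "(\<lambda>t. l (f t)) absolutely_integrable_on {0..T}"
proof -
  obtain s where s: "\<And>n. simple_function (lebesgue_on {0<..<T}) (s n)"
    "AE x in lebesgue_on {0<..<T}. (\<lambda>n. s n x) \<longlonglongrightarrow> f x"
    using f unfolding strongly_measurable_def by blast
  have [measurable]: "(\<lambda>x. l (s n x)) \<in> borel_measurable (lebesgue_on {0<..<T})" for n
    using simple_function_compose1[OF s(1), of l] by (intro borel_measurable_simple_function)
  define g where "g x = lim (\<lambda>n. l (s n x))" for x
  have gm [measurable]: "g \<in> borel_measurable (lebesgue_on {0<..<T})"
    unfolding g_def by (rule borel_measurable_lim_metric) measurable
  have gl: "AE x in lebesgue_on {0<..<T}. g x = l (f x)"
    using s(2)
  proof eventually_elim
    case (elim x)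
    then have "(\<lambda>n. l (s n x)) \<longlonglongrightarrow> l (f x)"
      by (rule continuous_on_tendsto_compose[OF l]) auto
    then show ?case unfolding g_def by (rule limI)
  qed
  have "integrable (lebesgue_on {0<..<T}) w" unfolding integrable_time_iff by (rule w(2))
  then have "integrable (lebesgue_on {0<..<T}) g"
  proof (rule Bochner_Integration.integrable_bound[OF _ gm])
    show "AE x in lebesgue_on {0<..<T}. norm (g x) \<le> norm (w x)"
      using gl w(1) by eventually_elim simp
  qed
  then have g: "g absolutely_integrable_on {0..T}" by (simp add: integrable_time_iff)
  obtain N where N: "negligible N" "\<And>r. r \<in> {0..T} - N \<Longrightarrow> g r = l (f r)"
    using gl unfolding AE_time_iff by blast
  show ?thesis by (rule absolutely_integrable_spike[OF g N(1)]) (simp add: N(2))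
qed

lemma strongly_measurable_functional_integrable:
  fixes T :: real and l :: "'a::real_normed_vector \<Rightarrow> real"
  assumes f: "strongly_measurable (lebesgue_on {0<..<T}) f" "(\<lambda>t. norm (f t)) absolutely_integrable_on {0..T}"
    and l: "bounded_linear l"
  shows "(\<lambda>t. l (f t)) absolutely_integrable_on {0..T}"
proof -
  obtain K where K: "\<And>x. norm (l x) \<le> norm x * K" using bounded_linear.bounded[OF l] by blast
  show ?thesis
  proof (rule strongly_measurable_compose_integrable[OF f(1)])
    show "continuous_on UNIV l" by (rule linear_continuous_on[OF l])
    show "AE t in lebesgue_on {0<..<T}. \<bar>l (f t)\<bar> \<le> K * norm (f t)" using K by (simp add: mult.commute)
    show "(\<lambda>t. K * norm (f t)) absolutely_integrable_on {0..T}" by (intro set_integrable_mult_right f(2))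
  qed
qed

lemma has_time_derivative_functional:
  assumes "has_time_derivative T f g" "bounded_linear l"
  shows "has_time_derivative T (\<lambda>t. l (f t)) (\<lambda>t. l (g t))"
  unfolding has_time_derivative_def
proof (intro allI impI)
  interpret l: bounded_linear l by fact
  fix \<phi> assume "time_test_function T \<phi>"
  then obtain J where J: "((\<lambda>t. \<phi> t *\<^sub>R g t) has_integral J) {0..T}" "((\<lambda>t. deriv \<phi> t *\<^sub>R f t) has_integral - J) {0..T}"
    using assms(1) unfolding has_time_derivative_def by blast
  show "\<exists>J. ((\<lambda>t. \<phi> t *\<^sub>R l (g t)) has_integral J) {0..T} \<and> ((\<lambda>t. deriv \<phi> t *\<^sub>R l (f t)) has_integral - J) {0..T}"
    using has_integral_linear[OF J(1) assms(2)] has_integral_linear[OF J(2) assms(2)]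
    by (intro exI[of _ "l J"]) (simp add: o_def l.scaleR l.neg)
qed

text \<open>
  The simple functions sample \<open>f\<close> at the grid point \<open>floor ((n + 1) t) / (n +
  1)\<close> to the left of \<open>t\<close>.
\<close>

lemma continuous_strongly_measurable:
  fixes f :: "real \<Rightarrow> 'a::real_normed_vector"
  assumes f: "continuous_on {0..T} f"
  shows "strongly_measurable (lebesgue_on {0<..<T}) f"
proof -
  define k where "k n t = real_of_int \<lfloor>real (Suc n) * t\<rfloor> / real (Suc n)" for n t
  have "simple_function (lebesgue_on {0<..<T}) (\<lambda>t. f (k n t))" for n
  proof (rule simple_function_compose1[where f = "k n" and g = f], rule simple_function_borel_measurable)
    show "k n \<in> borel_measurable (lebesgue_on {0<..<T})"
      unfolding k_def by (intro measurable_restrict_space1 measurable_completion) measurable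
    have "k n t \<in> (\<lambda>i. real_of_int i / real (Suc n)) ` {0..\<lfloor>real (Suc n) * T\<rfloor>}" if "t \<in> {0<..<T}" for t
      unfolding k_def using that by (intro imageI) (auto intro!: floor_mono mult_left_mono)
    then have "k n ` space (lebesgue_on {0<..<T}) \<subseteq> (\<lambda>i. real_of_int i / real (Suc n)) ` {0..\<lfloor>real (Suc n) * T\<rfloor>}"
      by (simp add: image_subset_iff del: of_nat_Suc)
    then show "finite (k n ` space (lebesgue_on {0<..<T}))" by (rule finite_subset) simp
  qed
  moreover have "(\<lambda>n. f (k n t)) \<longlonglongrightarrow> f t" if t: "t \<in> {0<..<T}" for t
  proof (rule continuous_on_tendsto_compose[OF f])
    have k: "k n t \<le> t" "t - inverse (real (Suc n)) \<le> k n t" for n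
    proof -
      define c where "c = real (Suc n)"
      have c: "c > 0" by (simp add: c_def)
      have "c * t - 1 \<le> real_of_int \<lfloor>c * t\<rfloor>" "real_of_int \<lfloor>c * t\<rfloor> \<le> c * t" by linarith+
      from this[THEN divide_right_mono, of c] show "k n t \<le> t" "t - inverse (real (Suc n)) \<le> k n t"
        unfolding k_def c_def[symmetric] using c by (simp_all add: diff_divide_distrib inverse_eq_divide)
    qed
    have "(\<lambda>n. t - inverse (real (Suc n))) \<longlonglongrightarrow> t - 0" by (intro tendsto_intros LIMSEQ_inverse_real_of_nat)
    then have "(\<lambda>n. t - inverse (real (Suc n))) \<longlonglongrightarrow> t" by simp
    then show "(\<lambda>n. k n t) \<longlonglongrightarrow> t" by (rule tendsto_sandwich[OF _ _ _ tendsto_const, rotated 2]) (intro always_eventually allI k)+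
    have "k n t \<in> {0..T}" for n using t k(1)[of n] by (simp add: k_def)
    then show "\<forall>\<^sub>F n in sequentially. k n t \<in> {0..T}" by (intro always_eventually allI)
  qed (use t in auto)
  moreover from this have "AE t in lebesgue_on {0<..<T}. (\<lambda>n. f (k n t)) \<longlonglongrightarrow> f t" by (intro AE_I2) simp
  ultimately show ?thesis unfolding strongly_measurable_def by (intro exI[of _ "\<lambda>n t. f (k n t)"]) blast
qed

lemma continuous_Lp_time_1:
  assumes f: "continuous_on {0..T} f" shows "Lp_time 1 T f"
  unfolding Lp_time_def
  using continuous_strongly_measurable[OF f]
  by (simp add: integrable_time_iff absolutely_integrable_continuous_real[OF continuous_on_norm[OF f]])

lemma Linf_time_Lp_time_1:
  assumes "Linf_time T f" shows "Lp_time 1 T f"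
proof -
  have sm: "strongly_measurable (lebesgue_on {0<..<T}) f" using assms by (simp add: Linf_time_def)
  obtain c where c: "AE t in lebesgue_on {0<..<T}. norm (f t) \<le> c" using assms unfolding Linf_time_def by blast
  have "(\<lambda>t. norm (f t)) absolutely_integrable_on {0..T}"
  proof (rule strongly_measurable_compose_integrable[OF sm])
    show "AE t in lebesgue_on {0<..<T}. \<bar>norm (f t)\<bar> \<le> c" using c by simp
    show "(\<lambda>t. c) absolutely_integrable_on {0..T}" by (intro absolutely_integrable_continuous_real continuous_intros)
  qed (intro continuous_intros)
  then show ?thesis using sm by (simp add: Lp_time_def integrable_time_iff)
qed

section \<open>Completeness of the space of square-integrable fields and the Leray projection\<close>

lemma norm_L2_power2: "(norm f)\<^sup>2 = (\<integral>x. (norm (rep_L2 f x))\<^sup>2 \<partial>torus)"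
  by (simp add: power2_norm_eq_inner inner_L2_rep)

lemma L2_integral_norm_le: "(\<integral>x. norm (rep_L2 f x) \<partial>torus) \<le> norm f"
proof -
  interpret finite_measure torus by (rule finite_measure_torus)
  have m: "measure torus (space torus) = 1"
    by (simp add: torus_def measure_restrict_space space_restrict_space content_cbox_cart interval_ne_empty_cart)
  define a where "a = (\<integral>x. norm (rep_L2 f x) \<partial>torus)"
  have i: "integrable torus (\<lambda>x. norm (rep_L2 f x))" "integrable torus (\<lambda>x. (norm (rep_L2 f x))\<^sup>2)"
    using square_integrable_integrable[OF square_integrable_rep_L2[of f]] square_integrable_rep_L2[of f]
    by (auto simp: square_integrable_def)
  have "0 \<le> (\<integral>x. (norm (rep_L2 f x) - a)\<^sup>2 \<partial>torus)" by (rule integral_nonneg_AE) simp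
  also have "\<dots> = (\<integral>x. (norm (rep_L2 f x))\<^sup>2 - (2 * a) * norm (rep_L2 f x) + a\<^sup>2 \<partial>torus)"
    by (intro Bochner_Integration.integral_cong) (auto simp: power2_eq_square algebra_simps)
  also have "\<dots> = (norm f)\<^sup>2 - (2 * a) * a + a\<^sup>2"
    using i m by (simp add: norm_L2_power2 a_def)
  finally have "a\<^sup>2 \<le> (norm f)\<^sup>2" by (simp add: power2_eq_square)
  then show ?thesis unfolding a_def by (rule power2_le_imp_le) simp
qed

lemma rep_L2_diff: "AE x in torus. rep_L2 (f - g) x = rep_L2 f x - rep_L2 g x"
  using rep_L2_add[of f "(-1) *\<^sub>R g"] rep_L2_scaleR[of "-1" g]
  by eventually_elim simp

text \<open>
  Riesz-Fischer: a subsequence converges almost everywhere, and Fatou's lemma turns the Cauchy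
  property into convergence in norm to that pointwise limit.
\<close>

lemma L2_complete:
  fixes X :: "nat \<Rightarrow> L2"
  assumes X: "Cauchy X"
  shows "convergent X"
proof -
  have [measurable]: "rep_L2 f \<in> borel_measurable torus" for f
    using square_integrable_rep_L2[of f] by (simp add: square_integrable_def)
  have L1: "\<exists>N. \<forall>i\<ge>N. \<forall>j\<ge>N. (LINT x|torus. norm (rep_L2 (X i) x - rep_L2 (X j) x)) < e" if e: "e > 0" for e
  proof -
    obtain N where N: "\<And>i j. i \<ge> N \<Longrightarrow> j \<ge> N \<Longrightarrow> norm (X i - X j) < e"
      using X e unfolding Cauchy_iff by blast
    have "(LINT x|torus. norm (rep_L2 (X i) x - rep_L2 (X j) x)) < e" if "i \<ge> N" "j \<ge> N" for i j
    proof -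
      have "(LINT x|torus. norm (rep_L2 (X i) x - rep_L2 (X j) x)) = (LINT x|torus. norm (rep_L2 (X i - X j) x))"
      proof (rule integral_cong_AE)
        show "AE x in torus. norm (rep_L2 (X i) x - rep_L2 (X j) x) = norm (rep_L2 (X i - X j) x)"
          using rep_L2_diff[of "X i" "X j"] by eventually_elim simp
      qed measurable
      also have "\<dots> \<le> norm (X i - X j)" by (rule L2_integral_norm_le)
      finally show ?thesis using N[OF that] by linarith
    qed
    then show ?thesis by blast
  qed
  obtain r where r: "strict_mono r" "AE x in torus. Cauchy (\<lambda>i. rep_L2 (X (r i)) x)"
    by (rule cauchy_L1_AE_cauchy_subseq[of torus "\<lambda>i. rep_L2 (X i)",
          OF square_integrable_integrable[OF square_integrable_rep_L2] L1])
  define h where "h x = lim (\<lambda>i. rep_L2 (X (r i)) x)" for x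
  have h: "AE x in torus. (\<lambda>i. rep_L2 (X (r i)) x) \<longlonglongrightarrow> h x"
    using r(2)
  proof eventually_elim
    case (elim x)
    then have "convergent (\<lambda>i. rep_L2 (X (r i)) x)" by (rule Cauchy_convergent)
    then show ?case unfolding h_def convergent_LIMSEQ_iff .
  qed
  have hm [measurable]: "h \<in> borel_measurable torus"
    unfolding h_def by (rule borel_measurable_lim_metric) measurable
  have tail: "\<exists>N. \<forall>i\<ge>N. (\<integral>\<^sup>+x. ennreal ((norm (h x - rep_L2 (X i) x))\<^sup>2) \<partial>torus) \<le> ennreal (e\<^sup>2)" if e: "e > 0" for e
  proof -
    obtain N where N: "\<And>i j. i \<ge> N \<Longrightarrow> j \<ge> N \<Longrightarrow> norm (X i - X j) < e"
      using X e unfolding Cauchy_iff by blast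
    have "(\<integral>\<^sup>+x. ennreal ((norm (h x - rep_L2 (X i) x))\<^sup>2) \<partial>torus) \<le> ennreal (e\<^sup>2)" if i: "i \<ge> N" for i
    proof -
      have "(\<integral>\<^sup>+x. ennreal ((norm (h x - rep_L2 (X i) x))\<^sup>2) \<partial>torus)
          = (\<integral>\<^sup>+x. liminf (\<lambda>j. ennreal ((norm (rep_L2 (X (r j)) x - rep_L2 (X i) x))\<^sup>2)) \<partial>torus)"
      proof (rule nn_integral_cong_AE)
        show "AE x in torus. ennreal ((norm (h x - rep_L2 (X i) x))\<^sup>2)
          = liminf (\<lambda>j. ennreal ((norm (rep_L2 (X (r j)) x - rep_L2 (X i) x))\<^sup>2))"
          using h
        proof eventually_elim
          case (elim x)
          then have "(\<lambda>j. ennreal ((norm (rep_L2 (X (r j)) x - rep_L2 (X i) x))\<^sup>2))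
              \<longlonglongrightarrow> ennreal ((norm (h x - rep_L2 (X i) x))\<^sup>2)"
            by (intro tendsto_intros tendsto_ennrealI)
          then show ?case by (rule lim_imp_Liminf[OF sequentially_bot, symmetric])
        qed
      qed
      also have "\<dots> \<le> liminf (\<lambda>j. \<integral>\<^sup>+x. ennreal ((norm (rep_L2 (X (r j)) x - rep_L2 (X i) x))\<^sup>2) \<partial>torus)"
        by (rule nn_integral_liminf) measurable
      also have "\<dots> \<le> liminf (\<lambda>j. ennreal (e\<^sup>2))"
      proof (rule Liminf_mono)
        show "\<forall>\<^sub>F j in sequentially. (\<integral>\<^sup>+x. ennreal ((norm (rep_L2 (X (r j)) x - rep_L2 (X i) x))\<^sup>2) \<partial>torus) \<le> ennreal (e\<^sup>2)"
          using eventually_ge_at_top[of N]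
        proof eventually_elim
          case (elim j)
          then have "r j \<ge> N" using seq_suble[OF r(1), of j] by linarith
          then have n: "norm (X (r j) - X i) \<le> e" using N[OF \<open>r j \<ge> N\<close> i] by simp
          have "(\<integral>\<^sup>+x. ennreal ((norm (rep_L2 (X (r j)) x - rep_L2 (X i) x))\<^sup>2) \<partial>torus)
              = (\<integral>\<^sup>+x. ennreal ((norm (rep_L2 (X (r j) - X i) x))\<^sup>2) \<partial>torus)"
          proof (rule nn_integral_cong_AE)
            show "AE x in torus. ennreal ((norm (rep_L2 (X (r j)) x - rep_L2 (X i) x))\<^sup>2)
                = ennreal ((norm (rep_L2 (X (r j) - X i) x))\<^sup>2)"
              using rep_L2_diff[of "X (r j)" "X i"] by eventually_elim simp
          qed
          also have "\<dots> = ennreal ((norm (X (r j) - X i))\<^sup>2)"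
            unfolding norm_L2_power2 using square_integrable_rep_L2[of "X (r j) - X i"]
            by (intro nn_integral_eq_integral) (auto simp: square_integrable_def)
          also have "\<dots> \<le> ennreal (e\<^sup>2)" using n by (intro ennreal_leI power_mono) auto
          finally show ?case .
        qed
      qed
      also have "\<dots> = ennreal (e\<^sup>2)" by (simp add: Liminf_const)
      finally show ?thesis .
    qed
    then show ?thesis by blast
  qed
  have sq: "square_integrable h"
  proof -
    obtain N where N: "(\<integral>\<^sup>+x. ennreal ((norm (h x - rep_L2 (X N) x))\<^sup>2) \<partial>torus) \<le> ennreal (1\<^sup>2)"
      using tail[of 1] by auto
    have "square_integrable (\<lambda>x. h x - rep_L2 (X N) x)"
      unfolding square_integrable_def integrable_iff_bounded
      using le_less_trans[OF N] by (auto simp: less_top)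
    from square_integrable_add[OF this square_integrable_rep_L2[of "X N"]] show ?thesis by simp
  qed
  have "X \<longlonglongrightarrow> to_L2 h"
  proof (rule LIMSEQ_I)
    fix e :: real assume e: "e > 0"
    then obtain N where N: "\<And>i. i \<ge> N \<Longrightarrow> (\<integral>\<^sup>+x. ennreal ((norm (h x - rep_L2 (X i) x))\<^sup>2) \<partial>torus) \<le> ennreal ((e/2)\<^sup>2)"
      using tail[of "e/2"] by auto
    have "norm (X i - to_L2 h) < e" if "i \<ge> N" for i
    proof -
      have ae: "AE x in torus. rep_L2 (to_L2 h - X i) x = h x - rep_L2 (X i) x"
        using rep_L2_diff[of "to_L2 h" "X i"] rep_to_L2[OF sq] by eventually_elim simp
      have "ennreal ((norm (to_L2 h - X i))\<^sup>2) = (\<integral>\<^sup>+x. ennreal ((norm (rep_L2 (to_L2 h - X i) x))\<^sup>2) \<partial>torus)"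
        unfolding norm_L2_power2 using square_integrable_rep_L2[of "to_L2 h - X i"]
        by (intro nn_integral_eq_integral[symmetric]) (auto simp: square_integrable_def)
      also have "\<dots> = (\<integral>\<^sup>+x. ennreal ((norm (h x - rep_L2 (X i) x))\<^sup>2) \<partial>torus)"
      proof (rule nn_integral_cong_AE)
        show "AE x in torus. ennreal ((norm (rep_L2 (to_L2 h - X i) x))\<^sup>2) = ennreal ((norm (h x - rep_L2 (X i) x))\<^sup>2)"
          using ae by eventually_elim simp
      qed
      also have "\<dots> \<le> ennreal ((e/2)\<^sup>2)" by (rule N[OF that])
      finally have "(norm (to_L2 h - X i))\<^sup>2 \<le> (e/2)\<^sup>2" by (simp add: ennreal_le_iff)
      then have "norm (to_L2 h - X i) \<le> e/2" by (rule power2_le_imp_le) (use e in simp)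
      then show ?thesis using e by (simp add: norm_minus_commute)
    qed
    then show "\<exists>N. \<forall>i\<ge>N. norm (X i - to_L2 h) < e" by blast
  qed
  then show ?thesis by (auto simp: convergent_def)
qed

lemma parallelogram_law:
  fixes a b :: "'a::real_inner"
  shows "(norm (a + b))\<^sup>2 + (norm (a - b))\<^sup>2 = 2 * (norm a)\<^sup>2 + 2 * (norm b)\<^sup>2"
  by (simp add: power2_norm_eq_inner inner_add_left inner_add_right inner_diff_left inner_diff_right inner_commute)

lemma closure_subspace:
  fixes S :: "'a::real_normed_vector set"
  assumes "subspace S" shows "subspace (closure S)"
  unfolding subspace_def
proof (intro conjI ballI allI)
  show "0 \<in> closure S" using subspace_0[OF assms] closure_subset by blast
  fix x y assume "x \<in> closure S" "y \<in> closure S"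
  then obtain X Y where "\<And>n. X n \<in> S" "X \<longlonglongrightarrow> x" "\<And>n. Y n \<in> S" "Y \<longlonglongrightarrow> y"
    unfolding closure_sequential by blast
  then show "x + y \<in> closure S"
    unfolding closure_sequential
    by (intro exI[of _ "\<lambda>n. X n + Y n"] conjI allI subspace_add[OF assms] tendsto_add)
next
  fix c :: real and x assume "x \<in> closure S"
  then obtain X where "\<And>n. X n \<in> S" "X \<longlonglongrightarrow> x" unfolding closure_sequential by blast
  then show "c *\<^sub>R x \<in> closure S"
    unfolding closure_sequential
    by (intro exI[of _ "\<lambda>n. c *\<^sub>R X n"] conjI allI subspace_scale[OF assms] tendsto_scaleR tendsto_const)
qed

lemma subspace_H_set: "subspace H_set"
proof -
  have "subspace (to_L2 ` \<V>)"
    unfolding subspace_def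
  proof (intro conjI ballI allI)
    show "0 \<in> to_L2 ` \<V>" using \<V>_zero by (auto simp: zero_L2.abs_eq)
    fix f g assume "f \<in> to_L2 ` \<V>" "g \<in> to_L2 ` \<V>"
    then show "f + g \<in> to_L2 ` \<V>"
      by (auto simp: to_L2_add[symmetric] \<V>_square_integrable intro!: imageI \<V>_add)
  next
    fix c :: real and f assume "f \<in> to_L2 ` \<V>"
    then show "c *\<^sub>R f \<in> to_L2 ` \<V>"
      by (auto simp: to_L2_scaleR[symmetric] \<V>_square_integrable intro!: imageI \<V>_scaleR)
  qed
  then show ?thesis unfolding H_set_def by (rule closure_subspace)
qed

lemma closed_H_set: "closed H_set"
  by (simp add: H_set_def)

text \<open>
  The classical minimising sequence for the distance from \<open>f\<close>, which is a Cauchy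
  sequence by the parallelogram law.
\<close>

lemma H_set_projection_exists:
  "\<exists>h\<in>H_set. \<forall>k\<in>H_set. (f - h) \<bullet> k = 0"
proof -
  note [simp] = subspace_0[OF subspace_H_set]
  define d where "d = Inf ((\<lambda>h. norm (f - h)) ` H_set)"
  have ne: "(\<lambda>h. norm (f - h)) ` H_set \<noteq> {}" using subspace_0[OF subspace_H_set] by blast
  have bdd: "bdd_below ((\<lambda>h. norm (f - h)) ` H_set)" by (intro bdd_belowI[of _ 0]) auto
  have d: "d \<le> norm (f - h)" if "h \<in> H_set" for h
    unfolding d_def using that bdd by (intro cInf_lower) auto
  have d0: "0 \<le> d" unfolding d_def using ne by (intro cInf_greatest) auto
  have "\<exists>h\<in>H_set. norm (f - h) < d + inverse (real (Suc n))" for n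
  proof -
    have "d < d + inverse (real (Suc n))" by simp
    then show ?thesis using cInf_lessD[OF ne, of "d + inverse (real (Suc n))"] unfolding d_def by auto
  qed
  then obtain X where X: "\<And>n. X n \<in> H_set" "\<And>n. norm (f - X n) < d + inverse (real (Suc n))" by metis
  have est: "(norm (X n - X m))\<^sup>2 \<le> 4 * (2 * d + 1) * inverse (real (Suc N))" if "n \<ge> N" "m \<ge> N" for n m N
  proof -
    let ?e = "inverse (real (Suc N))"
    have e: "0 < ?e" "?e \<le> 1" by (auto simp: field_simps)
    have le: "norm (f - X k) \<le> d + ?e" if "k \<ge> N" for k
    proof -
      have "inverse (real (Suc k)) \<le> ?e" using that by (simp add: field_simps)
      then show ?thesis using X(2)[of k] by linarith
    qed
    have sq: "(norm (f - X k))\<^sup>2 \<le> d\<^sup>2 + (2 * d + 1) * ?e" if "k \<ge> N" for k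
    proof -
      have "(norm (f - X k))\<^sup>2 \<le> (d + ?e)\<^sup>2" using le[OF that] by (intro power_mono) auto
      also have "\<dots> = d\<^sup>2 + (2 * d + ?e) * ?e" by (simp add: power2_eq_square algebra_simps)
      also have "\<dots> \<le> d\<^sup>2 + (2 * d + 1) * ?e" using e by (intro add_left_mono mult_right_mono) auto
      finally show ?thesis .
    qed
    have mid: "(1/2) *\<^sub>R (X n + X m) \<in> H_set"
      using X(1) subspace_H_set by (intro subspace_scale subspace_add)
    have "(f - X n) + (f - X m) = 2 *\<^sub>R (f - (1/2) *\<^sub>R (X n + X m))"
      by (simp add: algebra_simps scaleR_2)
    then have "norm ((f - X n) + (f - X m)) \<ge> 2 * d" using d[OF mid] by simp
    then have "(2 * d)\<^sup>2 \<le> (norm ((f - X n) + (f - X m)))\<^sup>2" using d0 by (intro power_mono) auto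
    moreover have "(norm ((f - X n) + (f - X m)))\<^sup>2 + (norm ((f - X n) - (f - X m)))\<^sup>2
        = 2 * (norm (f - X n))\<^sup>2 + 2 * (norm (f - X m))\<^sup>2" by (rule parallelogram_law)
    moreover have n: "norm ((f - X n) - (f - X m)) = norm (X n - X m)" by (simp add: norm_minus_commute)
    moreover have "(2 * d)\<^sup>2 = 4 * d\<^sup>2" by (simp add: power_mult_distrib)
    ultimately have "(norm (X n - X m))\<^sup>2 \<le> 4 * ((2 * d + 1) * ?e)"
      using sq[OF that(1)] sq[OF that(2)] unfolding n by linarith
    then show ?thesis by (simp only: mult.assoc)
  qed
  have "Cauchy X"
  proof (rule metric_CauchyI)
    fix e :: real assume e: "e > 0"
    have p: "0 < 4 * (2 * d + 1)" using d0 by simp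
    obtain N where N: "inverse (real (Suc N)) < e\<^sup>2 / (4 * (2 * d + 1))"
      using reals_Archimedean[of "e\<^sup>2 / (4 * (2 * d + 1))"] e p by auto
    then have "4 * (2 * d + 1) * inverse (real (Suc N)) < e\<^sup>2" using p by (simp only: pos_less_divide_eq mult.commute)
    then have "dist (X m) (X n) < e" if "m \<ge> N" "n \<ge> N" for m n
      using est[OF that] e unfolding dist_norm by (intro power2_less_imp_less[of _ e]) auto
    then show "\<exists>M. \<forall>m\<ge>M. \<forall>n\<ge>M. dist (X m) (X n) < e" by blast
  qed
  then obtain h where h: "X \<longlonglongrightarrow> h" using L2_complete by (auto simp: convergent_def)
  have hH: "h \<in> H_set" using closed_H_set X(1) h closed_sequentially by blast
  have nh: "norm (f - h) \<le> d"
  proof (rule LIMSEQ_le)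
    show "(\<lambda>n. norm (f - X n)) \<longlonglongrightarrow> norm (f - h)" by (intro tendsto_intros h)
    show "(\<lambda>n. d + inverse (real (Suc n))) \<longlonglongrightarrow> d" using LIMSEQ_inverse_real_of_nat_add[of d] by simp
    show "\<exists>N. \<forall>n\<ge>N. norm (f - X n) \<le> d + inverse (real (Suc n))" using X(2) less_imp_le by blast
  qed
  have "(f - h) \<bullet> k = 0" if k: "k \<in> H_set" for k
  proof (cases "k = 0")
    case False
    define c where "c = ((f - h) \<bullet> k) / (k \<bullet> k)"
    have "d \<le> norm (f - (h + c *\<^sub>R k))" using hH k subspace_H_set by (intro d subspace_add subspace_scale)
    then have "(norm (f - h))\<^sup>2 \<le> (norm ((f - h) - c *\<^sub>R k))\<^sup>2"
      using nh by (intro power_mono) (auto simp: diff_diff_eq)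
    also have "\<dots> = (norm (f - h))\<^sup>2 - 2 * c * ((f - h) \<bullet> k) + c\<^sup>2 * (k \<bullet> k)"
      unfolding power2_norm_eq_inner by (simp add: inner_diff_left inner_diff_right inner_commute power2_eq_square)
    also have "\<dots> = (norm (f - h))\<^sup>2 - ((f - h) \<bullet> k)\<^sup>2 / (k \<bullet> k)"
      using False by (simp add: c_def power2_eq_square field_simps)
    finally have "((f - h) \<bullet> k)\<^sup>2 / (k \<bullet> k) \<le> 0" by simp
    moreover have "k \<bullet> k > 0" using False by simp
    ultimately have "((f - h) \<bullet> k)\<^sup>2 \<le> 0" by (auto simp: divide_le_0_iff)
    then show ?thesis by simp
  qed simp
  then show ?thesis using hH by blast
qed

lemma Leray:
  shows Leray_H_set: "Leray f \<in> H_set"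
    and inner_Leray: "k \<in> H_set \<Longrightarrow> Leray f \<bullet> k = f \<bullet> k"
proof -
  obtain h where h: "h \<in> H_set" "\<forall>k\<in>H_set. (f - h) \<bullet> k = 0" using H_set_projection_exists by blast
  have "Leray f = h" unfolding Leray_def
  proof (rule the_equality)
    fix h' assume h': "h' \<in> H_set \<and> (\<forall>k\<in>H_set. (f - h') \<bullet> k = 0)"
    then have "h' - h \<in> H_set" using h subspace_diff[OF subspace_H_set] by blast
    then have "(f - h) \<bullet> (h' - h) - (f - h') \<bullet> (h' - h) = 0" using h h' by simp
    then have "(h' - h) \<bullet> (h' - h) = 0" by (simp add: inner_diff_left)
    then show "h' = h" by simp
  qed (use h in blast)
  then show "Leray f \<in> H_set" "k \<in> H_set \<Longrightarrow> Leray f \<bullet> k = f \<bullet> k"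
    using h by (auto simp: inner_diff_left)
qed

section \<open>The Ladyzhenskaya inequality\<close>

text \<open>
  The mean of \<open>g\<close> over a period of the \<open>j\<close>-th coordinate. Working with
  such means, which are again functions on the whole space, avoids splitting \<open>real^3\<close>
  into lower-dimensional factors.
\<close>

definition axis_average :: "3 \<Rightarrow> (real^3 \<Rightarrow> real) \<Rightarrow> real^3 \<Rightarrow> real" where
  "axis_average j g x = integral {0..1} (\<lambda>s. g (x + s *\<^sub>R axis j 1))"

definition continuous_periodic :: "(real^3 \<Rightarrow> real) \<Rightarrow> bool" where
  "continuous_periodic g \<longleftrightarrow> continuous_on UNIV g \<and> periodic g"

text \<open>
  Translations by at most one period suffice, as \<open>g\<close> is compared at points of the
  unit cube.
\<close>

definition axis_invariant :: "3 \<Rightarrow> (real^3 \<Rightarrow> real) \<Rightarrow> bool" where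
  "axis_invariant j g \<longleftrightarrow> (\<forall>x. \<forall>t\<in>{0..1}. g (x + t *\<^sub>R axis j 1) = g x)"

lemma line_continuous:
  "continuous_periodic g \<Longrightarrow> continuous_on S (\<lambda>s. g (x + s *\<^sub>R axis j 1))"
  unfolding continuous_periodic_def
  by (elim conjE, erule continuous_on_compose2) (auto intro!: continuous_intros)

lemma line_integrable:
  "continuous_periodic g \<Longrightarrow> (\<lambda>s. g (x + s *\<^sub>R axis j 1)) integrable_on {a..b}"
  by (intro integrable_continuous_real line_continuous)

lemma continuous_periodic_add:
  "continuous_periodic f \<Longrightarrow> continuous_periodic g \<Longrightarrow> continuous_periodic (\<lambda>x. f x + g x)"
  by (auto simp: continuous_periodic_def periodic_def intro!: continuous_intros)

lemma continuous_periodic_mult: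
  "continuous_periodic f \<Longrightarrow> continuous_periodic g \<Longrightarrow> continuous_periodic (\<lambda>x. f x * g x)"
  by (auto simp: continuous_periodic_def periodic_def intro!: continuous_intros)

lemma continuous_periodic_const: "continuous_periodic (\<lambda>x. c)"
  by (auto simp: continuous_periodic_def periodic_def)

lemma continuous_periodic_power:
  "continuous_periodic f \<Longrightarrow> continuous_periodic (\<lambda>x. f x ^ n)"
  by (auto simp: continuous_periodic_def periodic_def intro!: continuous_intros)

lemmas continuous_periodic_arith = continuous_periodic_add continuous_periodic_mult
  continuous_periodic_const continuous_periodic_power

lemma continuous_periodic_axis_average:
  assumes "continuous_periodic g"
  shows "continuous_periodic (axis_average j g)"
  unfolding continuous_periodic_def
proof
  have "continuous_on UNIV (\<lambda>x. integral (cbox 0 1) (\<lambda>s::real. g (x + s *\<^sub>R axis j 1)))"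
  proof (rule integral_continuous_on_param)
    show "continuous_on (UNIV \<times> cbox 0 1) (\<lambda>(x, s::real). g (x + s *\<^sub>R axis j 1))"
      using assms unfolding continuous_periodic_def case_prod_beta
      by (elim conjE, elim continuous_on_compose2) (auto intro!: continuous_intros)
  qed
  then show "continuous_on UNIV (axis_average j g)" by (simp add: axis_average_def[abs_def])
  show "periodic (axis_average j g)"
    unfolding periodic_def
  proof (intro allI)
    fix x i
    have "g (x + axis i 1 + s *\<^sub>R axis j 1) = g (x + s *\<^sub>R axis j 1)" for s
    proof -
      have "x + axis i 1 + s *\<^sub>R axis j 1 = (x + s *\<^sub>R axis j 1) + axis i 1" by (simp add: add.assoc add.commute)
      moreover have "g ((x + s *\<^sub>R axis j 1) + axis i 1) = g (x + s *\<^sub>R axis j 1)"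
        using assms unfolding continuous_periodic_def periodic_def by blast
      ultimately show ?thesis by (simp only:)
    qed
    then show "axis_average j g (x + axis i 1) = axis_average j g x" by (simp add: axis_average_def)
  qed
qed

lemma axis_invariant_average:
  assumes g: "continuous_periodic g"
  shows "axis_invariant j (axis_average j g)"
  unfolding axis_invariant_def
proof (intro allI ballI)
  fix x and t :: real assume t: "t \<in> {0..1}"
  define G where "G s = g (x + s *\<^sub>R axis j 1)" for s
  have Gi: "G integrable_on {a..b}" for a b unfolding G_def[abs_def] by (rule line_integrable[OF g])
  have "G (s + 1) = g ((x + s *\<^sub>R axis j 1) + axis j 1)" for s by (simp add: G_def algebra_simps)
  then have per: "G (s + 1) = G s" for s
    using g by (simp add: continuous_periodic_def periodic_def G_def)
  have "axis_average j g (x + t *\<^sub>R axis j 1) = integral {0..1} (\<lambda>s. G (s + t))"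
  proof -
    have "g (x + t *\<^sub>R axis j 1 + s *\<^sub>R axis j 1) = G (s + t)" for s
      by (simp add: G_def scaleR_add_left ac_simps)
    then show ?thesis by (simp only: axis_average_def)
  qed
  also have "\<dots> = integral {t..1 + t} G" using integral_shift_real_ivl[of t t "1 + t" G] by simp
  also have "\<dots> = integral {t..1} G + integral {1..1 + t} G"
    using t by (intro Henstock_Kurzweil_Integration.integral_combine[symmetric] Gi) auto
  also have "integral {1..1 + t} G = integral {0..t} (\<lambda>s. G (s + 1))"
    using integral_shift_real_ivl[of 1 1 "1 + t" G] by simp
  also have "\<dots> = integral {0..t} G" by (simp add: per)
  also have "integral {t..1} G + integral {0..t} G = integral {0..1} G"
    using t Henstock_Kurzweil_Integration.integral_combine[OF _ _ Gi, of 0 t 1] by simp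
  finally show "axis_average j g (x + t *\<^sub>R axis j 1) = axis_average j g x"
    by (simp add: axis_average_def G_def[abs_def])
qed

lemma axis_invariant_average_other:
  assumes "axis_invariant i g"
  shows "axis_invariant i (axis_average j g)"
  unfolding axis_invariant_def
proof (intro allI ballI)
  fix x and t :: real assume t: "t \<in> {0..1}"
  have "g (x + t *\<^sub>R axis i 1 + s *\<^sub>R axis j 1) = g (x + s *\<^sub>R axis j 1)" for s
  proof -
    have "x + t *\<^sub>R axis i 1 + s *\<^sub>R axis j 1 = (x + s *\<^sub>R axis j 1) + t *\<^sub>R axis i 1" by (simp add: ac_simps)
    then show ?thesis using assms t unfolding axis_invariant_def by metis
  qed
  then show "axis_average j g (x + t *\<^sub>R axis i 1) = axis_average j g x" by (simp add: axis_average_def)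
qed

lemma axis_average_pull_out:
  assumes "axis_invariant j p"
  shows "axis_average j (\<lambda>x. p x * g x) x = p x * axis_average j g x"
proof -
  have "integral {0..1} (\<lambda>s. p (x + s *\<^sub>R axis j 1) * g (x + s *\<^sub>R axis j 1)) =
      integral {0..1} (\<lambda>s. p x * g (x + s *\<^sub>R axis j 1))"
    using assms by (intro Henstock_Kurzweil_Integration.integral_cong) (simp add: axis_invariant_def)
  then show ?thesis by (simp add: axis_average_def)
qed

lemma axis_average_commute:
  assumes g: "continuous_periodic g"
  shows "axis_average i (axis_average j g) x = axis_average j (axis_average i g) x"
proof -
  have "integral (cbox 0 1) (\<lambda>s::real. integral (cbox 0 1) (\<lambda>t::real. g (x + s *\<^sub>R axis i 1 + t *\<^sub>R axis j 1))) =
    integral (cbox 0 1) (\<lambda>t::real. integral (cbox 0 1) (\<lambda>s::real. g (x + s *\<^sub>R axis i 1 + t *\<^sub>R axis j 1)))"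
  proof (rule integral_swap_continuous)
    show "continuous_on (cbox (0, 0) (1, 1)) (\<lambda>(s, t::real). g (x + s *\<^sub>R axis i 1 + t *\<^sub>R axis j 1))"
      using g unfolding continuous_periodic_def case_prod_beta
      by (elim conjE, elim continuous_on_compose2) (auto intro!: continuous_intros)
  qed
  then show ?thesis by (simp add: axis_average_def ac_simps)
qed

lemma torus_integral_eq_integral:
  fixes g :: "real^3 \<Rightarrow> real"
  assumes "continuous_on UNIV g"
  shows "(\<integral>x. g x \<partial>torus) = integral (cbox 0 1) g"
proof -
  have "(\<integral>x. g x \<partial>torus) = (\<integral>x. indicator (cbox 0 1) x *\<^sub>R g x \<partial>lborel)"
    unfolding torus_def by (rule integral_restrict_space) simp
  also have "\<dots> = integral (cbox 0 1) g"
    using set_borel_integral_eq_integral(2)[of "cbox 0 1" g]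
      borel_integrable_compact[of "cbox 0 1" g] continuous_on_subset[OF assms]
    by (auto simp: set_lebesgue_integral_def set_integrable_def)
  finally show ?thesis .
qed

lemma torus_integral_axis_average:
  assumes g: "continuous_periodic g"
  shows "(\<integral>x. axis_average j g x \<partial>torus) = (\<integral>x. g x \<partial>torus)"
proof -
  have gc: "continuous_on UNIV g" "periodic g" using g by (auto simp: continuous_periodic_def)
  have "(\<integral>x. axis_average j g x \<partial>torus) = integral (cbox 0 1) (axis_average j g)"
    using continuous_periodic_axis_average[OF g] by (intro torus_integral_eq_integral) (simp add: continuous_periodic_def)
  also have "\<dots> = integral (cbox 0 1) (\<lambda>x. integral (cbox 0 1) (\<lambda>s::real. g (x + s *\<^sub>R axis j 1)))"
    by (simp add: axis_average_def[abs_def])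
  also have "\<dots> = integral (cbox 0 1) (\<lambda>s::real. integral (cbox 0 1) (\<lambda>x. g (x + s *\<^sub>R axis j 1)))"
  proof (rule integral_swap_continuous)
    show "continuous_on (cbox (0, 0) (1, 1)) (\<lambda>(x, s::real). g (x + s *\<^sub>R axis j 1))"
      using gc(1) unfolding case_prod_beta by (elim continuous_on_compose2) (auto intro!: continuous_intros)
  qed
  also have "\<dots> = integral (cbox 0 1) (\<lambda>s::real. \<integral>x. g x \<partial>torus)"
  proof (rule Henstock_Kurzweil_Integration.integral_cong)
    fix s :: real assume s: "s \<in> cbox 0 1"
    have "continuous_on UNIV (\<lambda>x. g (x + s *\<^sub>R axis j 1))"
      using gc(1) by (elim continuous_on_compose2) (auto intro!: continuous_intros)
    from torus_integral_eq_integral[OF this] torus_integral_shift[OF gc, of s j] s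
    show "integral (cbox 0 1) (\<lambda>x. g (x + s *\<^sub>R axis j 1)) = (\<integral>x. g x \<partial>torus)" by simp
  qed
  also have "\<dots> = (\<integral>x. g x \<partial>torus)" by simp
  finally show ?thesis .
qed

lemma axis_average_mono:
  assumes "continuous_periodic f" "continuous_periodic g" "\<And>x. f x \<le> g x"
  shows "axis_average j f x \<le> axis_average j g x"
  unfolding axis_average_def using assms by (intro integral_le line_integrable) auto

lemma axis_average_add:
  assumes "continuous_periodic f" "continuous_periodic g"
  shows "axis_average j (\<lambda>x. f x + g x) x = axis_average j f x + axis_average j g x"
  unfolding axis_average_def by (intro integral_add line_integrable assms)

lemma axis_average_cmult: "axis_average j (\<lambda>x. c * f x) x = c * axis_average j f x"
  unfolding axis_average_def by simp

lemma nonneg_quadratic_form_discriminant: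
  fixes A B C :: real
  assumes "\<And>a b. 0 \<le> a\<^sup>2 * A + (2 * a * b) * B + b\<^sup>2 * C"
  shows "B\<^sup>2 \<le> A * C"
proof -
  have A: "A \<ge> 0" using assms[of 1 0] by simp
  show ?thesis
  proof (cases "A = 0")
    case True
    have "0 \<le> (- (C + 1))\<^sup>2 * A + (2 * (- (C + 1)) * B) * B + B\<^sup>2 * C" by (rule assms)
    also have "\<dots> = - ((C + 2) * B\<^sup>2)" using True by (simp add: power2_eq_square algebra_simps)
    finally have le: "(C + 2) * B\<^sup>2 \<le> 0" by linarith
    have "C \<ge> 0" using assms[of 0 1] by simp
    then have "1 * B\<^sup>2 \<le> (C + 2) * B\<^sup>2" by (intro mult_right_mono) auto
    then have "B\<^sup>2 \<le> 0" using le by linarith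
    then show ?thesis using True by simp
  next
    case False
    have "0 \<le> B\<^sup>2 * A + (2 * B * (- A)) * B + (- A)\<^sup>2 * C" by (rule assms)
    also have "\<dots> = A * (A * C - B\<^sup>2)" by (simp add: power2_eq_square algebra_simps)
    finally show ?thesis using A False by (simp add: zero_le_mult_iff)
  qed
qed

text \<open>
  The average of \<open>(a f + b g)^2\<close> is a nonnegative quadratic form in \<open>(a,
  b)\<close>.
\<close>

lemma plane_average_Cauchy_Schwarz:
  assumes f: "continuous_periodic f" and g: "continuous_periodic g"
  shows "(axis_average i (axis_average j (\<lambda>x. f x * g x)) x)\<^sup>2 \<le>
    axis_average i (axis_average j (\<lambda>x. (f x)\<^sup>2)) x * axis_average i (axis_average j (\<lambda>x. (g x)\<^sup>2)) x"
proof (rule nonneg_quadratic_form_discriminant)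
  fix a b :: real
  note cp = continuous_periodic_arith continuous_periodic_axis_average
  have "0 = axis_average i (axis_average j (\<lambda>x. 0)) x" by (simp add: axis_average_def)
  also have "\<dots> \<le> axis_average i (axis_average j (\<lambda>x. a\<^sup>2 * (f x)\<^sup>2 + ((2 * a * b) * (f x * g x) + b\<^sup>2 * (g x)\<^sup>2))) x"
  proof (intro axis_average_mono cp f g)
    fix x show "0 \<le> a\<^sup>2 * (f x)\<^sup>2 + ((2 * a * b) * (f x * g x) + b\<^sup>2 * (g x)\<^sup>2)"
      using zero_le_power2[of "a * f x + b * g x"] by (simp add: power2_eq_square algebra_simps)
  qed
  also have "axis_average j (\<lambda>x. a\<^sup>2 * (f x)\<^sup>2 + ((2 * a * b) * (f x * g x) + b\<^sup>2 * (g x)\<^sup>2)) =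
      (\<lambda>x. a\<^sup>2 * axis_average j (\<lambda>x. (f x)\<^sup>2) x + ((2 * a * b) * axis_average j (\<lambda>x. f x * g x) x + b\<^sup>2 * axis_average j (\<lambda>x. (g x)\<^sup>2) x))"
    by (rule ext) (simp only: axis_average_add axis_average_cmult cp f g)
  also have "axis_average i \<dots> x = a\<^sup>2 * axis_average i (axis_average j (\<lambda>x. (f x)\<^sup>2)) x
      + ((2 * a * b) * axis_average i (axis_average j (\<lambda>x. f x * g x)) x + b\<^sup>2 * axis_average i (axis_average j (\<lambda>x. (g x)\<^sup>2)) x)"
    by (simp only: axis_average_add axis_average_cmult cp f g)
  finally show "0 \<le> a\<^sup>2 * axis_average i (axis_average j (\<lambda>x. (f x)\<^sup>2)) x
      + (2 * a * b) * axis_average i (axis_average j (\<lambda>x. f x * g x)) x + b\<^sup>2 * axis_average i (axis_average j (\<lambda>x. (g x)\<^sup>2)) x"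
    by (simp only: add.assoc)
qed

lemma torus_integral_Cauchy_Schwarz:
  fixes f g :: "real^3 \<Rightarrow> real"
  assumes f: "continuous_on UNIV f" and g: "continuous_on UNIV g"
  shows "(\<integral>x. f x * g x \<partial>torus)\<^sup>2 \<le> (\<integral>x. (f x)\<^sup>2 \<partial>torus) * (\<integral>x. (g x)\<^sup>2 \<partial>torus)"
proof (rule nonneg_quadratic_form_discriminant)
  fix a b :: real
  have i: "integrable torus (\<lambda>x. (f x)\<^sup>2)" "integrable torus (\<lambda>x. f x * g x)" "integrable torus (\<lambda>x. (g x)\<^sup>2)"
    by (intro integrable_torus_continuous continuous_intros f g)+
  have "0 \<le> (\<integral>x. (a * f x + b * g x)\<^sup>2 \<partial>torus)" by (rule integral_nonneg_AE) simp
  also have "\<dots> = (\<integral>x. a\<^sup>2 * (f x)\<^sup>2 + (2 * a * b) * (f x * g x) + b\<^sup>2 * (g x)\<^sup>2 \<partial>torus)"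
    by (intro Bochner_Integration.integral_cong) (auto simp: power2_eq_square algebra_simps)
  also have "\<dots> = a\<^sup>2 * (\<integral>x. (f x)\<^sup>2 \<partial>torus) + (2 * a * b) * (\<integral>x. f x * g x \<partial>torus) + b\<^sup>2 * (\<integral>x. (g x)\<^sup>2 \<partial>torus)"
    using i by simp
  finally show "0 \<le> a\<^sup>2 * (\<integral>x. (f x)\<^sup>2 \<partial>torus) + (2 * a * b) * (\<integral>x. f x * g x \<partial>torus) + b\<^sup>2 * (\<integral>x. (g x)\<^sup>2 \<partial>torus)" .
qed

lemma trig_poly_norm_continuous_periodic:
  assumes "trig_poly \<phi>"
  shows "continuous_periodic (\<lambda>x. norm (\<phi> x))" "continuous_periodic (\<lambda>x. norm (pd j \<phi> x))"
  using trig_poly_continuous[OF assms] trig_poly_pd_continuous[OF assms] trig_poly_periodic[OF assms]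
    periodic_pd[OF trig_poly_periodic[OF assms] trig_poly_differentiable[OF assms]]
  by (auto simp: continuous_periodic_def periodic_def intro!: continuous_intros)

text \<open>
  The one-dimensional Sobolev inequality along a line: \<open>|\<phi>|^2\<close> at a point
  exceeds its value at any other point of the period by at most the integral of \<open>2 |\<phi>|
  |\<partial>_j \<phi>|\<close>; average over the other point.
\<close>

lemma norm_square_le_axis_average:
  assumes \<phi>: "trig_poly \<phi>"
  shows "(norm (\<phi> x))\<^sup>2 \<le> axis_average j (\<lambda>x. (norm (\<phi> x))\<^sup>2 + 2 * (norm (\<phi> x) * norm (pd j \<phi> x))) x"
proof -
  note cp = continuous_periodic_arith trig_poly_norm_continuous_periodic[OF \<phi>]
  define G where "G s = (norm (\<phi> (x + s *\<^sub>R axis j 1)))\<^sup>2" for s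
  define h where "h s = 2 * (norm (\<phi> (x + s *\<^sub>R axis j 1)) * norm (pd j \<phi> (x + s *\<^sub>R axis j 1)))" for s
  define G' where "G' s = 2 * (\<phi> (x + s *\<^sub>R axis j 1) \<bullet> pd j \<phi> (x + s *\<^sub>R axis j 1))" for s
  have Gi: "G integrable_on {a..b}" and hi: "h integrable_on {a..b}" for a b
    unfolding G_def[abs_def] h_def[abs_def] by (intro line_integrable cp)+
  have der: "(G has_vector_derivative G' s) (at s within S)" for s S
  proof -
    have "(\<phi> has_derivative frechet_derivative \<phi> (at (x + s *\<^sub>R axis j 1))) (at (x + s *\<^sub>R axis j 1))"
      using trig_poly_differentiable[OF \<phi>] frechet_derivative_works by blast
    then have "((\<phi> \<circ> (\<lambda>s. x + s *\<^sub>R axis j 1)) has_derivative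
        frechet_derivative \<phi> (at (x + s *\<^sub>R axis j 1)) \<circ> (\<lambda>h. h *\<^sub>R axis j 1)) (at s)"
      by (intro diff_chain_at) (auto intro!: derivative_eq_intros)
    moreover have "frechet_derivative \<phi> (at (x + s *\<^sub>R axis j 1)) (h *\<^sub>R axis j 1) = h *\<^sub>R pd j \<phi> (x + s *\<^sub>R axis j 1)" for h
      unfolding pd_def using trig_poly_differentiable[OF \<phi>] linear_frechet_derivative linear_cmul by blast
    ultimately have d: "((\<lambda>s. \<phi> (x + s *\<^sub>R axis j 1)) has_derivative (\<lambda>h. h *\<^sub>R pd j \<phi> (x + s *\<^sub>R axis j 1))) (at s within S)"
      by (simp add: o_def has_derivative_at_withinI)
    show ?thesis
      unfolding G_def[abs_def] G'_def has_vector_derivative_def power2_norm_eq_inner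
      by (rule has_derivative_eq_rhs[OF has_derivative_inner[OF d d]]) (auto simp: inner_commute)
  qed
  have low: "G 0 \<le> G s + integral {0..1} h" if s: "s \<in> {0..1}" for s
  proof -
    have f: "(G' has_integral (G s - G 0)) {0..s}"
      using s by (intro fundamental_theorem_of_calculus der) auto
    have "norm (integral {0..s} G') \<le> integral {0..s} h"
    proof (rule Henstock_Kurzweil_Integration.integral_norm_bound_integral[OF _ hi])
      show "G' integrable_on {0..s}" using f by (auto simp: integrable_on_def)
      show "norm (G' u) \<le> h u" for u
        using Cauchy_Schwarz_ineq2[of "\<phi> (x + u *\<^sub>R axis j 1)" "pd j \<phi> (x + u *\<^sub>R axis j 1)"]
        by (simp add: G'_def h_def)
    qed
    moreover have "integral {0..s} h \<le> integral {0..1} h"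
      using s by (intro integral_subset_le hi) (auto simp: h_def)
    ultimately show ?thesis using integral_unique[OF f] by simp
  qed
  have "G 0 = integral {0..1} (\<lambda>s::real. G 0)" by simp
  also have "\<dots> \<le> integral {0..1} (\<lambda>s. G s + integral {0..1} h)"
    by (rule integral_le) (use low Gi in \<open>auto intro!: integrable_add\<close>)
  also have "\<dots> = integral {0..1} G + integral {0..1} h"
    using Gi by (subst integral_add) auto
  also have "\<dots> = axis_average j (\<lambda>x. (norm (\<phi> x))\<^sup>2 + 2 * (norm (\<phi> x) * norm (pd j \<phi> x))) x"
    unfolding axis_average_def G_def[symmetric] h_def[symmetric] using integral_add[OF Gi hi] by simp
  finally show ?thesis by (simp add: G_def)
qed

lemma axis_invariant_constant:
  assumes inv: "\<And>j. axis_invariant j g" and x: "x \<in> cbox 0 1"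
  shows "g x = g 0"
proof -
  have c: "0 \<le> x $ i" "x $ i \<le> 1" for i using x by (auto simp: cbox_01)
  have "x = 0 + (x $ 1) *\<^sub>R axis 1 1 + (x $ 2) *\<^sub>R axis 2 1 + (x $ 3) *\<^sub>R axis 3 1"
    by (subst vec_axis_sum[of x]) (simp add: sum_3)
  moreover have "g (y + (x $ i) *\<^sub>R axis i 1) = g y" for y i
    using inv[of i] c[of i] unfolding axis_invariant_def by simp
  ultimately show ?thesis by metis
qed

text \<open>
  The triple average is invariant in all directions, hence constant on the cube, and has the same
  integral as \<open>g\<close>.
\<close>

lemma all_axes_average:
  assumes g: "continuous_periodic g" and x: "x \<in> cbox 0 1"
  shows "axis_average 1 (axis_average 2 (axis_average 3 g)) x = (\<integral>x. g x \<partial>torus)"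
proof -
  let ?F = "axis_average 1 (axis_average 2 (axis_average 3 g))"
  note cp = g continuous_periodic_axis_average
  have inv: "axis_invariant j ?F" for j
  proof -
    have "axis_invariant 1 ?F" by (intro axis_invariant_average cp)
    moreover have "axis_invariant 2 ?F"
      by (rule axis_invariant_average_other, rule axis_invariant_average, rule cp, rule g)
    moreover have "axis_invariant 3 ?F"
      by (rule axis_invariant_average_other, rule axis_invariant_average_other, rule axis_invariant_average[OF g])
    moreover have "j = 1 \<or> j = 2 \<or> j = 3" by (rule exhaust_3)
    ultimately show ?thesis by blast
  qed
  have "?F y = ?F x" if "y \<in> cbox 0 1" for y
    using axis_invariant_constant[OF inv that] axis_invariant_constant[OF inv x] by simp
  then have "(\<integral>y. ?F y \<partial>torus) = (\<integral>y. ?F x \<partial>torus)"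
    by (intro Bochner_Integration.integral_cong) (auto simp: space_torus)
  also have "\<dots> = ?F x"
    by (simp add: torus_def measure_restrict_space space_restrict_space content_cbox_cart interval_ne_empty_cart)
  finally have "?F x = (\<integral>y. ?F y \<partial>torus)" by simp
  also have "\<dots> = (\<integral>x. g x \<partial>torus)"
    by (simp add: torus_integral_axis_average cp)
  finally show ?thesis .
qed

text \<open>
  One bounds \<open>|\<phi>|^2\<close> by its line averages \<open>h 1\<close> and \<open>h
  2\<close> in the first two directions. The product of these separates under the average over the
  plane of the first two axes, since each factor is independent of one variable; this is
  Ladyzhenskaya's two-dimensional argument and yields \<open>G (G + 4 E)\<close> up to a factor,
  with the planar averages \<open>G\<close> of \<open>|\<phi>|^2\<close> and \<open>E\<close> of
  \<open>|\<nabla>\<phi>|^2\<close>. The third direction is used to bound one factor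
  \<open>G\<close> by \<open>a (a + 2 d)\<close>.
\<close>

theorem Ladyzhenskaya:
  assumes \<phi>: "trig_poly \<phi>"
  defines "a \<equiv> sqrt (\<integral>x. (norm (\<phi> x))\<^sup>2 \<partial>torus)"
    and "d \<equiv> sqrt (\<integral>x. (\<Sum>j\<in>UNIV. (norm (pd j \<phi> x))\<^sup>2) \<partial>torus)"
  shows "(\<integral>x. norm (\<phi> x) ^ 4 \<partial>torus) \<le> a * (a + 2 * d) * (2 * a\<^sup>2 + 8 * d\<^sup>2)"
proof -
  define N where "N x = norm (\<phi> x)" for x
  define D where "D j x = norm (pd j \<phi> x)" for j x
  define S where "S x = (\<Sum>j\<in>UNIV. (D j x)\<^sup>2)" for x
  define h where "h j x = (N x)\<^sup>2 + 2 * (N x * D j x)" for j x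
  define M where "M g = axis_average 1 (axis_average 2 g)" for g
  have NDc: "continuous_periodic N" "continuous_periodic (D j)" for j
    unfolding N_def[abs_def] D_def[abs_def] by (rule trig_poly_norm_continuous_periodic[OF \<phi>])+
  note arith = continuous_periodic_arith
  have S3: "S x = (D 1 x)\<^sup>2 + ((D 2 x)\<^sup>2 + (D 3 x)\<^sup>2)" for x by (simp add: S_def sum_3)
  have cp: "continuous_periodic (h j)" "continuous_periodic S" "continuous_periodic (\<lambda>x. (N x)\<^sup>2)"
    "continuous_periodic (\<lambda>x. (D j x)\<^sup>2)" "continuous_periodic (\<lambda>x. N x * D j x)" for j
    unfolding h_def[abs_def] S3[abs_def] by (intro arith NDc)+
  have cpM: "continuous_periodic (M g)" if "continuous_periodic g" for g
    unfolding M_def using that by (intro continuous_periodic_axis_average)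
  have tint: "integrable torus g" if "continuous_periodic g" for g
    using that by (intro integrable_torus_continuous) (simp add: continuous_periodic_def)
  have a0: "a \<ge> 0" "d \<ge> 0" by (auto simp: a_def d_def intro!: integral_nonneg_AE sum_nonneg)
  have a2: "a\<^sup>2 = (\<integral>x. (N x)\<^sup>2 \<partial>torus)" "d\<^sup>2 = (\<integral>x. S x \<partial>torus)"
    by (auto simp: a_def d_def N_def S_def D_def intro!: real_sqrt_pow2 integral_nonneg_AE sum_nonneg)
  have sup: "(N x)\<^sup>2 \<le> axis_average j (h j) x" for x j
    using norm_square_le_axis_average[OF \<phi>, of x j] by (simp add: N_def h_def[abs_def] D_def)
  \<comment> \<open>The total average of \<open>h 3\<close> bounds every planar average of \<open>N\<^sup>2\<close>.\<close>
  define G where "G = M (\<lambda>x. (N x)\<^sup>2)"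
  define E where "E = M S"
  have plane: "G x \<le> a * (a + 2 * d)" if x: "x \<in> cbox 0 1" for x
  proof -
    have "G x \<le> M (axis_average 3 (h 3)) x"
      unfolding G_def M_def by (intro axis_average_mono continuous_periodic_axis_average cp sup)
    also have "\<dots> = (\<integral>x. h 3 x \<partial>torus)"
      unfolding M_def by (rule all_axes_average[OF cp(1) x])
    also have "\<dots> = a\<^sup>2 + 2 * (\<integral>x. N x * D 3 x \<partial>torus)"
      unfolding h_def a2 using tint[OF cp(3)] tint[OF cp(5)] by simp
    also have "(\<integral>x. N x * D 3 x \<partial>torus) \<le> a * d"
    proof (rule power2_le_imp_le)
      have "(\<integral>x. N x * D 3 x \<partial>torus)\<^sup>2 \<le> (\<integral>x. (N x)\<^sup>2 \<partial>torus) * (\<integral>x. (D 3 x)\<^sup>2 \<partial>torus)"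
        using NDc by (intro torus_integral_Cauchy_Schwarz) (auto simp: continuous_periodic_def)
      also have "(\<integral>x. (D 3 x)\<^sup>2 \<partial>torus) \<le> (\<integral>x. S x \<partial>torus)"
        by (intro integral_mono tint cp) (simp add: S3)
      finally show "(\<integral>x. N x * D 3 x \<partial>torus)\<^sup>2 \<le> (a * d)\<^sup>2"
        by (simp add: a2 power_mult_distrib mult_left_mono)
    qed (use a0 in simp)
    finally show ?thesis by (simp add: power2_eq_square algebra_simps)
  qed
  have pos: "0 \<le> M g x" if "continuous_periodic g" "\<And>x. 0 \<le> g x" for g x
  proof -
    have "0 = M (\<lambda>x. 0) x" by (simp add: M_def axis_average_def)
    also have "\<dots> \<le> M g x" unfolding M_def
      using that by (intro axis_average_mono continuous_periodic_axis_average arith)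
    finally show ?thesis .
  qed
  have G0: "0 \<le> G x" and E0: "0 \<le> E x" for x
    unfolding G_def E_def by (intro pos cp; simp add: S_def sum_nonneg)+
  have Mh: "M (h j) x \<le> G x + 2 * sqrt (G x * E x)" "0 \<le> M (h j) x" for j x
  proof -
    have "M (h j) x = G x + 2 * M (\<lambda>x. N x * D j x) x"
    proof -
      have "axis_average 2 (h j) = (\<lambda>x. axis_average 2 (\<lambda>x. (N x)\<^sup>2) x + 2 * axis_average 2 (\<lambda>x. N x * D j x) x)"
        unfolding h_def[abs_def] by (rule ext) (simp only: axis_average_add axis_average_cmult cp arith)
      then show ?thesis
        unfolding M_def G_def by (simp only: axis_average_add axis_average_cmult cp arith continuous_periodic_axis_average)
    qed
    moreover have "M (\<lambda>x. N x * D j x) x \<le> sqrt (G x * E x)"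
    proof (rule real_le_rsqrt)
      have "(M (\<lambda>x. N x * D j x) x)\<^sup>2 \<le> G x * M (\<lambda>x. (D j x)\<^sup>2) x"
        unfolding M_def G_def by (rule plane_average_Cauchy_Schwarz[OF NDc])
      also have "M (\<lambda>x. (D j x)\<^sup>2) x \<le> E x"
      proof -
        have "(D j x)\<^sup>2 \<le> S x" for x unfolding S_def by (rule member_le_sum) auto
        then show ?thesis unfolding M_def E_def
          by (intro axis_average_mono continuous_periodic_axis_average cp)
      qed
      finally show "(M (\<lambda>x. N x * D j x) x)\<^sup>2 \<le> G x * E x" using G0 by (simp add: mult_left_mono)
    qed
    ultimately show "M (h j) x \<le> G x + 2 * sqrt (G x * E x)" by simp
    show "0 \<le> M (h j) x" by (intro pos cp) (simp add: h_def N_def D_def)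
  qed
  let ?p = "\<lambda>x. axis_average 1 (h 1) x * axis_average 2 (h 2) x"
  have "(\<integral>x. norm (\<phi> x) ^ 4 \<partial>torus) \<le> (\<integral>x. ?p x \<partial>torus)"
  proof (rule integral_mono)
    show "integrable torus (\<lambda>x. norm (\<phi> x) ^ 4)"
      using tint[OF continuous_periodic_power[OF NDc(1)], of 4] by (simp add: N_def)
    show "integrable torus ?p" by (intro tint arith continuous_periodic_axis_average cp)
    fix x
    have "norm (\<phi> x) ^ 4 = (N x)\<^sup>2 * (N x)\<^sup>2" by (simp add: N_def power_numeral_reduce power2_eq_square)
    also have "\<dots> \<le> ?p x" by (intro mult_mono' sup) auto
    finally show "norm (\<phi> x) ^ 4 \<le> ?p x" .
  qed
  \<comment> \<open>Averaging over the first two axes separates the two factors.\<close>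
  also have "(\<integral>x. ?p x \<partial>torus) = (\<integral>x. M (h 1) x * M (h 2) x \<partial>torus)"
  proof -
    have 1: "axis_average 1 ?p x = axis_average 1 (axis_average 2 (h 2)) x * axis_average 1 (h 1) x" for x
      by (subst axis_average_pull_out[OF axis_invariant_average[OF cp(1)]]) (rule mult.commute)
    have inv: "axis_invariant 2 (axis_average 1 (axis_average 2 (h 2)))"
      by (rule axis_invariant_average_other, rule axis_invariant_average, rule cp)
    have 2: "axis_average 2 (axis_average 1 ?p) x = M (h 2) x * M (h 1) x" for x
      unfolding ext[OF 1] M_def axis_average_pull_out[OF inv]
      by (simp only: axis_average_commute[OF cp(1)[of 1], of 1 2 x])
    have "(\<integral>x. ?p x \<partial>torus) = (\<integral>x. axis_average 2 (axis_average 1 ?p) x \<partial>torus)"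
      by (simp add: torus_integral_axis_average arith continuous_periodic_axis_average cp)
    then show ?thesis unfolding 2 by (simp add: mult.commute)
  qed
  also have "\<dots> \<le> (\<integral>x. a * (a + 2 * d) * (2 * G x + 8 * E x) \<partial>torus)"
  proof (rule integral_mono_AE)
    show "integrable torus (\<lambda>x. M (h 1) x * M (h 2) x)" by (intro tint arith cpM cp)
    show "integrable torus (\<lambda>x. a * (a + 2 * d) * (2 * G x + 8 * E x))"
      unfolding G_def E_def by (intro tint arith cpM cp)
    show "AE x in torus. M (h 1) x * M (h 2) x \<le> a * (a + 2 * d) * (2 * G x + 8 * E x)"
    proof (rule AE_I2)
      fix x assume "x \<in> space torus"
      then have x: "x \<in> cbox 0 1" by (simp add: space_torus)
      define r where "r = sqrt (G x * E x)"
      have r: "r\<^sup>2 = G x * E x" "0 \<le> r" using G0 E0 by (auto simp: r_def)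
      have "2 * sqrt (G x) * (2 * sqrt (E x)) \<le> (sqrt (G x))\<^sup>2 + (2 * sqrt (E x))\<^sup>2" by (rule sum_squares_bound)
      then have r4: "4 * r \<le> G x + 4 * E x"
        using G0 E0 by (simp add: r_def real_sqrt_mult power_mult_distrib mult.assoc)
      have "M (h 1) x * M (h 2) x \<le> (G x + 2 * r) * (G x + 2 * r)"
        using Mh[of 1 x] Mh[of 2 x] by (intro mult_mono) (auto simp: r_def)
      also have "\<dots> = G x * (G x + 4 * r + 4 * E x)"
        using r(1) by (simp add: power2_eq_square algebra_simps)
      also have "\<dots> \<le> G x * (2 * G x + 8 * E x)" using r4 G0 by (intro mult_left_mono) auto
      also have "\<dots> \<le> (a * (a + 2 * d)) * (2 * G x + 8 * E x)"
        using G0 E0 by (intro mult_right_mono plane[OF x]) auto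
      finally show "M (h 1) x * M (h 2) x \<le> a * (a + 2 * d) * (2 * G x + 8 * E x)" .
    qed
  qed
  also have "\<dots> = a * (a + 2 * d) * (2 * (\<integral>x. G x \<partial>torus) + 8 * (\<integral>x. E x \<partial>torus))"
    using tint[OF cpM[OF cp(3)]] tint[OF cpM[OF cp(2)]] unfolding G_def E_def by simp
  finally have "(\<integral>x. norm (\<phi> x) ^ 4 \<partial>torus) \<le> a * (a + 2 * d) * (2 * (\<integral>x. G x \<partial>torus) + 8 * (\<integral>x. E x \<partial>torus))" .
  moreover have "(\<integral>x. G x \<partial>torus) = a\<^sup>2" "(\<integral>x. E x \<partial>torus) = d\<^sup>2"
    unfolding G_def E_def M_def a2
    by (simp_all add: torus_integral_axis_average continuous_periodic_axis_average cp)
  ultimately show ?thesis by (simp only:)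
qed

section \<open>Fourier modes and truncation\<close>

definition lattice :: "(real^3) set" where
  "lattice = {k. \<forall>i. k $ i \<in> \<int>}"

definition wave :: "real^3 \<Rightarrow> real^3 \<Rightarrow> real^3 \<Rightarrow> real^3 \<Rightarrow> real^3" where
  "wave k a b x = cos (2 * pi * (k \<bullet> x)) *\<^sub>R a + sin (2 * pi * (k \<bullet> x)) *\<^sub>R b"

lemma trig_poly_iff_wave:
  "trig_poly \<phi> \<longleftrightarrow> (\<exists>K a b. finite K \<and> K \<subseteq> lattice \<and> \<phi> = (\<lambda>x. \<Sum>k\<in>K. wave k (a k) (b k) x))"
  unfolding trig_poly_def wave_def lattice_def by (simp add: subset_eq)

lemma trig_poly_wave: "k \<in> lattice \<Longrightarrow> trig_poly (wave k a b)"
  unfolding trig_poly_iff_wave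
  by (rule exI[of _ "{k}"], rule exI[of _ "\<lambda>_. a"], rule exI[of _ "\<lambda>_. b"]) auto

lemma pd_wave: "pd j (wave k a b) x = wave k ((2 * pi * k $ j) *\<^sub>R b) (- (2 * pi * k $ j) *\<^sub>R a) x"
  using pd_trig[of j "(2 * pi) *\<^sub>R k" a b x] by (simp add: wave_def[abs_def])

lemma pd_sum:
  assumes "finite I" "\<And>i. i \<in> I \<Longrightarrow> (f i) differentiable at x"
  shows "pd j (\<lambda>x. \<Sum>i\<in>I. f i x) x = (\<Sum>i\<in>I. pd j (f i) x)"
  using assms
proof (induction I rule: finite_induct)
  case empty then show ?case by (simp add: pd_const)
next
  case (insert i I)
  have "pd j (\<lambda>x. f i x + (\<Sum>i\<in>I. f i x)) x = pd j (f i) x + pd j (\<lambda>x. \<Sum>i\<in>I. f i x) x"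
    using insert by (intro pd_add differentiable_sum) auto
  then show ?case using insert by simp
qed

lemma trig_poly_pd:
  assumes "trig_poly \<phi>" shows "trig_poly (pd j \<phi>)"
proof -
  obtain K a b where K: "finite K" "K \<subseteq> lattice" "\<phi> = (\<lambda>x. \<Sum>k\<in>K. wave k (a k) (b k) x)"
    using assms unfolding trig_poly_iff_wave by blast
  have "pd j \<phi> = (\<lambda>x. \<Sum>k\<in>K. wave k ((2 * pi * k $ j) *\<^sub>R b k) (- (2 * pi * k $ j) *\<^sub>R a k) x)"
    unfolding K(3) using K(1,2)
    by (intro ext, subst pd_sum) (auto simp: pd_wave intro!: trig_poly_differentiable trig_poly_wave)
  then show ?thesis unfolding trig_poly_iff_wave
    using K by (intro exI[of _ K] exI[of _ "\<lambda>k. (2 * pi * k $ j) *\<^sub>R b k"] exI[of _ "\<lambda>k. - (2 * pi * k $ j) *\<^sub>R a k"]) auto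
qed

lemma trig_poly_component_test_function:
  assumes "trig_poly \<phi>" shows "test_function (\<lambda>x. \<phi> x $ i)"
proof -
  obtain K a b where K: "finite K" "K \<subseteq> lattice" "\<phi> = (\<lambda>x. \<Sum>k\<in>K. wave k (a k) (b k) x)"
    using assms unfolding trig_poly_iff_wave by blast
  have "(\<lambda>x. \<phi> x $ i) = (\<lambda>x. \<Sum>k\<in>K. cos (2 * pi * (k \<bullet> x)) * a k $ i + sin (2 * pi * (k \<bullet> x)) * b k $ i)"
    unfolding K(3) wave_def by simp
  moreover have "test_function \<dots>"
    using K(1,2) by (intro test_function_sum test_function_trig) (auto simp: lattice_def)
  ultimately show ?thesis by simp
qed

lemma pd_component:
  assumes "\<phi> differentiable at x"
  shows "pd j (\<lambda>x. \<phi> x $ i) x = pd j \<phi> x $ i"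
proof -
  have "(\<phi> has_derivative frechet_derivative \<phi> (at x)) (at x)"
    using assms frechet_derivative_works by blast
  then have "((\<lambda>x. \<phi> x $ i) has_derivative (\<lambda>h. frechet_derivative \<phi> (at x) h $ i)) (at x)"
    by (rule bounded_linear.has_derivative[OF bounded_linear_vec_nth])
  then show ?thesis using pd_eqI by (fastforce simp: pd_def)
qed

lemma trig_poly_square_integrable: "trig_poly \<phi> \<Longrightarrow> square_integrable \<phi>"
  by (intro square_integrable_continuous trig_poly_continuous)

lemma inner_to_L2_components:
  assumes "trig_poly \<phi>"
  shows "f \<bullet> to_L2 \<phi> = (\<Sum>i\<in>UNIV. (\<integral>x. \<phi> x $ i *\<^sub>R rep_L2 f x \<partial>torus) $ i)"
proof -
  have int: "integrable torus (\<lambda>x. \<phi> x $ i *\<^sub>R rep_L2 f x)" for i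
    by (rule integrable_test_rep[OF trig_poly_component_test_function[OF assms]])
  have "f \<bullet> to_L2 \<phi> = (\<integral>x. rep_L2 f x \<bullet> \<phi> x \<partial>torus)"
    by (rule inner_to_L2[OF trig_poly_square_integrable[OF assms]])
  also have "\<dots> = (\<integral>x. (\<Sum>i\<in>UNIV. (\<phi> x $ i *\<^sub>R rep_L2 f x) $ i) \<partial>torus)"
    by (simp add: inner_vec_def mult.commute)
  also have "\<dots> = (\<Sum>i\<in>UNIV. \<integral>x. (\<phi> x $ i *\<^sub>R rep_L2 f x) $ i \<partial>torus)"
    using int by (intro Bochner_Integration.integral_sum integrable_bounded_linear[OF bounded_linear_vec_nth])
  also have "\<dots> = (\<Sum>i\<in>UNIV. (\<integral>x. \<phi> x $ i *\<^sub>R rep_L2 f x \<partial>torus) $ i)"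
    using int by (intro sum.cong refl integral_bounded_linear[OF bounded_linear_vec_nth])
  finally show ?thesis .
qed

text \<open>
  Weak derivatives are defined through scalar test functions; this is the vector version, for
  which it suffices to test with the components of \<open>\<phi>\<close>.
\<close>

lemma wpd_integration_by_parts:
  assumes f: "f \<in> H1" and \<phi>: "trig_poly \<phi>"
  shows "wpd j f \<bullet> to_L2 \<phi> = - (f \<bullet> to_L2 (pd j \<phi>))"
proof -
  have "(\<integral>x. \<phi> x $ i *\<^sub>R rep_L2 (wpd j f) x \<partial>torus) = - (\<integral>x. pd j \<phi> x $ i *\<^sub>R rep_L2 f x \<partial>torus)" for i
  proof -
    have "pd j (\<lambda>x. \<phi> x $ i) = (\<lambda>x. pd j \<phi> x $ i)"
      using pd_component trig_poly_differentiable[OF \<phi>] by blast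
    then show ?thesis
      using weak_pd_wpd[OF f, of j] trig_poly_component_test_function[OF \<phi>, of i]
      unfolding weak_pd_def by fastforce
  qed
  then show ?thesis
    by (simp add: inner_to_L2_components \<phi> trig_poly_pd sum_negf)
qed

lemma torus_integral_divergence_zero:
  fixes \<psi> :: "real^3 \<Rightarrow> real^3"
  assumes "\<And>x. \<psi> differentiable at x" "\<And>j. continuous_on UNIV (pd j \<psi>)" "periodic \<psi>"
  shows "(\<integral>x. divergence \<psi> x \<partial>torus) = 0"
proof -
  have int: "integrable torus (pd j \<psi>)" for j using assms by (intro integrable_torus_continuous)
  have "(\<integral>x. divergence \<psi> x \<partial>torus) = (\<Sum>j\<in>UNIV. \<integral>x. pd j \<psi> x $ j \<partial>torus)"
    unfolding divergence_def using int
    by (intro Bochner_Integration.integral_sum integrable_bounded_linear[OF bounded_linear_vec_nth])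
  also have "\<dots> = (\<Sum>j\<in>UNIV. (\<integral>x. pd j \<psi> x \<partial>torus) $ j)"
    using int by (intro sum.cong refl integral_bounded_linear[OF bounded_linear_vec_nth])
  also have "\<dots> = 0" using torus_integral_pd_zero[OF assms] by simp
  finally show ?thesis .
qed

text \<open>
  Such a wave is a derivative of a periodic function.
\<close>

lemma torus_integral_wave_zero:
  assumes "k \<in> lattice" "k \<noteq> 0"
  shows "(\<integral>x. wave k a b x \<partial>torus) = 0"
proof -
  obtain j where j: "k $ j \<noteq> 0" using assms(2) by (auto simp: vec_eq_iff)
  define c where "c = 2 * pi * k $ j"
  have c: "c \<noteq> 0" using j by (simp add: c_def)
  let ?w = "wave k ((- (1 / c)) *\<^sub>R b) ((1 / c) *\<^sub>R a)"
  have "pd j ?w x = wave k a b x" for x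
    using c by (simp add: pd_wave c_def[symmetric])
  then have "(\<integral>x. wave k a b x \<partial>torus) = (\<integral>x. pd j ?w x \<partial>torus)" by simp
  also have "\<dots> = 0"
    using trig_poly_wave[OF assms(1)] by (intro torus_integral_pd_zero trig_poly_differentiable trig_poly_pd_continuous trig_poly_periodic)
  finally show ?thesis .
qed

lemma measure_torus: "measure torus (space torus) = 1"
  by (simp add: torus_def measure_restrict_space space_restrict_space content_cbox_cart interval_ne_empty_cart)

lemma torus_integral_wave:
  assumes "k \<in> lattice"
  shows "(\<integral>x. wave k a b x \<partial>torus) = (if k = 0 then a else 0)"
  using torus_integral_wave_zero[OF assms] by (auto simp: wave_def measure_torus)

lemma lattice_closed: "k \<in> lattice \<Longrightarrow> l \<in> lattice \<Longrightarrow> k + l \<in> lattice"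
    "k \<in> lattice \<Longrightarrow> l \<in> lattice \<Longrightarrow> k - l \<in> lattice" "k \<in> lattice \<Longrightarrow> - k \<in> lattice" "0 \<in> lattice"
  by (auto simp: lattice_def)

text \<open>
  Convolution with the kernel \<open>cos (2 pi k x)\<close> is, up to the factor one half, the
  projection to the waves of frequency \<open>k\<close>, which are also those of frequency
  \<open>- k\<close>; the product formula for cosines shifts the wave to the frequencies \<open>k
  - l\<close> and \<open>k + l\<close>. Each of the two cases contributes one half, and both apply
  when \<open>k\<close> and \<open>l\<close> vanish.
\<close>

lemma torus_convolution_wave:
  assumes "k \<in> lattice" "l \<in> lattice"
  shows "(\<integral>y. cos (2 * pi * (k \<bullet> (x - y))) *\<^sub>R wave l a b y \<partial>torus) =
    (if k = l then (1/2) *\<^sub>R wave l a b x else 0) + (if k = - l then (1/2) *\<^sub>R wave l a b x else 0)"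
proof -
  define \<theta> where "\<theta> = 2 * pi * (k \<bullet> x)"
  let ?a1 = "cos \<theta> *\<^sub>R a + sin \<theta> *\<^sub>R b" and ?b1 = "sin \<theta> *\<^sub>R a - cos \<theta> *\<^sub>R b"
  let ?a2 = "cos \<theta> *\<^sub>R a - sin \<theta> *\<^sub>R b" and ?b2 = "sin \<theta> *\<^sub>R a + cos \<theta> *\<^sub>R b"
  have "cos (2 * pi * (k \<bullet> (x - y))) *\<^sub>R wave l a b y =
      (1/2) *\<^sub>R (wave (k - l) ?a1 ?b1 y + wave (k + l) ?a2 ?b2 y)" for y
  proof -
    define \<kappa> \<nu> where "\<kappa> = 2 * pi * (k \<bullet> y)" and "\<nu> = 2 * pi * (l \<bullet> y)"
    have 1: "2 * pi * (k \<bullet> (x - y)) = \<theta> - \<kappa>" "2 * pi * ((k - l) \<bullet> y) = \<kappa> - \<nu>" "2 * pi * ((k + l) \<bullet> y) = \<kappa> + \<nu>"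
      by (auto simp: \<theta>_def \<kappa>_def \<nu>_def inner_diff_left inner_diff_right inner_add_left algebra_simps)
    have "cos (\<theta> - \<kappa>) * cos \<nu> = (1/2) * (cos (\<kappa> - \<nu>) * cos \<theta> + sin (\<kappa> - \<nu>) * sin \<theta> + (cos (\<kappa> + \<nu>) * cos \<theta> + sin (\<kappa> + \<nu>) * sin \<theta>))"
      by (simp add: cos_diff sin_diff cos_add sin_add algebra_simps)
    moreover have "cos (\<theta> - \<kappa>) * sin \<nu> = (1/2) * (cos (\<kappa> - \<nu>) * sin \<theta> - sin (\<kappa> - \<nu>) * cos \<theta> + (- cos (\<kappa> + \<nu>) * sin \<theta> + sin (\<kappa> + \<nu>) * cos \<theta>))"
      by (simp add: cos_diff sin_diff cos_add sin_add algebra_simps)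
    ultimately show ?thesis
      unfolding wave_def 1 \<nu>_def[symmetric] scaleR_add_right scaleR_scaleR
      by (simp only:) (simp add: algebra_simps)
  qed
  then have "(\<integral>y. cos (2 * pi * (k \<bullet> (x - y))) *\<^sub>R wave l a b y \<partial>torus) =
      (\<integral>y. (1/2) *\<^sub>R (wave (k - l) ?a1 ?b1 y + wave (k + l) ?a2 ?b2 y) \<partial>torus)" by simp
  also have "\<dots> = (1/2) *\<^sub>R ((\<integral>y. wave (k - l) ?a1 ?b1 y \<partial>torus) + (\<integral>y. wave (k + l) ?a2 ?b2 y \<partial>torus))"
    using assms by (subst integral_scaleR_right, subst Bochner_Integration.integral_add)
      (auto intro!: integrable_torus_continuous trig_poly_continuous trig_poly_wave lattice_closed)
  also have "\<dots> = (if k = l then (1/2) *\<^sub>R ?a1 else 0) + (if k = - l then (1/2) *\<^sub>R ?a2 else 0)"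
    using assms by (simp add: torus_integral_wave lattice_closed scaleR_add_right eq_neg_iff_add_eq_0)
  also have "\<dots> = (if k = l then (1/2) *\<^sub>R wave l a b x else 0) + (if k = - l then (1/2) *\<^sub>R wave l a b x else 0)"
    by (auto simp: wave_def \<theta>_def)
  finally show ?thesis .
qed

text \<open>
  Every wave is met twice, from \<open>k = l\<close> and from \<open>k = - l\<close>, each time
  with the factor one half.
\<close>

lemma torus_convolution_reproduces:
  assumes K: "finite K" "K \<subseteq> lattice" "\<And>k. k \<in> K \<Longrightarrow> - k \<in> K"
    and L: "finite L" "L \<subseteq> K" and \<phi>: "\<phi> = (\<lambda>x. \<Sum>l\<in>L. wave l (a l) (b l) x)"
  shows "(\<Sum>k\<in>K. \<integral>y. cos (2 * pi * (k \<bullet> (x - y))) *\<^sub>R \<phi> y \<partial>torus) = \<phi> x"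
proof -
  have "(\<integral>y. cos (2 * pi * (k \<bullet> (x - y))) *\<^sub>R \<phi> y \<partial>torus) =
     (\<Sum>l\<in>L. (\<integral>y. cos (2 * pi * (k \<bullet> (x - y))) *\<^sub>R wave l (a l) (b l) y \<partial>torus))" for k
    unfolding \<phi> scaleR_sum_right using K L
    by (intro Bochner_Integration.integral_sum integrable_torus_continuous continuous_intros)
      (auto intro!: trig_poly_continuous trig_poly_wave)
  then have "(\<Sum>k\<in>K. \<integral>y. cos (2 * pi * (k \<bullet> (x - y))) *\<^sub>R \<phi> y \<partial>torus) =
     (\<Sum>l\<in>L. \<Sum>k\<in>K. (\<integral>y. cos (2 * pi * (k \<bullet> (x - y))) *\<^sub>R wave l (a l) (b l) y \<partial>torus))"
    using sum.swap by (simp only:)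
  also have "\<dots> = (\<Sum>l\<in>L. wave l (a l) (b l) x)"
  proof (rule sum.cong[OF refl])
    fix l assume "l \<in> L"
    then have l: "l \<in> K" "- l \<in> K" using K L by auto
    have "(\<Sum>k\<in>K. (\<integral>y. cos (2 * pi * (k \<bullet> (x - y))) *\<^sub>R wave l (a l) (b l) y \<partial>torus)) =
      (\<Sum>k\<in>K. if k = l then (1/2) *\<^sub>R wave l (a l) (b l) x else 0) + (\<Sum>k\<in>K. if k = - l then (1/2) *\<^sub>R wave l (a l) (b l) x else 0)"
      unfolding sum.distrib[symmetric]
      by (rule sum.cong[OF refl], rule torus_convolution_wave) (use K l in auto)
    also have "\<dots> = wave l (a l) (b l) x"
      using K(1) l by (simp add: sum.delta scaleR_add_left[symmetric])
    finally show "(\<Sum>k\<in>K. (\<integral>y. cos (2 * pi * (k \<bullet> (x - y))) *\<^sub>R wave l (a l) (b l) y \<partial>torus)) = wave l (a l) (b l) x" .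
  qed
  finally show ?thesis by (simp add: \<phi>)
qed

text \<open>
  The orthogonal projection of the \<open>i\<close>-th axis vector to the plane perpendicular to
  \<open>k\<close>. The three projections are linearly dependent but form a tight frame of this
  plane (\<open>sum_perp\<close>), and unlike a basis they are given by a formula.
\<close>

definition perp :: "real^3 \<Rightarrow> 3 \<Rightarrow> real^3" where
  "perp k i = axis i 1 - (k $ i / (k \<bullet> k)) *\<^sub>R k"

text \<open>
  Frequency, polarisation, and whether the wave is a cosine.
\<close>

type_synonym mode = "(real^3) \<times> 3 \<times> bool"

definition mode_field :: "mode \<Rightarrow> real^3 \<Rightarrow> real^3" where
  "mode_field m = (case m of (k, i, c) \<Rightarrow> wave k (if c then perp k i else 0) (if c then 0 else perp k i))"

definition mode_V :: "mode \<Rightarrow> V" where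
  "mode_V m = to_V (to_L2 (mode_field m))"

text \<open>
  The eigenvalue of the Laplacian, up to sign, on waves of that frequency.
\<close>

definition eigenvalue :: "mode \<Rightarrow> real" where
  "eigenvalue m = 4 * pi\<^sup>2 * (fst m \<bullet> fst m)"

definition frequencies :: "nat \<Rightarrow> (real^3) set" where
  "frequencies N = {k \<in> lattice. k \<noteq> 0 \<and> (\<forall>i. \<bar>k $ i\<bar> \<le> real N)}"

definition modes :: "nat \<Rightarrow> mode set" where
  "modes N = frequencies N \<times> UNIV"

definition mode_coeff :: "L2 \<Rightarrow> mode \<Rightarrow> real" where
  "mode_coeff h m = h \<bullet> of_V (mode_V m)"

text \<open>
  The orthogonal projection to the span of the modes with frequencies in the cube of radius
  \<open>N\<close>. No normalising factors are needed although the modes are neither orthogonal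
  nor of norm one: the factor one half in the norm of a wave is compensated by the simultaneous
  presence of \<open>k\<close> and \<open>- k\<close>.
\<close>

definition truncation :: "nat \<Rightarrow> L2 \<Rightarrow> V" where
  "truncation N h = (\<Sum>m\<in>modes N. mode_coeff h m *\<^sub>R mode_V m)"

lemma perp_orthogonal: "k \<bullet> perp k i = 0"
  by (cases "k = 0") (auto simp: perp_def inner_diff_right inner_axis)

lemma inner_perp: "v \<bullet> k = 0 \<Longrightarrow> v \<bullet> perp k i = v $ i"
  by (simp add: perp_def inner_diff_right inner_axis)

lemma norm_perp_le: "norm (perp k i) \<le> 1"
proof (cases "k = 0")
  case False
  have "(norm (perp k i))\<^sup>2 = perp k i \<bullet> axis i 1 - (k $ i / (k \<bullet> k)) * (k \<bullet> perp k i)"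
    unfolding power2_norm_eq_inner by (subst (2) perp_def) (simp add: inner_diff_right inner_commute)
  also have "\<dots> = 1 - (k $ i)\<^sup>2 / (k \<bullet> k)"
    by (simp add: perp_orthogonal inner_axis) (simp add: perp_def power2_eq_square)
  also have "\<dots> \<le> 1\<^sup>2" by simp
  finally show ?thesis by (rule power2_le_imp_le) simp
qed (simp add: perp_def)

text \<open>
  The coefficients are the coordinates of \<open>v\<close>, because \<open>v\<close> is orthogonal
  to \<open>k\<close>; projecting \<open>v\<close>, the sum of its coordinate vectors, gives
  \<open>v\<close> back.
\<close>

lemma sum_perp:
  assumes "v \<bullet> k = 0"
  shows "(\<Sum>i\<in>UNIV. (v \<bullet> perp k i) *\<^sub>R perp k i) = v"
proof -
  have "(\<Sum>i\<in>UNIV. (v \<bullet> perp k i) *\<^sub>R perp k i) = (\<Sum>i\<in>UNIV. v $ i *\<^sub>R axis i 1) - (\<Sum>i\<in>UNIV. (v $ i * k $ i)) *\<^sub>R ((1 / (k \<bullet> k)) *\<^sub>R k)"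
    unfolding inner_perp[OF assms] unfolding perp_def
    by (simp add: scaleR_diff_right sum_subtractf scaleR_sum_left sum_divide_distrib)
  also have "(\<Sum>i\<in>UNIV. (v $ i * k $ i)) = 0" using assms by (simp add: inner_vec_def)
  finally show ?thesis using vec_axis_sum[of v] by simp
qed

lemma divergence_wave:
  assumes "k \<bullet> a = 0" "k \<bullet> b = 0"
  shows "divergence (wave k a b) x = 0"
proof -
  define C S where "C = cos (2 * pi * (k \<bullet> x))" and "S = sin (2 * pi * (k \<bullet> x))"
  have "divergence (wave k a b) x = (\<Sum>i\<in>UNIV. (C * 2 * pi) * (k $ i * b $ i) - (S * 2 * pi) * (k $ i * a $ i))"
    unfolding divergence_def pd_wave wave_def C_def[symmetric] S_def[symmetric] by (simp add: algebra_simps)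
  also have "\<dots> = (C * 2 * pi) * (k \<bullet> b) - (S * 2 * pi) * (k \<bullet> a)"
    unfolding inner_vec_def by (simp only: sum_subtractf sum_distrib_left inner_real_def)
  finally have "divergence (wave k a b) x = (C * 2 * pi) * (k \<bullet> b) - (S * 2 * pi) * (k \<bullet> a)" .
  then show ?thesis using assms by simp
qed

lemma wave_in_V:
  assumes "k \<in> lattice" "k \<noteq> 0" "k \<bullet> a = 0" "k \<bullet> b = 0"
  shows "wave k a b \<in> \<V>"
  using assms by (simp add: \<V>_def trig_poly_wave divergence_wave torus_integral_wave)

lemma mode_field_in_V: "m \<in> modes N \<Longrightarrow> mode_field m \<in> \<V>"
  by (cases m) (auto simp: modes_def frequencies_def mode_field_def perp_orthogonal intro!: wave_in_V)

lemma of_V_to_V: "\<phi> \<in> \<V> \<Longrightarrow> of_V (to_V (to_L2 \<phi>)) = to_L2 \<phi>"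
  by (intro to_V_inverse \<V>_subset_V_set)

lemma of_V_mode_V: "m \<in> modes N \<Longrightarrow> of_V (mode_V m) = to_L2 (mode_field m)"
  unfolding mode_V_def by (intro of_V_to_V mode_field_in_V)

lemma of_V_simps: "of_V (u + v) = of_V u + of_V v" "of_V (u - v) = of_V u - of_V v"
  "of_V (c *\<^sub>R u) = c *\<^sub>R of_V u" "of_V 0 = 0"
  by (simp_all add: plus_V.rep_eq minus_V.rep_eq scaleR_V.rep_eq zero_V.rep_eq)

lemma of_V_sum: "of_V (\<Sum>i\<in>I. f i) = (\<Sum>i\<in>I. of_V (f i))"
  by (induction I rule: infinite_finite_induct) (auto simp: of_V_simps)

lemma to_V_diff:
  assumes "f \<in> V_set" "g \<in> V_set"
  shows "to_V (f - g) = to_V f - to_V g"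
proof -
  have "of_V (to_V (f - g)) = of_V (to_V f - to_V g)"
    using assms V_set_diff by (simp add: of_V_simps to_V_inverse)
  then show ?thesis by (simp add: of_V_inject)
qed

lemma finite_frequencies: "finite (frequencies N)"
proof (rule finite_subset)
  let ?A = "real_of_int ` {- int N..int N}"
  show "frequencies N \<subseteq> (\<lambda>f. \<chi> i. f i) ` (PiE UNIV (\<lambda>_. ?A))"
  proof
    fix k assume k: "k \<in> frequencies N"
    have "k $ i \<in> ?A" for i
    proof -
      have ki: "k $ i \<in> \<int>" "\<bar>k $ i\<bar> \<le> real N" using k by (auto simp: frequencies_def lattice_def)
      then obtain n where n: "k $ i = of_int n" by (auto elim: Ints_cases)
      have "\<bar>real_of_int n\<bar> \<le> real N" using ki(2) n by simp
      then have "n \<in> {- int N..int N}" by (simp, linarith)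
      then show ?thesis using n by (intro image_eqI)
    qed
    then have "(\<lambda>i. k $ i) \<in> PiE UNIV (\<lambda>_. ?A)" by auto
    moreover have "k = (\<chi> i. (\<lambda>i. k $ i) i)" by simp
    ultimately show "k \<in> (\<lambda>f. \<chi> i. f i) ` (PiE UNIV (\<lambda>_. ?A))" by blast
  qed
  show "finite ((\<lambda>f. \<chi> i. f i) ` (PiE UNIV (\<lambda>_::3. ?A)))" by (intro finite_imageI finite_PiE) auto
qed

lemma finite_modes: "finite (modes N)"
  by (simp add: modes_def finite_frequencies)

lemma frequencies_mono: "M \<le> N \<Longrightarrow> frequencies M \<subseteq> frequencies N"
  unfolding frequencies_def by (auto intro: order_trans)

lemma modes_mono: "M \<le> N \<Longrightarrow> modes M \<subseteq> modes N"
  using frequencies_mono by (auto simp: modes_def)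

lemma eigenvalue_ge_1:
  assumes "m \<in> modes N" shows "1 \<le> eigenvalue m"
proof -
  let ?k = "fst m"
  have k: "?k \<in> lattice" "?k \<noteq> 0" using assms by (auto simp: modes_def frequencies_def)
  then obtain i where i: "?k $ i \<noteq> 0" by (auto simp: vec_eq_iff)
  have "?k $ i \<in> \<int>" using k by (simp add: lattice_def)
  then obtain n where n: "?k $ i = of_int n" by (auto elim: Ints_cases)
  have "1 \<le> \<bar>n\<bar>" using i n by auto
  then have "1 \<le> \<bar>n\<bar> * \<bar>n\<bar>" using mult_mono[of 1 "\<bar>n\<bar>" 1 "\<bar>n\<bar>"] by simp
  then have "1 \<le> ?k $ i * ?k $ i" using n by (simp flip: of_int_mult)
  also have "\<dots> \<le> ?k \<bullet> ?k" unfolding inner_vec_def inner_real_def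
    by (rule member_le_sum) auto
  finally have 1: "1 \<le> ?k \<bullet> ?k" .
  have "3 * 3 \<le> pi * pi" using pi_gt3 by (intro mult_mono) auto
  then have "1 \<le> 4 * pi\<^sup>2" by (simp add: power2_eq_square)
  then have "1 * 1 \<le> 4 * pi\<^sup>2 * (?k \<bullet> ?k)" using 1 by (intro mult_mono) auto
  then show ?thesis by (simp add: eigenvalue_def)
qed

text \<open>
  The divergence of a periodic field has mean zero; apply this to the product of
  \<open>\<phi>\<close> with the scalar wave, whose gradient is parallel to \<open>k\<close>.
\<close>

lemma V_Fourier_orthogonal:
  assumes \<phi>: "\<phi> \<in> \<V>" and k: "k \<in> lattice"
  shows "(\<integral>y. cos (2 * pi * (k \<bullet> y)) *\<^sub>R \<phi> y \<partial>torus) \<bullet> k = 0" (is ?c)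
    "(\<integral>y. sin (2 * pi * (k \<bullet> y)) *\<^sub>R \<phi> y \<partial>torus) \<bullet> k = 0" (is ?s)
proof -
  note t = \<V>_trig[OF \<phi>]
  have gen: "(\<integral>y. (- sin (2 * pi * (k \<bullet> y)) * a + cos (2 * pi * (k \<bullet> y)) * b) *\<^sub>R \<phi> y \<partial>torus) \<bullet> k = 0" for a b
  proof -
    define \<psi> where "\<psi> = (\<lambda>x. cos (2 * pi * (k \<bullet> x)) * a + sin (2 * pi * (k \<bullet> x)) * b)"
    have tf: "test_function \<psi>" unfolding \<psi>_def using k by (intro test_function_trig) (simp add: lattice_def)
    note d = test_function_differentiable[OF tf] trig_poly_differentiable[OF t]
    have pd\<psi>: "pd j \<psi> x = 2 * pi * (- sin (2 * pi * (k \<bullet> x)) * a + cos (2 * pi * (k \<bullet> x)) * b) * k $ j" for j x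
      using pd_trig[of j "(2 * pi) *\<^sub>R k" a b x] by (simp add: \<psi>_def algebra_simps)
    have eq: "pd j (\<lambda>x. \<psi> x *\<^sub>R \<phi> x) = (\<lambda>x. \<psi> x *\<^sub>R pd j \<phi> x + pd j \<psi> x *\<^sub>R \<phi> x)" for j
      by (intro ext pd_scaleR d)
    have div: "divergence (\<lambda>x. \<psi> x *\<^sub>R \<phi> x) x =
        2 * pi * ((- sin (2 * pi * (k \<bullet> x)) * a + cos (2 * pi * (k \<bullet> x)) * b) *\<^sub>R \<phi> x \<bullet> k)" for x
    proof -
      have "divergence (\<lambda>x. \<psi> x *\<^sub>R \<phi> x) x = \<psi> x * divergence \<phi> x + (\<Sum>j\<in>UNIV. pd j \<psi> x * \<phi> x $ j)"
        unfolding divergence_def eq by (simp add: sum.distrib sum_distrib_left)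
      moreover have "(\<Sum>j\<in>UNIV. c * k $ j * \<phi> x $ j) = c * (\<phi> x \<bullet> k)" for c
        by (simp add: inner_vec_def sum_distrib_left mult_ac)
      ultimately show ?thesis using \<phi> unfolding pd\<psi> by (simp add: \<V>_def)
    qed
    have "(\<integral>x. divergence (\<lambda>x. \<psi> x *\<^sub>R \<phi> x) x \<partial>torus) = 0"
    proof (rule torus_integral_divergence_zero)
      show "(\<lambda>x. \<psi> x *\<^sub>R \<phi> x) differentiable at x" for x using d by (intro differentiable_scaleR)
      show "continuous_on UNIV (pd j (\<lambda>x. \<psi> x *\<^sub>R \<phi> x))" for j
        unfolding eq by (intro continuous_intros test_function_continuous test_function_pd tf
            trig_poly_continuous trig_poly_pd_continuous t)
      show "periodic (\<lambda>x. \<psi> x *\<^sub>R \<phi> x)"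
        using tf trig_poly_periodic[OF t] by (simp add: periodic_def test_function_def)
    qed
    then have "(\<integral>x. (- sin (2 * pi * (k \<bullet> x)) * a + cos (2 * pi * (k \<bullet> x)) * b) *\<^sub>R \<phi> x \<bullet> k \<partial>torus) = 0"
      unfolding div by simp
    moreover have "integrable torus (\<lambda>x. (- sin (2 * pi * (k \<bullet> x)) * a + cos (2 * pi * (k \<bullet> x)) * b) *\<^sub>R \<phi> x)"
      by (intro integrable_torus_continuous continuous_intros trig_poly_continuous t)
    ultimately show ?thesis by (simp only: integral_inner_left)
  qed
  show ?c using gen[of 0 1] by simp
  show ?s using gen[of "-1" 0] by simp
qed

lemma inner_to_L2_scalar:
  assumes "\<phi> \<in> \<V>" "continuous_on UNIV \<psi>"
  shows "to_L2 \<phi> \<bullet> to_L2 (\<lambda>x. \<psi> x *\<^sub>R p) = (\<integral>y. \<psi> y *\<^sub>R \<phi> y \<partial>torus) \<bullet> p"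
proof -
  note c = trig_poly_continuous[OF \<V>_trig[OF assms(1)]]
  have "to_L2 \<phi> \<bullet> to_L2 (\<lambda>x. \<psi> x *\<^sub>R p) = (\<integral>y. \<phi> y \<bullet> (\<psi> y *\<^sub>R p) \<partial>torus)"
    by (rule inner_L2.abs_eq) (auto intro!: square_integrable_continuous continuous_intros c assms(2))
  also have "\<dots> = (\<integral>y. (\<psi> y *\<^sub>R \<phi> y) \<bullet> p \<partial>torus)" by simp
  also have "\<dots> = (\<integral>y. \<psi> y *\<^sub>R \<phi> y \<partial>torus) \<bullet> p"
    by (rule integral_inner_left) (intro integrable_torus_continuous continuous_intros c assms(2))
  finally show ?thesis .
qed

lemma sum_modes_at_frequency:
  assumes \<phi>: "\<phi> \<in> \<V>" and k: "k \<in> frequencies N"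
  shows "(\<Sum>p\<in>UNIV. mode_coeff (to_L2 \<phi>) (k, p) *\<^sub>R mode_field (k, p) x) =
    (\<integral>y. cos (2 * pi * (k \<bullet> (x - y))) *\<^sub>R \<phi> y \<partial>torus)"
proof -
  have kl: "k \<in> lattice" using k by (simp add: frequencies_def)
  note c = trig_poly_continuous[OF \<V>_trig[OF \<phi>]]
  define a where "a = (\<integral>y. cos (2 * pi * (k \<bullet> y)) *\<^sub>R \<phi> y \<partial>torus)"
  define b where "b = (\<integral>y. sin (2 * pi * (k \<bullet> y)) *\<^sub>R \<phi> y \<partial>torus)"
  have orth: "a \<bullet> k = 0" "b \<bullet> k = 0" using V_Fourier_orthogonal[OF \<phi> kl] by (auto simp: a_def b_def)
  have m: "(k, i, q) \<in> modes N" for i q using k by (simp add: modes_def)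
  have ca: "mode_coeff (to_L2 \<phi>) (k, i, True) = a \<bullet> perp k i" for i
    using inner_to_L2_scalar[OF \<phi>, of "\<lambda>y. cos (2 * pi * (k \<bullet> y))" "perp k i"]
    by (simp add: mode_coeff_def of_V_mode_V[OF m] mode_field_def wave_def[abs_def] a_def continuous_intros)
  have cb: "mode_coeff (to_L2 \<phi>) (k, i, False) = b \<bullet> perp k i" for i
    using inner_to_L2_scalar[OF \<phi>, of "\<lambda>y. sin (2 * pi * (k \<bullet> y))" "perp k i"]
    by (simp add: mode_coeff_def of_V_mode_V[OF m] mode_field_def wave_def[abs_def] b_def continuous_intros)
  have "(\<Sum>p\<in>UNIV. mode_coeff (to_L2 \<phi>) (k, p) *\<^sub>R mode_field (k, p) x) =
    (\<Sum>i\<in>UNIV. \<Sum>q\<in>UNIV. mode_coeff (to_L2 \<phi>) (k, i, q) *\<^sub>R mode_field (k, i, q) x)"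
    unfolding UNIV_Times_UNIV[symmetric] by (subst sum.cartesian_product) (simp add: case_prod_beta)
  also have "\<dots> = (\<Sum>i\<in>UNIV. cos (2 * pi * (k \<bullet> x)) *\<^sub>R (a \<bullet> perp k i) *\<^sub>R perp k i +
      sin (2 * pi * (k \<bullet> x)) *\<^sub>R (b \<bullet> perp k i) *\<^sub>R perp k i)"
    by (simp add: UNIV_bool ca cb mode_field_def wave_def mult.commute add.commute)
  also have "\<dots> = cos (2 * pi * (k \<bullet> x)) *\<^sub>R a + sin (2 * pi * (k \<bullet> x)) *\<^sub>R b"
    unfolding sum.distrib scaleR_sum_right[symmetric] sum_perp[OF orth(1)] sum_perp[OF orth(2)] ..
  also have "\<dots> = (\<integral>y. cos (2 * pi * (k \<bullet> x)) *\<^sub>R cos (2 * pi * (k \<bullet> y)) *\<^sub>R \<phi> y +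
      sin (2 * pi * (k \<bullet> x)) *\<^sub>R sin (2 * pi * (k \<bullet> y)) *\<^sub>R \<phi> y \<partial>torus)"
    unfolding a_def b_def
    by (subst Bochner_Integration.integral_add)
      (auto intro!: integrable_torus_continuous continuous_intros c simp del: scaleR_scaleR)
  also have "\<dots> = (\<integral>y. cos (2 * pi * (k \<bullet> (x - y))) *\<^sub>R \<phi> y \<partial>torus)"
    by (simp add: inner_diff_right right_diff_distrib cos_diff scaleR_add_left)
  finally show ?thesis .
qed

text \<open>
  The frequency \<open>0\<close> is allowed because a member of \<open>\<V>\<close> may be
  presented with a constant term, which then vanishes.
\<close>

definition band_limited :: "nat \<Rightarrow> (real^3 \<Rightarrow> real^3) \<Rightarrow> bool" where
  "band_limited N \<phi> \<longleftrightarrow> (\<exists>L a b. finite L \<and> L \<subseteq> insert 0 (frequencies N) \<and> \<phi> = (\<lambda>x. \<Sum>l\<in>L. wave l (a l) (b l) x))"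

text \<open>
  Frequency by frequency, the tight frame turns the sum into a convolution with a cosine kernel.
\<close>

lemma sum_modes_reproduces:
  assumes \<phi>: "\<phi> \<in> \<V>" and bl: "band_limited N \<phi>"
  shows "(\<Sum>m\<in>modes N. mode_coeff (to_L2 \<phi>) m *\<^sub>R mode_field m x) = \<phi> x"
proof -
  obtain L a b where L: "finite L" "L \<subseteq> insert 0 (frequencies N)" "\<phi> = (\<lambda>x. \<Sum>l\<in>L. wave l (a l) (b l) x)"
    using bl unfolding band_limited_def by blast
  have "(\<Sum>m\<in>modes N. mode_coeff (to_L2 \<phi>) m *\<^sub>R mode_field m x) =
    (\<Sum>k\<in>frequencies N. \<Sum>p\<in>UNIV. mode_coeff (to_L2 \<phi>) (k, p) *\<^sub>R mode_field (k, p) x)"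
    unfolding modes_def by (subst sum.cartesian_product) (simp add: case_prod_beta)
  also have "\<dots> = (\<Sum>k\<in>frequencies N. \<integral>y. cos (2 * pi * (k \<bullet> (x - y))) *\<^sub>R \<phi> y \<partial>torus)"
    by (intro sum.cong refl sum_modes_at_frequency[OF \<phi>])
  also have "\<dots> = (\<Sum>k\<in>insert 0 (frequencies N). \<integral>y. cos (2 * pi * (k \<bullet> (x - y))) *\<^sub>R \<phi> y \<partial>torus)"
  proof -
    have "0 \<notin> frequencies N" by (simp add: frequencies_def)
    then show ?thesis using \<phi> by (simp add: finite_frequencies \<V>_def)
  qed
  also have "\<dots> = \<phi> x"
    by (rule torus_convolution_reproduces[OF _ _ _ L])
      (simp add: finite_frequencies, auto simp: frequencies_def lattice_def)
  finally show ?thesis .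
qed

lemma V_band_limited:
  assumes "\<phi> \<in> \<V>" obtains N where "\<And>M. M \<ge> N \<Longrightarrow> band_limited M \<phi>"
proof -
  obtain L a b where L: "finite L" "L \<subseteq> lattice" "\<phi> = (\<lambda>x. \<Sum>l\<in>L. wave l (a l) (b l) x)"
    using \<V>_trig[OF assms] unfolding trig_poly_iff_wave by blast
  have "finite (insert 0 ((\<lambda>l. norm l) ` L))" using L by simp
  define r where "r = Max (insert 0 ((\<lambda>l. norm l) ` L))"
  have r: "norm l \<le> r" if "l \<in> L" for l unfolding r_def using that L by (intro Max_ge) auto
  obtain N where N: "r \<le> real N" using real_arch_simple by blast
  show ?thesis
  proof (rule that)
    fix M assume "N \<le> M"
    have "L \<subseteq> insert 0 (frequencies M)"
    proof
      fix l assume l: "l \<in> L"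
      have "\<bar>l $ i\<bar> \<le> real M" for i
        using component_le_norm_cart[of l i] r[OF l] N \<open>N \<le> M\<close> by linarith
      then show "l \<in> insert 0 (frequencies M)" using l L(2) by (auto simp: frequencies_def)
    qed
    then show "band_limited M \<phi>" unfolding band_limited_def using L by blast
  qed
qed

lemma band_limited_mode_field:
  assumes "m \<in> modes N" shows "band_limited N (mode_field m)"
proof -
  obtain k i c where m: "m = (k, i, c)" by (cases m)
  show ?thesis unfolding band_limited_def
    by (rule exI[of _ "{k}"], rule exI[of _ "\<lambda>_. if c then perp k i else 0"],
        rule exI[of _ "\<lambda>_. if c then 0 else perp k i"])
      (use assms in \<open>auto simp: m modes_def mode_field_def\<close>)
qed

lemma wpd_trig_poly: "trig_poly \<phi> \<Longrightarrow> wpd j (to_L2 \<phi>) = to_L2 (pd j \<phi>)"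
  by (intro wpd_eqI weak_pd_trig_poly)

lemma pd_pd_wave: "pd j (pd j (wave k a b)) x = - ((2 * pi * k $ j)\<^sup>2) *\<^sub>R wave k a b x"
proof -
  have "pd j (wave k a b) = wave k ((2 * pi * k $ j) *\<^sub>R b) (- (2 * pi * k $ j) *\<^sub>R a)" for a b
    by (rule ext) (rule pd_wave)
  then show ?thesis by (simp add: wave_def algebra_simps power2_eq_square)
qed

text \<open>
  Integration by parts: a mode is an eigenvector of the Laplacian, so its inner products with
  \<open>v\<close> in \<open>V\<close> and in \<open>L2\<close> differ by the eigenvalue.
\<close>

lemma inner_mode_V:
  assumes m: "m \<in> modes N"
  shows "mode_V m \<bullet> v = eigenvalue m * mode_coeff (of_V v) m"
proof -
  obtain k i c where kic: "m = (k, i, c)" by (cases m)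
  have t: "trig_poly (mode_field m)" using mode_field_in_V[OF m] \<V>_trig by blast
  have pp: "pd j (pd j (mode_field m)) = (\<lambda>x. (- ((2 * pi * k $ j)\<^sup>2)) *\<^sub>R mode_field m x)" for j
    by (rule ext) (simp add: kic mode_field_def pd_pd_wave)
  have "mode_V m \<bullet> v = (\<Sum>j\<in>UNIV. wpd j (of_V v) \<bullet> to_L2 (pd j (mode_field m)))"
    by (simp add: inner_V_def of_V_mode_V[OF m] wpd_trig_poly[OF t] inner_commute)
  also have "\<dots> = (\<Sum>j\<in>UNIV. (2 * pi * k $ j)\<^sup>2 * (of_V v \<bullet> to_L2 (mode_field m)))"
    by (simp add: wpd_integration_by_parts[OF of_V_H1 trig_poly_pd[OF t]] pp
        to_L2_scaleR[OF trig_poly_square_integrable[OF t]] del: scaleR_minus_left)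
  also have "\<dots> = (4 * pi\<^sup>2 * (k \<bullet> k)) * (of_V v \<bullet> to_L2 (mode_field m))"
    by (simp add: sum_distrib_right[symmetric] inner_vec_def power2_eq_square sum_distrib_left mult_ac)
  finally show ?thesis by (simp add: eigenvalue_def kic mode_coeff_def of_V_mode_V[OF m[unfolded kic]])
qed

text \<open>
  The smooth representative of the truncation, on which pointwise operations are possible.
\<close>

definition truncation_field :: "nat \<Rightarrow> L2 \<Rightarrow> real^3 \<Rightarrow> real^3" where
  "truncation_field N h x = (\<Sum>m\<in>modes N. mode_coeff h m *\<^sub>R mode_field m x)"

lemma V_sum: "finite I \<Longrightarrow> (\<And>i. i \<in> I \<Longrightarrow> f i \<in> \<V>) \<Longrightarrow> (\<lambda>x. \<Sum>i\<in>I. f i x) \<in> \<V>"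
  by (induction I rule: finite_induct) (auto intro: \<V>_zero \<V>_add)

lemma to_L2_sum:
  "finite I \<Longrightarrow> (\<And>i. i \<in> I \<Longrightarrow> f i \<in> \<V>) \<Longrightarrow> to_L2 (\<lambda>x. \<Sum>i\<in>I. f i x) = (\<Sum>i\<in>I. to_L2 (f i))"
proof (induction I rule: finite_induct)
  case empty then show ?case by (simp add: zero_L2.abs_eq)
next
  case (insert i I)
  then have "to_L2 (\<lambda>x. f i x + (\<Sum>i\<in>I. f i x)) = to_L2 (f i) + to_L2 (\<lambda>x. \<Sum>i\<in>I. f i x)"
    by (intro to_L2_add \<V>_square_integrable V_sum) auto
  then show ?case using insert by simp
qed

lemma truncation_field_in_V: "truncation_field N h \<in> \<V>"
  unfolding truncation_field_def[abs_def] by (intro V_sum finite_modes \<V>_scaleR mode_field_in_V)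

lemma of_V_truncation: "of_V (truncation N h) = to_L2 (truncation_field N h)"
proof -
  have "to_L2 (truncation_field N h) = (\<Sum>m\<in>modes N. to_L2 (\<lambda>x. mode_coeff h m *\<^sub>R mode_field m x))"
    unfolding truncation_field_def[abs_def] by (intro to_L2_sum finite_modes \<V>_scaleR mode_field_in_V)
  also have "\<dots> = (\<Sum>m\<in>modes N. mode_coeff h m *\<^sub>R of_V (mode_V m))"
    by (intro sum.cong refl) (simp add: to_L2_scaleR \<V>_square_integrable mode_field_in_V of_V_mode_V)
  finally show ?thesis by (simp add: truncation_def of_V_sum of_V_simps)
qed

lemma truncation_eq_to_V: "truncation N h = to_V (to_L2 (truncation_field N h))"
  using of_V_truncation by (metis of_V_inverse)

lemma truncation_V:
  assumes "\<phi> \<in> \<V>" "band_limited N \<phi>"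
  shows "truncation N (to_L2 \<phi>) = to_V (to_L2 \<phi>)"
proof -
  have "truncation_field N (to_L2 \<phi>) = \<phi>"
    using sum_modes_reproduces[OF assms] by (auto simp: truncation_field_def)
  then show ?thesis by (simp add: truncation_eq_to_V)
qed

lemma mode_coeff_add: "mode_coeff (f + g) m = mode_coeff f m + mode_coeff g m"
  and mode_coeff_diff: "mode_coeff (f - g) m = mode_coeff f m - mode_coeff g m"
  and mode_coeff_scaleR: "mode_coeff (c *\<^sub>R f) m = c * mode_coeff f m"
  by (simp_all add: mode_coeff_def inner_add_left inner_diff_left)

lemma truncation_add: "truncation N (f + g) = truncation N f + truncation N g"
  and truncation_diff: "truncation N (f - g) = truncation N f - truncation N g"
  and truncation_scaleR: "truncation N (c *\<^sub>R f) = c *\<^sub>R truncation N f"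
  by (simp_all add: truncation_def mode_coeff_add mode_coeff_diff mode_coeff_scaleR scaleR_add_left
      scaleR_diff_left sum.distrib sum_subtractf scaleR_sum_right)

lemma truncation_mode_V: "m \<in> modes N \<Longrightarrow> truncation N (of_V (mode_V m)) = mode_V m"
  using truncation_V[OF mode_field_in_V band_limited_mode_field, of m N] by (simp add: of_V_mode_V) (simp add: mode_V_def)

lemma inner_of_V_truncation:
  "of_V (truncation N h) \<bullet> g = (\<Sum>m\<in>modes N. mode_coeff h m * mode_coeff g m)"
  by (simp add: truncation_def of_V_sum of_V_simps inner_sum_left mode_coeff_def inner_commute[of g])

text \<open>
  The truncation is symmetric and reproduces the modes.
\<close>

lemma mode_coeff_truncation:
  assumes "m \<in> modes N"
  shows "mode_coeff (of_V (truncation N h)) m = mode_coeff h m"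
proof -
  have "mode_coeff (of_V (truncation N h)) m = of_V (truncation N (of_V (mode_V m))) \<bullet> h"
    unfolding mode_coeff_def[of "of_V (truncation N h)"] inner_of_V_truncation by (simp add: mult.commute)
  then show ?thesis by (simp add: truncation_mode_V[OF assms] mode_coeff_def inner_commute)
qed

lemma inner_truncation:
  "truncation N h \<bullet> v = (\<Sum>m\<in>modes N. eigenvalue m * (mode_coeff h m * mode_coeff (of_V v) m))"
  unfolding truncation_def inner_sum_left
  by (intro sum.cong refl) (simp add: inner_mode_V)

lemma norm_of_V_truncation: "(norm (of_V (truncation N h)))\<^sup>2 = (\<Sum>m\<in>modes N. (mode_coeff h m)\<^sup>2)"
  unfolding power2_norm_eq_inner by (simp add: inner_of_V_truncation mode_coeff_truncation power2_eq_square)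

lemma norm_truncation: "(norm (truncation N h))\<^sup>2 = (\<Sum>m\<in>modes N. eigenvalue m * (mode_coeff h m)\<^sup>2)"
  unfolding power2_norm_eq_inner by (simp add: inner_truncation mode_coeff_truncation power2_eq_square)

lemma norm_of_V_truncation_le: "norm (of_V (truncation N h)) \<le> norm h"
proof -
  let ?p = "of_V (truncation N h)"
  have "?p \<bullet> ?p = ?p \<bullet> h"
    by (simp add: inner_of_V_truncation mode_coeff_truncation)
  then have "norm ?p * norm ?p \<le> norm ?p * norm h"
    using norm_cauchy_schwarz[of ?p h] by (simp add: power2_norm_eq_inner[symmetric] power2_eq_square)
  then show ?thesis by (cases "norm ?p = 0") auto
qed

lemma norm_truncation_le: "norm (truncation N (of_V v)) \<le> norm v"
proof -
  let ?p = "truncation N (of_V v)"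
  have "?p \<bullet> ?p = ?p \<bullet> v"
    by (simp add: inner_truncation mode_coeff_truncation)
  then have "norm ?p * norm ?p \<le> norm ?p * norm v"
    using norm_cauchy_schwarz[of ?p v] by (simp add: power2_norm_eq_inner[symmetric] power2_eq_square)
  then show ?thesis by (cases "norm ?p = 0") auto
qed

lemma norm_le_norm_H1_V: "norm v \<le> norm_H1 (of_V v)"
  unfolding norm_H1_def norm_V_def inner_V_def
  by (simp add: power2_norm_eq_inner)

lemma V_dense:
  assumes "e > 0" obtains \<phi> where "\<phi> \<in> \<V>" "norm (v - to_V (to_L2 \<phi>)) < e"
proof -
  obtain \<phi> where \<phi>: "\<phi> \<in> \<V>" "norm_H1 (of_V v - to_L2 \<phi>) < e"
    using of_V[of v] assms unfolding V_set_def by blast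
  then have "norm (v - to_V (to_L2 \<phi>)) < e"
    using norm_le_norm_H1_V[of "v - to_V (to_L2 \<phi>)"] by (simp add: of_V_simps of_V_to_V)
  then show ?thesis using \<phi>(1) that by blast
qed

text \<open>
  The truncations are uniformly bounded and eventually fix each member of the dense set
  \<open>\<V>\<close>.
\<close>

lemma truncation_tendsto_V: "(\<lambda>N. truncation N (of_V v)) \<longlonglongrightarrow> v"
proof (rule LIMSEQ_I)
  fix e :: real assume e: "e > 0"
  obtain \<phi> where \<phi>: "\<phi> \<in> \<V>" "norm (v - to_V (to_L2 \<phi>)) < e / 2" using V_dense[of "e/2" v] e by auto
  obtain N where N: "\<And>M. M \<ge> N \<Longrightarrow> band_limited M \<phi>" using V_band_limited[OF \<phi>(1)] by blast
  have "norm (truncation M (of_V v) - v) < e" if M: "M \<ge> N" for M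
  proof -
    let ?w = "to_V (to_L2 \<phi>)"
    have "truncation M (of_V v) - v = truncation M (of_V (v - ?w)) - (v - ?w)"
      using truncation_V[OF \<phi>(1) N[OF M]] by (simp add: of_V_simps of_V_to_V \<phi> truncation_diff)
    then have "norm (truncation M (of_V v) - v) \<le> norm (truncation M (of_V (v - ?w))) + norm (v - ?w)"
      by (simp only: norm_triangle_ineq4)
    then show ?thesis using norm_truncation_le[of M "v - ?w"] \<phi>(2) by linarith
  qed
  then show "\<exists>N. \<forall>M\<ge>N. norm (truncation M (of_V v) - v) < e" by blast
qed

lemma truncation_tendsto_H:
  assumes "h \<in> H_set" shows "(\<lambda>N. of_V (truncation N h)) \<longlonglongrightarrow> h"
proof (rule LIMSEQ_I)
  fix e :: real assume e: "e > 0"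
  then obtain g where g: "g \<in> to_L2 ` \<V>" "dist g h < e / 2"
    using assms unfolding H_set_def closure_approachable by (meson half_gt_zero)
  then obtain \<phi> where \<phi>: "\<phi> \<in> \<V>" "norm (h - to_L2 \<phi>) < e / 2"
    by (auto simp: dist_norm norm_minus_commute)
  obtain N where N: "\<And>M. M \<ge> N \<Longrightarrow> band_limited M \<phi>" using V_band_limited[OF \<phi>(1)] by blast
  have "norm (of_V (truncation M h) - h) < e" if M: "M \<ge> N" for M
  proof -
    have "of_V (truncation M h) - h = of_V (truncation M (h - to_L2 \<phi>)) - (h - to_L2 \<phi>)"
      using truncation_V[OF \<phi>(1) N[OF M]] by (simp add: of_V_simps of_V_to_V \<phi> truncation_diff)
    then have "norm (of_V (truncation M h) - h) \<le> norm (of_V (truncation M (h - to_L2 \<phi>))) + norm (h - to_L2 \<phi>)"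
      by (simp only: norm_triangle_ineq4)
    then show ?thesis using norm_of_V_truncation_le[of M "h - to_L2 \<phi>"] \<phi>(2) by linarith
  qed
  then show "\<exists>N. \<forall>M\<ge>N. norm (of_V (truncation M h) - h) < e" by blast
qed

lemma of_V_in_H: "of_V v \<in> H_set"
  using of_V V_set_subset_H_set by blast

text \<open>
  The eigenvalues are at least one and the mean vanishes, so this holds mode by mode.
\<close>

theorem Poincare: "norm (of_V v) \<le> norm v"
proof (rule LIMSEQ_le)
  show "(\<lambda>N. norm (of_V (truncation N (of_V v)))) \<longlonglongrightarrow> norm (of_V v)"
    by (intro tendsto_norm truncation_tendsto_H of_V_in_H)
  show "(\<lambda>N. norm (truncation N (of_V v))) \<longlonglongrightarrow> norm v"
    by (intro tendsto_norm truncation_tendsto_V)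
  have "norm (of_V (truncation N (of_V v))) \<le> norm (truncation N (of_V v))" for N
  proof (rule power2_le_imp_le)
    show "(norm (of_V (truncation N (of_V v))))\<^sup>2 \<le> (norm (truncation N (of_V v)))\<^sup>2"
      unfolding norm_of_V_truncation norm_truncation
      using mult_right_mono[OF eigenvalue_ge_1] by (intro sum_mono) fastforce
  qed simp
  then show "\<exists>N. \<forall>n\<ge>N. norm (of_V (truncation n (of_V v))) \<le> norm (truncation n (of_V v))" by blast
qed

lemma bounded_linear_of_V: "bounded_linear of_V"
  by (rule bounded_linear_intro[of _ 1]) (auto simp: of_V_simps Poincare)

lemma to_dual_apply: "blinfun_apply (to_dual f) v = f \<bullet> of_V v"
  unfolding to_dual_def
  by (subst bounded_linear_Blinfun_apply)
    (auto intro: bounded_linear_compose[OF bounded_linear_inner_right bounded_linear_of_V])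

section \<open>Interpolation inequalities for trigonometric polynomials\<close>

lemma norm_to_L2: "square_integrable \<phi> \<Longrightarrow> (norm (to_L2 \<phi>))\<^sup>2 = (\<integral>x. (norm (\<phi> x))\<^sup>2 \<partial>torus)"
  unfolding power2_norm_eq_inner by (subst inner_L2.abs_eq) auto

lemma norm_to_V:
  assumes "\<phi> \<in> \<V>"
  shows "(norm (to_V (to_L2 \<phi>)))\<^sup>2 = (\<integral>x. (\<Sum>j\<in>UNIV. (norm (pd j \<phi> x))\<^sup>2) \<partial>torus)"
proof -
  note t = \<V>_trig[OF assms]
  have "(norm (to_V (to_L2 \<phi>)))\<^sup>2 = (\<Sum>j\<in>UNIV. (norm (to_L2 (pd j \<phi>)))\<^sup>2)"
    unfolding power2_norm_eq_inner by (simp add: inner_V_def of_V_to_V[OF assms] wpd_trig_poly[OF t])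
  also have "\<dots> = (\<Sum>j\<in>UNIV. \<integral>x. (norm (pd j \<phi> x))\<^sup>2 \<partial>torus)"
    by (simp add: norm_to_L2 trig_poly_square_integrable trig_poly_pd t)
  also have "\<dots> = (\<integral>x. (\<Sum>j\<in>UNIV. (norm (pd j \<phi> x))\<^sup>2) \<partial>torus)"
    by (intro Bochner_Integration.integral_sum[symmetric] integrable_torus_continuous continuous_intros trig_poly_pd_continuous t)
  finally show ?thesis .
qed

lemma norm_pd_le:
  assumes "\<phi> \<in> \<V>" shows "norm (to_L2 (pd j \<phi>)) \<le> norm (to_V (to_L2 \<phi>))"
proof (rule power2_le_imp_le)
  have "(norm (to_V (to_L2 \<phi>)))\<^sup>2 = (\<Sum>j\<in>UNIV. (norm (to_L2 (pd j \<phi>)))\<^sup>2)"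
    unfolding power2_norm_eq_inner by (simp add: inner_V_def of_V_to_V[OF assms] wpd_trig_poly \<V>_trig[OF assms])
  then show "(norm (to_L2 (pd j \<phi>)))\<^sup>2 \<le> (norm (to_V (to_L2 \<phi>)))\<^sup>2"
    by (simp only:) (rule member_le_sum, auto)
qed simp

definition L4_norm_square :: "(real^3 \<Rightarrow> real^3) \<Rightarrow> real" where
  "L4_norm_square \<phi> = sqrt (\<integral>x. norm (\<phi> x) ^ 4 \<partial>torus)"

lemma L4_norm_square_nonneg: "0 \<le> L4_norm_square \<phi>"
  by (auto simp: L4_norm_square_def intro!: integral_nonneg_AE)

text \<open>
  The Poincare inequality makes the lower-order terms of the inequality superfluous.
\<close>

lemma Ladyzhenskaya_V:
  assumes "\<phi> \<in> \<V>"
  shows "(L4_norm_square \<phi>)\<^sup>2 \<le> 30 * norm (to_L2 \<phi>) * norm (to_V (to_L2 \<phi>)) ^ 3"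
proof -
  note t = \<V>_trig[OF assms]
  define a d where "a = norm (to_L2 \<phi>)" and "d = norm (to_V (to_L2 \<phi>))"
  have a: "a = sqrt (\<integral>x. (norm (\<phi> x))\<^sup>2 \<partial>torus)"
    unfolding norm_to_L2[OF trig_poly_square_integrable[OF t], symmetric] by (simp add: a_def)
  have d: "d = sqrt (\<integral>x. (\<Sum>j\<in>UNIV. (norm (pd j \<phi> x))\<^sup>2) \<partial>torus)"
    unfolding norm_to_V[OF assms, symmetric] by (simp add: d_def)
  have ad: "0 \<le> a" "a \<le> d" using Poincare[of "to_V (to_L2 \<phi>)"] by (auto simp: a_def d_def of_V_to_V assms)
  have "(L4_norm_square \<phi>)\<^sup>2 = (\<integral>x. norm (\<phi> x) ^ 4 \<partial>torus)"
    unfolding L4_norm_square_def by (intro real_sqrt_pow2 integral_nonneg_AE) simp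
  also have "\<dots> \<le> a * (a + 2 * d) * (2 * a\<^sup>2 + 8 * d\<^sup>2)"
    using Ladyzhenskaya[OF t] unfolding a[symmetric] d[symmetric] .
  also have "\<dots> \<le> a * (3 * d) * (10 * d\<^sup>2)"
  proof (rule mult_mono)
    have "a\<^sup>2 \<le> d\<^sup>2" using ad by (intro power_mono) auto
    then show "2 * a\<^sup>2 + 8 * d\<^sup>2 \<le> 10 * d\<^sup>2" by simp
  qed (use ad in \<open>auto intro!: mult_left_mono mult_nonneg_nonneg\<close>)
  also have "\<dots> = 30 * a * d ^ 3" by (simp add: power2_eq_square power3_eq_cube)
  finally show ?thesis by (simp add: a_def d_def)
qed

lemma L4_norm_square_le:
  assumes "\<phi> \<in> \<V>" shows "L4_norm_square \<phi> \<le> 6 * (norm (to_V (to_L2 \<phi>)))\<^sup>2"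
proof (rule power2_le_imp_le)
  define a d where "a = norm (to_L2 \<phi>)" and "d = norm (to_V (to_L2 \<phi>))"
  have ad: "0 \<le> a" "a \<le> d" using Poincare[of "to_V (to_L2 \<phi>)"] by (auto simp: a_def d_def of_V_to_V assms)
  have "(L4_norm_square \<phi>)\<^sup>2 \<le> 30 * a * d ^ 3" using Ladyzhenskaya_V[OF assms] by (simp add: a_def d_def)
  also have "\<dots> \<le> 36 * d * d ^ 3" using ad by (intro mult_right_mono mult_mono) auto
  also have "\<dots> = (6 * d\<^sup>2)\<^sup>2" by (simp add: power2_eq_square power3_eq_cube)
  finally show "(L4_norm_square \<phi>)\<^sup>2 \<le> (6 * (norm (to_V (to_L2 \<phi>)))\<^sup>2)\<^sup>2" by (simp add: d_def)
qed simp

text \<open>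
  Young's inequality with the exponents 4 and 4/3, obtained by distinguishing which of the two
  norms dominates.
\<close>

lemma L4_norm_square_interpolation:
  assumes e: "e > 0"
  obtains D where "D > 0"
    "\<And>\<phi>. \<phi> \<in> \<V> \<Longrightarrow> L4_norm_square \<phi> \<le> e * (norm (to_V (to_L2 \<phi>)))\<^sup>2 + D * (norm (to_L2 \<phi>))\<^sup>2"
proof -
  \<comment> \<open>The threshold at which the first case gives exactly the coefficient
    \<open>e\<close>.\<close>
  define \<eta> where "\<eta> = e\<^sup>2 / 30"
  define D where "D = sqrt (30 / \<eta> ^ 3)"
  have \<eta>: "\<eta> > 0" using e by (simp add: \<eta>_def)
  have D: "D > 0" "D\<^sup>2 = 30 / \<eta> ^ 3" using \<eta> by (auto simp: D_def)
  show ?thesis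
  proof (rule that[OF D(1)])
    fix \<phi> assume \<phi>: "\<phi> \<in> \<V>"
    define a d where "a = norm (to_L2 \<phi>)" and "d = norm (to_V (to_L2 \<phi>))"
    have ad: "0 \<le> a" "0 \<le> d" by (auto simp: a_def d_def)
    have L: "(L4_norm_square \<phi>)\<^sup>2 \<le> 30 * a * d ^ 3" using Ladyzhenskaya_V[OF \<phi>] by (simp add: a_def d_def)
    have "L4_norm_square \<phi> \<le> e * d\<^sup>2 + D * a\<^sup>2"
    proof (cases "a \<le> \<eta> * d")
      case True
      then have "30 * a * d ^ 3 \<le> 30 * (\<eta> * d) * d ^ 3" using ad by (intro mult_right_mono mult_left_mono) auto
      also have "\<dots> = (e * d\<^sup>2)\<^sup>2" by (simp add: \<eta>_def power2_eq_square power3_eq_cube)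
      finally have "L4_norm_square \<phi> \<le> e * d\<^sup>2"
        using L e by (intro power2_le_imp_le[of "L4_norm_square \<phi>" "e * d\<^sup>2"]) auto
      moreover have "0 \<le> D * a\<^sup>2" using D by simp
      ultimately show ?thesis by linarith
    next
      case False
      then have "d \<le> a / \<eta>" using \<eta> by (simp add: field_simps)
      then have "30 * a * d ^ 3 \<le> 30 * a * (a / \<eta>) ^ 3" using ad by (intro mult_left_mono power_mono) auto
      also have "\<dots> = D\<^sup>2 * a ^ 4" unfolding D(2) by (simp add: power_divide power_numeral_reduce)
      also have "\<dots> = (D * a\<^sup>2)\<^sup>2" by (simp add: power_mult_distrib power2_eq_square power_numeral_reduce)
      finally have "L4_norm_square \<phi> \<le> D * a\<^sup>2"
        using L D by (intro power2_le_imp_le[of "L4_norm_square \<phi>" "D * a\<^sup>2"]) auto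
      moreover have "0 \<le> e * d\<^sup>2" using e by simp
      ultimately show ?thesis by linarith
    qed
    then show "L4_norm_square \<phi> \<le> e * (norm (to_V (to_L2 \<phi>)))\<^sup>2 + D * (norm (to_L2 \<phi>))\<^sup>2"
      by (simp add: a_def d_def)
  qed
qed

text \<open>
  Differentiation exchanges the sine and the cosine mode of a frequency.
\<close>

definition conjugate_mode :: "mode \<Rightarrow> mode" where
  "conjugate_mode m = (fst m, fst (snd m), \<not> snd (snd m))"

definition mode_sign :: "mode \<Rightarrow> real" where
  "mode_sign m = (if snd (snd m) then -1 else 1)"

lemma conjugate_mode_simps:
  "conjugate_mode (conjugate_mode m) = m" "fst (conjugate_mode m) = fst m"
  "eigenvalue (conjugate_mode m) = eigenvalue m" "conjugate_mode m \<in> modes N \<longleftrightarrow> m \<in> modes N"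
  by (auto simp: conjugate_mode_def eigenvalue_def modes_def mem_Times_iff)

lemma pd_mode_field:
  "pd j (mode_field m) x = (mode_sign m * (2 * pi * fst m $ j)) *\<^sub>R mode_field (conjugate_mode m) x"
  by (cases m) (auto simp: mode_field_def pd_wave conjugate_mode_def mode_sign_def wave_def)

lemma pd_truncation_field:
  "pd j (truncation_field N h) =
    (\<lambda>x. \<Sum>m\<in>modes N. (mode_coeff h m * (mode_sign m * (2 * pi * fst m $ j))) *\<^sub>R mode_field (conjugate_mode m) x)"
proof
  fix x
  have t: "trig_poly (mode_field m)" if "m \<in> modes N" for m using mode_field_in_V[OF that] \<V>_trig by blast
  have "pd j (truncation_field N h) x = (\<Sum>m\<in>modes N. pd j (\<lambda>x. mode_coeff h m *\<^sub>R mode_field m x) x)"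
    unfolding truncation_field_def[abs_def]
    by (intro pd_sum finite_modes) (auto intro: trig_poly_differentiable trig_poly_scaleR t)
  also have "\<dots> = (\<Sum>m\<in>modes N. mode_coeff h m *\<^sub>R pd j (mode_field m) x)"
    by (intro sum.cong refl, subst pd_scaleR) (auto intro: trig_poly_differentiable t simp: pd_const)
  finally show "pd j (truncation_field N h) x =
    (\<Sum>m\<in>modes N. (mode_coeff h m * (mode_sign m * (2 * pi * fst m $ j))) *\<^sub>R mode_field (conjugate_mode m) x)"
    by (simp add: pd_mode_field)
qed

lemma pd_truncation_field_in_V: "pd j (truncation_field N h) \<in> \<V>"
  unfolding pd_truncation_field
  by (intro V_sum finite_modes \<V>_scaleR mode_field_in_V[of _ N]) (simp add: conjugate_mode_simps)

text \<open>
  The derivative of a truncation is a combination of the same modes.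
\<close>

lemma truncation_pd:
  "truncation N (to_L2 (pd j (truncation_field N h))) = to_V (to_L2 (pd j (truncation_field N h)))"
proof -
  let ?c = "\<lambda>m. mode_coeff h m * (mode_sign m * (2 * pi * fst m $ j))"
  let ?w = "\<Sum>m\<in>modes N. ?c m *\<^sub>R mode_V (conjugate_mode m)"
  have c: "conjugate_mode m \<in> modes N" if "m \<in> modes N" for m using that by (simp add: conjugate_mode_simps)
  have "to_L2 (pd j (truncation_field N h)) = (\<Sum>m\<in>modes N. to_L2 (\<lambda>x. ?c m *\<^sub>R mode_field (conjugate_mode m) x))"
    unfolding pd_truncation_field by (intro to_L2_sum finite_modes \<V>_scaleR mode_field_in_V[OF c])
  also have "\<dots> = of_V ?w"
    unfolding of_V_sum of_V_simps
    by (intro sum.cong refl) (simp add: to_L2_scaleR \<V>_square_integrable mode_field_in_V[OF c] of_V_mode_V[OF c])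
  finally have w: "to_L2 (pd j (truncation_field N h)) = of_V ?w" .
  have "truncation N (of_V (\<Sum>m\<in>I. ?c m *\<^sub>R mode_V (conjugate_mode m))) = (\<Sum>m\<in>I. ?c m *\<^sub>R mode_V (conjugate_mode m))"
    if "finite I" "I \<subseteq> modes N" for I
    using that
  proof (induction I rule: finite_induct)
    case empty
    then show ?case using truncation_scaleR[of N 0 0] by (simp add: of_V_simps)
  next
    case (insert m I)
    then show ?case by (simp add: of_V_simps truncation_add truncation_scaleR truncation_mode_V[OF c])
  qed
  from this[OF finite_modes subset_refl] show ?thesis unfolding w of_V_inverse .
qed

text \<open>
  Each derivative multiplies a coefficient by \<open>2 pi k_j\<close> up to sign, and the sum of
  the squares of these factors over \<open>j\<close> is the eigenvalue.
\<close>

lemma norm_second_derivatives: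
  "(\<Sum>j\<in>UNIV. (norm (to_V (to_L2 (pd j (truncation_field N h)))))\<^sup>2) = (\<Sum>m\<in>modes N. (eigenvalue m)\<^sup>2 * (mode_coeff h m)\<^sup>2)"
proof -
  have coeff: "(mode_coeff (to_L2 (pd j (truncation_field N h))) m)\<^sup>2 =
      (2 * pi * fst m $ j)\<^sup>2 * (mode_coeff h (conjugate_mode m))\<^sup>2" if m: "m \<in> modes N" for j m
  proof -
    have tf: "trig_poly (truncation_field N h)" "trig_poly (mode_field m)"
      using truncation_field_in_V mode_field_in_V[OF m] \<V>_trig by blast+
    have c: "conjugate_mode m \<in> modes N" using m by (simp add: conjugate_mode_simps)
    have "mode_coeff (to_L2 (pd j (truncation_field N h))) m = wpd j (to_L2 (truncation_field N h)) \<bullet> to_L2 (mode_field m)"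
      by (simp add: mode_coeff_def of_V_mode_V[OF m] wpd_trig_poly[OF tf(1)])
    also have "\<dots> = - (to_L2 (truncation_field N h) \<bullet> to_L2 (pd j (mode_field m)))"
      by (rule wpd_integration_by_parts[OF trig_poly_H1[OF tf(1)] tf(2)])
    also have "to_L2 (pd j (mode_field m)) = (mode_sign m * (2 * pi * fst m $ j)) *\<^sub>R of_V (mode_V (conjugate_mode m))"
      by (simp add: pd_mode_field[abs_def] to_L2_scaleR \<V>_square_integrable mode_field_in_V[OF c] of_V_mode_V[OF c])
    also have "to_L2 (truncation_field N h) \<bullet> \<dots> = (mode_sign m * (2 * pi * fst m $ j)) * mode_coeff h (conjugate_mode m)"
      using mode_coeff_truncation[OF c, of h] by (simp add: mode_coeff_def of_V_truncation)
    finally show ?thesis by (simp add: power_mult_distrib mode_sign_def)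
  qed
  have "(\<Sum>j\<in>UNIV. (norm (to_V (to_L2 (pd j (truncation_field N h)))))\<^sup>2) =
     (\<Sum>j\<in>UNIV. \<Sum>m\<in>modes N. eigenvalue m * ((2 * pi * fst m $ j)\<^sup>2 * (mode_coeff h (conjugate_mode m))\<^sup>2))"
    unfolding truncation_pd[symmetric] norm_truncation
    by (intro sum.cong refl) (simp add: coeff)
  also have "\<dots> = (\<Sum>m\<in>modes N. \<Sum>j\<in>UNIV. eigenvalue m * ((2 * pi * fst m $ j)\<^sup>2 * (mode_coeff h (conjugate_mode m))\<^sup>2))"
    by (rule sum.swap)
  also have "\<dots> = (\<Sum>m\<in>modes N. (eigenvalue m)\<^sup>2 * (mode_coeff h (conjugate_mode m))\<^sup>2)"
  proof (rule sum.cong[OF refl])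
    fix m
    have "(\<Sum>j\<in>UNIV. (2 * pi * fst m $ j)\<^sup>2) = eigenvalue m"
      by (simp add: eigenvalue_def inner_vec_def power_mult_distrib sum_distrib_left power2_eq_square mult_ac)
    then show "(\<Sum>j\<in>UNIV. eigenvalue m * ((2 * pi * fst m $ j)\<^sup>2 * (mode_coeff h (conjugate_mode m))\<^sup>2)) =
        (eigenvalue m)\<^sup>2 * (mode_coeff h (conjugate_mode m))\<^sup>2"
      by (simp add: sum_distrib_left[symmetric] sum_distrib_right[symmetric] power2_eq_square)
  qed
  also have "\<dots> = (\<Sum>m\<in>modes N. (eigenvalue m)\<^sup>2 * (mode_coeff h m)\<^sup>2)"
    by (rule sum.reindex_bij_witness[of _ conjugate_mode conjugate_mode]) (auto simp: conjugate_mode_simps)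
  finally show ?thesis .
qed

lemma norm_mode_field_le: "norm (mode_field m x) \<le> 1"
proof -
  obtain k i c where m: "m = (k, i, c)" by (cases m)
  have "norm (mode_field m x) \<le> 1 * norm (perp k i)"
    by (auto simp: m mode_field_def wave_def intro!: mult_left_le_one_le)
  then show ?thesis using norm_perp_le[of k i] by linarith
qed

text \<open>
  The summand is dominated by a product of three factors, one for each coordinate: \<open>(1 +
  |k|^2)^(-2)\<close> is the third power of \<open>(1 + |k|^2)^(-2/3)\<close>, and each of these
  factors is at most \<open>(1 + k_i^2)^(-2/3)\<close>, which is summable over the integers as
  \<open>4/3 > 1\<close>.
\<close>

lemma lattice_sum_bounded: "\<exists>B. \<forall>N. (\<Sum>k\<in>frequencies N. 1 / (k \<bullet> k)\<^sup>2) \<le> B"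
proof -
  define g :: "real \<Rightarrow> real" where "g n = (1 + n\<^sup>2) powr (- (2/3))" for n
  have g0: "g n > 0" for n by (simp add: g_def add_pos_nonneg less_imp_neq[symmetric])
  have sg: "summable (\<lambda>n. g (real n))"
  proof (rule summable_comparison_test_ev)
    show "summable (\<lambda>n. real n powr (- (4/3)))" by (simp add: summable_real_powr_iff)
    show "\<forall>\<^sub>F n in sequentially. norm (g (real n)) \<le> real n powr (- (4/3))"
      using eventually_gt_at_top[of 0]
    proof eventually_elim
      case (elim n)
      have "g (real n) \<le> ((real n)\<^sup>2) powr (- (2/3))"
        unfolding g_def using elim by (intro powr_mono2') auto
      also have "(real n)\<^sup>2 = real n powr 2" using elim by (simp add: powr_numeral)
      also have "\<dots> powr (- (2/3)) = real n powr (- (4/3))" unfolding powr_powr by simp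
      finally show ?case using g0[of "real n"] by simp
    qed
  qed
  define A where "A N = real_of_int ` {- int N..int N}" for N
  have fA: "finite (A N)" for N by (simp add: A_def)
  define S where "S = 2 * (\<Sum>n. g (real n))"
  have SA: "(\<Sum>a\<in>A N. g a) \<le> S" for N
  proof -
    let ?P = "(\<lambda>n. real n) ` {..N}"
    have "A N \<subseteq> ?P \<union> uminus ` ?P"
    proof
      fix a assume "a \<in> A N"
      then obtain n where n: "a = real_of_int n" "\<bar>n\<bar> \<le> int N" by (auto simp: A_def)
      show "a \<in> ?P \<union> uminus ` ?P"
      proof (cases "n \<ge> 0")
        case True
        then have "a = real (nat n)" "nat n \<le> N" using n by auto
        then show ?thesis by auto
      next
        case False
        then have "a = - real (nat (- n))" "nat (- n) \<le> N" using n by auto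
        then show ?thesis by auto
      qed
    qed
    then have "(\<Sum>a\<in>A N. g a) \<le> (\<Sum>a\<in>?P \<union> uminus ` ?P. g a)"
      using less_imp_le[OF g0] by (intro sum_mono2) auto
    also have "\<dots> \<le> (\<Sum>a\<in>?P. g a) + (\<Sum>a\<in>uminus ` ?P. g a)"
    proof -
      have "(\<Sum>a\<in>?P \<union> uminus ` ?P. g a) + (\<Sum>a\<in>?P \<inter> uminus ` ?P. g a) = (\<Sum>a\<in>?P. g a) + (\<Sum>a\<in>uminus ` ?P. g a)"
        by (rule sum.union_inter) auto
      moreover have "0 \<le> (\<Sum>a\<in>?P \<inter> uminus ` ?P. g a)" using less_imp_le[OF g0] by (intro sum_nonneg)
      ultimately show ?thesis by linarith
    qed
    also have "(\<Sum>a\<in>uminus ` ?P. g a) = (\<Sum>a\<in>?P. g a)"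
      by (subst sum.reindex) (auto simp: g_def)
    also have "(\<Sum>a\<in>?P. g a) = (\<Sum>n\<le>N. g (real n))" by (subst sum.reindex) (auto simp: inj_on_def)
    also have "\<dots> \<le> (\<Sum>n. g (real n))" using sg less_imp_le[OF g0] by (intro sum_le_suminf) auto
    finally show ?thesis by (simp add: S_def)
  qed
  \<comment> \<open>Nonzero lattice points satisfy \<open>|k| \<ge> 1\<close>; this allows the shift
    from \<open>|k|^2\<close> to \<open>1 + |k|^2\<close> at the cost of a factor 4.\<close>
  have prod: "1 / (k \<bullet> k)\<^sup>2 \<le> 4 * (\<Prod>i\<in>UNIV. g (k $ i))" if k: "k \<in> frequencies N" for k N
  proof -
    have k1: "1 \<le> k \<bullet> k"
    proof -
      obtain i where i: "k $ i \<noteq> 0" using k by (auto simp: frequencies_def vec_eq_iff)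
      have "k $ i \<in> \<int>" using k by (simp add: frequencies_def lattice_def)
      then have "1 \<le> \<bar>k $ i\<bar>" using i by (auto elim!: Ints_cases)
      then have "1 \<le> \<bar>k $ i\<bar> * \<bar>k $ i\<bar>" using mult_mono[of 1 "\<bar>k $ i\<bar>" 1 "\<bar>k $ i\<bar>"] by simp
      also have "\<dots> \<le> k \<bullet> k" unfolding inner_vec_def inner_real_def abs_mult_self_eq
        by (rule member_le_sum) auto
      finally show ?thesis .
    qed
    have "(k $ i)\<^sup>2 \<le> k \<bullet> k" for i
      unfolding inner_vec_def inner_real_def power2_eq_square by (rule member_le_sum) auto
    then have "(1 + k \<bullet> k) powr (- (2/3)) \<le> g (k $ i)" for i
      unfolding g_def by (intro powr_mono2') (auto intro: add_pos_nonneg)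
    then have "(\<Prod>i\<in>(UNIV::3 set). (1 + k \<bullet> k) powr (- (2/3))) \<le> (\<Prod>i\<in>UNIV. g (k $ i))"
      by (intro prod_mono) auto
    moreover have "(\<Prod>i\<in>(UNIV::3 set). (1 + k \<bullet> k) powr (- (2/3))) = 1 / (1 + k \<bullet> k)\<^sup>2"
    proof -
      have p: "1 + k \<bullet> k > 0" using k1 by simp
      have "(\<Prod>i\<in>(UNIV::3 set). (1 + k \<bullet> k) powr (- (2/3))) = ((1 + k \<bullet> k) powr (- (2/3))) ^ 3" by simp
      also have "\<dots> = (1 + k \<bullet> k) powr (- 2)" using p by (simp add: powr_power)
      also have "\<dots> = 1 / (1 + k \<bullet> k)\<^sup>2" using p by (simp add: powr_minus divide_inverse)
      finally show ?thesis .
    qed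
    moreover have "1 / (k \<bullet> k)\<^sup>2 \<le> 4 * (1 / (1 + k \<bullet> k)\<^sup>2)"
    proof -
      have "(1 + k \<bullet> k)\<^sup>2 \<le> (2 * (k \<bullet> k))\<^sup>2" using k1 by (intro power_mono) auto
      also have "\<dots> = 4 * (k \<bullet> k)\<^sup>2" by (simp add: power_mult_distrib)
      finally have "(1 + k \<bullet> k)\<^sup>2 \<le> 4 * (k \<bullet> k)\<^sup>2" .
      moreover have "0 < (k \<bullet> k)\<^sup>2" "0 < (1 + k \<bullet> k)\<^sup>2" using k1 by auto
      ultimately show ?thesis by (simp add: field_simps)
    qed
    ultimately show ?thesis by linarith
  qed
  have "(\<Sum>k\<in>frequencies N. 1 / (k \<bullet> k)\<^sup>2) \<le> 4 * S ^ 3" for N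
  proof -
    let ?E = "PiE (UNIV :: 3 set) (\<lambda>_. A N)"
    have fE: "finite ?E" using fA by (intro finite_PiE) auto
    have sub: "frequencies N \<subseteq> (\<lambda>f. \<chi> i. f i) ` ?E"
    proof
      fix k assume k: "k \<in> frequencies N"
      have "k $ i \<in> A N" for i
      proof -
        have ki: "k $ i \<in> \<int>" "\<bar>k $ i\<bar> \<le> real N" using k by (auto simp: frequencies_def lattice_def)
        then obtain n where n: "k $ i = of_int n" by (auto elim: Ints_cases)
        have "\<bar>real_of_int n\<bar> \<le> real N" using ki(2) n by simp
        then have "n \<in> {- int N..int N}" by (simp, linarith)
        then show ?thesis using n unfolding A_def by (intro image_eqI)
      qed
      then have "(\<lambda>i. k $ i) \<in> ?E" by auto
      moreover have "k = (\<chi> i. (\<lambda>i. k $ i) i)" by simp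
      ultimately show "k \<in> (\<lambda>f. \<chi> i. f i) ` ?E" by blast
    qed
    have "(\<Sum>k\<in>frequencies N. 1 / (k \<bullet> k)\<^sup>2) \<le> (\<Sum>k\<in>frequencies N. 4 * (\<Prod>i\<in>UNIV. g (k $ i)))"
      by (intro sum_mono prod)
    also have "\<dots> \<le> (\<Sum>k\<in>(\<lambda>f. \<chi> i. f i) ` ?E. 4 * (\<Prod>i\<in>UNIV. g (k $ i)))"
      using fE less_imp_le[OF g0] by (intro sum_mono2 sub) (auto intro: prod_nonneg)
    also have "\<dots> = (\<Sum>f\<in>?E. 4 * (\<Prod>i\<in>UNIV. g (f i)))"
      by (subst sum.reindex) (auto simp: inj_on_def vec_eq_iff fun_eq_iff)
    also have "\<dots> = 4 * (\<Prod>i\<in>(UNIV::3 set). \<Sum>a\<in>A N. g a)"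
      by (subst prod_sum_PiE) (auto simp: fA sum_distrib_left)
    also have "\<dots> = 4 * (\<Sum>a\<in>A N. g a) ^ 3" by simp
    also have "\<dots> \<le> 4 * S ^ 3"
      using SA less_imp_le[OF g0] by (intro mult_left_mono power_mono sum_nonneg) auto
    finally show ?thesis .
  qed
  then show ?thesis by blast
qed

lemma eigenvalue_tail:
  assumes e: "e > 0"
  obtains N0 where "\<And>N. (\<Sum>m\<in>modes N - modes N0. 1 / (eigenvalue m)\<^sup>2) \<le> e"
proof -
  define S where "S N = (\<Sum>m\<in>modes N. 1 / (eigenvalue m)\<^sup>2)" for N
  obtain B where B: "\<And>N. (\<Sum>k\<in>frequencies N. 1 / (k \<bullet> k)\<^sup>2) \<le> B" using lattice_sum_bounded by blast
  \<comment> \<open>There are six modes for each frequency.\<close>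
  have bound: "S N \<le> 6 * B" for N
  proof -
    have "S N = (\<Sum>k\<in>frequencies N. \<Sum>p\<in>UNIV. 1 / (eigenvalue (k, p :: 3 \<times> bool))\<^sup>2)"
      unfolding S_def modes_def by (subst sum.cartesian_product) (simp add: case_prod_beta)
    also have "\<dots> \<le> (\<Sum>k\<in>frequencies N. \<Sum>p\<in>(UNIV :: (3 \<times> bool) set). 1 / (k \<bullet> k)\<^sup>2)"
    proof (intro sum_mono)
      fix k and p :: "3 \<times> bool" assume k: "k \<in> frequencies N"
      have "k \<bullet> k > 0" using k by (simp add: frequencies_def)
      moreover have "3 * 3 \<le> pi * pi" using pi_gt3 by (intro mult_mono) auto
      then have "1 * (k \<bullet> k) \<le> 4 * pi\<^sup>2 * (k \<bullet> k)" by (intro mult_right_mono) (auto simp: power2_eq_square)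
      ultimately have "(k \<bullet> k)\<^sup>2 \<le> (eigenvalue (k, p))\<^sup>2" "0 < (k \<bullet> k)\<^sup>2"
        by (auto simp: eigenvalue_def intro!: power_mono)
      moreover from this have "0 < (eigenvalue (k, p))\<^sup>2" by linarith
      ultimately show "1 / (eigenvalue (k, p))\<^sup>2 \<le> 1 / (k \<bullet> k)\<^sup>2"
        by (intro divide_left_mono mult_pos_pos) auto
    qed
    also have "\<dots> = 6 * (\<Sum>k\<in>frequencies N. 1 / (k \<bullet> k)\<^sup>2)"
      by (simp add: sum_distrib_left card_cartesian_product UNIV_Times_UNIV[symmetric] del: UNIV_Times_UNIV)
    also have "\<dots> \<le> 6 * B" using B by simp
    finally show ?thesis .
  qed
  have mono: "incseq S"
    unfolding S_def by (intro incseq_SucI sum_mono2 finite_modes modes_mono) auto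
  have "Bseq S"
    by (rule BseqI'[of _ "6 * B"]) (use bound in \<open>auto simp: S_def sum_nonneg\<close>)
  then have "convergent S" using mono by (intro Bseq_mono_convergent) (auto simp: incseq_def)
  then have "Cauchy S" by (rule convergent_Cauchy)
  then obtain N0 where N0: "\<And>m n. m \<ge> N0 \<Longrightarrow> n \<ge> N0 \<Longrightarrow> norm (S m - S n) < e"
    using e unfolding Cauchy_iff by blast
  show ?thesis
  proof (rule that[of N0])
    fix N
    have "(\<Sum>m\<in>modes N - modes N0. 1 / (eigenvalue m)\<^sup>2) \<le> (\<Sum>m\<in>modes (max N N0) - modes N0. 1 / (eigenvalue m)\<^sup>2)"
      using modes_mono[of N "max N N0"] by (intro sum_mono2) (auto simp: finite_modes)
    also have "\<dots> = S (max N N0) - S N0"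
      unfolding S_def by (intro sum_diff finite_modes modes_mono) simp
    also have "\<dots> \<le> e" using N0[of "max N N0" N0] by simp
    finally show "(\<Sum>m\<in>modes N - modes N0. 1 / (eigenvalue m)\<^sup>2) \<le> e" .
  qed
qed

lemma sum_abs_le_sqrt:
  fixes a b :: "'a \<Rightarrow> real"
  shows "(\<Sum>i\<in>I. \<bar>a i * b i\<bar>) \<le> sqrt (\<Sum>i\<in>I. (a i)\<^sup>2) * sqrt (\<Sum>i\<in>I. (b i)\<^sup>2)"
  using L2_set_mult_ineq[of "\<lambda>i. a i" "\<lambda>i. b i" I] by (simp add: L2_set_def abs_mult)

text \<open>
  The supremum is at most the sum of the absolute coefficients. Beyond a fixed frequency
  Cauchy-Schwarz with the weights \<open>1 / eigenvalue\<close> gives the second-order norm with a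
  small factor, because \<open>eigenvalue^(-2)\<close> is summable in dimension three; the
  finitely many low modes are controlled by the \<open>L2\<close> norm.
\<close>

theorem Agmon_truncation:
  assumes e: "e > 0"
  obtains D where "D > 0"
    "\<And>N h x. norm (truncation_field N h x) \<le>
       e * sqrt (\<Sum>m\<in>modes N. (eigenvalue m)\<^sup>2 * (mode_coeff h m)\<^sup>2) + D * norm h"
proof -
  have "e\<^sup>2 > 0" using e by simp
  then obtain N0 where N0: "\<And>N. (\<Sum>m\<in>modes N - modes N0. 1 / (eigenvalue m)\<^sup>2) \<le> e\<^sup>2"
    using eigenvalue_tail by blast
  define D where "D = sqrt (real (card (modes N0))) + 1"
  show ?thesis
  proof (rule that[of D])
    show "D > 0" by (simp add: D_def add_nonneg_pos)
    fix N h x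
    let ?c = "mode_coeff h"
    have c2: "(\<Sum>m\<in>modes N. (?c m)\<^sup>2) \<le> (norm h)\<^sup>2"
      using norm_of_V_truncation_le[of N h] unfolding norm_of_V_truncation[symmetric] by (intro power_mono) auto
    have "norm (truncation_field N h x) \<le> (\<Sum>m\<in>modes N. norm (?c m *\<^sub>R mode_field m x))"
      unfolding truncation_field_def by (rule norm_sum)
    also have "\<dots> \<le> (\<Sum>m\<in>modes N. \<bar>?c m\<bar>)"
      by (intro sum_mono) (simp add: mult_left_le norm_mode_field_le)
    also have "\<dots> = (\<Sum>m\<in>modes N - modes N0. \<bar>?c m\<bar>) + (\<Sum>m\<in>modes N \<inter> modes N0. \<bar>?c m\<bar>)"
      using sum.Int_Diff[OF finite_modes, of "\<lambda>m. \<bar>?c m\<bar>" N "modes N0"] by simp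
    also have "(\<Sum>m\<in>modes N - modes N0. \<bar>?c m\<bar>) \<le> e * sqrt (\<Sum>m\<in>modes N. (eigenvalue m)\<^sup>2 * (?c m)\<^sup>2)"
    proof -
      have "(\<Sum>m\<in>modes N - modes N0. \<bar>?c m\<bar>) = (\<Sum>m\<in>modes N - modes N0. \<bar>(1 / eigenvalue m) * (eigenvalue m * ?c m)\<bar>)"
        using eigenvalue_ge_1 by (intro sum.cong refl) force
      also have "\<dots> \<le> sqrt (\<Sum>m\<in>modes N - modes N0. (1 / eigenvalue m)\<^sup>2) * sqrt (\<Sum>m\<in>modes N - modes N0. (eigenvalue m * ?c m)\<^sup>2)"
        by (rule sum_abs_le_sqrt)
      also have "\<dots> \<le> e * sqrt (\<Sum>m\<in>modes N. (eigenvalue m)\<^sup>2 * (?c m)\<^sup>2)"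
      proof (rule mult_mono)
        show "sqrt (\<Sum>m\<in>modes N - modes N0. (1 / eigenvalue m)\<^sup>2) \<le> e"
          using N0[of N] e by (intro real_le_lsqrt) (auto simp: power_divide sum_nonneg)
        have "(\<Sum>m\<in>modes N - modes N0. (eigenvalue m * ?c m)\<^sup>2) \<le> (\<Sum>m\<in>modes N. (eigenvalue m * ?c m)\<^sup>2)"
          by (intro sum_mono2 finite_modes) auto
        then show "sqrt (\<Sum>m\<in>modes N - modes N0. (eigenvalue m * ?c m)\<^sup>2) \<le> sqrt (\<Sum>m\<in>modes N. (eigenvalue m)\<^sup>2 * (?c m)\<^sup>2)"
          by (simp add: power_mult_distrib)
      qed (use e in \<open>auto simp: sum_nonneg\<close>)
      finally show ?thesis .
    qed
    also have "(\<Sum>m\<in>modes N \<inter> modes N0. \<bar>?c m\<bar>) \<le> D * norm h"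
    proof -
      have "(\<Sum>m\<in>modes N \<inter> modes N0. \<bar>1 * ?c m\<bar>) \<le> sqrt (\<Sum>m\<in>modes N \<inter> modes N0. 1\<^sup>2) * sqrt (\<Sum>m\<in>modes N \<inter> modes N0. (?c m)\<^sup>2)"
        by (rule sum_abs_le_sqrt)
      also have "\<dots> \<le> D * norm h"
      proof (rule mult_mono)
        have "card (modes N \<inter> modes N0) \<le> card (modes N0)" by (intro card_mono finite_modes) auto
        then have le: "sqrt (real (card (modes N \<inter> modes N0))) \<le> sqrt (real (card (modes N0)))" by simp
        have eq: "(\<Sum>m\<in>modes N \<inter> modes N0. 1\<^sup>2) = real (card (modes N \<inter> modes N0))" by simp
        show "sqrt (\<Sum>m\<in>modes N \<inter> modes N0. 1\<^sup>2) \<le> D" unfolding D_def eq using le by linarith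
        have "(\<Sum>m\<in>modes N \<inter> modes N0. (?c m)\<^sup>2) \<le> (\<Sum>m\<in>modes N. (?c m)\<^sup>2)"
          by (intro sum_mono2 finite_modes) auto
        then show "sqrt (\<Sum>m\<in>modes N \<inter> modes N0. (?c m)\<^sup>2) \<le> norm h"
          using c2 by (intro real_le_lsqrt) (auto simp: sum_nonneg)
      qed (auto simp: D_def sum_nonneg)
      finally show ?thesis by simp
    qed
    finally show "norm (truncation_field N h x) \<le>
       e * sqrt (\<Sum>m\<in>modes N. (eigenvalue m)\<^sup>2 * (mode_coeff h m)\<^sup>2) + D * norm h" by simp
  qed
qed

section \<open>The trilinear form on trigonometric polynomials\<close>

definition advection_form :: "(real^3 \<Rightarrow> real^3) \<Rightarrow> (real^3 \<Rightarrow> real^3) \<Rightarrow> (real^3 \<Rightarrow> real^3) \<Rightarrow> real" where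
  "advection_form \<phi> \<psi> \<xi> = to_L2 (advection \<phi> \<psi>) \<bullet> to_L2 \<xi>"

lemma advection_continuous:
  assumes "\<phi> \<in> \<V>" "\<psi> \<in> \<V>" shows "continuous_on UNIV (advection \<phi> \<psi>)"
  unfolding advection_def[abs_def]
  by (intro continuous_intros trig_poly_continuous trig_poly_pd_continuous \<V>_trig assms)

lemma advection_square_integrable:
  "\<phi> \<in> \<V> \<Longrightarrow> \<psi> \<in> \<V> \<Longrightarrow> square_integrable (advection \<phi> \<psi>)"
  by (intro square_integrable_continuous advection_continuous)

lemma advection_form_integral:
  assumes "\<phi> \<in> \<V>" "\<psi> \<in> \<V>" "\<xi> \<in> \<V>"
  shows "advection_form \<phi> \<psi> \<xi> = (\<integral>x. advection \<phi> \<psi> x \<bullet> \<xi> x \<partial>torus)"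
  unfolding advection_form_def
  by (subst inner_L2.abs_eq) (auto intro: advection_square_integrable \<V>_square_integrable assms)

text \<open>
  The sum of the two forms is the integral of the divergence of \<open>(\<psi> . \<xi>)
  \<phi>\<close>, since \<open>\<phi>\<close> is divergence free.
\<close>

lemma advection_form_antisymmetric:
  assumes "\<phi> \<in> \<V>" "\<psi> \<in> \<V>" "\<xi> \<in> \<V>"
  shows "advection_form \<phi> \<psi> \<xi> = - advection_form \<phi> \<xi> \<psi>"
proof -
  note t = assms[THEN \<V>_trig]
  note d = t[THEN trig_poly_differentiable]
  note c = t[THEN trig_poly_continuous] t[THEN trig_poly_pd_continuous]
  let ?q = "\<lambda>x. \<psi> x \<bullet> \<xi> x"
  have dq: "?q differentiable at x" for x using d by (intro differentiable_inner)
  have pdq: "pd j ?q x = \<psi> x \<bullet> pd j \<xi> x + pd j \<psi> x \<bullet> \<xi> x" for j x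
    using pd_eqI[OF has_derivative_inner[OF d(2)[unfolded frechet_derivative_works] d(3)[unfolded frechet_derivative_works]], of j]
    by (simp add: pd_def)
  have eq: "pd j (\<lambda>x. ?q x *\<^sub>R \<phi> x) = (\<lambda>x. ?q x *\<^sub>R pd j \<phi> x + pd j ?q x *\<^sub>R \<phi> x)" for j
    by (intro ext pd_scaleR dq d)
  have div: "divergence (\<lambda>x. ?q x *\<^sub>R \<phi> x) x = advection \<phi> \<psi> x \<bullet> \<xi> x + advection \<phi> \<xi> x \<bullet> \<psi> x" for x
  proof -
    have "divergence (\<lambda>x. ?q x *\<^sub>R \<phi> x) x = ?q x * divergence \<phi> x + (\<Sum>j\<in>UNIV. pd j ?q x * \<phi> x $ j)"
      unfolding divergence_def eq by (simp add: sum.distrib sum_distrib_left)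
    also have "divergence \<phi> x = 0" using assms by (simp add: \<V>_def)
    finally show ?thesis
      by (simp add: pdq advection_def inner_sum_left inner_sum_right sum.distrib inner_commute algebra_simps)
  qed
  have "(\<integral>x. divergence (\<lambda>x. ?q x *\<^sub>R \<phi> x) x \<partial>torus) = 0"
  proof (rule torus_integral_divergence_zero)
    show "(\<lambda>x. ?q x *\<^sub>R \<phi> x) differentiable at x" for x using dq d by (intro differentiable_scaleR)
    show "continuous_on UNIV (pd j (\<lambda>x. ?q x *\<^sub>R \<phi> x))" for j
      unfolding eq pdq[abs_def] by (intro continuous_intros c)
    show "periodic (\<lambda>x. ?q x *\<^sub>R \<phi> x)"
      using t[THEN trig_poly_periodic] by (simp add: periodic_def)
  qed
  moreover have "(\<integral>x. advection \<phi> \<psi> x \<bullet> \<xi> x + advection \<phi> \<xi> x \<bullet> \<psi> x \<partial>torus) =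
      (\<integral>x. advection \<phi> \<psi> x \<bullet> \<xi> x \<partial>torus) + (\<integral>x. advection \<phi> \<xi> x \<bullet> \<psi> x \<partial>torus)"
    by (intro Bochner_Integration.integral_add integrable_torus_continuous continuous_intros advection_continuous c assms)
  ultimately show ?thesis by (simp add: div advection_form_integral assms)
qed

lemma advection_form_abs_le:
  assumes "\<phi> \<in> \<V>" "\<psi> \<in> \<V>" "\<xi> \<in> \<V>"
  shows "\<bar>advection_form \<phi> \<psi> \<xi>\<bar> \<le> (\<Sum>j\<in>UNIV. \<integral>x. norm (\<phi> x) * norm (pd j \<psi> x) * norm (\<xi> x) \<partial>torus)"
proof -
  note t = assms[THEN \<V>_trig]
  note c = t[THEN trig_poly_continuous] t[THEN trig_poly_pd_continuous]
  have "\<bar>advection_form \<phi> \<psi> \<xi>\<bar> \<le> (\<integral>x. \<bar>advection \<phi> \<psi> x \<bullet> \<xi> x\<bar> \<partial>torus)"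
    unfolding advection_form_integral[OF assms] by (rule integral_abs_bound)
  also have "\<dots> \<le> (\<integral>x. (\<Sum>j\<in>UNIV. norm (\<phi> x) * norm (pd j \<psi> x) * norm (\<xi> x)) \<partial>torus)"
  proof (rule integral_mono)
    show "integrable torus (\<lambda>x. \<bar>advection \<phi> \<psi> x \<bullet> \<xi> x\<bar>)"
      by (intro integrable_torus_continuous continuous_intros advection_continuous c assms)
    show "integrable torus (\<lambda>x. \<Sum>j\<in>UNIV. norm (\<phi> x) * norm (pd j \<psi> x) * norm (\<xi> x))"
      by (intro integrable_torus_continuous continuous_intros c)
    fix x
    have "norm (advection \<phi> \<psi> x) \<le> (\<Sum>j\<in>UNIV. norm (\<phi> x $ j *\<^sub>R pd j \<psi> x))"
      unfolding advection_def by (rule norm_sum)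
    also have "\<dots> \<le> (\<Sum>j\<in>UNIV. norm (\<phi> x) * norm (pd j \<psi> x))"
      by (intro sum_mono) (auto intro!: mult_right_mono component_le_norm_cart)
    finally have "norm (advection \<phi> \<psi> x) * norm (\<xi> x) \<le> (\<Sum>j\<in>UNIV. norm (\<phi> x) * norm (pd j \<psi> x)) * norm (\<xi> x)"
      by (intro mult_right_mono) auto
    then show "\<bar>advection \<phi> \<psi> x \<bullet> \<xi> x\<bar> \<le> (\<Sum>j\<in>UNIV. norm (\<phi> x) * norm (pd j \<psi> x) * norm (\<xi> x))"
      using Cauchy_Schwarz_ineq2[of "advection \<phi> \<psi> x" "\<xi> x"] by (simp add: sum_distrib_right)
  qed
  also have "\<dots> = (\<Sum>j\<in>UNIV. \<integral>x. norm (\<phi> x) * norm (pd j \<psi> x) * norm (\<xi> x) \<partial>torus)"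
    by (intro Bochner_Integration.integral_sum integrable_torus_continuous continuous_intros c)
  finally show ?thesis .
qed

text \<open>
  Hoelder's inequality with the exponents 4, 4 and 2.
\<close>

lemma torus_integral_triple:
  fixes f g h :: "real^3 \<Rightarrow> real^3"
  assumes c: "continuous_on UNIV f" "continuous_on UNIV g" "continuous_on UNIV h"
  shows "(\<integral>x. norm (f x) * norm (g x) * norm (h x) \<partial>torus) \<le>
    sqrt (L4_norm_square f * L4_norm_square g) * sqrt (\<integral>x. (norm (h x))\<^sup>2 \<partial>torus)"
proof -
  let ?I = "\<integral>x. norm (f x) * norm (g x) * norm (h x) \<partial>torus"
  let ?J = "\<integral>x. (norm (f x) * norm (g x))\<^sup>2 \<partial>torus"
  have "?I\<^sup>2 \<le> ?J * (\<integral>x. (norm (h x))\<^sup>2 \<partial>torus)"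
    by (intro torus_integral_Cauchy_Schwarz continuous_intros c)
  moreover have "?J \<le> L4_norm_square f * L4_norm_square g"
  proof (rule power2_le_imp_le)
    have "?J = (\<integral>x. (norm (f x))\<^sup>2 * (norm (g x))\<^sup>2 \<partial>torus)" by (simp add: power_mult_distrib)
    then have "?J\<^sup>2 \<le> (\<integral>x. ((norm (f x))\<^sup>2)\<^sup>2 \<partial>torus) * (\<integral>x. ((norm (g x))\<^sup>2)\<^sup>2 \<partial>torus)"
      by (simp only:) (intro torus_integral_Cauchy_Schwarz continuous_intros c)
    also have "\<dots> = (\<integral>x. norm (f x) ^ 4 \<partial>torus) * (\<integral>x. norm (g x) ^ 4 \<partial>torus)" by simp
    also have "\<dots> = (L4_norm_square f * L4_norm_square g)\<^sup>2"
      by (simp add: L4_norm_square_def power_mult_distrib integral_nonneg_AE)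
    finally show "?J\<^sup>2 \<le> (L4_norm_square f * L4_norm_square g)\<^sup>2" .
  qed (simp add: L4_norm_square_nonneg)
  moreover have "0 \<le> (\<integral>x. (norm (h x))\<^sup>2 \<partial>torus)" by (rule integral_nonneg_AE) simp
  ultimately have "?I\<^sup>2 \<le> (L4_norm_square f * L4_norm_square g) * (\<integral>x. (norm (h x))\<^sup>2 \<partial>torus)"
    by (meson mult_right_mono order_trans)
  then show ?thesis unfolding real_sqrt_mult[symmetric] by (rule real_le_rsqrt)
qed

lemma sqrt_norm_to_L2: "\<phi> \<in> \<V> \<Longrightarrow> sqrt (\<integral>x. (norm (\<phi> x))\<^sup>2 \<partial>torus) = norm (to_L2 \<phi>)"
  by (simp add: norm_to_L2[symmetric] \<V>_square_integrable)

lemma sqrt_norm_pd_le: "\<phi> \<in> \<V> \<Longrightarrow> sqrt (\<integral>x. (norm (pd j \<phi> x))\<^sup>2 \<partial>torus) \<le> norm (to_V (to_L2 \<phi>))"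
  using norm_pd_le[of \<phi> j]
  by (simp add: norm_to_L2[symmetric] trig_poly_square_integrable trig_poly_pd \<V>_trig)

text \<open>
  For the energy estimates: the gradient falls on the middle argument, taken in \<open>L2\<close>.
\<close>

lemma advection_form_le_L4:
  assumes "\<phi> \<in> \<V>" "\<psi> \<in> \<V>" "\<xi> \<in> \<V>"
  shows "\<bar>advection_form \<phi> \<psi> \<xi>\<bar> \<le> 3 * sqrt (L4_norm_square \<phi> * L4_norm_square \<xi>) * norm (to_V (to_L2 \<psi>))"
proof -
  note t = assms[THEN \<V>_trig]
  note c = t[THEN trig_poly_continuous] t[THEN trig_poly_pd_continuous]
  have "(\<integral>x. norm (\<phi> x) * norm (pd j \<psi> x) * norm (\<xi> x) \<partial>torus) \<le>
      sqrt (L4_norm_square \<phi> * L4_norm_square \<xi>) * norm (to_V (to_L2 \<psi>))" for j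
  proof -
    have "(\<integral>x. norm (\<phi> x) * norm (pd j \<psi> x) * norm (\<xi> x) \<partial>torus) = (\<integral>x. norm (\<phi> x) * norm (\<xi> x) * norm (pd j \<psi> x) \<partial>torus)"
      by (simp add: mult_ac)
    also have "\<dots> \<le> sqrt (L4_norm_square \<phi> * L4_norm_square \<xi>) * sqrt (\<integral>x. (norm (pd j \<psi> x))\<^sup>2 \<partial>torus)"
      by (rule torus_integral_triple) (intro c)+
    also have "\<dots> \<le> sqrt (L4_norm_square \<phi> * L4_norm_square \<xi>) * norm (to_V (to_L2 \<psi>))"
      by (intro mult_left_mono sqrt_norm_pd_le assms) (simp add: L4_norm_square_nonneg)
    finally show ?thesis .
  qed
  then have "(\<Sum>j\<in>UNIV. \<integral>x. norm (\<phi> x) * norm (pd j \<psi> x) * norm (\<xi> x) \<partial>torus) \<le>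
      (\<Sum>j\<in>(UNIV :: 3 set). sqrt (L4_norm_square \<phi> * L4_norm_square \<xi>) * norm (to_V (to_L2 \<psi>)))"
    by (intro sum_mono)
  then show ?thesis using advection_form_abs_le[OF assms] by simp
qed

lemma advection_form_le:
  assumes "\<phi> \<in> \<V>" "\<psi> \<in> \<V>" "\<xi> \<in> \<V>"
  shows "\<bar>advection_form \<phi> \<psi> \<xi>\<bar> \<le> 18 * norm (to_V (to_L2 \<phi>)) * norm (to_V (to_L2 \<psi>)) * norm (to_V (to_L2 \<xi>))"
proof -
  have "sqrt (L4_norm_square \<phi> * L4_norm_square \<xi>) \<le> 6 * norm (to_V (to_L2 \<phi>)) * norm (to_V (to_L2 \<xi>))"
  proof (rule real_le_lsqrt)
    have "L4_norm_square \<phi> * L4_norm_square \<xi> \<le> (6 * (norm (to_V (to_L2 \<phi>)))\<^sup>2) * (6 * (norm (to_V (to_L2 \<xi>)))\<^sup>2)"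
      by (intro mult_mono L4_norm_square_le assms) (auto simp: L4_norm_square_nonneg)
    then show "L4_norm_square \<phi> * L4_norm_square \<xi> \<le> (6 * norm (to_V (to_L2 \<phi>)) * norm (to_V (to_L2 \<xi>)))\<^sup>2"
      by (simp add: power_mult_distrib)
  qed auto
  then have "3 * sqrt (L4_norm_square \<phi> * L4_norm_square \<xi>) * norm (to_V (to_L2 \<psi>)) \<le>
    3 * (6 * norm (to_V (to_L2 \<phi>)) * norm (to_V (to_L2 \<xi>))) * norm (to_V (to_L2 \<psi>))"
    by (intro mult_right_mono mult_left_mono) auto
  then show ?thesis using advection_form_le_L4[OF assms] by (simp add: mult_ac)
qed

text \<open>
  For a first argument with two derivatives in \<open>L2\<close>, which is bounded by the Agmon
  inequality.
\<close>

lemma advection_form_le_sup: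
  assumes "\<phi> \<in> \<V>" "\<psi> \<in> \<V>" "\<xi> \<in> \<V>" and S: "\<And>x. norm (\<phi> x) \<le> S"
  shows "\<bar>advection_form \<phi> \<psi> \<xi>\<bar> \<le> 3 * S * norm (to_V (to_L2 \<psi>)) * norm (to_L2 \<xi>)"
proof -
  note t = assms(1-3)[THEN \<V>_trig]
  note c = t[THEN trig_poly_continuous] t[THEN trig_poly_pd_continuous]
  have S0: "0 \<le> S" using S[of 0] norm_ge_zero order_trans by blast
  have "(\<integral>x. norm (\<phi> x) * norm (pd j \<psi> x) * norm (\<xi> x) \<partial>torus) \<le> S * (norm (to_V (to_L2 \<psi>)) * norm (to_L2 \<xi>))" for j
  proof -
    have "(\<integral>x. norm (\<phi> x) * norm (pd j \<psi> x) * norm (\<xi> x) \<partial>torus) \<le> (\<integral>x. S * (norm (pd j \<psi> x) * norm (\<xi> x)) \<partial>torus)"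
      by (intro integral_mono integrable_torus_continuous continuous_intros c)
        (simp add: mult.assoc mult_right_mono S)
    also have "\<dots> = S * (\<integral>x. norm (pd j \<psi> x) * norm (\<xi> x) \<partial>torus)" by simp
    also have "(\<integral>x. norm (pd j \<psi> x) * norm (\<xi> x) \<partial>torus) \<le>
        sqrt (\<integral>x. (norm (pd j \<psi> x))\<^sup>2 \<partial>torus) * sqrt (\<integral>x. (norm (\<xi> x))\<^sup>2 \<partial>torus)"
      unfolding real_sqrt_mult[symmetric]
      by (intro real_le_rsqrt torus_integral_Cauchy_Schwarz continuous_intros c)
    also have "\<dots> \<le> norm (to_V (to_L2 \<psi>)) * norm (to_L2 \<xi>)"
      unfolding sqrt_norm_to_L2[OF assms(3)] by (intro mult_right_mono sqrt_norm_pd_le assms) auto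
    finally show ?thesis using S0 by (simp add: mult_left_mono)
  qed
  then have "(\<Sum>j\<in>UNIV. \<integral>x. norm (\<phi> x) * norm (pd j \<psi> x) * norm (\<xi> x) \<partial>torus) \<le>
      (\<Sum>j\<in>(UNIV :: 3 set). S * (norm (to_V (to_L2 \<psi>)) * norm (to_L2 \<xi>)))"
    by (intro sum_mono)
  then show ?thesis using advection_form_abs_le[OF assms(1-3)] by (simp add: mult_ac)
qed

text \<open>
  For a middle argument with two derivatives in \<open>L2\<close>, whose gradient is in
  \<open>L4\<close>.
\<close>

lemma advection_form_le_L4_gradient:
  assumes "\<phi> \<in> \<V>" "\<psi> \<in> \<V>" "\<xi> \<in> \<V>"
  shows "\<bar>advection_form \<phi> \<psi> \<xi>\<bar> \<le> (\<Sum>j\<in>UNIV. sqrt (L4_norm_square \<phi> * L4_norm_square (pd j \<psi>))) * norm (to_L2 \<xi>)"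
proof -
  note t = assms[THEN \<V>_trig]
  note c = t[THEN trig_poly_continuous] t[THEN trig_poly_pd_continuous]
  have "(\<integral>x. norm (\<phi> x) * norm (pd j \<psi> x) * norm (\<xi> x) \<partial>torus) \<le>
      sqrt (L4_norm_square \<phi> * L4_norm_square (pd j \<psi>)) * norm (to_L2 \<xi>)" for j
    unfolding sqrt_norm_to_L2[OF assms(3), symmetric] by (rule torus_integral_triple) (intro c)+
  then have "(\<Sum>j\<in>UNIV. \<integral>x. norm (\<phi> x) * norm (pd j \<psi> x) * norm (\<xi> x) \<partial>torus) \<le>
      (\<Sum>j\<in>UNIV. sqrt (L4_norm_square \<phi> * L4_norm_square (pd j \<psi>)) * norm (to_L2 \<xi>))"
    by (intro sum_mono)
  then show ?thesis using advection_form_abs_le[OF assms] by (simp add: sum_distrib_right)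
qed

text \<open>
  The functional that \<open>B_op\<close> has to assign to a pair of trigonometric polynomials.
\<close>

definition advection_dual :: "(real^3 \<Rightarrow> real^3) \<Rightarrow> (real^3 \<Rightarrow> real^3) \<Rightarrow> (V \<Rightarrow>\<^sub>L real)" where
  "advection_dual \<phi> \<psi> = to_dual (Leray (to_L2 (advection \<phi> \<psi>)))"

lemma advection_dual_apply: "blinfun_apply (advection_dual \<phi> \<psi>) v = to_L2 (advection \<phi> \<psi>) \<bullet> of_V v"
  by (simp add: advection_dual_def to_dual_apply inner_Leray of_V_in_H)

lemma advection_dual_field: "\<xi> \<in> \<V> \<Longrightarrow> blinfun_apply (advection_dual \<phi> \<psi>) (to_V (to_L2 \<xi>)) = advection_form \<phi> \<psi> \<xi>"
  by (simp add: advection_dual_apply of_V_to_V advection_form_def)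

text \<open>
  The estimate of the form is known for a trigonometric polynomial as third argument only; the
  functional itself is already continuous on \<open>V\<close>, so truncation extends it.
\<close>

lemma norm_advection_dual_le:
  assumes "\<phi> \<in> \<V>" "\<psi> \<in> \<V>"
  shows "norm (advection_dual \<phi> \<psi>) \<le> 18 * norm (to_V (to_L2 \<phi>)) * norm (to_V (to_L2 \<psi>))"
proof (rule norm_blinfun_bound)
  fix v
  let ?b = "18 * norm (to_V (to_L2 \<phi>)) * norm (to_V (to_L2 \<psi>))"
  show "norm (blinfun_apply (advection_dual \<phi> \<psi>) v) \<le> ?b * norm v"
  proof (rule LIMSEQ_le)
    show "(\<lambda>N. norm (blinfun_apply (advection_dual \<phi> \<psi>) (truncation N (of_V v)))) \<longlonglongrightarrow> norm (blinfun_apply (advection_dual \<phi> \<psi>) v)"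
      by (intro tendsto_norm blinfun.tendsto tendsto_const truncation_tendsto_V)
    show "(\<lambda>N. ?b * norm (truncation N (of_V v))) \<longlonglongrightarrow> ?b * norm v"
      by (intro tendsto_mult tendsto_norm tendsto_const truncation_tendsto_V)
    show "\<exists>N. \<forall>n\<ge>N. norm (blinfun_apply (advection_dual \<phi> \<psi>) (truncation n (of_V v))) \<le> ?b * norm (truncation n (of_V v))"
      unfolding truncation_eq_to_V
      using advection_form_le[OF assms truncation_field_in_V] by (simp add: advection_dual_field truncation_field_in_V)
  qed
qed simp

lemma advection_dual_add_left:
  assumes "\<phi> \<in> \<V>" "\<phi>' \<in> \<V>" "\<psi> \<in> \<V>"
  shows "advection_dual (\<lambda>x. \<phi> x + \<phi>' x) \<psi> = advection_dual \<phi> \<psi> + advection_dual \<phi>' \<psi>"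
proof (rule blinfun_eqI)
  fix v
  have "advection (\<lambda>x. \<phi> x + \<phi>' x) \<psi> = (\<lambda>x. advection \<phi> \<psi> x + advection \<phi>' \<psi> x)"
    by (auto simp: advection_def scaleR_add_left sum.distrib)
  then show "blinfun_apply (advection_dual (\<lambda>x. \<phi> x + \<phi>' x) \<psi>) v = blinfun_apply (advection_dual \<phi> \<psi> + advection_dual \<phi>' \<psi>) v"
    by (simp add: advection_dual_apply to_L2_add advection_square_integrable assms inner_add_left blinfun.add_left)
qed

lemma advection_dual_add_right:
  assumes "\<phi> \<in> \<V>" "\<psi>' \<in> \<V>" "\<psi> \<in> \<V>"
  shows "advection_dual \<phi> (\<lambda>x. \<psi> x + \<psi>' x) = advection_dual \<phi> \<psi> + advection_dual \<phi> \<psi>'"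
proof (rule blinfun_eqI)
  fix v
  have "advection \<phi> (\<lambda>x. \<psi> x + \<psi>' x) = (\<lambda>x. advection \<phi> \<psi> x + advection \<phi> \<psi>' x)"
    using assms[THEN \<V>_trig, THEN trig_poly_differentiable]
    by (auto simp: advection_def pd_add scaleR_add_right sum.distrib)
  then show "blinfun_apply (advection_dual \<phi> (\<lambda>x. \<psi> x + \<psi>' x)) v = blinfun_apply (advection_dual \<phi> \<psi> + advection_dual \<phi> \<psi>') v"
    by (simp add: advection_dual_apply to_L2_add advection_square_integrable assms inner_add_left blinfun.add_left)
qed

lemma advection_dual_scaleR:
  assumes "\<phi> \<in> \<V>" "\<psi> \<in> \<V>"
  shows "advection_dual (\<lambda>x. c *\<^sub>R \<phi> x) \<psi> = c *\<^sub>R advection_dual \<phi> \<psi>"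
    "advection_dual \<phi> (\<lambda>x. c *\<^sub>R \<psi> x) = c *\<^sub>R advection_dual \<phi> \<psi>"
proof -
  have 1: "advection (\<lambda>x. c *\<^sub>R \<phi> x) \<psi> = (\<lambda>x. c *\<^sub>R advection \<phi> \<psi> x)"
    by (auto simp: advection_def scaleR_sum_right)
  have "pd j (\<lambda>x. c *\<^sub>R \<psi> x) x = c *\<^sub>R pd j \<psi> x" for j x
    using pd_scaleR[OF differentiable_const trig_poly_differentiable[OF \<V>_trig[OF assms(2)]], of j c x] by (simp add: pd_const)
  then have 2: "advection \<phi> (\<lambda>x. c *\<^sub>R \<psi> x) = (\<lambda>x. c *\<^sub>R advection \<phi> \<psi> x)"
    by (auto simp: advection_def scaleR_sum_right mult.commute)
  show "advection_dual (\<lambda>x. c *\<^sub>R \<phi> x) \<psi> = c *\<^sub>R advection_dual \<phi> \<psi>"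
    "advection_dual \<phi> (\<lambda>x. c *\<^sub>R \<psi> x) = c *\<^sub>R advection_dual \<phi> \<psi>"
    by (auto intro!: blinfun_eqI simp: 1 2 advection_dual_apply to_L2_scaleR advection_square_integrable assms blinfun.scaleR_left)
qed

section \<open>The Stokes operator and the bilinear operator on V\<close>

text \<open>
  Integration by parts against trigonometric polynomials, extended to \<open>w\<close> by
  truncation: both sides are continuous in \<open>w\<close>.
\<close>

lemma inner_Stokes:
  assumes v: "v \<in> Dom_A"
  shows "Stokes v \<bullet> of_V w = v \<bullet> w"
proof -
  have H: "of_V v \<in> H1" "wpd j (of_V v) \<in> H1" for j using v by (auto simp: Dom_A_def H2_def)
  let ?f = "\<Sum>j\<in>UNIV. wpd j (wpd j (of_V v))"
  have field: "- (?f \<bullet> to_L2 \<phi>) = v \<bullet> to_V (to_L2 \<phi>)" if \<phi>: "\<phi> \<in> \<V>" for \<phi>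
    using \<V>_trig[OF \<phi>]
    by (simp add: inner_sum_left wpd_integration_by_parts[OF H(2)] inner_V_def of_V_to_V[OF \<phi>] wpd_trig_poly sum_negf)
  have "- (?f \<bullet> of_V w) = v \<bullet> w"
  proof (rule LIMSEQ_unique)
    show "(\<lambda>N. - (?f \<bullet> of_V (truncation N (of_V w)))) \<longlonglongrightarrow> - (?f \<bullet> of_V w)"
      by (intro tendsto_minus tendsto_inner tendsto_const truncation_tendsto_H of_V_in_H)
    have "(\<lambda>N. v \<bullet> truncation N (of_V w)) \<longlonglongrightarrow> v \<bullet> w"
      by (intro tendsto_inner tendsto_const truncation_tendsto_V)
    moreover have "- (?f \<bullet> of_V (truncation N (of_V w))) = v \<bullet> truncation N (of_V w)" for N
      using field[OF truncation_field_in_V[of N "of_V w"]] by (simp only: of_V_truncation truncation_eq_to_V[symmetric])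
    ultimately show "(\<lambda>N. - (?f \<bullet> of_V (truncation N (of_V w)))) \<longlonglongrightarrow> v \<bullet> w" by (simp only:)
  qed
  then show ?thesis by (simp add: Stokes_def inner_Leray of_V_in_H)
qed

lemma truncation_Dom_A: "truncation N h \<in> Dom_A"
proof -
  have "wpd j (to_L2 (truncation_field N h)) \<in> H1" for j
    by (simp add: wpd_trig_poly trig_poly_H1 trig_poly_pd \<V>_trig truncation_field_in_V)
  then show ?thesis
    by (simp add: Dom_A_def H2_def of_V_truncation trig_poly_H1 \<V>_trig truncation_field_in_V)
qed

text \<open>
  The Riesz map of \<open>V\<close> has the defining property of the extended Stokes operator, and
  it is the only such map as truncations lie in the domain of the Stokes operator and approximate
  every element of \<open>V\<close>.
\<close>

theorem A_op_apply: "blinfun_apply (A_op u) v = u \<bullet> v"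
  and bounded_linear_A_op: "bounded_linear A_op"
proof -
  have Dom: "blinfun_inner_right u = to_dual (Stokes u)" if "u \<in> Dom_A" for u :: V
    by (rule blinfun_eqI) (simp add: to_dual_apply inner_Stokes[OF that])
  have "A_op = blinfun_inner_right"
    unfolding A_op_def
  proof (rule the_equality)
    show "bounded_linear (blinfun_inner_right :: V \<Rightarrow> V \<Rightarrow>\<^sub>L real) \<and> (\<forall>u\<in>Dom_A. blinfun_inner_right u = to_dual (Stokes u))"
      using Dom bounded_linear_blinfun_inner_right by blast
    fix A :: "V \<Rightarrow> V \<Rightarrow>\<^sub>L real"
    assume A: "bounded_linear A \<and> (\<forall>u\<in>Dom_A. A u = to_dual (Stokes u))"
    show "A = blinfun_inner_right"
    proof
      fix u
      have "(\<lambda>N. A (truncation N (of_V u))) \<longlonglongrightarrow> A u"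
        by (rule bounded_linear.tendsto[OF conjunct1[OF A] truncation_tendsto_V])
      moreover have "A (truncation N (of_V u)) = blinfun_inner_right (truncation N (of_V u))" for N
        using bspec[OF conjunct2[OF A] truncation_Dom_A] Dom[OF truncation_Dom_A] by simp
      moreover have "(\<lambda>N. blinfun_inner_right (truncation N (of_V u))) \<longlonglongrightarrow> blinfun_inner_right u"
        by (intro bounded_linear.tendsto[OF bounded_linear_blinfun_inner_right] truncation_tendsto_V)
      ultimately show "A u = blinfun_inner_right u" by (simp add: LIMSEQ_unique)
    qed
  qed
  then show "blinfun_apply (A_op u) v = u \<bullet> v" "bounded_linear A_op"
    by (simp_all add: bounded_linear_blinfun_inner_right)
qed

lemma truncation_field_add: "truncation_field N (f + g) = (\<lambda>x. truncation_field N f x + truncation_field N g x)"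
  and truncation_field_scaleR: "truncation_field N (c *\<^sub>R f) = (\<lambda>x. c *\<^sub>R truncation_field N f x)"
  by (auto simp: truncation_field_def mode_coeff_add mode_coeff_scaleR scaleR_add_left sum.distrib scaleR_sum_right)

abbreviation V_field :: "nat \<Rightarrow> V \<Rightarrow> real^3 \<Rightarrow> real^3" where
  "V_field N u \<equiv> truncation_field N (of_V u)"

lemma norm_V_field: "norm (to_V (to_L2 (V_field N u))) \<le> norm u"
  using norm_truncation_le[of N u] by (simp add: truncation_eq_to_V)

lemma norm_H_field: "norm (to_L2 (V_field N u)) \<le> norm (of_V u)"
  using norm_of_V_truncation_le[of N "of_V u"] by (simp add: of_V_truncation)

text \<open>
  Local Lipschitz continuity, from which the limit defining the extension exists.
\<close>

lemma norm_advection_dual_diff: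
  assumes "\<phi> \<in> \<V>" "\<psi> \<in> \<V>" "\<phi>' \<in> \<V>" "\<psi>' \<in> \<V>"
  shows "norm (advection_dual \<phi> \<psi> - advection_dual \<phi>' \<psi>') \<le>
    18 * (norm (to_V (to_L2 \<phi>) - to_V (to_L2 \<phi>')) * norm (to_V (to_L2 \<psi>))
      + norm (to_V (to_L2 \<phi>')) * norm (to_V (to_L2 \<psi>) - to_V (to_L2 \<psi>')))"
proof -
  define \<delta> where "\<delta> = (\<lambda>x. \<phi> x + (-1) *\<^sub>R \<phi>' x)"
  define \<epsilon> where "\<epsilon> = (\<lambda>x. \<psi> x + (-1) *\<^sub>R \<psi>' x)"
  have in_V: "\<delta> \<in> \<V>" "\<epsilon> \<in> \<V>" unfolding \<delta>_def \<epsilon>_def by (intro \<V>_add \<V>_scaleR assms)+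
  have d: "to_V (to_L2 \<delta>) = to_V (to_L2 \<phi>) - to_V (to_L2 \<phi>')" and e: "to_V (to_L2 \<epsilon>) = to_V (to_L2 \<psi>) - to_V (to_L2 \<psi>')"
  proof -
    have gen: "to_V (to_L2 (\<lambda>x. f x + (-1) *\<^sub>R g x)) = to_V (to_L2 f) - to_V (to_L2 g)" if fg: "f \<in> \<V>" "g \<in> \<V>" for f g
    proof -
      have "to_L2 (\<lambda>x. f x + (-1) *\<^sub>R g x) = to_L2 f + (-1) *\<^sub>R to_L2 g"
        unfolding to_L2_add[OF \<V>_square_integrable[OF fg(1)] square_integrable_scaleR[OF \<V>_square_integrable[OF fg(2)]]]
          to_L2_scaleR[OF \<V>_square_integrable[OF fg(2)]] ..
      then have "of_V (to_V (to_L2 (\<lambda>x. f x + (-1) *\<^sub>R g x))) = of_V (to_V (to_L2 f) - to_V (to_L2 g))"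
        unfolding of_V_to_V[OF \<V>_add[OF fg(1) \<V>_scaleR[OF fg(2)]]] of_V_simps of_V_to_V[OF fg(1)] of_V_to_V[OF fg(2)]
        by (simp only:) simp
      then show ?thesis by (simp only: of_V_inject)
    qed
    show "to_V (to_L2 \<delta>) = to_V (to_L2 \<phi>) - to_V (to_L2 \<phi>')" unfolding \<delta>_def by (rule gen[OF assms(1,3)])
    show "to_V (to_L2 \<epsilon>) = to_V (to_L2 \<psi>) - to_V (to_L2 \<psi>')" unfolding \<epsilon>_def by (rule gen[OF assms(2,4)])
  qed
  have "advection_dual \<delta> \<psi> = advection_dual \<phi> \<psi> - advection_dual \<phi>' \<psi>"
    unfolding \<delta>_def advection_dual_add_left[OF assms(1) \<V>_scaleR[OF assms(3)] assms(2)]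
      advection_dual_scaleR(1)[OF assms(3,2)] by simp
  moreover have "advection_dual \<phi>' \<epsilon> = advection_dual \<phi>' \<psi> - advection_dual \<phi>' \<psi>'"
    unfolding \<epsilon>_def advection_dual_add_right[OF assms(3) \<V>_scaleR[OF assms(4)] assms(2)]
      advection_dual_scaleR(2)[OF assms(3,4)] by simp
  ultimately have "advection_dual \<phi> \<psi> - advection_dual \<phi>' \<psi>' = advection_dual \<delta> \<psi> + advection_dual \<phi>' \<epsilon>" by simp
  then have "norm (advection_dual \<phi> \<psi> - advection_dual \<phi>' \<psi>') \<le> norm (advection_dual \<delta> \<psi>) + norm (advection_dual \<phi>' \<epsilon>)"
    by (simp only: norm_triangle_ineq)
  then show ?thesis
    using norm_advection_dual_le[OF in_V(1) assms(2)] norm_advection_dual_le[OF assms(3) in_V(2)] by (simp add: d e)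
qed

lemma advection_dual_Cauchy:
  "Cauchy (\<lambda>N. advection_dual (V_field N u) (V_field N v))"
proof (rule CauchyI)
  fix e :: real assume e: "e > 0"
  define c where "c = e / (18 * (norm u + norm v + 1))"
  have s: "0 < 18 * (norm u + norm v + 1)" by (simp add: add_nonneg_pos)
  have c: "c > 0" unfolding c_def using e s by (rule divide_pos_pos)
  have Cu: "Cauchy (\<lambda>N. truncation N (of_V u))" and Cv: "Cauchy (\<lambda>N. truncation N (of_V v))"
    using truncation_tendsto_V LIMSEQ_imp_Cauchy by blast+
  obtain N1 where N1: "\<And>m n. m \<ge> N1 \<Longrightarrow> n \<ge> N1 \<Longrightarrow> norm (truncation m (of_V u) - truncation n (of_V u)) < c"
    using Cu c unfolding Cauchy_iff by blast
  obtain N2 where N2: "\<And>m n. m \<ge> N2 \<Longrightarrow> n \<ge> N2 \<Longrightarrow> norm (truncation m (of_V v) - truncation n (of_V v)) < c"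
    using Cv c unfolding Cauchy_iff by blast
  have "norm (advection_dual (V_field m u) (V_field m v) - advection_dual (V_field n u) (V_field n v)) < e"
    if mn: "m \<ge> max N1 N2" "n \<ge> max N1 N2" for m n
  proof -
    have "norm (advection_dual (V_field m u) (V_field m v) - advection_dual (V_field n u) (V_field n v)) \<le>
      18 * (norm (truncation m (of_V u) - truncation n (of_V u)) * norm (truncation m (of_V v))
        + norm (truncation n (of_V u)) * norm (truncation m (of_V v) - truncation n (of_V v)))"
      using norm_advection_dual_diff[OF truncation_field_in_V truncation_field_in_V truncation_field_in_V truncation_field_in_V]
      unfolding truncation_eq_to_V .
    also have "\<dots> \<le> 18 * (c * norm v + norm u * c)"
      using N1[of m n] N2[of m n] mn c
      by (intro mult_left_mono add_mono mult_mono norm_truncation_le) auto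
    also have "\<dots> < 18 * (norm u + norm v + 1) * c" using c by (simp add: algebra_simps)
    also have "\<dots> = e" using s by (simp add: c_def)
    finally show ?thesis .
  qed
  then show "\<exists>M. \<forall>m\<ge>M. \<forall>n\<ge>M. norm (advection_dual (V_field m u) (V_field m v) - advection_dual (V_field n u) (V_field n v)) < e"
    by blast
qed

lemma bounded_bilinear_eq_limit:
  assumes B: "bounded_bilinear B"
    and eq: "\<And>\<phi> \<psi>. \<phi> \<in> \<V> \<Longrightarrow> \<psi> \<in> \<V> \<Longrightarrow> B (to_V (to_L2 \<phi>)) (to_V (to_L2 \<psi>)) = advection_dual \<phi> \<psi>"
  shows "(\<lambda>N. advection_dual (V_field N u) (V_field N v)) \<longlonglongrightarrow> B u v"
proof -
  have "(\<lambda>N. B (truncation N (of_V u)) (truncation N (of_V v))) \<longlonglongrightarrow> B u v"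
    by (intro bounded_bilinear.tendsto[OF B] truncation_tendsto_V)
  then show ?thesis by (simp add: truncation_eq_to_V eq truncation_field_in_V)
qed

text \<open>
  The limit along truncations exists since \<open>V'\<close> is complete, inherits bilinearity and
  the bound, and agrees with the given operator on trigonometric polynomials, which are eventually
  fixed by truncation.
\<close>

theorem bounded_bilinear_B_op: "bounded_bilinear B_op"
  and B_op_field: "\<phi> \<in> \<V> \<Longrightarrow> \<psi> \<in> \<V> \<Longrightarrow> B_op (to_V (to_L2 \<phi>)) (to_V (to_L2 \<psi>)) = advection_dual \<phi> \<psi>"
proof -
  let ?b = "\<lambda>N u v. advection_dual (V_field N u) (V_field N v)"
  define B where "B u v = lim (\<lambda>N. ?b N u v)" for u v
  have lim: "(\<lambda>N. ?b N u v) \<longlonglongrightarrow> B u v" for u v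
    using Cauchy_convergent[OF advection_dual_Cauchy, of u v] by (simp add: B_def convergent_LIMSEQ_iff)
  note fV = truncation_field_in_V
  have bil: "bounded_bilinear B"
  proof
    fix a a' b b' :: V and r :: real
    show "B (a + a') b = B a b + B a' b"
    proof (rule LIMSEQ_unique[OF lim])
      show "(\<lambda>N. ?b N (a + a') b) \<longlonglongrightarrow> B a b + B a' b"
        unfolding of_V_simps truncation_field_add advection_dual_add_left[OF fV fV fV] by (intro tendsto_add lim)
    qed
    show "B a (b + b') = B a b + B a b'"
    proof (rule LIMSEQ_unique[OF lim])
      show "(\<lambda>N. ?b N a (b + b')) \<longlonglongrightarrow> B a b + B a b'"
        unfolding of_V_simps truncation_field_add advection_dual_add_right[OF fV fV fV] by (intro tendsto_add lim)
    qed
    show "B (r *\<^sub>R a) b = r *\<^sub>R B a b"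
    proof (rule LIMSEQ_unique[OF lim])
      show "(\<lambda>N. ?b N (r *\<^sub>R a) b) \<longlonglongrightarrow> r *\<^sub>R B a b"
        unfolding of_V_simps truncation_field_scaleR advection_dual_scaleR(1)[OF fV fV] by (intro tendsto_scaleR tendsto_const lim)
    qed
    show "B a (r *\<^sub>R b) = r *\<^sub>R B a b"
    proof (rule LIMSEQ_unique[OF lim])
      show "(\<lambda>N. ?b N a (r *\<^sub>R b)) \<longlonglongrightarrow> r *\<^sub>R B a b"
        unfolding of_V_simps truncation_field_scaleR advection_dual_scaleR(2)[OF fV fV] by (intro tendsto_scaleR tendsto_const lim)
    qed
    show "\<exists>K. \<forall>a b. norm (B a b) \<le> norm a * norm b * K"
    proof (intro exI[of _ 18] allI)
      fix a b
      have "norm (?b N a b) \<le> norm a * norm b * 18" for N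
      proof -
        have "norm (?b N a b) \<le> 18 * (norm (to_V (to_L2 (V_field N a))) * norm (to_V (to_L2 (V_field N b))))"
          using norm_advection_dual_le[OF fV fV] by (simp add: mult.assoc)
        also have "\<dots> \<le> 18 * (norm a * norm b)" by (intro mult_left_mono mult_mono norm_V_field) auto
        finally show ?thesis by simp
      qed
      then show "norm (B a b) \<le> norm a * norm b * 18"
        by (intro LIMSEQ_le_const2[OF tendsto_norm[OF lim]]) auto
    qed
  qed
  have fld: "B (to_V (to_L2 \<phi>)) (to_V (to_L2 \<psi>)) = advection_dual \<phi> \<psi>" if "\<phi> \<in> \<V>" "\<psi> \<in> \<V>" for \<phi> \<psi>
  proof (rule LIMSEQ_unique[OF lim])
    obtain N1 where N1: "\<And>M. M \<ge> N1 \<Longrightarrow> band_limited M \<phi>" using V_band_limited[OF \<open>\<phi> \<in> \<V>\<close>] by blast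
    obtain N2 where N2: "\<And>M. M \<ge> N2 \<Longrightarrow> band_limited M \<psi>" using V_band_limited[OF \<open>\<psi> \<in> \<V>\<close>] by blast
    have "?b M (to_V (to_L2 \<phi>)) (to_V (to_L2 \<psi>)) = advection_dual \<phi> \<psi>" if M: "M \<ge> max N1 N2" for M
    proof -
      have "truncation_field M (to_L2 \<phi>) = \<phi>" "truncation_field M (to_L2 \<psi>) = \<psi>"
        using sum_modes_reproduces[OF \<open>\<phi> \<in> \<V>\<close> N1] sum_modes_reproduces[OF \<open>\<psi> \<in> \<V>\<close> N2] M
        by (auto simp: truncation_field_def)
      then show ?thesis by (simp add: of_V_to_V \<open>\<phi> \<in> \<V>\<close> \<open>\<psi> \<in> \<V>\<close>)
    qed
    then show "(\<lambda>N. ?b N (to_V (to_L2 \<phi>)) (to_V (to_L2 \<psi>))) \<longlonglongrightarrow> advection_dual \<phi> \<psi>"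
      by (intro tendsto_eventually eventually_sequentiallyI[of "max N1 N2"])
  qed
  have "B_op = B" unfolding B_op_def
  proof (rule the_equality)
    show "bounded_bilinear B \<and> (\<forall>\<phi>\<in>\<V>. \<forall>\<psi>\<in>\<V>. B (to_V (to_L2 \<phi>)) (to_V (to_L2 \<psi>)) = to_dual (Leray (to_L2 (advection \<phi> \<psi>))))"
      using bil fld by (simp add: advection_dual_def)
    fix B' assume B': "bounded_bilinear B' \<and> (\<forall>\<phi>\<in>\<V>. \<forall>\<psi>\<in>\<V>. B' (to_V (to_L2 \<phi>)) (to_V (to_L2 \<psi>)) = to_dual (Leray (to_L2 (advection \<phi> \<psi>))))"
    have "(\<lambda>N. ?b N u v) \<longlonglongrightarrow> B' u v" for u v
      by (rule bounded_bilinear_eq_limit) (use B' in \<open>auto simp: advection_dual_def\<close>)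
    then show "B' = B" by (intro ext) (rule LIMSEQ_unique[OF _ lim])
  qed
  then show "bounded_bilinear B_op"
    "\<phi> \<in> \<V> \<Longrightarrow> \<psi> \<in> \<V> \<Longrightarrow> B_op (to_V (to_L2 \<phi>)) (to_V (to_L2 \<psi>)) = advection_dual \<phi> \<psi>"
    using bil fld by auto
qed

text \<open>
  The means by which identities and estimates pass from trigonometric polynomials to
  \<open>V\<close>.
\<close>

lemma B_op_tendsto:
  "(\<lambda>N. advection_form (V_field N u) (V_field N v) (V_field N w)) \<longlonglongrightarrow> blinfun_apply (B_op u v) w"
proof -
  have "(\<lambda>N. blinfun_apply (B_op (truncation N (of_V u)) (truncation N (of_V v))) (truncation N (of_V w)))
      \<longlonglongrightarrow> blinfun_apply (B_op u v) w"
    by (intro blinfun.tendsto bounded_bilinear.tendsto[OF bounded_bilinear_B_op] truncation_tendsto_V)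
  then show ?thesis
    by (simp add: truncation_eq_to_V B_op_field truncation_field_in_V advection_dual_field)
qed

lemma B_op_antisymmetric: "blinfun_apply (B_op u v) w = - blinfun_apply (B_op u w) v"
proof (rule LIMSEQ_unique[OF B_op_tendsto])
  have "advection_form (V_field N u) (V_field N v) (V_field N w) = - advection_form (V_field N u) (V_field N w) (V_field N v)" for N
    by (intro advection_form_antisymmetric truncation_field_in_V)
  then show "(\<lambda>N. advection_form (V_field N u) (V_field N v) (V_field N w)) \<longlonglongrightarrow> - blinfun_apply (B_op u w) v"
    using tendsto_minus[OF B_op_tendsto[of u w v]] by (simp only:)
qed

lemma B_op_self: "blinfun_apply (B_op u v) v = 0"
  using B_op_antisymmetric[of u v v] by simp

lemma B_op_bound_via_fields:
  assumes "\<And>N. \<bar>advection_form (V_field N u) (V_field N v) (V_field N w)\<bar> \<le> C"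
  shows "\<bar>blinfun_apply (B_op u v) w\<bar> \<le> C"
  by (intro LIMSEQ_le_const2[OF tendsto_rabs[OF B_op_tendsto[of u v w]]]) (use assms in auto)

lemma B_op_le: "\<bar>blinfun_apply (B_op u v) w\<bar> \<le> 18 * norm u * norm v * norm w"
proof (rule B_op_bound_via_fields)
  fix N
  have "\<bar>advection_form (V_field N u) (V_field N v) (V_field N w)\<bar> \<le>
     18 * (norm (to_V (to_L2 (V_field N u))) * norm (to_V (to_L2 (V_field N v))) * norm (to_V (to_L2 (V_field N w))))"
    using advection_form_le[OF truncation_field_in_V truncation_field_in_V truncation_field_in_V] by (simp add: mult.assoc)
  also have "\<dots> \<le> 18 * (norm u * norm v * norm w)" by (intro mult_left_mono mult_mono norm_V_field) auto
  finally show "\<bar>advection_form (V_field N u) (V_field N v) (V_field N w)\<bar> \<le> 18 * norm u * norm v * norm w"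
    by (simp add: mult.assoc)
qed

lemma B_op_interpolation:
  assumes e: "e > 0"
  obtains D where "D > 0"
    "\<And>u v. \<bar>blinfun_apply (B_op u v) u\<bar> \<le> norm v * (e * (norm u)\<^sup>2 + D * (norm (of_V u))\<^sup>2)"
proof -
  have "e / 3 > 0" using e by simp
  then obtain D where D: "D > 0"
    "\<And>\<phi>. \<phi> \<in> \<V> \<Longrightarrow> L4_norm_square \<phi> \<le> e / 3 * (norm (to_V (to_L2 \<phi>)))\<^sup>2 + D * (norm (to_L2 \<phi>))\<^sup>2"
    using L4_norm_square_interpolation by blast
  show ?thesis
  proof (rule that[of "3 * D"])
    show "3 * D > 0" using D by simp
    fix u v
    show "\<bar>blinfun_apply (B_op u v) u\<bar> \<le> norm v * (e * (norm u)\<^sup>2 + 3 * D * (norm (of_V u))\<^sup>2)"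
    proof (rule B_op_bound_via_fields)
      fix N
      let ?\<phi> = "V_field N u"
      have "L4_norm_square ?\<phi> \<le> e / 3 * (norm (to_V (to_L2 ?\<phi>)))\<^sup>2 + D * (norm (to_L2 ?\<phi>))\<^sup>2"
        by (rule D(2)[OF truncation_field_in_V])
      also have "\<dots> \<le> e / 3 * (norm u)\<^sup>2 + D * (norm (of_V u))\<^sup>2"
        using e D(1) by (intro add_mono mult_left_mono power_mono norm_V_field norm_H_field) auto
      finally have L: "3 * L4_norm_square ?\<phi> \<le> e * (norm u)\<^sup>2 + 3 * D * (norm (of_V u))\<^sup>2" by simp
      have "\<bar>advection_form ?\<phi> (V_field N v) ?\<phi>\<bar> \<le> 3 * L4_norm_square ?\<phi> * norm (to_V (to_L2 (V_field N v)))"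
        using advection_form_le_L4[OF truncation_field_in_V truncation_field_in_V truncation_field_in_V, of N "of_V u" N "of_V v" N "of_V u"]
        by (simp add: L4_norm_square_nonneg)
      also have "\<dots> \<le> (e * (norm u)\<^sup>2 + 3 * D * (norm (of_V u))\<^sup>2) * norm v"
        using L4_norm_square_nonneg[of ?\<phi>] L by (intro mult_mono norm_V_field) auto
      finally show "\<bar>advection_form ?\<phi> (V_field N v) ?\<phi>\<bar> \<le> norm v * (e * (norm u)\<^sup>2 + 3 * D * (norm (of_V u))\<^sup>2)"
        by (simp add: mult.commute)
    qed
  qed
qed

text \<open>
  Since \<open>Stokes v\<close> represents the functional \<open>w \<mapsto> v \<bullet>
  w\<close>, it multiplies coefficients by the eigenvalues.
\<close>

lemma mode_coeff_Stokes:
  assumes "v \<in> Dom_A" "m \<in> modes N"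
  shows "mode_coeff (Stokes v) m = eigenvalue m * mode_coeff (of_V v) m"
  using inner_mode_V[OF assms(2), of v] by (simp add: mode_coeff_def inner_Stokes[OF assms(1)] inner_commute)

lemma Stokes_in_H: "Stokes v \<in> H_set"
  unfolding Stokes_def using subspace_neg[OF subspace_H_set] Leray_H_set by blast

lemma norm_truncation_Stokes:
  assumes "v \<in> Dom_A"
  shows "(\<Sum>m\<in>modes N. (eigenvalue m)\<^sup>2 * (mode_coeff (of_V v) m)\<^sup>2) = (norm (of_V (truncation N (Stokes v))))\<^sup>2"
  unfolding norm_of_V_truncation
  by (intro sum.cong refl) (simp add: mode_coeff_Stokes[OF assms] power_mult_distrib)

text \<open>
  From \<open>||v||^2 = (A v, v)\<close> and Young's inequality.
\<close>

lemma V_norm_interpolation: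
  assumes v: "v \<in> Dom_A" and e: "e > 0"
  shows "norm v \<le> e * norm (Stokes v) + norm (of_V v) / e"
proof (rule power2_le_imp_le)
  let ?a = "norm (Stokes v)" and ?b = "norm (of_V v)"
  have "(norm v)\<^sup>2 = Stokes v \<bullet> of_V v" by (simp add: inner_Stokes[OF v] power2_norm_eq_inner)
  also have "\<dots> \<le> ?a * ?b" by (rule norm_cauchy_schwarz)
  also have "\<dots> \<le> (e * ?a)\<^sup>2 + 2 * (?a * ?b) + (?b / e)\<^sup>2"
    by (simp add: add_nonneg_nonneg)
  also have "\<dots> = (e * ?a + ?b / e)\<^sup>2" using e by (simp add: power2_sum)
  finally show "(norm v)\<^sup>2 \<le> (e * ?a + ?b / e)\<^sup>2" .
qed (use e in simp)

text \<open>
  In \<open>B(v,u)w\<close> the regular argument \<open>v\<close> is taken in the supremum norm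
  and \<open>\<nabla>u\<close> in \<open>L2\<close>. In \<open>B(u,v)w\<close> the fields
  \<open>u\<close> and \<open>\<nabla>v\<close> are taken in \<open>L4\<close>. In both cases the
  norm of two derivatives of \<open>v\<close> carries an arbitrarily small factor, so that
  viscosity can absorb these terms however large \<open>||u||\<close> is.
\<close>

theorem B_op_Stokes_bound:
  assumes e: "e > 0"
  obtains D where "D > 0"
    "\<And>v u w. v \<in> Dom_A \<Longrightarrow> \<bar>blinfun_apply (B_op v u) w\<bar> + \<bar>blinfun_apply (B_op u v) w\<bar> \<le>
       norm u * norm (of_V w) * (e * norm (Stokes v) + D * norm (of_V v))"
proof -
  \<comment> \<open>The factors of \<open>norm (Stokes v)\<close> add up to \<open>e/2 + e/12 +
    e/4\<close>, which is below \<open>e\<close>.\<close>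
  define e1 where "e1 = e / 6"
  have e1: "e1 > 0" using e by (simp add: e1_def)
  obtain D1 where D1: "D1 > 0"
    "\<And>N h x. norm (truncation_field N h x) \<le>
       e1 * sqrt (\<Sum>m\<in>modes N. (eigenvalue m)\<^sup>2 * (mode_coeff h m)\<^sup>2) + D1 * norm h"
    using Agmon_truncation[OF e1] by blast
  define e2 where "e2 = (e / 36)\<^sup>2 / 6"
  have e2: "e2 > 0" using e by (simp add: e2_def)
  obtain D2 where D2: "D2 > 0"
    "\<And>\<phi>. \<phi> \<in> \<V> \<Longrightarrow> L4_norm_square \<phi> \<le> e2 * (norm (to_V (to_L2 \<phi>)))\<^sup>2 + D2 * (norm (to_L2 \<phi>))\<^sup>2"
    using L4_norm_square_interpolation[OF e2] by blast
  define s where "s = sqrt (6 * D2)"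
  have s: "s > 0" "s\<^sup>2 = 6 * D2" using D2 by (auto simp: s_def)
  define e3 where "e3 = e / (12 * s)"
  have e3: "e3 > 0" using e s by (simp add: e3_def)
  define D where "D = 3 * D1 + 3 * s / e3"
  show ?thesis
  proof (rule that[of D])
    show "D > 0" using D1 s e3 by (simp add: D_def add_pos_nonneg)
    fix v u w assume v: "v \<in> Dom_A"
    let ?S = "norm (Stokes v)" and ?h = "norm (of_V v)"
    note fV = truncation_field_in_V
    have c2: "(\<Sum>m\<in>modes N. (eigenvalue m)\<^sup>2 * (mode_coeff (of_V v) m)\<^sup>2) \<le> ?S\<^sup>2" for N
      unfolding norm_truncation_Stokes[OF v] by (intro power_mono norm_of_V_truncation_le) auto
    have b1: "\<bar>blinfun_apply (B_op v u) w\<bar> \<le> 3 * (e1 * ?S + D1 * ?h) * (norm u * norm (of_V w))"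
    proof (rule B_op_bound_via_fields)
      fix N
      have "sqrt (\<Sum>m\<in>modes N. (eigenvalue m)\<^sup>2 * (mode_coeff (of_V v) m)\<^sup>2) \<le> ?S"
        using c2 by (intro real_le_lsqrt) (auto simp: sum_nonneg)
      then have "e1 * sqrt (\<Sum>m\<in>modes N. (eigenvalue m)\<^sup>2 * (mode_coeff (of_V v) m)\<^sup>2) \<le> e1 * ?S"
        using e1 by (intro mult_left_mono) auto
      then have sup: "norm (V_field N v x) \<le> e1 * ?S + D1 * ?h" for x using D1(2)[of N "of_V v" x] by linarith
      have "\<bar>advection_form (V_field N v) (V_field N u) (V_field N w)\<bar> \<le>
          3 * (e1 * ?S + D1 * ?h) * (norm (to_V (to_L2 (V_field N u))) * norm (to_L2 (V_field N w)))"
        using advection_form_le_sup[OF fV fV fV sup] by (simp add: mult.assoc)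
      also have "\<dots> \<le> 3 * (e1 * ?S + D1 * ?h) * (norm u * norm (of_V w))"
        using e1 D1(1) by (intro mult_left_mono mult_mono norm_V_field norm_H_field) auto
      finally show "\<bar>advection_form (V_field N v) (V_field N u) (V_field N w)\<bar> \<le> 3 * (e1 * ?S + D1 * ?h) * (norm u * norm (of_V w))" .
    qed
    have b2: "\<bar>blinfun_apply (B_op u v) w\<bar> \<le> 3 * (e / 36 * ?S + s * norm v) * (norm u * norm (of_V w))"
    proof (rule B_op_bound_via_fields)
      fix N
      let ?p = "\<lambda>j. pd j (V_field N v)"
      have "sqrt (L4_norm_square (V_field N u) * L4_norm_square (?p j)) \<le> norm u * (e / 36 * ?S + s * norm v)" for j
      proof (rule real_le_lsqrt)
        have "(norm (to_V (to_L2 (?p j))))\<^sup>2 \<le> (\<Sum>j\<in>UNIV. (norm (to_V (to_L2 (?p j))))\<^sup>2)"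
          by (rule member_le_sum) auto
        also have "\<dots> \<le> ?S\<^sup>2" unfolding norm_second_derivatives by (rule c2)
        finally have 1: "(norm (to_V (to_L2 (?p j))))\<^sup>2 \<le> ?S\<^sup>2" .
        have "norm (to_L2 (?p j)) \<le> norm v" using norm_pd_le[OF fV] norm_V_field order_trans by blast
        then have 2: "(norm (to_L2 (?p j)))\<^sup>2 \<le> (norm v)\<^sup>2" by (intro power_mono) auto
        have "L4_norm_square (?p j) \<le> e2 * ?S\<^sup>2 + D2 * (norm v)\<^sup>2"
          using D2(2)[OF pd_truncation_field_in_V, of j N "of_V v"] mult_left_mono[OF 1, of e2] mult_left_mono[OF 2, of D2] e2 D2(1)
          by linarith
        moreover have "L4_norm_square (V_field N u) \<le> 6 * (norm u)\<^sup>2"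
        proof -
          have "L4_norm_square (V_field N u) \<le> 6 * (norm (to_V (to_L2 (V_field N u))))\<^sup>2" by (rule L4_norm_square_le[OF fV])
          also have "\<dots> \<le> 6 * (norm u)\<^sup>2" by (intro mult_left_mono power_mono norm_V_field) auto
          finally show ?thesis .
        qed
        ultimately have "L4_norm_square (V_field N u) * L4_norm_square (?p j) \<le> (6 * (norm u)\<^sup>2) * (e2 * ?S\<^sup>2 + D2 * (norm v)\<^sup>2)"
          by (intro mult_mono) (auto simp: L4_norm_square_nonneg)
        also have "\<dots> = (norm u)\<^sup>2 * ((e / 36 * ?S)\<^sup>2 + (s * norm v)\<^sup>2)"
          by (simp add: e2_def s(2) power_mult_distrib power_divide algebra_simps)
        also have "\<dots> \<le> (norm u)\<^sup>2 * (e / 36 * ?S + s * norm v)\<^sup>2"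
          using e s by (intro mult_left_mono) (auto simp: power2_sum)
        finally show "L4_norm_square (V_field N u) * L4_norm_square (?p j) \<le> (norm u * (e / 36 * ?S + s * norm v))\<^sup>2"
          by (simp add: power_mult_distrib)
      qed (use e s in auto)
      then have "(\<Sum>j\<in>UNIV. sqrt (L4_norm_square (V_field N u) * L4_norm_square (?p j))) \<le> (\<Sum>j\<in>(UNIV :: 3 set). norm u * (e / 36 * ?S + s * norm v))"
        by (intro sum_mono)
      then have sm: "(\<Sum>j\<in>UNIV. sqrt (L4_norm_square (V_field N u) * L4_norm_square (?p j))) \<le> 3 * (norm u * (e / 36 * ?S + s * norm v))"
        by simp
      have "\<bar>advection_form (V_field N u) (V_field N v) (V_field N w)\<bar> \<le>
          (\<Sum>j\<in>UNIV. sqrt (L4_norm_square (V_field N u) * L4_norm_square (?p j))) * norm (to_L2 (V_field N w))"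
        by (rule advection_form_le_L4_gradient[OF fV fV fV])
      also have "\<dots> \<le> 3 * (norm u * (e / 36 * ?S + s * norm v)) * norm (of_V w)"
        using e s by (intro mult_mono sm norm_H_field) auto
      finally show "\<bar>advection_form (V_field N u) (V_field N v) (V_field N w)\<bar> \<le> 3 * (e / 36 * ?S + s * norm v) * (norm u * norm (of_V w))"
        by (simp add: mult_ac)
    qed
    have "s * norm v \<le> s * (e3 * ?S + ?h / e3)" using s by (intro mult_left_mono V_norm_interpolation v e3) auto
    also have "\<dots> = e / 12 * ?S + s / e3 * ?h" using s by (simp add: e3_def algebra_simps)
    finally have "3 * (e1 * ?S + D1 * ?h) + 3 * (e / 36 * ?S + s * norm v) \<le>
      3 * (e1 * ?S + D1 * ?h) + 3 * (e / 36 * ?S + (e / 12 * ?S + s / e3 * ?h))" by simp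
    also have "\<dots> = (e / 2 + e / 12 + e / 4) * ?S + D * ?h" by (simp add: e1_def D_def algebra_simps)
    also have "\<dots> \<le> e * ?S + D * ?h" using e by (intro add_right_mono mult_right_mono) auto
    finally have "(3 * (e1 * ?S + D1 * ?h) + 3 * (e / 36 * ?S + s * norm v)) * (norm u * norm (of_V w)) \<le> (e * ?S + D * ?h) * (norm u * norm (of_V w))"
      by (intro mult_right_mono) auto
    then show "\<bar>blinfun_apply (B_op v u) w\<bar> + \<bar>blinfun_apply (B_op u v) w\<bar> \<le> norm u * norm (of_V w) * (e * ?S + D * ?h)"
      using b1 b2 by (simp add: algebra_simps)
  qed
qed

section \<open>The energy balance\<close>

text \<open>
  What the energy argument needs of a pair \<open>(u, B)\<close> with time derivatives
  \<open>F\<close> and \<open>G\<close>: the equations tested with single modes, and dominating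
  functions that make the limit of infinitely many modes possible. It contains no nonlinearity, so
  differences of solutions have the property too.
\<close>

definition evolution ::
    "real \<Rightarrow> real \<Rightarrow> (real \<Rightarrow> V) \<Rightarrow> (real \<Rightarrow> L2) \<Rightarrow> (real \<Rightarrow> V \<Rightarrow>\<^sub>L real) \<Rightarrow> (real \<Rightarrow> V \<Rightarrow>\<^sub>L real) \<Rightarrow> bool" where
  "evolution \<alpha> T u B F G \<longleftrightarrow>
     continuous_on {0..T} u \<and>
     (\<forall>t\<in>{0..T}. B t \<in> H_set) \<and>
     (AE t in lebesgue_on {0<..<T}. B t \<in> V_set) \<and>
     (\<forall>N. \<forall>m\<in>modes N. primitive_on T (\<lambda>t. (\<alpha>\<^sup>2 * eigenvalue m + 1) * mode_coeff (of_V (u t)) m) (\<lambda>r. blinfun_apply (F r) (mode_V m))) \<and>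
     (\<forall>N. \<forall>m\<in>modes N. primitive_on T (\<lambda>t. mode_coeff (B t) m) (\<lambda>r. blinfun_apply (G r) (mode_V m))) \<and>
     (\<exists>f. f absolutely_integrable_on {0..T} \<and> (AE t in lebesgue_on {0<..<T}. norm (F t) \<le> f t)) \<and>
     (\<exists>g. g absolutely_integrable_on {0..T} \<and> (AE t in lebesgue_on {0<..<T}. (norm (G t))\<^sup>2 \<le> g t)) \<and>
     (\<exists>b. b absolutely_integrable_on {0..T} \<and> (AE t in lebesgue_on {0<..<T}. (norm (to_V (B t)))\<^sup>2 \<le> b t))"

text \<open>
  A functional applied to a distributional equation in the dual of \<open>V\<close> gives a scalar
  one. The coefficients of \<open>u\<close> appear with the factor \<open>\<alpha>^2 eigenvalue +
  1\<close>, since the mode is an eigenvector of \<open>\<alpha>^2 A + 1\<close>.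
\<close>

lemma weak_solution_evolution:
  assumes T: "0 < T" and ws: "weak_solution \<alpha> \<mu> T u0 B0 u B"
  obtains F G where "evolution \<alpha> T u B F G"
    "AE t in lebesgue_on {0<..<T}. F t = B_op (to_V (B t)) (to_V (B t)) - B_op (u t) (u t)"
    "AE t in lebesgue_on {0<..<T}. G t + \<mu> *\<^sub>R A_op (to_V (B t)) = B_op (to_V (B t)) (u t) - B_op (u t) (to_V (B t))"
proof -
  have u: "continuous_on {0..T} u" and BV: "AE t in lebesgue_on {0<..<T}. B t \<in> V_set"
    and B2: "Lp_time 2 T (\<lambda>t. to_V (B t))" and Cw: "Cw_H T B"
    using ws unfolding weak_solution_def by blast+
  obtain F where F: "Lp_time (4/3) T F"
    "has_time_derivative T (\<lambda>t. \<alpha>\<^sup>2 *\<^sub>R A_op (u t) + to_dual (of_V (u t))) F"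
    "AE t in lebesgue_on {0<..<T}. F t = B_op (to_V (B t)) (to_V (B t)) - B_op (u t) (u t)"
    using ws unfolding weak_solution_def by blast
  obtain G where G: "Lp_time 2 T G" "has_time_derivative T (\<lambda>t. to_dual (B t)) G"
    "AE t in lebesgue_on {0<..<T}. G t + \<mu> *\<^sub>R A_op (to_V (B t)) = B_op (to_V (B t)) (u t) - B_op (u t) (to_V (B t))"
    using ws unfolding weak_solution_def by blast
  have ev: "bounded_linear (\<lambda>l :: V \<Rightarrow>\<^sub>L real. blinfun_apply l v)" for v
    by (rule blinfun.bounded_linear_left)
  have Fp: "primitive_on T (\<lambda>t. (\<alpha>\<^sup>2 * eigenvalue m + 1) * mode_coeff (of_V (u t)) m) (\<lambda>r. blinfun_apply (F r) (mode_V m))"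
    if m: "m \<in> modes N" for m N
  proof (rule has_time_derivative_imp_primitive_on[OF T])
    have eq: "blinfun_apply (\<alpha>\<^sup>2 *\<^sub>R A_op (u t) + to_dual (of_V (u t))) (mode_V m) = (\<alpha>\<^sup>2 * eigenvalue m + 1) * mode_coeff (of_V (u t)) m" for t
      using inner_mode_V[OF m, of "u t"]
      by (simp add: blinfun.add_left blinfun.scaleR_left A_op_apply to_dual_apply mode_coeff_def inner_commute[of "u t"] algebra_simps)
    show "has_time_derivative T (\<lambda>t. (\<alpha>\<^sup>2 * eigenvalue m + 1) * mode_coeff (of_V (u t)) m) (\<lambda>r. blinfun_apply (F r) (mode_V m))"
      using has_time_derivative_functional[OF F(2) ev[of "mode_V m"]] unfolding eq .
    have "(\<lambda>t. norm (F t)) absolutely_integrable_on {0..T}" by (rule Lp_time_norm_integrable[OF F(1)]) simp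
    then show "(\<lambda>r. blinfun_apply (F r) (mode_V m)) absolutely_integrable_on {0..T}"
      using F(1) by (intro strongly_measurable_functional_integrable[OF _ _ ev]) (auto simp: Lp_time_def)
    have "continuous_on {0..T} (\<lambda>t. of_V (u t))"
      by (rule bounded_linear.continuous_on[OF bounded_linear_of_V u])
    then show "continuous_on {0..T} (\<lambda>t. (\<alpha>\<^sup>2 * eigenvalue m + 1) * mode_coeff (of_V (u t)) m)"
      unfolding mode_coeff_def by (intro continuous_intros)
  qed
  have Gp: "primitive_on T (\<lambda>t. mode_coeff (B t) m) (\<lambda>r. blinfun_apply (G r) (mode_V m))" for m
  proof (rule has_time_derivative_imp_primitive_on[OF T])
    show "has_time_derivative T (\<lambda>t. mode_coeff (B t) m) (\<lambda>r. blinfun_apply (G r) (mode_V m))"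
      using has_time_derivative_functional[OF G(2) ev[of "mode_V m"]] unfolding to_dual_apply mode_coeff_def .
    have "(\<lambda>t. norm (G t)) absolutely_integrable_on {0..T}" by (rule Lp_time_norm_integrable[OF G(1)]) simp
    then show "(\<lambda>r. blinfun_apply (G r) (mode_V m)) absolutely_integrable_on {0..T}"
      using G(1) by (intro strongly_measurable_functional_integrable[OF _ _ ev]) (auto simp: Lp_time_def)
    show "continuous_on {0..T} (\<lambda>t. mode_coeff (B t) m)"
      using Cw of_V_in_H unfolding Cw_H_def mode_coeff_def by blast
  qed
  have "evolution \<alpha> T u B F G"
    unfolding evolution_def
  proof (intro conjI)
    show "\<forall>t\<in>{0..T}. B t \<in> H_set" using Cw by (simp add: Cw_H_def)
    show "\<forall>N. \<forall>m\<in>modes N. primitive_on T (\<lambda>t. (\<alpha>\<^sup>2 * eigenvalue m + 1) * mode_coeff (of_V (u t)) m) (\<lambda>r. blinfun_apply (F r) (mode_V m))"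
      using Fp by blast
    show "\<forall>N. \<forall>m\<in>modes N. primitive_on T (\<lambda>t. mode_coeff (B t) m) (\<lambda>r. blinfun_apply (G r) (mode_V m))"
      using Gp by blast
    show "\<exists>f. f absolutely_integrable_on {0..T} \<and> (AE t in lebesgue_on {0<..<T}. norm (F t) \<le> f t)"
      by (intro exI[of _ "\<lambda>t. norm (F t)"] conjI Lp_time_norm_integrable[OF F(1)]) auto
    show "\<exists>g. g absolutely_integrable_on {0..T} \<and> (AE t in lebesgue_on {0<..<T}. (norm (G t))\<^sup>2 \<le> g t)"
      by (intro exI[of _ "\<lambda>t. (norm (G t))\<^sup>2"] conjI Lp_time_norm_square_integrable[OF G(1)]) auto
    show "\<exists>b. b absolutely_integrable_on {0..T} \<and> (AE t in lebesgue_on {0<..<T}. (norm (to_V (B t)))\<^sup>2 \<le> b t)"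
      by (intro exI[of _ "\<lambda>t. (norm (to_V (B t)))\<^sup>2"] conjI Lp_time_norm_square_integrable[OF B2]) auto
  qed (fact u, fact BV)
  then show ?thesis using F(3) G(3) that by blast
qed

lemma norm_diff_square_le:
  fixes a b :: "'a::real_normed_vector"
  shows "(norm (a - b))\<^sup>2 \<le> 2 * (norm a)\<^sup>2 + 2 * (norm b)\<^sup>2"
proof -
  have "(norm (a - b))\<^sup>2 \<le> (norm a + norm b)\<^sup>2" by (intro power_mono norm_triangle_ineq4) auto
  also have "\<dots> \<le> 2 * (norm a)\<^sup>2 + 2 * (norm b)\<^sup>2"
    using sum_squares_bound[of "norm a" "norm b"] by (simp add: power2_sum)
  finally show ?thesis .
qed

lemma evolution_diff:
  assumes 1: "evolution \<alpha> T u1 B1 F1 G1" and 2: "evolution \<alpha> T u2 B2 F2 G2"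
  shows "evolution \<alpha> T (\<lambda>t. u1 t - u2 t) (\<lambda>t. B1 t - B2 t) (\<lambda>t. F1 t - F2 t) (\<lambda>t. G1 t - G2 t)"
proof -
  obtain f1 where f1: "f1 absolutely_integrable_on {0..T}" "AE t in lebesgue_on {0<..<T}. norm (F1 t) \<le> f1 t"
    using 1 unfolding evolution_def by blast
  obtain f2 where f2: "f2 absolutely_integrable_on {0..T}" "AE t in lebesgue_on {0<..<T}. norm (F2 t) \<le> f2 t"
    using 2 unfolding evolution_def by blast
  obtain g1 where g1: "g1 absolutely_integrable_on {0..T}" "AE t in lebesgue_on {0<..<T}. (norm (G1 t))\<^sup>2 \<le> g1 t"
    using 1 unfolding evolution_def by blast
  obtain g2 where g2: "g2 absolutely_integrable_on {0..T}" "AE t in lebesgue_on {0<..<T}. (norm (G2 t))\<^sup>2 \<le> g2 t"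
    using 2 unfolding evolution_def by blast
  obtain b1 where b1: "b1 absolutely_integrable_on {0..T}" "AE t in lebesgue_on {0<..<T}. (norm (to_V (B1 t)))\<^sup>2 \<le> b1 t"
    using 1 unfolding evolution_def by blast
  obtain b2 where b2: "b2 absolutely_integrable_on {0..T}" "AE t in lebesgue_on {0<..<T}. (norm (to_V (B2 t)))\<^sup>2 \<le> b2 t"
    using 2 unfolding evolution_def by blast
  have V: "AE t in lebesgue_on {0<..<T}. B1 t \<in> V_set" "AE t in lebesgue_on {0<..<T}. B2 t \<in> V_set"
    using 1 2 unfolding evolution_def by blast+
  show ?thesis unfolding evolution_def
  proof (intro conjI ballI allI)
    show "continuous_on {0..T} (\<lambda>t. u1 t - u2 t)"
      using 1 2 unfolding evolution_def by (intro continuous_on_diff) blast+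
    show "B1 t - B2 t \<in> H_set" if "t \<in> {0..T}" for t
      using 1 2 that unfolding evolution_def by (intro subspace_diff[OF subspace_H_set]) blast+
    show "AE t in lebesgue_on {0<..<T}. B1 t - B2 t \<in> V_set"
      using V by eventually_elim (rule V_set_diff)
    fix N m assume m: "m \<in> modes N"
    have "primitive_on T (\<lambda>t. (\<alpha>\<^sup>2 * eigenvalue m + 1) * mode_coeff (of_V (u1 t)) m - (\<alpha>\<^sup>2 * eigenvalue m + 1) * mode_coeff (of_V (u2 t)) m)
        (\<lambda>r. blinfun_apply (F1 r) (mode_V m) - blinfun_apply (F2 r) (mode_V m))"
      using 1 2 m unfolding evolution_def by (intro primitive_on_diff) blast+
    then show "primitive_on T (\<lambda>t. (\<alpha>\<^sup>2 * eigenvalue m + 1) * mode_coeff (of_V (u1 t - u2 t)) m) (\<lambda>r. blinfun_apply (F1 r - F2 r) (mode_V m))"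
      by (simp add: of_V_simps mode_coeff_diff blinfun.diff_left right_diff_distrib)
    have "primitive_on T (\<lambda>t. mode_coeff (B1 t) m - mode_coeff (B2 t) m)
        (\<lambda>r. blinfun_apply (G1 r) (mode_V m) - blinfun_apply (G2 r) (mode_V m))"
      using 1 2 m unfolding evolution_def by (intro primitive_on_diff) blast+
    then show "primitive_on T (\<lambda>t. mode_coeff (B1 t - B2 t) m) (\<lambda>r. blinfun_apply (G1 r - G2 r) (mode_V m))"
      by (simp add: mode_coeff_diff blinfun.diff_left)
  next
    show "\<exists>f. f absolutely_integrable_on {0..T} \<and> (AE t in lebesgue_on {0<..<T}. norm (F1 t - F2 t) \<le> f t)"
    proof (intro exI[of _ "\<lambda>t. f1 t + f2 t"] conjI set_integral_add f1 f2)
      show "AE t in lebesgue_on {0<..<T}. norm (F1 t - F2 t) \<le> f1 t + f2 t"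
        using f1(2) f2(2)
      proof eventually_elim
        case (elim t) then show ?case using norm_triangle_ineq4[of "F1 t" "F2 t"] by linarith
      qed
    qed
    show "\<exists>g. g absolutely_integrable_on {0..T} \<and> (AE t in lebesgue_on {0<..<T}. (norm (G1 t - G2 t))\<^sup>2 \<le> g t)"
    proof (intro exI[of _ "\<lambda>t. 2 * g1 t + 2 * g2 t"] conjI set_integral_add set_integrable_mult_right g1 g2)
      show "AE t in lebesgue_on {0<..<T}. (norm (G1 t - G2 t))\<^sup>2 \<le> 2 * g1 t + 2 * g2 t"
        using g1(2) g2(2)
      proof eventually_elim
        case (elim t) then show ?case using norm_diff_square_le[of "G1 t" "G2 t"] by linarith
      qed
    qed
    show "\<exists>b. b absolutely_integrable_on {0..T} \<and> (AE t in lebesgue_on {0<..<T}. (norm (to_V (B1 t - B2 t)))\<^sup>2 \<le> b t)"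
    proof (intro exI[of _ "\<lambda>t. 2 * b1 t + 2 * b2 t"] conjI set_integral_add set_integrable_mult_right b1 b2)
      show "AE t in lebesgue_on {0<..<T}. (norm (to_V (B1 t - B2 t)))\<^sup>2 \<le> 2 * b1 t + 2 * b2 t"
        using b1(2) b2(2) V
      proof eventually_elim
        case (elim t) then show ?case using norm_diff_square_le[of "to_V (B1 t)" "to_V (B2 t)"] by (simp add: to_V_diff)
      qed
    qed
  qed
qed

lemma weighted_square_sum_primitive:
  assumes I: "finite I" and x: "\<And>m. m \<in> I \<Longrightarrow> primitive_on T (x m) (\<eta> m)"
  shows "primitive_on T (\<lambda>t. \<Sum>m\<in>I. a m * (x m t)\<^sup>2) (\<lambda>r. 2 * (\<Sum>m\<in>I. a m * (x m r * \<eta> m r)))"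
proof -
  have "primitive_on T (\<lambda>t. \<Sum>m\<in>I. a m * (x m t * x m t)) (\<lambda>r. \<Sum>m\<in>I. a m * (x m r * \<eta> m r + x m r * \<eta> m r))"
    by (intro primitive_on_sum I primitive_on_cmult primitive_on_mult x)
  moreover have "(\<Sum>m\<in>I. a m * (x m r * \<eta> m r + x m r * \<eta> m r)) = 2 * (\<Sum>m\<in>I. a m * (x m r * \<eta> m r))" for r
    by (simp add: sum_distrib_left algebra_simps)
  ultimately show ?thesis by (simp only: power2_eq_square)
qed

text \<open>
  The abstract form of testing with the solution itself: \<open>a m\<close> is the eigenvalue of
  the operator under the time derivative. Multiplying the equation of the mode \<open>m\<close> by
  its coefficient and summing up to \<open>N\<close> tests the equation with the truncation of
  \<open>z\<close>, which converges to \<open>z\<close> in \<open>V\<close> and is bounded by it.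
\<close>

lemma Galerkin_energy:
  assumes a: "\<And>N m. m \<in> modes N \<Longrightarrow> a m > 0"
    and pr: "\<And>N m. m \<in> modes N \<Longrightarrow> primitive_on T (\<lambda>t. a m * mode_coeff (h t) m) (\<lambda>r. blinfun_apply (F r) (mode_V m))"
    and z: "AE r in lebesgue_on {0<..<T}. of_V (z r) = h r"
    and E: "\<And>t. t \<in> {0..T} \<Longrightarrow> (\<lambda>N. \<Sum>m\<in>modes N. a m * (mode_coeff (h t) m)\<^sup>2) \<longlonglongrightarrow> E t"
    and W: "AE r in lebesgue_on {0<..<T}. norm (F r) * norm (z r) \<le> W r" "W absolutely_integrable_on {0..T}"
  shows "primitive_on T E (\<lambda>r. 2 * blinfun_apply (F r) (z r))"
proof -
  define X where "X N t = (\<Sum>m\<in>modes N. a m * (mode_coeff (h t) m)\<^sup>2)" for N t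
  define g where "g N r = 2 * (\<Sum>m\<in>modes N. mode_coeff (h r) m * blinfun_apply (F r) (mode_V m))" for N r
  have Xp: "primitive_on T (X N) (g N)" for N
  proof -
    have "primitive_on T (\<lambda>t. mode_coeff (h t) m) (\<lambda>r. blinfun_apply (F r) (mode_V m) / a m)" if m: "m \<in> modes N" for m
      using primitive_on_cmult[OF pr[OF m], of "1 / a m"] a[OF m] by simp
    from weighted_square_sum_primitive[where a = a and x = "\<lambda>m t. mode_coeff (h t) m", OF finite_modes[of N] this]
    have "primitive_on T (X N) (\<lambda>r. 2 * (\<Sum>m\<in>modes N. a m * (mode_coeff (h r) m * (blinfun_apply (F r) (mode_V m) / a m))))"
      by (simp add: X_def[abs_def])
    moreover have "(\<Sum>m\<in>modes N. a m * (mode_coeff (h r) m * (blinfun_apply (F r) (mode_V m) / a m))) =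
        (\<Sum>m\<in>modes N. mode_coeff (h r) m * blinfun_apply (F r) (mode_V m))" for r
      by (intro sum.cong refl) (use a in \<open>force\<close>)
    ultimately show ?thesis unfolding g_def[abs_def] by (simp only:)
  qed
  have g: "g N r = 2 * blinfun_apply (F r) (truncation N (of_V (z r)))" if "of_V (z r) = h r" for N r
    unfolding g_def that truncation_def by (simp add: blinfun.sum_right blinfun.scaleR_right)
  show ?thesis
  proof (rule primitive_on_limit[where x = X and g = g and w = "\<lambda>r. 2 * W r", OF Xp])
    show "(\<lambda>N. X N t) \<longlonglongrightarrow> E t" if "t \<in> {0..T}" for t using E[OF that] by (simp add: X_def)
    show "AE r in lebesgue_on {0<..<T}. (\<lambda>N. g N r) \<longlonglongrightarrow> 2 * blinfun_apply (F r) (z r)"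
      using z
    proof eventually_elim
      case (elim r)
      show ?case unfolding g[OF elim]
        by (intro tendsto_mult tendsto_const blinfun.tendsto truncation_tendsto_V)
    qed
    show "AE r in lebesgue_on {0<..<T}. \<forall>N. \<bar>g N r\<bar> \<le> 2 * W r"
      using z W(1)
    proof eventually_elim
      case (elim r)
      show ?case
      proof
        fix N
        have "\<bar>blinfun_apply (F r) (truncation N (of_V (z r)))\<bar> \<le> norm (F r) * norm (truncation N (of_V (z r)))"
          using norm_blinfun[of "F r"] by simp
        also have "\<dots> \<le> norm (F r) * norm (z r)" by (intro mult_left_mono norm_truncation_le) auto
        finally show "\<bar>g N r\<bar> \<le> 2 * W r" using elim by (simp add: g[OF elim(1)] abs_mult)
      qed
    qed
    show "(\<lambda>r. 2 * W r) absolutely_integrable_on {0..T}" by (intro set_integrable_mult_right W(2))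
  qed
qed

theorem evolution_energy:
  assumes ev: "evolution \<alpha> T u B F G"
  shows "primitive_on T (\<lambda>t. \<alpha>\<^sup>2 * (norm (u t))\<^sup>2 + (norm (of_V (u t)))\<^sup>2 + (norm (B t))\<^sup>2)
    (\<lambda>r. 2 * blinfun_apply (F r) (u r) + 2 * blinfun_apply (G r) (to_V (B r)))"
proof (rule primitive_on_add)
  have u: "continuous_on {0..T} u" using ev by (simp add: evolution_def)
  obtain f where f: "f absolutely_integrable_on {0..T}" "AE t in lebesgue_on {0<..<T}. norm (F t) \<le> f t"
    using ev unfolding evolution_def by blast
  obtain g where g: "g absolutely_integrable_on {0..T}" "AE t in lebesgue_on {0<..<T}. (norm (G t))\<^sup>2 \<le> g t"
    using ev unfolding evolution_def by blast
  obtain b where b: "b absolutely_integrable_on {0..T}" "AE t in lebesgue_on {0<..<T}. (norm (to_V (B t)))\<^sup>2 \<le> b t"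
    using ev unfolding evolution_def by blast
  show "primitive_on T (\<lambda>t. \<alpha>\<^sup>2 * (norm (u t))\<^sup>2 + (norm (of_V (u t)))\<^sup>2) (\<lambda>r. 2 * blinfun_apply (F r) (u r))"
  proof (rule Galerkin_energy[where a = "\<lambda>m. \<alpha>\<^sup>2 * eigenvalue m + 1" and h = "\<lambda>t. of_V (u t)" and W = "\<lambda>r. norm (u r) * f r"])
    show "0 < \<alpha>\<^sup>2 * eigenvalue m + 1" if "m \<in> modes N" for N m
      using eigenvalue_ge_1[OF that] by (simp add: add_nonneg_pos)
    show "primitive_on T (\<lambda>t. (\<alpha>\<^sup>2 * eigenvalue m + 1) * mode_coeff (of_V (u t)) m) (\<lambda>r. blinfun_apply (F r) (mode_V m))"
      if "m \<in> modes N" for N m using ev that unfolding evolution_def by blast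
    show "(\<lambda>N. \<Sum>m\<in>modes N. (\<alpha>\<^sup>2 * eigenvalue m + 1) * (mode_coeff (of_V (u t)) m)\<^sup>2) \<longlonglongrightarrow> \<alpha>\<^sup>2 * (norm (u t))\<^sup>2 + (norm (of_V (u t)))\<^sup>2" for t
    proof -
      have "(\<lambda>N. \<alpha>\<^sup>2 * (norm (truncation N (of_V (u t))))\<^sup>2 + (norm (of_V (truncation N (of_V (u t)))))\<^sup>2) \<longlonglongrightarrow> \<alpha>\<^sup>2 * (norm (u t))\<^sup>2 + (norm (of_V (u t)))\<^sup>2"
        by (intro tendsto_intros truncation_tendsto_V truncation_tendsto_H of_V_in_H)
      then show ?thesis
        unfolding norm_truncation norm_of_V_truncation
        by (simp add: sum_distrib_left sum.distrib distrib_right mult.assoc)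
    qed
    show "AE r in lebesgue_on {0<..<T}. norm (F r) * norm (u r) \<le> norm (u r) * f r"
      using f(2)
    proof eventually_elim
      case (elim r)
      then show ?case using mult_right_mono[OF elim, of "norm (u r)"] by (simp only: mult.commute norm_ge_zero simp_thms)
    qed
    show "(\<lambda>r. norm (u r) * f r) absolutely_integrable_on {0..T}"
      by (intro absolutely_integrable_continuous_mult_real continuous_on_norm u f(1))
  qed simp
  have BV: "AE t in lebesgue_on {0<..<T}. B t \<in> V_set" using ev unfolding evolution_def by blast
  show "primitive_on T (\<lambda>t. (norm (B t))\<^sup>2) (\<lambda>r. 2 * blinfun_apply (G r) (to_V (B r)))"
  proof (rule Galerkin_energy[where a = "\<lambda>m. 1" and h = B and W = "\<lambda>r. g r + b r"])
    show "primitive_on T (\<lambda>t. 1 * mode_coeff (B t) m) (\<lambda>r. blinfun_apply (G r) (mode_V m))" if "m \<in> modes N" for N m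
      using ev that unfolding evolution_def by simp
    show "AE r in lebesgue_on {0<..<T}. of_V (to_V (B r)) = B r"
      using BV by eventually_elim (rule to_V_inverse)
    show "(\<lambda>N. \<Sum>m\<in>modes N. 1 * (mode_coeff (B t) m)\<^sup>2) \<longlonglongrightarrow> (norm (B t))\<^sup>2" if "t \<in> {0..T}" for t
    proof -
      have "B t \<in> H_set" using ev that by (simp add: evolution_def)
      then have "(\<lambda>N. (norm (of_V (truncation N (B t))))\<^sup>2) \<longlonglongrightarrow> (norm (B t))\<^sup>2"
        by (intro tendsto_intros truncation_tendsto_H)
      then show ?thesis by (simp add: norm_of_V_truncation)
    qed
    show "AE r in lebesgue_on {0<..<T}. norm (G r) * norm (to_V (B r)) \<le> g r + b r"
      using g(2) b(2)
    proof eventually_elim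
      case (elim r)
      have "2 * norm (G r) * norm (to_V (B r)) \<le> (norm (G r))\<^sup>2 + (norm (to_V (B r)))\<^sup>2" by (rule sum_squares_bound)
      moreover have "0 \<le> norm (G r) * norm (to_V (B r))" by simp
      ultimately show ?case using elim by linarith
    qed
    show "(\<lambda>r. g r + b r) absolutely_integrable_on {0..T}" by (intro set_integral_add g b)
  qed simp
qed

text \<open>
  Measurability in time comes from the coefficients, which are continuous.
\<close>

lemma evolution_gradient_square_integrable:
  assumes ev: "evolution \<alpha> T u B F G"
  shows "(\<lambda>r. (norm (to_V (B r)))\<^sup>2) absolutely_integrable_on {0..T}"
proof -
  obtain b where b: "b absolutely_integrable_on {0..T}" "AE t in lebesgue_on {0<..<T}. (norm (to_V (B t)))\<^sup>2 \<le> b t"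
    using ev unfolding evolution_def by blast
  have BV: "AE t in lebesgue_on {0<..<T}. B t \<in> V_set" using ev unfolding evolution_def by blast
  show ?thesis
  proof (rule time_dominated_convergence(1)[where f = "\<lambda>N r. (norm (truncation N (B r)))\<^sup>2" and w = b])
    show "(\<lambda>r. (norm (truncation N (B r)))\<^sup>2) absolutely_integrable_on {0..T}" for N
    proof -
      have "continuous_on {0..T} (\<lambda>r. mode_coeff (B r) m)" if "m \<in> modes N" for m
        using ev that unfolding evolution_def by (blast intro: primitive_on_continuous)
      then show ?thesis unfolding norm_truncation
        by (intro absolutely_integrable_continuous_real continuous_intros)
    qed
    show "AE r in lebesgue_on {0<..<T}. (\<lambda>N. (norm (truncation N (B r)))\<^sup>2) \<longlonglongrightarrow> (norm (to_V (B r)))\<^sup>2"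
      using BV
    proof eventually_elim
      case (elim r)
      have "(\<lambda>N. (norm (truncation N (of_V (to_V (B r)))))\<^sup>2) \<longlonglongrightarrow> (norm (to_V (B r)))\<^sup>2"
        by (intro tendsto_intros truncation_tendsto_V)
      then show ?case by (simp add: to_V_inverse[OF elim])
    qed
    show "AE r in lebesgue_on {0<..<T}. \<forall>N. \<bar>(norm (truncation N (B r)))\<^sup>2\<bar> \<le> b r"
      using BV b(2)
    proof eventually_elim
      case (elim r)
      have "(norm (truncation N (of_V (to_V (B r)))))\<^sup>2 \<le> (norm (to_V (B r)))\<^sup>2" for N
        by (intro power_mono norm_truncation_le) auto
      then show ?case
        unfolding to_V_inverse[OF elim(1)] abs_power2 using elim(2) order_trans by blast
    qed
  qed (rule b(1))
qed

section \<open>A priori bounds\<close>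

text \<open>
  The transfer terms \<open>B(b,b)u\<close> and \<open>B(b,u)b\<close> cancel by antisymmetry and
  the others vanish. The dissipation has the right sign and is dropped.
\<close>

lemma energy_bound:
  assumes T: "0 < T" and mu: "\<mu> > 0" and ws: "weak_solution \<alpha> \<mu> T u0 (of_V B0) u B" and t: "t \<in> {0..T}"
  shows "\<alpha>\<^sup>2 * (norm (u t))\<^sup>2 + (norm (of_V (u t)))\<^sup>2 + (norm (B t))\<^sup>2 \<le> (K1_const \<alpha> u0 B0)\<^sup>2"
proof -
  obtain F G where ev: "evolution \<alpha> T u B F G"
    and F: "AE t in lebesgue_on {0<..<T}. F t = B_op (to_V (B t)) (to_V (B t)) - B_op (u t) (u t)"
    and G: "AE t in lebesgue_on {0<..<T}. G t + \<mu> *\<^sub>R A_op (to_V (B t)) = B_op (to_V (B t)) (u t) - B_op (u t) (to_V (B t))"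
    using weak_solution_evolution[OF T ws] by blast
  have le: "AE r in lebesgue_on {0<..<T}. 2 * blinfun_apply (F r) (u r) + 2 * blinfun_apply (G r) (to_V (B r)) \<le>
      0 * (\<alpha>\<^sup>2 * (norm (u r))\<^sup>2 + (norm (of_V (u r)))\<^sup>2 + (norm (B r))\<^sup>2) - 0"
    using F G
  proof eventually_elim
    case (elim r)
    define b where "b = to_V (B r)"
    have Gr: "G r = B_op b (u r) - B_op (u r) b - \<mu> *\<^sub>R A_op b"
      using elim(2) unfolding b_def by (simp add: algebra_simps)
    have "blinfun_apply (G r) b = blinfun_apply (B_op b (u r)) b - \<mu> * (b \<bullet> b)"
      unfolding Gr by (simp add: blinfun.diff_left blinfun.scaleR_left A_op_apply B_op_self)
    moreover have "blinfun_apply (F r) (u r) = - blinfun_apply (B_op b (u r)) b"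
      unfolding elim(1) b_def[symmetric] by (simp add: blinfun.diff_left B_op_self B_op_antisymmetric[of b b])
    ultimately show ?case using mu by (simp add: b_def)
  qed
  have "u 0 = u0" "B 0 = of_V B0" using ws by (auto simp: weak_solution_def)
  then show ?thesis
    using Gronwall_primitive[OF evolution_energy[OF ev] _ le t]
    by (simp add: K1_const_def add_nonneg_nonneg)
qed

lemma energy_bound_components:
  assumes "0 < T" "\<alpha> > 0" "\<mu> > 0" "weak_solution \<alpha> \<mu> T u0 (of_V B0) u B" "t \<in> {0..T}"
  shows "norm (u t) \<le> K1_const \<alpha> u0 B0 / \<alpha>" "norm (B t) \<le> K1_const \<alpha> u0 B0"
proof -
  note * = energy_bound[OF assms(1,3-5)]
  have K: "K1_const \<alpha> u0 B0 \<ge> 0" by (simp add: K1_const_def)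
  have "(\<alpha> * norm (u t))\<^sup>2 \<le> (K1_const \<alpha> u0 B0)\<^sup>2"
    using * by (smt (verit) power_mult_distrib zero_le_power2)
  then have "\<alpha> * norm (u t) \<le> K1_const \<alpha> u0 B0" by (rule power2_le_imp_le) (rule K)
  then show "norm (u t) \<le> K1_const \<alpha> u0 B0 / \<alpha>" using assms(2) by (simp add: field_simps)
  have "0 \<le> \<alpha>\<^sup>2 * (norm (u t))\<^sup>2" by simp
  then have "(norm (B t))\<^sup>2 \<le> (K1_const \<alpha> u0 B0)\<^sup>2" using * zero_le_power2[of "norm (of_V (u t))"] by linarith
  then show "norm (B t) \<le> K1_const \<alpha> u0 B0" by (rule power2_le_imp_le) (rule K)
qed

text \<open>
  Testing the magnetic equation with the Stokes operator of \<open>b\<close> is legitimate only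
  after truncation, as the time derivative is a functional on \<open>V\<close>. The test function
  is the truncation of \<open>Stokes b\<close>, which produces \<open>Q N\<close>, the square of
  its norm, in the dissipation. The nonlinear terms are at most \<open>(3/2) \<mu> q + C\<close>
  with the square \<open>q\<close> of the norm of \<open>Stokes b\<close> itself, so that \<open>-
  (\<mu>/2) q\<close> survives when \<open>Q N\<close> tends to \<open>q\<close>. The choice of
  \<open>e\<close> makes the first nonlinear contribution at most \<open>\<mu> q\<close>, and
  Young's inequality bounds the second by \<open>C\<close> and another \<open>(\<mu>/2) q\<close>.
\<close>

lemma gradient_bound:
  assumes e: "e * (U + 1) = \<mu> / 2" "e > 0" and D: "D > 0"
    "\<And>v u w. v \<in> Dom_A \<Longrightarrow> \<bar>blinfun_apply (B_op v u) w\<bar> + \<bar>blinfun_apply (B_op u v) w\<bar> \<le>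
       norm u * norm (of_V w) * (e * norm (Stokes v) + D * norm (of_V v))"
    and T: "0 < T" and mu: "\<mu> > 0" and U: "U \<ge> 0"
    and ss: "strong_solution \<alpha> \<mu> T u0 B0 u B"
    and u: "\<And>t. t \<in> {0..T} \<Longrightarrow> norm (u t) \<le> U" and B: "\<And>t. t \<in> {0..T} \<Longrightarrow> norm (B t) \<le> H"
    and t: "t \<in> {0..T}"
  shows "(norm (to_V (B t)))\<^sup>2 \<le> (norm B0)\<^sup>2 + (2 * U * D * H / \<mu>)\<^sup>2"
proof -
  have ws: "weak_solution \<alpha> \<mu> T u0 (of_V B0) u B"
    and SA: "AE t in lebesgue_on {0<..<T}. to_V (B t) \<in> Dom_A"
    and S2: "Lp_time 2 T (\<lambda>t. Stokes (to_V (B t)))"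
    and BV: "\<And>t. t \<in> {0..T} \<Longrightarrow> of_V (to_V (B t)) = B t"
    and Bc: "continuous_on {0..T} (\<lambda>t. to_V (B t))"
    using ss to_V_inverse unfolding strong_solution_def by blast+
  obtain F G where ev: "evolution \<alpha> T u B F G"
    and G: "AE t in lebesgue_on {0<..<T}. G t + \<mu> *\<^sub>R A_op (to_V (B t)) = B_op (to_V (B t)) (u t) - B_op (u t) (to_V (B t))"
    using weak_solution_evolution[OF T ws] by blast
  have H: "H \<ge> 0" using B[OF t] norm_ge_zero[of "B t"] by linarith
  define C where "C = (2 * U * D * H)\<^sup>2 / (2 * \<mu>)"
  define Z where "Z t = (norm (to_V (B t)))\<^sup>2" for t
  define q where "q r = (norm (Stokes (to_V (B r))))\<^sup>2" for r
  define X where "X N r = (\<Sum>m\<in>modes N. eigenvalue m * (mode_coeff (B r) m)\<^sup>2)" for N r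
  define g where "g N r = 2 * (\<Sum>m\<in>modes N. eigenvalue m * (mode_coeff (B r) m * blinfun_apply (G r) (mode_V m)))" for N r
  define Q where "Q N r = (\<Sum>m\<in>modes N. (eigenvalue m)\<^sup>2 * (mode_coeff (B r) m)\<^sup>2)" for N r
  have coeff: "primitive_on T (\<lambda>t. mode_coeff (B t) m) (\<lambda>r. blinfun_apply (G r) (mode_V m))" if "m \<in> modes N" for m N
    using ev that unfolding evolution_def by blast
  have Xp: "primitive_on T (X N) (g N)" for N
    unfolding X_def[abs_def] g_def[abs_def] by (intro weighted_square_sum_primitive finite_modes coeff)
  have qi: "q absolutely_integrable_on {0..T}"
    unfolding q_def[abs_def] by (rule Lp_time_norm_square_integrable[OF S2])
  have ci: "(\<lambda>r. c) absolutely_integrable_on {0..T}" for c :: real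
    by (intro absolutely_integrable_continuous_real continuous_intros)
  have Qi: "Q N absolutely_integrable_on {0..T}" for N
    unfolding Q_def[abs_def]
    by (intro absolutely_integrable_continuous_real continuous_on_sum continuous_on_mult continuous_on_power
        continuous_on_const primitive_on_continuous[OF coeff])
  have good: "AE r in lebesgue_on {0<..<T}. r \<in> {0..T} \<and> to_V (B r) \<in> Dom_A \<and>
       G r = B_op (to_V (B r)) (u r) - B_op (u r) (to_V (B r)) - \<mu> *\<^sub>R A_op (to_V (B r))"
  proof -
    have "AE r in lebesgue_on {0<..<T}. r \<in> {0..T}" unfolding AE_time_iff by (intro exI[of _ "{}"]) auto
    then show ?thesis using SA G by eventually_elim (auto simp: algebra_simps)
  qed
  have Qeq: "Q N r = (norm (of_V (truncation N (Stokes (to_V (B r))))))\<^sup>2"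
    if "r \<in> {0..T}" "to_V (B r) \<in> Dom_A" for N r
    unfolding Q_def norm_truncation_Stokes[OF that(2), symmetric] BV[OF that(1)] ..
  have Qle: "Q N r \<le> q r" if "r \<in> {0..T}" "to_V (B r) \<in> Dom_A" for N r
    unfolding Qeq[OF that] q_def by (intro power_mono norm_of_V_truncation_le) auto
  \<comment> \<open>Here \<open>g N r\<close> is twice the value of \<open>G r\<close> at the
    truncation of \<open>Stokes b\<close>.\<close>
  have gle: "g N r \<le> C + 3 / 2 * \<mu> * q r - 2 * \<mu> * Q N r"
    if r: "r \<in> {0..T}" "to_V (B r) \<in> Dom_A"
      "G r = B_op (to_V (B r)) (u r) - B_op (u r) (to_V (B r)) - \<mu> *\<^sub>R A_op (to_V (B r))" for N r
  proof -
    define b where "b = to_V (B r)"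
    define w where "w = truncation N (Stokes b)"
    define x where "x = norm (Stokes b)"
    have b: "of_V b = B r" "b \<in> Dom_A" using BV r by (auto simp: b_def)
    have "g N r = 2 * blinfun_apply (G r) w"
      unfolding g_def w_def truncation_def
      by (simp add: blinfun.sum_right blinfun.scaleR_right mode_coeff_Stokes[OF b(2)] b(1) mult.assoc cong: sum.cong)
    moreover have "b \<bullet> w = Q N r"
      unfolding w_def truncation_def inner_sum_right Q_def
      by (intro sum.cong refl)
        (simp add: mode_coeff_Stokes[OF b(2)] b(1) inner_commute[of b] inner_mode_V power2_eq_square algebra_simps)
    ultimately have gN: "g N r = 2 * (blinfun_apply (B_op b (u r)) w - blinfun_apply (B_op (u r) b) w) - 2 * \<mu> * Q N r"
      unfolding r(3) b_def[symmetric] by (simp add: blinfun.diff_left blinfun.scaleR_left A_op_apply)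
    have "blinfun_apply (B_op b (u r)) w - blinfun_apply (B_op (u r) b) w \<le> norm (u r) * norm (of_V w) * (e * x + D * norm (B r))"
      using D(2)[OF b(2), of "u r" w] unfolding x_def b(1) by linarith
    also have "\<dots> \<le> U * x * (e * x + D * H)"
      using u[OF r(1)] B[OF r(1)] e D U norm_of_V_truncation_le[of N "Stokes b"] unfolding w_def x_def
      by (intro mult_mono add_mono mult_nonneg_nonneg add_nonneg_nonneg) auto
    also have "\<dots> \<le> \<mu> / 2 * x\<^sup>2 + U * D * H * x"
    proof -
      have "e * U \<le> \<mu> / 2" using e by (simp add: algebra_simps)
      from mult_right_mono[OF this, of "x\<^sup>2"] show ?thesis by (simp add: power2_eq_square algebra_simps)
    qed
    finally have *: "blinfun_apply (B_op b (u r)) w - blinfun_apply (B_op (u r) b) w \<le> \<mu> / 2 * x\<^sup>2 + U * D * H * x" .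
    have "2 * (U * D * H * x) \<le> \<mu> / 2 * x\<^sup>2 + C"
    proof -
      have "0 \<le> (\<mu> * x - 2 * U * D * H)\<^sup>2 / (2 * \<mu>)" using mu by simp
      also have "\<dots> = \<mu> / 2 * x\<^sup>2 + C - 2 * (U * D * H * x)"
        using mu unfolding C_def by (simp add: power2_eq_square field_simps)
      finally show ?thesis by simp
    qed
    then show ?thesis using * unfolding gN q_def b_def[symmetric] x_def by simp
  qed
  have Zle: "Z t - Z s \<le> integral {s..t} (\<lambda>r. C - \<mu> / 2 * Z r)" if st: "0 \<le> s" "s \<le> t" "t \<le> T" for s t
  proof -
    have XN: "X N t - X N s \<le> integral {s..t} (\<lambda>r. C + 3 / 2 * \<mu> * q r - 2 * \<mu> * Q N r)" for N
      unfolding primitive_on_integral[OF Xp st]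
    proof (rule integral_le_AE[OF primitive_on_absint[OF Xp] _ _ st(1,3)])
      show "(\<lambda>r. C + 3 / 2 * \<mu> * q r - 2 * \<mu> * Q N r) absolutely_integrable_on {0..T}"
        by (intro set_integral_diff set_integral_add set_integrable_mult_right ci qi Qi)
      show "AE r in lebesgue_on {0<..<T}. g N r \<le> C + 3 / 2 * \<mu> * q r - 2 * \<mu> * Q N r"
        using good by eventually_elim (intro gle; simp)
    qed
    have XZ: "(\<lambda>N. X N r) \<longlonglongrightarrow> Z r" if "r \<in> {0..T}" for r
    proof -
      have "(\<lambda>N. (norm (truncation N (of_V (to_V (B r)))))\<^sup>2) \<longlonglongrightarrow> Z r"
        unfolding Z_def by (intro tendsto_intros truncation_tendsto_V)
      then show ?thesis by (simp only: X_def norm_truncation BV[OF that])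
    qed
    have "(\<lambda>N. integral {s..t} (\<lambda>r. C + 3 / 2 * \<mu> * q r - 2 * \<mu> * Q N r)) \<longlonglongrightarrow> integral {s..t} (\<lambda>r. C - \<mu> / 2 * q r)"
    \<comment> \<open>The bound \<open>4 \<mu> q\<close> covers \<open>3/2 \<mu> q\<close> and
      \<open>2 \<mu> Q N\<close> with room to spare.\<close>
    proof (rule time_dominated_convergence(2)[where w = "\<lambda>r. C + 4 * \<mu> * q r", OF _ _ _ _ st(1,3)])
      show "(\<lambda>r. C + 3 / 2 * \<mu> * q r - 2 * \<mu> * Q N r) absolutely_integrable_on {0..T}" for N
        by (intro set_integral_diff set_integral_add set_integrable_mult_right ci qi Qi)
      show "(\<lambda>r. C + 4 * \<mu> * q r) absolutely_integrable_on {0..T}"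
        by (intro set_integral_add set_integrable_mult_right ci qi)
      show "AE r in lebesgue_on {0<..<T}. (\<lambda>N. C + 3 / 2 * \<mu> * q r - 2 * \<mu> * Q N r) \<longlonglongrightarrow> C - \<mu> / 2 * q r"
        using good
      proof eventually_elim
        case (elim r)
        have "(\<lambda>N. (norm (of_V (truncation N (Stokes (to_V (B r))))))\<^sup>2) \<longlonglongrightarrow> q r"
          unfolding q_def by (intro tendsto_intros truncation_tendsto_H Stokes_in_H)
        then have "(\<lambda>N. Q N r) \<longlonglongrightarrow> q r" using elim by (simp add: Qeq)
        then have "(\<lambda>N. C + 3 / 2 * \<mu> * q r - 2 * \<mu> * Q N r) \<longlonglongrightarrow> C + 3 / 2 * \<mu> * q r - 2 * \<mu> * q r"
          by (intro tendsto_intros)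
        then show ?case by (simp add: algebra_simps)
      qed
      show "AE r in lebesgue_on {0<..<T}. \<forall>N. \<bar>C + 3 / 2 * \<mu> * q r - 2 * \<mu> * Q N r\<bar> \<le> C + 4 * \<mu> * q r"
        using good
      proof eventually_elim
        case (elim r)
        show ?case
        proof
          fix N
          have "0 \<le> Q N r" "Q N r \<le> q r" using Qle[of r N] elim by (auto simp: Q_def sum_nonneg)
          then have "0 \<le> \<mu> * Q N r" "\<mu> * Q N r \<le> \<mu> * q r" using mu by (auto intro: mult_left_mono)
          moreover have "C \<ge> 0" using mu by (simp add: C_def)
          ultimately show "\<bar>C + 3 / 2 * \<mu> * q r - 2 * \<mu> * Q N r\<bar> \<le> C + 4 * \<mu> * q r" unfolding abs_le_iff
            by (auto simp: algebra_simps)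
        qed
      qed
    qed
    then have "Z t - Z s \<le> integral {s..t} (\<lambda>r. C - \<mu> / 2 * q r)"
      using st XN by (intro LIMSEQ_le[OF tendsto_diff[OF XZ[of t] XZ[of s]]]) auto
    also have "\<dots> \<le> integral {s..t} (\<lambda>r. C - \<mu> / 2 * Z r)"
    proof (rule integral_le_AE[OF _ _ _ st(1,3)])
      show "(\<lambda>r. C - \<mu> / 2 * q r) absolutely_integrable_on {0..T}"
        by (intro set_integral_diff set_integrable_mult_right ci qi)
      show "(\<lambda>r. C - \<mu> / 2 * Z r) absolutely_integrable_on {0..T}"
        unfolding Z_def by (intro absolutely_integrable_continuous_real continuous_intros Bc)
      show "AE r in lebesgue_on {0<..<T}. C - \<mu> / 2 * q r \<le> C - \<mu> / 2 * Z r"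
        using good
      proof eventually_elim
        case (elim r)
        let ?b = "to_V (B r)"
        \<comment> \<open>The dissipation dominates the quantity itself: \<open>||b||^2 = (A b, b)
          \<le> |A b| ||b||\<close>.\<close>
        have "norm ?b * norm ?b = Stokes ?b \<bullet> of_V ?b"
          using inner_Stokes[of ?b ?b] elim by (simp add: dot_square_norm power2_eq_square)
        also have "\<dots> \<le> norm (Stokes ?b) * norm ?b"
          using norm_cauchy_schwarz[of "Stokes ?b" "of_V ?b"] mult_left_mono[OF Poincare[of ?b], of "norm (Stokes ?b)"] by simp
        finally have "norm ?b \<le> norm (Stokes ?b)" by (cases "norm ?b = 0") (auto simp: mult_le_cancel_right)
        then have "Z r \<le> q r" unfolding Z_def q_def by (intro power_mono) auto
        then show ?case using mu by simp
      qed
    qed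
    finally show ?thesis .
  qed
  show ?thesis unfolding Z_def[symmetric]
  proof (rule dissipation_comparison[OF _ _ Zle t])
    show "continuous_on {0..T} Z" unfolding Z_def by (intro continuous_intros Bc)
    have "B 0 = of_V B0" using ws by (simp add: weak_solution_def)
    then show "Z 0 \<le> (norm B0)\<^sup>2 + (2 * U * D * H / \<mu>)\<^sup>2" by (simp add: Z_def of_V_inverse)
    have "C / (\<mu> / 2) = (2 * U * D * H / \<mu>)\<^sup>2" using mu by (simp add: C_def power2_eq_square field_simps)
    then show "C / (\<mu> / 2) \<le> (norm B0)\<^sup>2 + (2 * U * D * H / \<mu>)\<^sup>2" by simp
  qed (use mu in auto)
qed

section \<open>Comparison of a strong and a weak solution\<close>

text \<open>
  Inserting \<open>u2 = u1 - w\<close> and \<open>b2 = b1 - b\<close>, the two pairs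
  \<open>B(b1,b)w, B(b1,w)b\<close> and \<open>B(b,b)w, B(b,w)b\<close> cancel by antisymmetry,
  and the forms whose last two fields agree vanish. In each of the four remaining terms the third
  field is that of the first solution.
\<close>

lemma difference_power_balance:
  assumes "G1 = B_op b1 u1 - B_op u1 b1 - \<mu> *\<^sub>R A_op b1" "G2 = B_op b2 u2 - B_op u2 b2 - \<mu> *\<^sub>R A_op b2"
    and "F1 = B_op b1 b1 - B_op u1 u1" "F2 = B_op b2 b2 - B_op u2 u2"
  shows "blinfun_apply (F1 - F2) (u1 - u2) + blinfun_apply (G1 - G2) (b1 - b2) =
    - \<mu> * (norm (b1 - b2))\<^sup>2 + blinfun_apply (B_op (b1 - b2) b1) (u1 - u2) - blinfun_apply (B_op (u1 - u2) u1) (u1 - u2)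
      + blinfun_apply (B_op (b1 - b2) u1) (b1 - b2) - blinfun_apply (B_op (u1 - u2) b1) (b1 - b2)"
proof -
  define w b where "w = u1 - u2" and "b = b1 - b2"
  interpret B: bounded_bilinear B_op by (rule bounded_bilinear_B_op)
  interpret A: bounded_linear A_op by (rule bounded_linear_A_op)
  have 2: "u2 = u1 - w" "b2 = b1 - b" by (auto simp: w_def b_def)
  have "F1 - F2 = B_op b1 b + B_op b b1 - B_op b b - B_op u1 w - B_op w u1 + B_op w w"
    unfolding assms(3,4) 2 by (simp add: B.diff_left B.diff_right algebra_simps)
  moreover have "G1 - G2 = B_op b1 w + B_op b u1 - B_op b w - B_op u1 b - B_op w b1 + B_op w b - \<mu> *\<^sub>R A_op b"
    unfolding assms(1,2) 2 by (simp add: B.diff_left B.diff_right A.diff algebra_simps)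
  ultimately have "blinfun_apply (F1 - F2) w + blinfun_apply (G1 - G2) b =
     - \<mu> * (norm b)\<^sup>2 + blinfun_apply (B_op b b1) w - blinfun_apply (B_op w u1) w + blinfun_apply (B_op b u1) b - blinfun_apply (B_op w b1) b"
    using B_op_antisymmetric[of b1 w b] B_op_antisymmetric[of b w b]
    by (simp add: blinfun.diff_left blinfun.add_left blinfun.scaleR_left B_op_self A_op_apply dot_square_norm)
  then show ?thesis by (simp only: w_def b_def)
qed

text \<open>
  The constants: the two terms with \<open>b1\<close> add up to at most \<open>36 ||b|| ||b1||
  ||w||\<close>, and with the factor 2 of the energy balance Young's inequality gives
  \<open>(\<mu>/2) ||b||^2 + (72^2 / (2 \<mu>)) ||b1||^2 ||w||^2\<close>, where \<open>72^2 / 2 =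
  2592\<close>. The term with \<open>u1\<close> and \<open>b\<close> takes another
  \<open>(\<mu>/2) ||b||^2\<close>. The summand 1 makes \<open>K\<close> positive even for the
  zero solution.
\<close>

lemma difference_estimate:
  assumes e: "e * (U + 1) = \<mu> / 4" "e > 0" and D: "D > 0"
    "\<And>u v. \<bar>blinfun_apply (B_op u v) u\<bar> \<le> norm v * (e * (norm u)\<^sup>2 + D * (norm (of_V u))\<^sup>2)"
    and T: "0 < T" and alpha: "\<alpha> > 0" and mu: "\<mu> > 0" and U: "U \<ge> 0" and S: "S \<ge> 0"
    and 1: "weak_solution \<alpha> \<mu> T u01 B01 u1 B1" and 2: "weak_solution \<alpha> \<mu> T u02 B02 u2 B2"
    and u: "\<And>t. t \<in> {0..T} \<Longrightarrow> norm (u1 t) \<le> U"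
    and B: "\<And>t. t \<in> {0..T} \<Longrightarrow> (norm (to_V (B1 t)))\<^sup>2 \<le> S"
    and K: "K = (2592 * S / \<mu> + 36 * U) / \<alpha>\<^sup>2 + 2 * U * D + 1"
    and t: "t \<in> {0..T}"
  shows "(norm (of_V (u1 t - u2 t)))\<^sup>2 + \<alpha>\<^sup>2 * (norm (u1 t - u2 t))\<^sup>2 + (norm (B1 t - B2 t))\<^sup>2
      + \<mu> * (LINT s:{0..t}|lebesgue. (norm (to_V (B1 s - B2 s)))\<^sup>2 * exp (K * (t - s)))
    \<le> ((norm (of_V (u01 - u02)))\<^sup>2 + \<alpha>\<^sup>2 * (norm (u01 - u02))\<^sup>2 + (norm (B01 - B02))\<^sup>2) * exp (K * t)"
proof -
  obtain F1 G1 where ev1: "evolution \<alpha> T u1 B1 F1 G1"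
    and F1: "AE t in lebesgue_on {0<..<T}. F1 t = B_op (to_V (B1 t)) (to_V (B1 t)) - B_op (u1 t) (u1 t)"
    and G1: "AE t in lebesgue_on {0<..<T}. G1 t + \<mu> *\<^sub>R A_op (to_V (B1 t)) = B_op (to_V (B1 t)) (u1 t) - B_op (u1 t) (to_V (B1 t))"
    using weak_solution_evolution[OF T 1] by blast
  obtain F2 G2 where ev2: "evolution \<alpha> T u2 B2 F2 G2"
    and F2: "AE t in lebesgue_on {0<..<T}. F2 t = B_op (to_V (B2 t)) (to_V (B2 t)) - B_op (u2 t) (u2 t)"
    and G2: "AE t in lebesgue_on {0<..<T}. G2 t + \<mu> *\<^sub>R A_op (to_V (B2 t)) = B_op (to_V (B2 t)) (u2 t) - B_op (u2 t) (to_V (B2 t))"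
    using weak_solution_evolution[OF T 2] by blast
  note ev = evolution_diff[OF ev1 ev2]
  let ?y = "\<lambda>t. \<alpha>\<^sup>2 * (norm (u1 t - u2 t))\<^sup>2 + (norm (of_V (u1 t - u2 t)))\<^sup>2 + (norm (B1 t - B2 t))\<^sup>2"
  let ?p = "\<lambda>r. \<mu> * (norm (to_V (B1 r - B2 r)))\<^sup>2"
  have V: "AE r in lebesgue_on {0<..<T}. r \<in> {0..T} \<and> B1 r \<in> V_set \<and> B2 r \<in> V_set"
  proof -
    have "AE r in lebesgue_on {0<..<T}. r \<in> {0..T}" unfolding AE_time_iff by (intro exI[of _ "{}"]) auto
    moreover have "AE r in lebesgue_on {0<..<T}. B1 r \<in> V_set" "AE r in lebesgue_on {0<..<T}. B2 r \<in> V_set"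
      using ev1 ev2 unfolding evolution_def by blast+
    ultimately show ?thesis by eventually_elim simp
  qed
  have le: "AE r in lebesgue_on {0<..<T}. 2 * blinfun_apply (F1 r - F2 r) (u1 r - u2 r)
      + 2 * blinfun_apply (G1 r - G2 r) (to_V (B1 r - B2 r)) \<le> K * ?y r - ?p r"
    using V F1 F2 G1 G2
  proof eventually_elim
    case (elim r)
    define w where "w = u1 r - u2 r"
    define b where "b = to_V (B1 r) - to_V (B2 r)"
    define b1 where "b1 = to_V (B1 r)"
    have r: "r \<in> {0..T}" using elim by simp
    have b: "to_V (B1 r - B2 r) = b" using elim(1) by (simp add: b_def to_V_diff)
    have of_b: "of_V b = B1 r - B2 r" using elim(1) V_set_diff unfolding b[symmetric] by (simp add: to_V_inverse)
    have G: "G1 r = B_op b1 (u1 r) - B_op (u1 r) b1 - \<mu> *\<^sub>R A_op b1"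
      "G2 r = B_op (to_V (B2 r)) (u2 r) - B_op (u2 r) (to_V (B2 r)) - \<mu> *\<^sub>R A_op (to_V (B2 r))"
      using elim unfolding b1_def by (simp_all add: algebra_simps)
    have eq: "blinfun_apply (F1 r - F2 r) w + blinfun_apply (G1 r - G2 r) b =
        - \<mu> * (norm b)\<^sup>2 + blinfun_apply (B_op b b1) w - blinfun_apply (B_op w (u1 r)) w
        + blinfun_apply (B_op b (u1 r)) b - blinfun_apply (B_op w b1) b"
      unfolding w_def b_def b1_def by (rule difference_power_balance) (use G elim in \<open>auto simp: b1_def\<close>)
    have bb: "blinfun_apply (B_op b b1) w \<le> 18 * (norm b * norm b1 * norm w)"
      "- blinfun_apply (B_op w b1) b \<le> 18 * (norm b * norm b1 * norm w)"
      using B_op_le[of b b1 w] B_op_le[of w b1 b] by (auto simp: mult.assoc mult.left_commute mult.commute)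
    have wuw: "- blinfun_apply (B_op w (u1 r)) w \<le> 18 * U * (norm w)\<^sup>2"
    proof -
      have "- blinfun_apply (B_op w (u1 r)) w \<le> 18 * norm w * norm (u1 r) * norm w" using B_op_le[of w "u1 r" w] by linarith
      also have "\<dots> = 18 * norm (u1 r) * (norm w)\<^sup>2" by (simp add: power2_eq_square)
      also have "\<dots> \<le> 18 * U * (norm w)\<^sup>2" using u[OF r] by (intro mult_right_mono) auto
      finally show ?thesis .
    qed
    have bub: "blinfun_apply (B_op b (u1 r)) b \<le> \<mu> / 4 * (norm b)\<^sup>2 + U * D * (norm (of_V b))\<^sup>2"
    proof -
      have "blinfun_apply (B_op b (u1 r)) b \<le> norm (u1 r) * (e * (norm b)\<^sup>2 + D * (norm (of_V b))\<^sup>2)"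
        using D(2)[of b "u1 r"] by linarith
      also have "\<dots> \<le> U * (e * (norm b)\<^sup>2 + D * (norm (of_V b))\<^sup>2)"
        using u[OF r] e(2) D(1) by (intro mult_right_mono) auto
      also have "\<dots> \<le> \<mu> / 4 * (norm b)\<^sup>2 + U * D * (norm (of_V b))\<^sup>2"
      proof -
        have "e * U \<le> \<mu> / 4" using e by (simp add: algebra_simps)
        from mult_right_mono[OF this, of "(norm b)\<^sup>2"] show ?thesis by (simp add: algebra_simps)
      qed
      finally show ?thesis .
    qed
    have young: "72 * (norm b * norm b1 * norm w) \<le> \<mu> / 2 * (norm b)\<^sup>2 + 2592 * S / \<mu> * (norm w)\<^sup>2"
    proof -
      have "0 \<le> (\<mu> * norm b - 72 * (norm b1 * norm w))\<^sup>2 / (2 * \<mu>)" using mu by simp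
      also have "\<dots> = \<mu> / 2 * (norm b)\<^sup>2 + 2592 / \<mu> * (norm w)\<^sup>2 * (norm b1)\<^sup>2 - 72 * (norm b * norm b1 * norm w)"
        using mu by (simp add: power2_eq_square field_simps)
      also have "2592 / \<mu> * (norm w)\<^sup>2 * (norm b1)\<^sup>2 \<le> 2592 / \<mu> * (norm w)\<^sup>2 * S"
        using B[OF r] mu unfolding b1_def by (intro mult_left_mono) auto
      finally show ?thesis by (simp add: algebra_simps)
    qed
    have "2 * (blinfun_apply (F1 r - F2 r) w + blinfun_apply (G1 r - G2 r) b) \<le>
        - \<mu> * (norm b)\<^sup>2 + (2592 * S / \<mu> + 36 * U) * (norm w)\<^sup>2 + 2 * U * D * (norm (of_V b))\<^sup>2"
      using eq bb wuw bub young by (simp add: algebra_simps)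
    also have "(2592 * S / \<mu> + 36 * U) * (norm w)\<^sup>2 = (2592 * S / \<mu> + 36 * U) / \<alpha>\<^sup>2 * (\<alpha>\<^sup>2 * (norm w)\<^sup>2)"
      using alpha by simp
    also have "- \<mu> * (norm b)\<^sup>2 + (2592 * S / \<mu> + 36 * U) / \<alpha>\<^sup>2 * (\<alpha>\<^sup>2 * (norm w)\<^sup>2) + 2 * U * D * (norm (of_V b))\<^sup>2
        \<le> - \<mu> * (norm b)\<^sup>2 + K * (\<alpha>\<^sup>2 * (norm w)\<^sup>2) + K * (norm (of_V w))\<^sup>2 + K * (norm (of_V b))\<^sup>2"
    proof -
      have c: "0 \<le> (2592 * S / \<mu> + 36 * U) / \<alpha>\<^sup>2" "0 \<le> 2 * U * D" using mu U S D(1) by (auto intro!: divide_nonneg_nonneg add_nonneg_nonneg)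
      have "(2592 * S / \<mu> + 36 * U) / \<alpha>\<^sup>2 * (\<alpha>\<^sup>2 * (norm w)\<^sup>2) \<le> K * (\<alpha>\<^sup>2 * (norm w)\<^sup>2)"
        using c by (intro mult_right_mono) (auto simp: K)
      moreover have "2 * U * D * (norm (of_V b))\<^sup>2 \<le> K * (norm (of_V b))\<^sup>2"
        using c by (intro mult_right_mono) (auto simp: K)
      moreover have "0 \<le> K * (norm (of_V w))\<^sup>2" using c by (intro mult_nonneg_nonneg) (auto simp: K)
      ultimately show ?thesis by linarith
    qed
    finally show ?case unfolding b of_b[symmetric] w_def[symmetric] by (simp add: of_V_inverse algebra_simps)
  qed
  have p: "?p absolutely_integrable_on {0..T}"
    by (intro set_integrable_mult_right evolution_gradient_square_integrable[OF ev])
  have i: "u1 0 = u01" "u2 0 = u02" "B1 0 = B01" "B2 0 = B02" using 1 2 by (auto simp: weak_solution_def)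
  show ?thesis
    using Gronwall_primitive[OF evolution_energy[OF ev] p le t]
    by (simp add: i mult.assoc algebra_simps)
qed

text \<open>
  The constants \<open>D\<close> of the two interpolation inequalities are functions of the small
  parameter alone, so choosing them once and for all makes \<open>K4\<close> a function of the
  four numbers. The value of \<open>||B0||^2\<close> is recovered from \<open>K3\<close>.
\<close>

theorem strong_weak_stability:
  "\<exists>K4 :: real \<Rightarrow> real \<Rightarrow> real \<Rightarrow> real \<Rightarrow> real.
      \<forall>\<alpha> \<mu> T u01 B01 u02 B02 u1 B1 u2 B2.
        \<alpha> > 0 \<longrightarrow> \<mu> > 0 \<longrightarrow> T > 0 \<longrightarrow>
        strong_solution \<alpha> \<mu> T u01 B01 u1 B1 \<longrightarrow>
        weak_solution \<alpha> \<mu> T u02 (of_V B02) u2 B2 \<longrightarrow>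
        (let K = K4 (K1_const \<alpha> u01 B01) (K3_const 1 \<alpha> \<mu> u01 B01) \<alpha> \<mu> in
          K > 0 \<and>
          (\<forall>t\<in>{0..T}.
             (norm (of_V (u1 t - u2 t)))\<^sup>2 + \<alpha>\<^sup>2 * (norm (u1 t - u2 t))\<^sup>2 + (norm (B1 t - B2 t))\<^sup>2
               + \<mu> * (LINT s:{0..t}|lebesgue. (norm (to_V (B1 s - B2 s)))\<^sup>2 * exp (K * (t - s)))
             \<le> ((norm (of_V (u01 - u02)))\<^sup>2 + \<alpha>\<^sup>2 * (norm (u01 - u02))\<^sup>2
                 + (norm (of_V (B01 - B02)))\<^sup>2) * exp (K * t)))"
proof -
  have "\<exists>D>0. \<forall>v u w. v \<in> Dom_A \<longrightarrow> \<bar>blinfun_apply (B_op v u) w\<bar> + \<bar>blinfun_apply (B_op u v) w\<bar> \<le>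
       norm u * norm (of_V w) * (e * norm (Stokes v) + D * norm (of_V v))" if "e > 0" for e :: real
    using B_op_Stokes_bound[OF that] by metis
  then obtain DS where DS: "\<And>e. e > 0 \<Longrightarrow> DS e > 0"
    "\<And>e v u w. e > 0 \<Longrightarrow> v \<in> Dom_A \<Longrightarrow> \<bar>blinfun_apply (B_op v u) w\<bar> + \<bar>blinfun_apply (B_op u v) w\<bar> \<le>
       norm u * norm (of_V w) * (e * norm (Stokes v) + DS e * norm (of_V v))"
    by metis
  have "\<exists>D>0. \<forall>u v. \<bar>blinfun_apply (B_op u v) u\<bar> \<le> norm v * (e * (norm u)\<^sup>2 + D * (norm (of_V u))\<^sup>2)" if "e > 0" for e :: real
    using B_op_interpolation[OF that] by metis
  then obtain DI where DI: "\<And>e. e > 0 \<Longrightarrow> DI e > 0"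
    "\<And>e u v. e > 0 \<Longrightarrow> \<bar>blinfun_apply (B_op u v) u\<bar> \<le> norm v * (e * (norm u)\<^sup>2 + DI e * (norm (of_V u))\<^sup>2)"
    by metis
  \<comment> \<open>A bound for \<open>||B1||^2\<close> along the strong solution; the first bracket
    is \<open>||B0||^2\<close>.\<close>
  define S where "S k1 k3 \<alpha> \<mu> = (k3 - (k1 / \<alpha>) ^ 4 / \<mu> ^ 3 * k1\<^sup>2 / \<mu>) +
      (2 * (k1 / \<alpha>) * DS (\<mu> / (2 * (k1 / \<alpha> + 1))) * k1 / \<mu>)\<^sup>2" for k1 k3 \<alpha> \<mu> :: real
  define K4 where "K4 k1 k3 \<alpha> \<mu> = (2592 * S k1 k3 \<alpha> \<mu> / \<mu> + 36 * (k1 / \<alpha>)) / \<alpha>\<^sup>2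
      + 2 * (k1 / \<alpha>) * DI (\<mu> / (4 * (k1 / \<alpha> + 1))) + 1" for k1 k3 \<alpha> \<mu> :: real
  show ?thesis
  proof (rule exI[of _ K4], intro allI impI)
    fix \<alpha> \<mu> T u01 B01 u02 B02 u1 B1 u2 B2
    assume *: "\<alpha> > 0" "\<mu> > 0" "T > 0" and ss: "strong_solution \<alpha> \<mu> T u01 B01 u1 B1"
      and w2: "weak_solution \<alpha> \<mu> T u02 (of_V B02) u2 B2"
    define K where "K = K4 (K1_const \<alpha> u01 B01) (K3_const 1 \<alpha> \<mu> u01 B01) \<alpha> \<mu>"
    have w1: "weak_solution \<alpha> \<mu> T u01 (of_V B01) u1 B1" using ss by (simp add: strong_solution_def)
    define k1 where "k1 = K1_const \<alpha> u01 B01"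
    define U where "U = k1 / \<alpha>"
    define s where "s = S k1 (K3_const 1 \<alpha> \<mu> u01 B01) \<alpha> \<mu>"
    define e1 where "e1 = \<mu> / (2 * (U + 1))"
    define e2 where "e2 = \<mu> / (4 * (U + 1))"
    have U: "U \<ge> 0" using * by (simp add: U_def k1_def K1_const_def)
    have e: "e1 > 0" "e2 > 0" "e1 * (U + 1) = \<mu> / 2" "e2 * (U + 1) = \<mu> / 4"
      using U * by (auto simp: e1_def e2_def field_simps)
    have s: "s = (norm B01)\<^sup>2 + (2 * U * DS e1 * k1 / \<mu>)\<^sup>2"
      by (simp add: s_def S_def K3_const_def K2_const_def k1_def U_def e1_def)
    have S0: "s \<ge> 0" unfolding s by simp
    have Keq: "K = (2592 * s / \<mu> + 36 * U) / \<alpha>\<^sup>2 + 2 * U * DI e2 + 1"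
      by (simp add: K_def K4_def s_def U_def e2_def k1_def)
    have "0 \<le> (2592 * s / \<mu> + 36 * U) / \<alpha>\<^sup>2" "0 \<le> 2 * U * DI e2"
      using U S0 * DI(1)[OF e(2)] by (auto intro!: divide_nonneg_nonneg add_nonneg_nonneg)
    then have K0: "K > 0" unfolding Keq by linarith
    have u1: "norm (u1 t) \<le> U" "norm (B1 t) \<le> k1" if "t \<in> {0..T}" for t
      unfolding U_def k1_def by (rule energy_bound_components[OF *(3,1,2) w1 that])+
    have "(norm (of_V (u1 t - u2 t)))\<^sup>2 + \<alpha>\<^sup>2 * (norm (u1 t - u2 t))\<^sup>2 + (norm (B1 t - B2 t))\<^sup>2
             + \<mu> * (LINT s:{0..t}|lebesgue. (norm (to_V (B1 s - B2 s)))\<^sup>2 * exp (K * (t - s)))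
           \<le> ((norm (of_V (u01 - u02)))\<^sup>2 + \<alpha>\<^sup>2 * (norm (u01 - u02))\<^sup>2
               + (norm (of_V (B01 - B02)))\<^sup>2) * exp (K * t)"
      if t: "t \<in> {0..T}" for t
      unfolding minus_V.rep_eq[of B01]
    proof (rule difference_estimate[OF e(4,2) DI(1)[OF e(2)] DI(2)[OF e(2)] *(3,1,2) U S0 w1 w2 u1(1) _ Keq t])
      show "(norm (to_V (B1 t)))\<^sup>2 \<le> s" if r: "t \<in> {0..T}" for t
        unfolding s by (rule gradient_bound[OF e(3,1) DS(1)[OF e(1)] DS(2)[OF e(1)] *(3,2) U ss u1 r])
    qed
    then show "let K = K4 (K1_const \<alpha> u01 B01) (K3_const 1 \<alpha> \<mu> u01 B01) \<alpha> \<mu> in K > 0 \<and> (\<forall>t\<in>{0..T}.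
             (norm (of_V (u1 t - u2 t)))\<^sup>2 + \<alpha>\<^sup>2 * (norm (u1 t - u2 t))\<^sup>2 + (norm (B1 t - B2 t))\<^sup>2
               + \<mu> * (LINT s:{0..t}|lebesgue. (norm (to_V (B1 s - B2 s)))\<^sup>2 * exp (K * (t - s)))
             \<le> ((norm (of_V (u01 - u02)))\<^sup>2 + \<alpha>\<^sup>2 * (norm (u01 - u02))\<^sup>2
                 + (norm (of_V (B01 - B02)))\<^sup>2) * exp (K * t))"
      unfolding K_def[symmetric] Let_def using K0 by blast
  qed
qed

corollary strong_weak_uniqueness:
  assumes *: "\<alpha> > 0" "\<mu> > 0" "T > 0" and ss: "strong_solution \<alpha> \<mu> T u0 B0 u1 B1"
    and w2: "weak_solution \<alpha> \<mu> T u0 (of_V B0) u2 B2" and t: "t \<in> {0..T}"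
  shows "u1 t = u2 t" "B1 t = B2 t"
proof -
  let ?E = "(norm (of_V (u1 t - u2 t)))\<^sup>2 + \<alpha>\<^sup>2 * (norm (u1 t - u2 t))\<^sup>2 + (norm (B1 t - B2 t))\<^sup>2"
  let ?I = "\<lambda>K. \<mu> * (LINT s:{0..t}|lebesgue. (norm (to_V (B1 s - B2 s)))\<^sup>2 * exp (K * (t - s)))"
  obtain K where "?E + ?I K \<le>
     ((norm (of_V (u0 - u0)))\<^sup>2 + \<alpha>\<^sup>2 * (norm (u0 - u0))\<^sup>2 + (norm (of_V (B0 - B0)))\<^sup>2) * exp (K * t)"
    using strong_weak_stability * ss w2 t unfolding Let_def by meson
  then have "?E + ?I K \<le> 0"
    unfolding diff_self zero_V.rep_eq norm_zero by simp
  moreover have "0 \<le> ?I K"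
    using * unfolding set_lebesgue_integral_def by (intro mult_nonneg_nonneg integral_nonneg_AE) auto
  ultimately have "?E \<le> 0" by linarith
  moreover have "0 \<le> \<alpha>\<^sup>2 * (norm (u1 t - u2 t))\<^sup>2" by simp
  ultimately have "\<alpha>\<^sup>2 * (norm (u1 t - u2 t))\<^sup>2 \<le> 0" "(norm (B1 t - B2 t))\<^sup>2 \<le> 0"
    using zero_le_power2[of "norm (of_V (u1 t - u2 t))"] zero_le_power2[of "norm (B1 t - B2 t)"] by linarith+
  then show "u1 t = u2 t" "B1 t = B2 t" using * by (auto simp: mult_le_0_iff)
qed

theorem theorem3p5:
  "(\<exists>C>0. \<exists>K4 :: real \<Rightarrow> real \<Rightarrow> real \<Rightarrow> real \<Rightarrow> real.
      \<forall>\<alpha> \<mu> T u01 B01 u02 B02 u1 B1 u2 B2.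
        \<alpha> > 0 \<longrightarrow> \<mu> > 0 \<longrightarrow> T > 0 \<longrightarrow>
        strong_solution \<alpha> \<mu> T u01 B01 u1 B1 \<longrightarrow>
        weak_solution \<alpha> \<mu> T u02 (of_V B02) u2 B2 \<longrightarrow>
        (let K = K4 (K1_const \<alpha> u01 B01) (K3_const C \<alpha> \<mu> u01 B01) \<alpha> \<mu> in
          K > 0 \<and>
          (\<forall>t\<in>{0..T}.
             (norm (of_V (u1 t - u2 t)))\<^sup>2 + \<alpha>\<^sup>2 * (norm (u1 t - u2 t))\<^sup>2 + (norm (B1 t - B2 t))\<^sup>2
               + \<mu> * (LINT s:{0..t}|lebesgue. (norm (to_V (B1 s - B2 s)))\<^sup>2 * exp (K * (t - s)))
             \<le> ((norm (of_V (u01 - u02)))\<^sup>2 + \<alpha>\<^sup>2 * (norm (u01 - u02))\<^sup>2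
                 + (norm (of_V (B01 - B02)))\<^sup>2) * exp (K * t)))) \<and>
   (\<forall>\<alpha> \<mu> T u01 B01 u02 B02 u1 B1 u2 B2.
        \<alpha> > 0 \<longrightarrow> \<mu> > 0 \<longrightarrow> T > 0 \<longrightarrow>
        strong_solution \<alpha> \<mu> T u01 B01 u1 B1 \<longrightarrow>
        weak_solution \<alpha> \<mu> T u02 (of_V B02) u2 B2 \<longrightarrow>
        of_V u01 = of_V u02 \<longrightarrow> of_V B01 = of_V B02 \<longrightarrow>
        Lp_time_eq 1 T (\<lambda>t. of_V (u1 t)) (\<lambda>t. of_V (u2 t)) \<and> Lp_time_eq 1 T B1 B2)"
proof (rule conjI, goal_cases)
  case 1
  show ?case by (intro exI[of _ 1] conjI zero_less_one strong_weak_stability)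
next
  case 2
  show ?case
  proof (intro allI impI)
    fix \<alpha> \<mu> T u01 B01 u02 B02 u1 B1 u2 B2
    assume *: "\<alpha> > 0" "\<mu> > 0" "T > 0" and ss: "strong_solution \<alpha> \<mu> T u01 B01 u1 B1"
      and w2: "weak_solution \<alpha> \<mu> T u02 (of_V B02) u2 B2" and eq: "of_V u01 = of_V u02" "of_V B01 = of_V B02"
    have eq': "u02 = u01" "B02 = B01" using eq by (simp_all add: of_V_inject)
    note uniq = strong_weak_uniqueness[OF * ss w2[unfolded eq']]
    have w1: "weak_solution \<alpha> \<mu> T u01 (of_V B01) u1 B1" using ss by (simp add: strong_solution_def)
    have u: "Lp_time 1 T (\<lambda>t. of_V (u t))" and B: "Lp_time 1 T B"
      if w: "weak_solution \<alpha> \<mu> T u0 B0 u B" for u0 B0 u B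
    proof -
      have "continuous_on {0..T} u" "Linf_time T B" using w by (auto simp: weak_solution_def Cw_H_def)
      then show "Lp_time 1 T (\<lambda>t. of_V (u t))" "Lp_time 1 T B"
        by (auto intro: continuous_Lp_time_1 Linf_time_Lp_time_1 bounded_linear.continuous_on[OF bounded_linear_of_V])
    qed
    have ae: "AE t in lebesgue_on {0<..<T}. P t" if "\<And>t. t \<in> {0..T} \<Longrightarrow> P t" for P
      unfolding AE_time_iff by (intro exI[of _ "{}"]) (use that in auto)
    show "Lp_time_eq 1 T (\<lambda>t. of_V (u1 t)) (\<lambda>t. of_V (u2 t)) \<and> Lp_time_eq 1 T B1 B2"
      unfolding Lp_time_eq_def by (intro conjI u[OF w1] B[OF w1] u[OF w2] B[OF w2] ae) (use uniq in auto)
  qed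
qed

end
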